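(* Let $\mathcal H$ be a homogeneous foliation of degree $d\ge3$ on $\mathbb P^2_{\mathbb C}$, of type $\mathcal T_{\mathcal H}$, and let $\nu$ be an integer with $1\le\nu\le d-2$. (i) If $\mathcal T_{\mathcal H}=1\cdot\mathrm R_{\nu}+1\cdot\mathrm R_{d-\nu-1}+1\cdot\mathrm R_{d-1}$, then the $d$-web $\mathrm{Leg}\,\mathcal H$ is flat if and only if $\mathcal H$ is linearly conjugate to the foliation $\mathcal H_3^{d,\nu}$ given by $$\omega_3^{d,\nu}=\sum_{i=\nu+1}^{d}\binom di x^{d-i}y^i\,\mathrm dx-\sum_{i=0}^{\nu}\binom di x^{d-i}y^i\,\mathrm dy.$$ (ii) If $\mathcal T_{\mathcal H}=1\cdot\mathrm R_{\nu}+1\cdot\mathrm R_{d-\nu-1}+1\cdot\mathrm T_{d-1}$, then the $d$-web $\mathrm{Leg}\,\mathcal H$ is flat if and only if $\mathcal H$ is linearly conjugate to the foliation $\mathcal H_4^{d,\nu}$ given by $$\omega_4^{d,\nu}=(d-\nu-1)\sum_{i=\nu+1}^{d}\binom di x^{d-i}y^i\,\mathrm dx+\nu\sum_{i=0}^{\nu}\binom di x^{d-i}y^i\,\mathrm dy.$$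
   Context: Foliations. A foliation of degree $d$ on $\mathbb P^2_{\mathbb C}$ is given in homogeneous coordinates $[x:y:z]$, up to a nonzero scalar, by a $1$-form $\alpha\,\mathrm dx+\beta\,\mathrm dy+\gamma\,\mathrm dz$ with homogeneous coefficients of degree $d+1$ without common factor satisfying $x\alpha+y\beta+z\gamma=0$; in the affine chart $z=1$ it is described by a polynomial $1$-form with coprime coefficients. It is homogeneous if in some affine chart $(x,y)$ it is invariant under all homotheties $(x,y)\mapsto\lambda(x,y)$; it is then described by $\omega=A\,\mathrm dx+B\,\mathrm dy$ with $A,B$ homogeneous of degree $d$ without common factor. Linearly conjugate means conjugate under $\mathrm{PGL}_3(\mathbb C)=\mathrm{Aut}(\mathbb P^2_{\mathbb C})$. Radial singularities. Let $s$ be a singular point of a foliation $\mathcal F$ defined near $s$ by a vector field $\mathrm X$ with isolated zeros. $\nu(\mathcal F,s)$ is the vanishing order of $\mathrm X$ at $s$. For a line $\ell=\{f=0\}$ through $s$ not $\mathcal F$-invariant, $\mathrm{Tang}(\mathcal F,\ell,s)=\dim_{\mathbb C}\mathcal O_s/\langle f,\mathrm X(f)\rangle$; $\tau(\mathcal F,s)$ is the minimum of these numbers over all such lines. The point $s$ is radial of order $\tau(\mathcal F,s)-1$ if $\nu(\mathcal F,s)=1$ and $\tau(\mathcal F,s)\ge2$. Type. For $\mathcal H$ a homogeneous foliation of degree $d$ described in an affine chart $(x,y)$ by $\omega=A\,\mathrm dx+B\,\mathrm dy$, with $A,B$ homogeneous polynomials of degree $d$ without common factor, put $\mathrm D_{\mathcal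 H}=A_xB_y-A_yB_x$. A transverse inflection line of order $m\geq 1$ is a line through the origin, not $\mathcal H$-invariant, dividing $\mathrm D_{\mathcal H}$ with multiplicity exactly $m$. If $r_k$ is the number of radial singularities of order $k$ of $\mathcal H$ and $t_k$ the number of its transverse inflection lines of order $k$, the type of $\mathcal H$ is the formal sum $\mathcal T_{\mathcal H}=\sum_{k=1}^{d-1}(r_k\cdot\mathrm R_k+t_k\cdot\mathrm T_k)$ in formal variables $\mathrm R_k,\mathrm T_k$. Webs and Legendre transform. A $k$-web on a complex surface is given locally by a $k$-symmetric holomorphic $1$-form with isolated zeros (well defined up to units, compatible on overlaps) which at a generic point factors as a product of $k$ pairwise non-collinear linear forms. The set where this fails is the discriminant $\Delta(\mathcal W)$. The Legendre transform $\mathrm{Leg}\,\mathcal H$ is the $d$-web on the dual plane $\check{\mathbb P}^2_{\mathbb C}$ whose leaves are the families of tangent lines to the leaves of $\mathcal H$. In the affine chart $(p,q)$ of $\check{\mathbb P}^2_{\mathbb C}$ corresponding to the line $\{y=px-q\}$ it is given by $A(x,px-q)+pB(x,px-q)=0$ with $x=\frac{\mathrm dq}{\mathrm dp}$. Curvature. For a germ of web $\mathcal W=\mathcal F_1\boxtimes\cdots\boxtimes\mathcal F_k$ superposed from foliations defined by $1$-forms $\theta_i$ in coordinates $(u,v)$, write $\theta_i\wedge\theta_j=\delta_{ij}\,\mathrm du\wedge\mathrm dv$. For $r<s<t$ let $\eta_{rst}$ be the unique meromorphic $1$-form with $\mathrm d(\delta_{st}\theta_r)=\eta_{rst}\wedge\delta_{st}\theta_r$,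 $\mathrm d(\delta_{tr}\theta_s)=\eta_{rst}\wedge\delta_{tr}\theta_s$, $\mathrm d(\delta_{rs}\theta_t)=\eta_{rst}\wedge\delta_{rs}\theta_t$. The curvature $K(\mathcal W)=\mathrm d(\sum_{r<s<t}\eta_{rst})$ does not depend on choices. For a general web these local forms glue to a global meromorphic $2$-form with poles in $\Delta(\mathcal W)$. The web is flat if $K(\mathcal W)\equiv0$. *)

theory Defs
  imports "HOL-Analysis.Analysis" "HOL-Library.Multiset"
begin

text \<open>Polynomials are treated as polynomial functions, which is harmless over the infinite field
  of complex numbers. A 1-form with coefficients $c_i$ on complex $n$-space is the function
  $x \mapsto (c_1(x),\dots,c_n(x))$.\<close>

definition pairing :: "complex^'n \<Rightarrow> complex^'n \<Rightarrow> complex" where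
  "pairing l v = (\<Sum>i\<in>UNIV. l $ i * v $ i)"

definition partial_deriv :: "'n \<Rightarrow> (complex^'n \<Rightarrow> complex) \<Rightarrow> complex^'n \<Rightarrow> complex" where
  "partial_deriv i f x = deriv (\<lambda>t. f (x + axis i t)) 0"

text \<open>Holomorphy in several variables: complex-linear Frechet differentiability.\<close>

definition mholomorphic_on :: "(complex^'n \<Rightarrow> complex) \<Rightarrow> (complex^'n) set \<Rightarrow> bool" where
  "mholomorphic_on f U \<longleftrightarrow> (\<forall>x\<in>U. \<exists>l. (f has_derivative pairing l) (at x within U))"


section \<open>Foliations of the projective plane\<close>

definition hom_poly :: "nat \<Rightarrow> (complex^'n \<Rightarrow> complex) \<Rightarrow> bool" where
  "hom_poly n P \<longleftrightarrow> (\<exists>c :: ('n \<Rightarrow> nat) \<Rightarrow> complex.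
     P = (\<lambda>x. \<Sum>e | (\<Sum>i\<in>UNIV. e i) = n. c e * (\<Prod>i\<in>UNIV. x $ i ^ e i)))"

text \<open>It suffices to consider homogeneous factors, because every factor of a homogeneous
  polynomial is homogeneous.\<close>

definition no_common_factor :: "(complex^'n \<Rightarrow> complex^'n) \<Rightarrow> bool" where
  "no_common_factor \<omega> \<longleftrightarrow> \<not> (\<exists>m n R Q. m \<ge> 1 \<and> hom_poly m R \<and>
     (\<forall>i. hom_poly n (\<lambda>x. Q x $ i)) \<and> \<omega> = (\<lambda>x. R x *s Q x))"

definition foliation :: "nat \<Rightarrow> (complex^3 \<Rightarrow> complex^3) \<Rightarrow> bool" where
  "foliation d \<omega> \<longleftrightarrow> (\<forall>i. hom_poly (d + 1) (\<lambda>x. \<omega> x $ i)) \<and> no_common_factor \<omega> \<and>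
     (\<forall>x. pairing x (\<omega> x) = 0)"

definition same_foliation :: "(complex^3 \<Rightarrow> complex^3) \<Rightarrow> (complex^3 \<Rightarrow> complex^3) \<Rightarrow> bool" where
  "same_foliation \<omega> \<omega>' \<longleftrightarrow> (\<exists>c. c \<noteq> 0 \<and> \<omega>' = (\<lambda>x. c *s \<omega> x))"

definition pullback :: "complex^3^3 \<Rightarrow> (complex^3 \<Rightarrow> complex^3) \<Rightarrow> complex^3 \<Rightarrow> complex^3" where
  "pullback M \<omega> x = transpose M *v \<omega> (M *v x)"

definition linearly_conjugate :: "(complex^3 \<Rightarrow> complex^3) \<Rightarrow> (complex^3 \<Rightarrow> complex^3) \<Rightarrow> bool" where
  "linearly_conjugate \<omega> \<omega>' \<longleftrightarrow> (\<exists>M. invertible M \<and> same_foliation (pullback M \<omega>) \<omega>')"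

text \<open>An invertible matrix \<open>M\<close> stands for the linear coordinates in which the point with
  homogeneous coordinates \<open>v\<close> is \<open>M *v v\<close>; its affine chart consists of the points
  \<open>M *v vector [x, y, 1]\<close>, in which \<open>\<omega>\<close> is described by
  \<open>affine_form (pullback M \<omega>)\<close>.\<close>

definition affine_form :: "(complex^3 \<Rightarrow> complex^3) \<Rightarrow> complex^2 \<Rightarrow> complex^2" where
  "affine_form \<omega> w = (let a = \<omega> (vector [w $ 1, w $ 2, 1]) in vector [a $ 1, a $ 2])"

definition homothety :: "complex \<Rightarrow> complex^3^3" where
  "homothety c = (\<chi> i j. if i \<noteq> j then 0 else if i = 3 then 1 else c)"

definition homogeneous_in_chart :: "complex^3^3 \<Rightarrow> (complex^3 \<Rightarrow> complex^3) \<Rightarrow> bool" where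
  "homogeneous_in_chart M \<omega> \<longleftrightarrow> invertible M \<and>
     (\<forall>c. c \<noteq> 0 \<longrightarrow> same_foliation (pullback M \<omega>) (pullback (homothety c) (pullback M \<omega>)))"


section \<open>Radial singularities\<close>

text \<open>In this section \<open>\<eta>\<close> is the 1-form $a\,dx + b\,dy$ in an affine chart centred at the point
  of interest; the foliation is then defined by $X = b\,\partial_x - a\,\partial_y$. A line through
  the origin is given by the coefficient vector \<open>l \<noteq> 0\<close> of its equation $f = 0$.\<close>

definition kernel_field :: "(complex^2 \<Rightarrow> complex^2) \<Rightarrow> complex^2 \<Rightarrow> complex^2" where
  "kernel_field \<eta> w = vector [\<eta> w $ 2, - \<eta> w $ 1]"

definition invariant_line :: "(complex^2 \<Rightarrow> complex^2) \<Rightarrow> complex^2 \<Rightarrow> bool" where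
  "invariant_line \<eta> l \<longleftrightarrow> (\<forall>w. pairing l w = 0 \<longrightarrow> pairing l (kernel_field \<eta> w) = 0)"

definition vanishing_order :: "(complex^2 \<Rightarrow> complex^2) \<Rightarrow> nat" where
  "vanishing_order X = (LEAST n. \<exists>i j k. i + j = n \<and>
     (partial_deriv 1 ^^ i) ((partial_deriv 2 ^^ j) (\<lambda>w. X w $ k)) 0 \<noteq> 0)"

text \<open>Representatives of the germs of holomorphic functions at the origin.\<close>

definition germs :: "(complex^2 \<Rightarrow> complex) set" where
  "germs = {g. \<exists>U. open U \<and> 0 \<in> U \<and> mholomorphic_on g U}"

definition germ_ideal :: "(complex^2 \<Rightarrow> complex) \<Rightarrow> (complex^2 \<Rightarrow> complex) \<Rightarrow> (complex^2 \<Rightarrow> complex) set" where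
  "germ_ideal f g = {h \<in> germs. \<exists>a\<in>germs. \<exists>b\<in>germs.
     \<forall>\<^sub>F w in nhds 0. h w = a w * f w + b w * g w}"

text \<open>Dimension of the quotient of the ring of germs by the ideal generated by \<open>f\<close> and \<open>g\<close>:
  the length of a basis \<open>b\<close> of the quotient (unspecified if this dimension is infinite).\<close>

definition quotient_dim :: "(complex^2 \<Rightarrow> complex) \<Rightarrow> (complex^2 \<Rightarrow> complex) \<Rightarrow> nat" where
  "quotient_dim f g = (THE n. \<exists>b :: nat \<Rightarrow> complex^2 \<Rightarrow> complex. (\<forall>i<n. b i \<in> germs) \<and>
     (\<forall>h\<in>germs. \<exists>!c :: nat \<Rightarrow> complex. (\<forall>i\<ge>n. c i = 0) \<and>
        (\<lambda>w. h w - (\<Sum>i<n. c i * b i w)) \<in> germ_ideal f g))"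

definition tangency :: "(complex^2 \<Rightarrow> complex^2) \<Rightarrow> complex^2 \<Rightarrow> nat" where
  "tangency \<eta> l = quotient_dim (pairing l) (\<lambda>w. pairing l (kernel_field \<eta> w))"

definition min_tangency :: "(complex^2 \<Rightarrow> complex^2) \<Rightarrow> nat" where
  "min_tangency \<eta> = Inf {tangency \<eta> l | l. l \<noteq> 0 \<and> \<not> invariant_line \<eta> l}"

definition radial_at_origin :: "nat \<Rightarrow> (complex^2 \<Rightarrow> complex^2) \<Rightarrow> bool" where
  "radial_at_origin k \<eta> \<longleftrightarrow> \<eta> 0 = 0 \<and> vanishing_order (kernel_field \<eta>) = 1 \<and>
     min_tangency \<eta> \<ge> 2 \<and> k = min_tangency \<eta> - 1"

text \<open>Points of the projective plane are lines through the origin. The affine chart of \<open>M\<close> is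
  centred at the point \<open>M *v axis 3 1\<close>; the local condition does not depend on the chart
  chosen.\<close>

definition proj_point :: "complex^3 \<Rightarrow> (complex^3) set" where
  "proj_point s = range (\<lambda>c. c *s s)"

definition radial_singularities :: "nat \<Rightarrow> (complex^3 \<Rightarrow> complex^3) \<Rightarrow> (complex^3) set set" where
  "radial_singularities k \<omega> = {proj_point s | s. s \<noteq> 0 \<and>
     (\<exists>M. invertible M \<and> M *v axis 3 1 = s \<and> radial_at_origin k (affine_form (pullback M \<omega>)))}"


section \<open>Type of a homogeneous foliation\<close>

definition jacobian_det :: "(complex^2 \<Rightarrow> complex^2) \<Rightarrow> complex^2 \<Rightarrow> complex" where
  "jacobian_det \<eta> w =
     partial_deriv 1 (\<lambda>w. \<eta> w $ 1) w * partial_deriv 2 (\<lambda>w. \<eta> w $ 2) w -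
     partial_deriv 2 (\<lambda>w. \<eta> w $ 1) w * partial_deriv 1 (\<lambda>w. \<eta> w $ 2) w"

definition line_power_dvd :: "complex^2 \<Rightarrow> nat \<Rightarrow> (complex^2 \<Rightarrow> complex) \<Rightarrow> bool" where
  "line_power_dvd l m D \<longleftrightarrow> (\<exists>n Q. hom_poly n Q \<and> D = (\<lambda>w. pairing l w ^ m * Q w))"

definition inflection_lines :: "nat \<Rightarrow> (complex^2 \<Rightarrow> complex^2) \<Rightarrow> (complex^2) set set" where
  "inflection_lines m \<eta> = {{w. pairing l w = 0} | l. l \<noteq> 0 \<and> \<not> invariant_line \<eta> l \<and>
     line_power_dvd l m (jacobian_det \<eta>) \<and> \<not> line_power_dvd l (Suc m) (jacobian_det \<eta>)}"

datatype type_symbol = Rsym nat | Tsym nat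

text \<open>Formal sums with natural number coefficients are multisets. \<open>M\<close> is a chart in which the
  foliation is homogeneous.\<close>

definition foliation_type :: "nat \<Rightarrow> complex^3^3 \<Rightarrow> (complex^3 \<Rightarrow> complex^3) \<Rightarrow> type_symbol multiset" where
  "foliation_type d M \<omega> = (\<Sum>k=1..d-1.
     replicate_mset (card (radial_singularities k \<omega>)) (Rsym k) +
     replicate_mset (card (inflection_lines k (affine_form (pullback M \<omega>)))) (Tsym k))"


section \<open>Webs and curvature\<close>

text \<open>A $k$-symmetric 1-form on a domain of complex 2-space is a function of a point and a
  tangent vector.\<close>

definition wedge :: "complex^2 \<Rightarrow> complex^2 \<Rightarrow> complex" where
  "wedge a b = a $ 1 * b $ 2 - a $ 2 * b $ 1"

definition ext_deriv :: "(complex^2 \<Rightarrow> complex^2) \<Rightarrow> complex^2 \<Rightarrow> complex" where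
  "ext_deriv \<theta> m = partial_deriv 1 (\<lambda>m. \<theta> m $ 2) m - partial_deriv 2 (\<lambda>m. \<theta> m $ 1) m"

definition web_factorization ::
  "nat \<Rightarrow> (complex^2 \<Rightarrow> complex^2 \<Rightarrow> complex) \<Rightarrow> (complex^2) set \<Rightarrow> (nat \<Rightarrow> complex^2 \<Rightarrow> complex^2) \<Rightarrow> bool" where
  "web_factorization k W U \<theta> \<longleftrightarrow> open U \<and>
     (\<forall>i<k. \<forall>j. mholomorphic_on (\<lambda>m. \<theta> i m $ j) U) \<and>
     (\<forall>m\<in>U. \<forall>i<k. \<forall>j<k. i \<noteq> j \<longrightarrow> wedge (\<theta> i m) (\<theta> j m) \<noteq> 0) \<and>
     (\<forall>m\<in>U. \<forall>v. W m v = (\<Prod>i<k. pairing (\<theta> i m) v))"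

definition web_eta :: "(nat \<Rightarrow> complex^2 \<Rightarrow> complex^2) \<Rightarrow> nat \<Rightarrow> nat \<Rightarrow> nat \<Rightarrow> complex^2 \<Rightarrow> complex^2" where
  "web_eta \<theta> r s t m = (let \<delta> = (\<lambda>i j m. wedge (\<theta> i m) (\<theta> j m)) in (THE h.
     ext_deriv (\<lambda>m. \<delta> s t m *s \<theta> r m) m = wedge h (\<delta> s t m *s \<theta> r m) \<and>
     ext_deriv (\<lambda>m. \<delta> t r m *s \<theta> s m) m = wedge h (\<delta> t r m *s \<theta> s m) \<and>
     ext_deriv (\<lambda>m. \<delta> r s m *s \<theta> t m) m = wedge h (\<delta> r s m *s \<theta> t m)))"

definition web_curvature :: "nat \<Rightarrow> (nat \<Rightarrow> complex^2 \<Rightarrow> complex^2) \<Rightarrow> complex^2 \<Rightarrow> complex" where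
  "web_curvature k \<theta> =
     ext_deriv (\<lambda>m. \<Sum>(r, s, t) \<in> {(r, s, t). r < s \<and> s < t \<and> t < k}. web_eta \<theta> r s t m)"

text \<open>The curvature is a meromorphic form with poles in the discriminant, so it vanishes
  identically iff it vanishes wherever the web is locally a superposition of foliations.\<close>

definition flat_web :: "nat \<Rightarrow> (complex^2 \<Rightarrow> complex^2 \<Rightarrow> complex) \<Rightarrow> bool" where
  "flat_web k W \<longleftrightarrow> (\<forall>U \<theta>. web_factorization k W U \<theta> \<longrightarrow> (\<forall>m\<in>U. web_curvature k \<theta> m = 0))"

text \<open>The Legendre transform of $\alpha\,dx + \beta\,dy + \gamma\,dz$ in the chart $(p,q)$ of the
  lines $y = px - q$. Its leaf directions at such a line are the $(dp,dq)$ for which the foliation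
  is tangent to the line at the point $(x, px - q)$, where $x = dq/dp$; this point has homogeneous
  coordinates $P = [dq : p\,dq - q\,dp : dp]$. For $dp \neq 0$ the form below is
  $dp^d\,(\alpha + p\beta)(x, px - q, 1)$, which is $dp^d\,(A(x, px - q) + pB(x, px - q))$ if the
  affine form is $A\,dx + B\,dy$. The relation $x\alpha + y\beta + z\gamma = 0$ at $P$ reads
  $dq\,(\alpha + p\beta) = dp\,(q\beta - \gamma)$, which extends it to a symmetric form of degree
  $d$ with polynomial coefficients.\<close>

definition legendre_form :: "(complex^3 \<Rightarrow> complex^3) \<Rightarrow> complex^2 \<Rightarrow> complex^2 \<Rightarrow> complex" where
  "legendre_form \<omega> m v = (let p = m $ 1; q = m $ 2; dp = v $ 1; dq = v $ 2;
       a = \<omega> (vector [dq, p * dq - q * dp, dp])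
     in if dp \<noteq> 0 then (a $ 1 + p * a $ 2) / dp else (q * a $ 2 - a $ 3) / dq)"

text \<open>The charts $(p,q)$ attached to all linear coordinates cover the dual plane.\<close>

definition legendre_flat :: "nat \<Rightarrow> (complex^3 \<Rightarrow> complex^3) \<Rightarrow> bool" where
  "legendre_flat d \<omega> \<longleftrightarrow> (\<forall>M. invertible M \<longrightarrow> flat_web d (legendre_form (pullback M \<omega>)))"


section \<open>The two families\<close>

text \<open>The form on the projective plane described in the chart $z = 1$ by $A\,dx + B\,dy$ with
  \<open>A\<close>, \<open>B\<close> homogeneous of the same degree.\<close>

definition projective_form :: "(complex^2 \<Rightarrow> complex^2) \<Rightarrow> complex^3 \<Rightarrow> complex^3" where
  "projective_form \<eta> x = (let w = vector [x $ 1, x $ 2]; a = \<eta> w in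
     vector [x $ 3 * a $ 1, x $ 3 * a $ 2, - (x $ 1 * a $ 1 + x $ 2 * a $ 2)])"

definition omega3 :: "nat \<Rightarrow> nat \<Rightarrow> complex^2 \<Rightarrow> complex^2" where
  "omega3 d \<nu> w = vector
     [\<Sum>i=\<nu>+1..d. of_nat (d choose i) * w $ 1 ^ (d - i) * w $ 2 ^ i,
      - (\<Sum>i=0..\<nu>. of_nat (d choose i) * w $ 1 ^ (d - i) * w $ 2 ^ i)]"

definition omega4 :: "nat \<Rightarrow> nat \<Rightarrow> complex^2 \<Rightarrow> complex^2" where
  "omega4 d \<nu> w = vector
     [of_nat (d - \<nu> - 1) * (\<Sum>i=\<nu>+1..d. of_nat (d choose i) * w $ 1 ^ (d - i) * w $ 2 ^ i),
      of_nat \<nu> * (\<Sum>i=0..\<nu>. of_nat (d choose i) * w $ 1 ^ (d - i) * w $ 2 ^ i)]"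

end

theory Submission
  imports Defs "HOL-Complex_Analysis.Complex_Analysis" "HOL-Computational_Algebra.Fundamental_Theorem_Algebra"
begin

text \<open>Let \<open>A dx + B dy\<close> describe the foliation in a chart where it is homogeneous. Either type
  determines the foliation up to one complex parameter, and for the resulting normal form the
  curvature of the dual web can be computed in closed form.

  \<^emph>\<open>Normal form.\<close> A radial singularity of order \<open>k\<close> of a homogeneous foliation lies on the line at
  infinity. If \<open>s\<close> is its direction, order \<open>k\<close> means that \<open>s\<^sub>1 A + s\<^sub>2 B\<close> vanishes along the line
  through \<open>s\<close> to order exactly \<open>k + 1\<close> (\<open>radial_contact\<close>). Taking the singularities of orders
  \<open>\<nu>\<close> and \<open>d - \<nu> - 1\<close> as coordinate directions, \<open>A\<close> consists of monomials \<open>x\<^sup>d\<^sup>-\<^sup>i y\<^sup>i\<close> with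
  \<open>i > \<nu>\<close> and \<open>B\<close> of those with \<open>i \<le> \<nu>\<close>. The remaining singularity or inflection line has maximal
  order \<open>d - 1\<close>, which forces a combination \<open>a\<^sub>1 A + a\<^sub>2 B\<close> to be the \<open>d\<close>-th power of a linear form
  (\<open>contact_maximal\<close>, \<open>inflection_form\<close>). After rescaling, the linear form is \<open>x + y\<close>, so \<open>A\<close> and \<open>B\<close>
  are the two parts of the binomial expansion of \<open>(x + y)\<^sup>d\<close> up to constants, that is,
  they form \<open>model d \<nu> \<mu>\<close> up to a common constant, for some \<open>\<mu> \<noteq> 0\<close>
  (\<open>contacts_normal_form\<close>). Let \<open>u\<close> span the zero line of the linear form. Then \<open>\<mu> = -1\<close> iff \<open>a\<close> and
  \<open>u\<close> are proportional. They are for a radial singularity of order \<open>d - 1\<close>, where both are its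
  direction; they are not for an inflection line, because that line is not invariant.

  \<^emph>\<open>Curvature.\<close> The tangency points of the line \<open>y = p x - q\<close> with the model foliation lie on the lines
  \<open>y = \<tau> x\<close> where \<open>\<tau>\<close> runs through the \<open>d\<close> roots of the polynomial
  \<open>\<mu> (1 + \<tau>)\<^sup>d + (p - \<mu>) Q(\<tau>)\<close>, \<open>Q\<close> being the part of degree at most \<open>\<nu>\<close> of \<open>(1 + \<tau>)\<^sup>d\<close>. The roots depend on
  \<open>p\<close> alone, so that the web is given by the forms \<open>- q dp + (p - \<tau>\<^sub>i(p)) dq\<close>. The curvature turns out
  to be the derivative in \<open>p\<close> of a symmetric function of the roots and of their velocities. The
  polynomial satisfies a linear differential equation of first order in \<open>\<tau>\<close>, whence all the sums involved are
  rational in \<open>p\<close> (\<open>interpolation_sum\<close>), and the curvature is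
  \<open>(d - 2) (\<mu> + 1) (d - 1 - \<nu> (\<mu> + 1)) / (6 q (p - \<mu>)\<^sup>2)\<close> times \<open>dp \<and> dq\<close> (\<open>model_curvature\<close>). Hence the
  web of the model is flat iff \<open>\<mu> = -1\<close> or \<open>\<mu> = (d - 1 - \<nu>) / \<nu>\<close>; these are the two
  foliations of the statement. The other charts of the dual plane are reduced to this one by the
  transformation law of the curvature (\<open>web_curvature_pullback\<close>) and by continuity.

  In the first type \<open>\<mu> = -1\<close>, hence both sides of the equivalence hold; in the second \<open>\<mu> \<noteq> -1\<close>, hence
  flatness singles out the other value.\<close>

no_notation fps_nth (infixl "$" 75)

section \<open>Holomorphic functions of several variables\<close>

lemma partial_deriv_has_derivative:
  fixes f :: "complex^'n \<Rightarrow> complex"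
  assumes "(f has_derivative pairing l) (at x)"
  shows "((\<lambda>t. f (x + axis i t)) has_field_derivative l $ i) (at 0)"
    and "partial_deriv i f x = l $ i"
proof -
  have ax: "((\<lambda>t::complex. x + axis i t) has_derivative (\<lambda>t. axis i t)) (at 0)"
  proof -
    have "bounded_linear (\<lambda>t::complex. axis i t :: complex^'n)"
      by (rule linear_conv_bounded_linear[THEN iffD1], unfold_locales)
         (auto simp: axis_def vec_eq_iff)
    then show ?thesis by (auto intro!: derivative_eq_intros bounded_linear_imp_has_derivative)
  qed
  have "((\<lambda>t. f (x + axis i t)) has_derivative (\<lambda>t. pairing l (axis i t))) (at 0)"
    using diff_chain_at[OF ax, of f "pairing l"] assms by (simp add: o_def axis_def vec_eq_iff flip: zero_vec_def)
  moreover have "pairing l (axis i t) = l $ i * t" for t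
    by (simp add: pairing_def axis_def if_distrib cong: if_cong)
  ultimately show 1: "((\<lambda>t. f (x + axis i t)) has_field_derivative l $ i) (at 0)"
    by (simp add: has_field_derivative_def)
  then show "partial_deriv i f x = l $ i"
    unfolding partial_deriv_def by (rule DERIV_imp_deriv)
qed

definition gradient :: "(complex^'n \<Rightarrow> complex) \<Rightarrow> complex^'n \<Rightarrow> complex^'n" where
  "gradient f x = (\<chi> i. partial_deriv i f x)"

lemma gradient_eqI: "(f has_derivative pairing l) (at x) \<Longrightarrow> gradient f x = l"
  by (simp add: gradient_def vec_eq_iff partial_deriv_has_derivative)

lemma mholomorphic_has_gradient:
  assumes "mholomorphic_on f U" "open U" "x \<in> U"
  shows "(f has_derivative pairing (gradient f x)) (at x)"
  using assms gradient_eqI unfolding mholomorphic_on_def by (metis at_within_open)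

lemma mholomorphic_onI:
  "(\<And>x. x \<in> U \<Longrightarrow> (f has_derivative pairing (l x)) (at x)) \<Longrightarrow> mholomorphic_on f U"
  unfolding mholomorphic_on_def by (meson has_derivative_at_withinI)

lemma mholomorphic_continuous: "mholomorphic_on f U \<Longrightarrow> continuous_on U f"
  unfolding mholomorphic_on_def continuous_on_eq_continuous_within
  by (meson has_derivative_continuous)

lemma mholomorphic_subset: "mholomorphic_on f U \<Longrightarrow> V \<subseteq> U \<Longrightarrow> mholomorphic_on f V"
  unfolding mholomorphic_on_def by (meson has_derivative_subset subsetD)

lemma bounded_bilinear_pairing: "bounded_bilinear (pairing :: complex^'n \<Rightarrow> _)"
proof
  fix a b :: "complex^'n" and r
  show "\<exists>K. \<forall>a b :: complex^'n. norm (pairing a b) \<le> norm a * norm b * K"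
  proof (rule exI[of _ "of_nat CARD('n)"], intro allI)
    fix a b :: "complex^'n"
    have "norm (pairing a b) \<le> (\<Sum>i\<in>(UNIV::'n set). norm a * norm b)"
      unfolding pairing_def
      by (rule order_trans[OF norm_sum sum_mono]) (simp add: norm_mult mult_mono Finite_Cartesian_Product.norm_nth_le)
    then show "norm (pairing a b) \<le> norm a * norm b * of_nat CARD('n)" by (simp add: mult.commute)
  qed
qed (auto simp: pairing_def algebra_simps sum.distrib sum_distrib_left scaleR_sum_right)

lemmas bounded_linear_pairing = bounded_bilinear.bounded_linear_right[OF bounded_bilinear_pairing]
lemmas bounded_linear_pairing_left = bounded_bilinear.bounded_linear_left[OF bounded_bilinear_pairing]
lemmas continuous_on_pairing = bounded_bilinear.continuous_on[OF bounded_bilinear_pairing]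

lemma pairing_simps:
  "pairing (a + b) v = pairing a v + pairing b v" "pairing (a - b) v = pairing a v - pairing b v"
  "pairing (c *s a) v = c * pairing a v" "pairing (- a) v = - pairing a v"
  "pairing v (a + b) = pairing v a + pairing v b" "pairing v (a - b) = pairing v a - pairing v b"
  "pairing v (c *s a) = c * pairing v a" "pairing v (- a) = - pairing v a"
  "pairing v 0 = 0" "pairing 0 v = 0"
  by (simp_all add: pairing_def sum.distrib sum_subtractf sum_distrib_left sum_negf algebra_simps)

lemma pairing_sum_left: "pairing (\<Sum>i\<in>A. f i) v = (\<Sum>i\<in>A. pairing (f i) v)"
  by (induction A rule: infinite_finite_induct) (auto simp: pairing_simps)

text \<open>Differentiation under the integral sign, in the form that keeps complex linearity of the
  derivative visible.\<close>

lemma mholomorphic_integral: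
  fixes f :: "complex^'n \<Rightarrow> real \<Rightarrow> complex"
  assumes U: "open U" "convex U"
    and f: "\<And>x t. x \<in> U \<Longrightarrow> t \<in> {a..b} \<Longrightarrow> ((\<lambda>x. f x t) has_derivative pairing (G x t)) (at x)"
    and cf: "\<And>x. x \<in> U \<Longrightarrow> continuous_on {a..b} (f x)"
    and cG: "continuous_on (U \<times> {a..b}) (\<lambda>(x, t). G x t)"
    and x: "x \<in> U"
  shows "((\<lambda>x. integral {a..b} (f x)) has_derivative pairing (integral {a..b} (G x))) (at x)"
proof -
  let ?F = "\<lambda>x t. Blinfun (pairing (G x t))"
  have app: "blinfun_apply (?F x t) = pairing (G x t)" for x t
    by (simp add: bounded_linear_Blinfun_apply bounded_linear_pairing)
  have "((\<lambda>x. integral (cbox a b) (f x)) has_derivative integral (cbox a b) (?F x)) (at x within U)"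
  proof (rule leibniz_rule[where fx="?F"])
    show "((\<lambda>x. f x t) has_derivative ?F x t) (at x within U)" if "x \<in> U" "t \<in> cbox a b" for x t
      using that f[of x t] by (auto simp: app intro: has_derivative_at_withinI)
    show "f x integrable_on cbox a b" if "x \<in> U" for x
      using cf[OF that] by (auto intro: integrable_continuous_interval)
    have "continuous_on (U \<times> {a..b}) (\<lambda>z. ?F (fst z) (snd z))"
      by (rule continuous_on_blinfun_componentwise)
         (use cG in \<open>auto simp: app split_beta intro!: continuous_on_pairing\<close>)
    then show "continuous_on (U \<times> cbox a b) (\<lambda>(x, t). ?F x t)" by (simp add: split_beta)
  qed (use U x in auto)
  moreover have "blinfun_apply (integral (cbox a b) (?F x)) v = pairing (integral {a..b} (G x)) v" for v
  proof -
    have cGx: "continuous_on {a..b} (G x)"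
    proof -
      have "continuous_on {a..b} (\<lambda>t. (\<lambda>(x, t). G x t) (x, t))"
        by (rule continuous_on_compose2[OF cG]) (use x in \<open>auto intro!: continuous_intros\<close>)
      then show ?thesis by simp
    qed
    have "continuous_on {a..b} (\<lambda>t. ?F x t)"
      by (rule continuous_on_blinfun_componentwise)
         (use cGx in \<open>auto simp: app intro!: continuous_on_pairing\<close>)
    then have "?F x integrable_on {a..b}" by (rule integrable_continuous_interval)
    then have "blinfun_apply (integral (cbox a b) (?F x)) v = integral {a..b} (\<lambda>t. pairing (G x t) v)"
      by (subst blinfun_apply_integral) (auto simp: app)
    also have "\<dots> = pairing (integral {a..b} (G x)) v"
      using integral_linear[OF integrable_continuous_interval[OF cGx] bounded_linear_pairing_left[of v]]
      by (simp add: o_def)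
    finally show ?thesis .
  qed
  then have "blinfun_apply (integral (cbox a b) (?F x)) = pairing (integral {a..b} (G x))" by auto
  ultimately show ?thesis
    using U x at_within_open[OF x U(1)] by (simp add: cbox_interval)
qed

lemma norm_axis [simp]: "norm (axis i a :: complex^'n) = norm a"
proof -
  have "(\<Sum>j\<in>UNIV. (norm (axis i a $ j))\<^sup>2) = (\<Sum>j\<in>UNIV. if j = i then (norm a)\<^sup>2 else 0)"
    by (rule sum.cong) (auto simp: axis_def)
  then show ?thesis by (simp add: norm_vec_def L2_set_def)
qed

lemma bounded_linear_axis: "bounded_linear (\<lambda>t::complex. axis i t :: complex^'n)"
  by (rule linear_conv_bounded_linear[THEN iffD1], unfold_locales)
     (auto simp: axis_def vec_eq_iff)

definition circle_shift :: "'n \<Rightarrow> real \<Rightarrow> real \<Rightarrow> complex^'n" where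
  "circle_shift i r t = axis i (of_real r * cis t)"

lemma norm_circle_shift [simp]: "r > 0 \<Longrightarrow> norm (circle_shift i r t :: complex^'n) = r"
  by (simp add: circle_shift_def norm_axis norm_mult)

lemma continuous_on_circle_shift [continuous_intros]:
  assumes "continuous_on S g"
  shows "continuous_on S (\<lambda>x. circle_shift i r (g x) :: complex^'n)"
  unfolding circle_shift_def
  by (rule bounded_linear.continuous_on[OF bounded_linear_axis]) (intro continuous_intros assms)

text \<open>Cauchy's integral formula for the first derivative on the complex line through \<open>x\<close> in the
  direction of the \<open>i\<close>-th coordinate. It expresses the partial derivative as an integral of
  values of \<open>f\<close>, which is how regularity passes from \<open>f\<close> to its derivatives below.\<close>

lemma partial_deriv_Cauchy:
  fixes f :: "complex^'n \<Rightarrow> complex"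
  assumes f: "mholomorphic_on f U" "open U" and sub: "cball x r \<subseteq> U" and r: "r > 0"
  shows "partial_deriv i f x
    = 1 / (of_real (2 * pi) * of_real r) * integral {0..2*pi} (\<lambda>t. f (x + circle_shift i r t) * cis (- t))"
proof -
  let ?h = "\<lambda>z. f (x + axis i z)"
  have der: "\<exists>l. (?h has_field_derivative l) (at z)" if "z \<in> cball 0 r" for z
  proof -
    have "x + axis i z \<in> U"
      using that by (intro subsetD[OF sub]) (auto simp: dist_norm)
    from partial_deriv_has_derivative(1)[OF mholomorphic_has_gradient[OF f this], of i]
    have "((\<lambda>t. ?h (z + t)) has_field_derivative gradient f (x + axis i z) $ i) (at 0)"
      using linear_add[OF bounded_linear.linear[OF bounded_linear_axis[of i]]] by (simp add: add.assoc)
    then show ?thesis using DERIV_shift[of ?h _ 0 z] by (auto simp: add.commute)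
  qed
  have hol: "?h holomorphic_on ball 0 r"
    unfolding holomorphic_on_open[OF open_ball] using der by auto
  have cont: "continuous_on (cball 0 r) ?h"
    using der by (meson DERIV_isCont continuous_at_imp_continuous_on)
  have "((\<lambda>u. ?h u / (u - 0) ^ Suc 1) has_contour_integral (2 * pi * \<i>) / fact 1 * (deriv ^^ 1) ?h 0) (circlepath 0 r)"
    by (rule Cauchy_has_contour_integral_higher_derivative_circlepath[OF cont hol]) (use r in auto)
  then have "((\<lambda>t. ?h (r * cis t) / (r * cis t)\<^sup>2 * r * \<i> * cis t) has_integral
      (2 * pi * \<i>) * partial_deriv i f x) {0..2 * pi}"
    by (simp add: circlepath_def has_contour_integral_part_circlepath_iff partial_deriv_def numeral_2_eq_2)
  moreover have "?h (r * cis t) / (r * cis t)\<^sup>2 * r * \<i> * cis t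
      = (\<i> / r) * (f (x + circle_shift i r t) * cis (- t))" for t
    using r by (simp add: circle_shift_def field_simps power2_eq_square cis_mult)
  ultimately have "((\<lambda>t. (\<i> / r) * (f (x + circle_shift i r t) * cis (- t))) has_integral
      (2 * pi * \<i>) * partial_deriv i f x) {0..2 * pi}" by simp
  from has_integral_mult_right[OF this, of "r / \<i>"]
  have "integral {0..2*pi} (\<lambda>t. f (x + circle_shift i r t) * cis (- t)) = 2 * pi * r * partial_deriv i f x"
    using r by (intro integral_unique) (simp add: field_simps)
  then show ?thesis using r by (simp add: field_simps)
qed

lemma gradient_continuous:
  fixes f :: "complex^'n \<Rightarrow> complex"
  assumes f: "mholomorphic_on f U" "open U"
  shows "continuous_on U (gradient f)"
proof -
  have "continuous_on U (partial_deriv i f)" for i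
  proof (rule continuous_at_imp_continuous_on, rule ballI)
    fix x assume "x \<in> U"
    then obtain e where e: "e > 0" "cball x e \<subseteq> U" using f(2) open_contains_cball by blast
    define r where "r = e / 2"
    have rpos: "r > 0" using e by (simp add: r_def)
    have r: "cball y r \<subseteq> U" if "y \<in> ball x r" for y
    proof
      fix z assume "z \<in> cball y r"
      then have "dist x z \<le> e" using that dist_triangle[of x z y] by (auto simp: r_def)
      then show "z \<in> U" using e(2) by auto
    qed
    have mem: "y + circle_shift i r t \<in> U" if "y \<in> ball x r" for y t
      using rpos by (intro subsetD[OF r[OF that]]) (auto simp: dist_norm)
    have "continuous_on (ball x r) (\<lambda>y. integral (cbox 0 (2*pi)) (\<lambda>t. f (y + circle_shift i r t) * cis (- t)))"
    proof (rule integral_continuous_on_param)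
      have "continuous_on (ball x r \<times> cbox 0 (2*pi)) (\<lambda>z. f (fst z + circle_shift i r (snd z)) * cis (- snd z))"
        by (intro continuous_intros continuous_on_compose2[OF mholomorphic_continuous[OF f(1)]])
           (use mem in auto)
      then show "continuous_on (ball x r \<times> cbox 0 (2*pi)) (\<lambda>(y, t). f (y + circle_shift i r t) * cis (- t))"
        by (simp add: split_beta)
    qed
    then have "continuous_on (ball x r) (partial_deriv i f)"
      by (rule continuous_on_eq[OF continuous_on_mult[OF continuous_on_const[of _ "1 / (of_real (2 * pi) * of_real r)"]]])
         (subst partial_deriv_Cauchy[OF f r rpos], assumption, simp)
    then show "isCont (partial_deriv i f) x"
      using rpos by (simp add: continuous_on_eq_continuous_at)
  qed
  then show ?thesis unfolding gradient_def by (intro continuous_intros)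
qed

text \<open>Differentiating Cauchy's formula under the integral sign shows that a partial derivative
  is again holomorphic, with partial derivatives given by Cauchy's formula for the partial
  derivatives of \<open>f\<close>. Applying that formula once more to \<open>partial_deriv j f\<close> identifies the two
  mixed derivatives.\<close>

lemma
  fixes f :: "complex^'n \<Rightarrow> complex"
  assumes f: "mholomorphic_on f U" "open U"
  shows mholomorphic_partial_deriv: "mholomorphic_on (partial_deriv i f) U"
    and partial_deriv_commute: "x \<in> U \<Longrightarrow> partial_deriv j (partial_deriv i f) x = partial_deriv i (partial_deriv j f) x"
proof -
  have *: "\<exists>r>0. cball x r \<subseteq> U \<and> (\<exists>c. c = 1 / (of_real (2 * pi) * of_real r) \<and> (partial_deriv i f has_derivative
     pairing (\<chi> j. c * integral {0..2*pi} (\<lambda>t. partial_deriv j f (x + circle_shift i r t) * cis (- t)))) (at x))"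
    if "x \<in> U" for x i
  proof -
    obtain e where e: "e > 0" "cball x e \<subseteq> U" using f(2) \<open>x \<in> U\<close> open_contains_cball by blast
    define r where "r = e / 2"
    define c :: complex where "c = 1 / (of_real (2 * pi) * of_real r)"
    have rpos: "r > 0" using e by (simp add: r_def)
    have r: "cball y r \<subseteq> U" if "y \<in> ball x r" for y
    proof
      fix z assume "z \<in> cball y r"
      then have "dist x z \<le> e" using that dist_triangle[of x z y] by (auto simp: r_def)
      then show "z \<in> U" using e(2) by auto
    qed
    have mem: "y + circle_shift i r t \<in> U" if "y \<in> ball x r" for y t
      using rpos by (intro subsetD[OF r[OF that]]) (auto simp: dist_norm)
    define G where "G y t = cis (- t) *s gradient f (y + circle_shift i r t)" for y t
    have cG: "continuous_on (ball x r \<times> {0..2*pi}) (\<lambda>(y, t). G y t)"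
    proof -
      have "continuous_on (ball x r \<times> {0..2*pi}) (\<lambda>z. gradient f (fst z + circle_shift i r (snd z)))"
        by (intro continuous_intros continuous_on_compose2[OF gradient_continuous[OF f]])
           (use mem in auto)
      then show ?thesis
        unfolding G_def split_beta vector_scalar_mult_def by (intro continuous_intros) auto
    qed
    have "((\<lambda>y. integral {0..2*pi} (\<lambda>t. f (y + circle_shift i r t) * cis (- t))) has_derivative
        pairing (integral {0..2*pi} (G x))) (at x)"
    proof (rule mholomorphic_integral[OF open_ball convex_ball _ _ cG])
      fix y t assume "y \<in> ball x r" "t \<in> {0..2*pi}"
      have "((\<lambda>y. y + circle_shift i r t) has_derivative (\<lambda>v. v)) (at y)"
        by (auto intro!: derivative_eq_intros)
      from diff_chain_at[OF this mholomorphic_has_gradient[OF f mem[OF \<open>y \<in> ball x r\<close>, of t]]]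
      have "((\<lambda>y. f (y + circle_shift i r t)) has_derivative pairing (gradient f (y + circle_shift i r t))) (at y)"
        by (simp add: o_def)
      from has_derivative_mult_left[OF this, of "cis (- t)"]
      show "((\<lambda>x. f (x + circle_shift i r t) * cis (- t)) has_derivative pairing (G y t)) (at y)"
        by (rule has_derivative_eq_rhs) (auto simp: G_def pairing_def sum_distrib_left sum_distrib_right fun_eq_iff mult_ac)
    next
      fix y assume "y \<in> ball x r"
      then show "continuous_on {0..2*pi} (\<lambda>t. f (y + circle_shift i r t) * cis (- t))"
        by (intro continuous_intros continuous_on_compose2[OF mholomorphic_continuous[OF f(1)]])
           (use mem in auto)
    qed (use rpos in auto)
    from has_derivative_mult_right[OF this, of c]
    have 1: "((\<lambda>y. c * integral {0..2*pi} (\<lambda>t. f (y + circle_shift i r t) * cis (- t))) has_derivative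
        pairing (\<chi> j. c * integral {0..2*pi} (G x) $ j)) (at x)"
    proof (rule has_derivative_eq_rhs)
      have "(\<chi> j. c * integral {0..2*pi} (G x) $ j) = c *s integral {0..2*pi} (G x)"
        by (simp add: vec_eq_iff)
      then show "(\<lambda>v. c * pairing (integral {0..2*pi} (G x)) v)
          = pairing (\<chi> j. c * integral {0..2*pi} (G x) $ j)"
        by (simp only: pairing_simps fun_eq_iff) simp
    qed
    have "continuous_on {0..2*pi} (G x)"
    proof -
      have "continuous_on {0..2*pi} (\<lambda>t. (\<lambda>(x, t). G x t) (x, t))"
        by (rule continuous_on_compose2[OF cG]) (use rpos in \<open>auto intro!: continuous_intros\<close>)
      then show ?thesis by simp
    qed
    then have 2: "integral {0..2*pi} (G x) $ j = integral {0..2*pi} (\<lambda>t. partial_deriv j f (x + circle_shift i r t) * cis (- t))" for j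
      using integral_linear[OF integrable_continuous_interval bounded_linear_vec_nth, of 0 "2*pi" "G x" j]
      by (simp add: o_def G_def gradient_def mult.commute)
    have "(partial_deriv i f has_derivative
        pairing (\<chi> j. c * integral {0..2*pi} (G x) $ j)) (at x)"
      by (rule has_derivative_transform_within_open[OF 1, of "ball x r"])
         (simp_all add: rpos c_def partial_deriv_Cauchy[OF f r rpos])
    then have "(partial_deriv i f has_derivative
      pairing (\<chi> j. c * integral {0..2*pi} (\<lambda>t. partial_deriv j f (x + circle_shift i r t) * cis (- t)))) (at x)"
      by (simp only: 2)
    moreover have "cball x r \<subseteq> U" using r[of x] rpos by simp
    ultimately show ?thesis using rpos c_def by blast
  qed
  show h: "mholomorphic_on (partial_deriv i f) U" for i
    unfolding mholomorphic_on_def using *[of _ i] has_derivative_at_withinI by blast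
  assume x: "x \<in> U"
  obtain r c where r: "r > 0" "cball x r \<subseteq> U" "c = 1 / (of_real (2 * pi) * of_real r)"
    and d: "(partial_deriv i f has_derivative
     pairing (\<chi> j. c * integral {0..2*pi} (\<lambda>t. partial_deriv j f (x + circle_shift i r t) * cis (- t)))) (at x)"
    using *[OF x, of i] by blast
  show "partial_deriv j (partial_deriv i f) x = partial_deriv i (partial_deriv j f) x"
    using partial_deriv_has_derivative(2)[OF d, of j] partial_deriv_Cauchy[OF h f(2) r(2,1), of i j] r(3) by simp
qed

text \<open>Hadamard's lemma: the quotient \<open>a\<close> is the average of the derivative of \<open>h\<close> in the
  direction \<open>e\<close> over the segment from the projection of \<open>w\<close> to the line \<open>pairing l = 0\<close> up to
  \<open>w\<close>. It replaces Weierstrass division for divisors that are linear.\<close>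

lemma hadamard_division:
  fixes h :: "complex^'n \<Rightarrow> complex"
  assumes h: "mholomorphic_on h (ball 0 \<rho>)" and le: "pairing l e = 1" and \<rho>: "\<rho> > 0"
  shows "\<exists>a \<delta>. \<delta> > 0 \<and> mholomorphic_on a (ball 0 \<delta>) \<and>
    (\<forall>w\<in>ball 0 \<delta>. h w = h (w - pairing l w *s e) + pairing l w * a w)"
proof -
  define De where "De w = pairing (gradient h w) e" for w
  define S where "S w t = w - ((1 - of_real t) * pairing l w) *s e" for w :: "complex^'n" and t :: real
  obtain K where K: "K > 0" "\<And>w :: complex^'n. norm (pairing l w) \<le> norm w * K"
    using bounded_linear.pos_bounded[OF bounded_linear_pairing[of l]] by auto
  define \<delta> where "\<delta> = \<rho> / (1 + K * norm e)"
  have d: "\<delta> > 0" using K \<rho> unfolding \<delta>_def by (intro divide_pos_pos add_pos_nonneg) auto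
  have nsm: "norm (c *s (v::complex^'n)) = norm c * norm v" for c v
    by (simp add: norm_vec_def L2_set_def norm_mult power_mult_distrib flip: sum_distrib_left) (simp add: real_sqrt_mult)
  have mem: "S w t \<in> ball 0 \<rho>" if "w \<in> ball 0 \<delta>" "t \<in> {0..1}" for w t
  proof -
    have "norm (S w t) \<le> norm w + norm (((1 - of_real t) * pairing l w) *s e)"
      unfolding S_def by (rule norm_triangle_ineq4)
    also have "\<dots> = norm w + \<bar>1 - t\<bar> * norm (pairing l w) * norm e"
      unfolding nsm norm_mult by (metis norm_of_real of_real_1 of_real_diff)
    also have "\<dots> \<le> norm w + 1 * (norm w * K) * norm e"
      using that K by (intro add_left_mono mult_right_mono mult_mono) auto
    also have "\<dots> = norm w * (1 + K * norm e)" by (simp add: algebra_simps)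
    also have "\<dots> < \<delta> * (1 + K * norm e)" using that K by (intro mult_strict_right_mono add_pos_nonneg) auto
    also have "\<dots> = \<rho>" unfolding \<delta>_def using K by (simp add: add_pos_nonneg less_imp_neq[symmetric])
    finally show ?thesis by simp
  qed
  have De: "mholomorphic_on De (ball 0 \<rho>)"
  proof (rule mholomorphic_onI)
    fix x :: "complex^'n" assume x: "x \<in> ball 0 \<rho>"
    have "((\<lambda>w. \<Sum>i\<in>UNIV. partial_deriv i h w * e $ i) has_derivative
       (\<lambda>v. \<Sum>i\<in>UNIV. pairing (gradient (partial_deriv i h) x) v * e $ i)) (at x)"
      by (intro has_derivative_sum has_derivative_mult_left mholomorphic_has_gradient[OF mholomorphic_partial_deriv[OF h] _ x]) auto
    moreover have "De = (\<lambda>w. \<Sum>i\<in>UNIV. partial_deriv i h w * e $ i)"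
      by (simp add: De_def fun_eq_iff pairing_def gradient_def)
    moreover have "(\<lambda>v. \<Sum>i\<in>UNIV. pairing (gradient (partial_deriv i h) x) v * e $ i)
        = pairing (\<Sum>i\<in>UNIV. e $ i *s gradient (partial_deriv i h) x)"
      by (simp add: fun_eq_iff pairing_sum_left pairing_simps mult.commute)
    ultimately show "(De has_derivative pairing (\<Sum>i\<in>UNIV. e $ i *s gradient (partial_deriv i h) x)) (at x)"
      by metis
  qed
  have contS: "continuous_on A (\<lambda>z. S (f z) (g z))" if "continuous_on A f" "continuous_on A g"
    for A :: "'z::topological_space set" and f g
    unfolding S_def vector_scalar_mult_def using that
    by (intro continuous_intros continuous_on_pairing) auto
  define a where "a w = integral {0..1} (\<lambda>t. De (S w t))" for w
  define G where "G w t = gradient De (S w t) - ((1 - of_real t) * pairing (gradient De (S w t)) e) *s l" for w t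
  have "(a has_derivative pairing (integral {0..1} (G w))) (at w)" if "w \<in> ball 0 \<delta>" for w
    unfolding a_def
  proof (rule mholomorphic_integral[OF open_ball convex_ball _ _ _ that])
    fix w :: "complex^'n" and t assume wt: "w \<in> ball 0 \<delta>" "t \<in> {0..1::real}"
    have "((\<lambda>w. S w t) has_derivative (\<lambda>v. S v t)) (at w)"
    proof (rule bounded_linear_imp_has_derivative)
      show "bounded_linear (\<lambda>v. S v t)"
        by (rule linear_conv_bounded_linear[THEN iffD1], unfold_locales)
           (auto simp: S_def vec_eq_iff algebra_simps pairing_def sum.distrib sum_distrib_left scaleR_sum_right)
    qed
    from diff_chain_at[OF this mholomorphic_has_gradient[OF De open_ball mem[OF wt]]]
    show "((\<lambda>w. De (S w t)) has_derivative pairing (G w t)) (at w)"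
      unfolding o_def
      by (rule has_derivative_eq_rhs)
         (simp add: fun_eq_iff S_def G_def pairing_simps algebra_simps)
  next
    fix w :: "complex^'n" assume "w \<in> ball 0 \<delta>"
    then show "continuous_on {0..1} (\<lambda>t. De (S w t))"
      by (intro continuous_on_compose2[OF mholomorphic_continuous[OF De]] contS continuous_intros)
         (use mem in auto)
  next
    have "continuous_on (ball 0 \<delta> \<times> {0..1}) (\<lambda>z. gradient De (S (fst z) (snd z)))"
      by (intro continuous_on_compose2[OF gradient_continuous[OF De open_ball]] contS continuous_intros)
         (use mem in auto)
    then show "continuous_on (ball 0 \<delta> \<times> {0..1}) (\<lambda>(w, t). G w t)"
      unfolding G_def split_beta vector_scalar_mult_def by (intro continuous_intros continuous_on_pairing) auto
  qed
  then have "mholomorphic_on a (ball 0 \<delta>)" by (rule mholomorphic_onI)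
  moreover have "h w = h (w - pairing l w *s e) + pairing l w * a w" if w: "w \<in> ball 0 \<delta>" for w
  proof -
    have "((\<lambda>t. pairing l w * De (S w t)) has_integral (h (S w 1) - h (S w 0))) {0..1}"
    proof (rule fundamental_theorem_of_calculus)
      fix t :: real assume t: "t \<in> {0..1}"
      have "(S w has_derivative (\<lambda>s. (of_real s * pairing l w) *s e)) (at t)"
      proof -
        have "bounded_linear (\<lambda>s::real. s *\<^sub>R (pairing l w *s e))" by (rule bounded_linear_scaleR_left)
        moreover have "(\<lambda>s::real. s *\<^sub>R (pairing l w *s e)) = (\<lambda>s. (of_real s * pairing l w) *s e)"
          by (simp add: fun_eq_iff vec_eq_iff scaleR_conv_of_real[of _ "_ * _"] mult.assoc)
        ultimately have "bounded_linear (\<lambda>s::real. (of_real s * pairing l w) *s e)" by simp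
        then have "((\<lambda>s. (w - pairing l w *s e) + (of_real s * pairing l w) *s e) has_derivative
            (\<lambda>s. 0 + (of_real s * pairing l w) *s e)) (at t)"
          by (intro has_derivative_add has_derivative_const bounded_linear_imp_has_derivative)
        moreover have "S w = (\<lambda>s. (w - pairing l w *s e) + (of_real s * pairing l w) *s e)"
          by (simp add: S_def fun_eq_iff vec_eq_iff algebra_simps)
        ultimately show ?thesis by simp
      qed
      from diff_chain_at[OF this mholomorphic_has_gradient[OF h open_ball mem[OF w t]]]
      have "((\<lambda>t. h (S w t)) has_derivative (\<lambda>s. pairing (gradient h (S w t)) ((of_real s * pairing l w) *s e))) (at t)"
        by (simp add: o_def)
      moreover have "pairing (gradient h (S w t)) ((of_real s * pairing l w) *s e) = s *\<^sub>R (pairing l w * De (S w t))" for s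
        by (simp add: De_def pairing_simps scaleR_conv_of_real mult_ac)
      ultimately show "((\<lambda>t. h (S w t)) has_vector_derivative pairing l w * De (S w t)) (at t within {0..1})"
        unfolding has_vector_derivative_def by (simp add: has_derivative_at_withinI)
    qed simp
    moreover have "(\<lambda>t. De (S w t)) integrable_on {0..1}"
      by (intro integrable_continuous_interval continuous_on_compose2[OF mholomorphic_continuous[OF De]] contS continuous_intros)
         (use mem w in auto)
    then have "((\<lambda>t. pairing l w * De (S w t)) has_integral pairing l w * a w) {0..1}"
      unfolding a_def by (intro has_integral_mult_right integrable_integral)
    ultimately have "h (S w 1) - h (S w 0) = pairing l w * a w" by (rule has_integral_unique)
    then show ?thesis by (simp add: S_def algebra_simps)
  qed
  ultimately show ?thesis using d by blast
qed

text \<open>The derivative rules in the form \<open>pairing l\<close>, so that gradients can be read off by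
  unification.\<close>

lemma pairing_derivative_const: "((\<lambda>x :: complex^'n. c) has_derivative pairing 0) F"
proof -
  have "pairing (0 :: complex^'n) = (\<lambda>v. 0)" by (simp add: fun_eq_iff pairing_simps)
  then show ?thesis by (simp only: has_derivative_const)
qed

lemma pairing_derivative_nth: "((\<lambda>x :: complex^'n. x $ i) has_derivative pairing (axis i 1)) F"
proof -
  have "pairing (axis i 1 :: complex^'n) = (\<lambda>v. v $ i)"
    by (simp add: fun_eq_iff pairing_def axis_def if_distrib if_distribR cong: if_cong)
  then show ?thesis by (simp add: bounded_linear_vec_nth bounded_linear_imp_has_derivative)
qed

lemma pairing_derivative_pairing: "(pairing l has_derivative pairing l) F"
  by (rule bounded_linear_imp_has_derivative[OF bounded_linear_pairing])

lemma pairing_derivative_add: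
  "(f has_derivative pairing k) F \<Longrightarrow> (g has_derivative pairing l) F \<Longrightarrow>
    ((\<lambda>x. f x + g x) has_derivative pairing (k + l)) F"
  by (rule has_derivative_eq_rhs, erule (1) has_derivative_add) (simp add: fun_eq_iff pairing_simps)

lemma pairing_derivative_minus:
  "(f has_derivative pairing k) F \<Longrightarrow> ((\<lambda>x. - f x) has_derivative pairing (- k)) F"
  by (rule has_derivative_eq_rhs, erule has_derivative_minus) (simp add: fun_eq_iff pairing_simps)

lemma pairing_derivative_diff:
  "(f has_derivative pairing k) F \<Longrightarrow> (g has_derivative pairing l) F \<Longrightarrow>
    ((\<lambda>x. f x - g x) has_derivative pairing (k - l)) F"
  by (rule has_derivative_eq_rhs, erule (1) has_derivative_diff) (simp add: fun_eq_iff pairing_simps)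

lemma pairing_derivative_mult:
  "(f has_derivative pairing k) (at x) \<Longrightarrow> (g has_derivative pairing l) (at x) \<Longrightarrow>
    ((\<lambda>x. f x * g x) has_derivative pairing (f x *s l + g x *s k)) (at x)"
  by (rule has_derivative_eq_rhs, erule (1) has_derivative_mult)
     (simp add: fun_eq_iff pairing_simps mult.commute)

lemma pairing_derivative_chain:
  "(f has_derivative pairing k) (at x) \<Longrightarrow> (\<phi> has_field_derivative D) (at (f x)) \<Longrightarrow>
    ((\<lambda>x. \<phi> (f x)) has_derivative pairing (D *s k)) (at x)"
  unfolding has_field_derivative_def
  by (rule has_derivative_eq_rhs, erule diff_chain_at[unfolded o_def], assumption)
     (simp add: fun_eq_iff pairing_simps)

lemma pairing_derivative_divide:
  assumes "(f has_derivative pairing k) (at x)" "(g has_derivative pairing l) (at x)" "g x \<noteq> 0"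
  shows "((\<lambda>x. f x / g x) has_derivative pairing ((1 / g x) *s k - (f x / (g x)\<^sup>2) *s l)) (at x)"
proof -
  have "((\<lambda>x. inverse (g x)) has_derivative pairing ((- (1 / (g x)\<^sup>2)) *s l)) (at x)"
    by (rule pairing_derivative_chain[OF assms(2)])
       (use assms(3) in \<open>auto intro!: derivative_eq_intros simp: field_simps power2_eq_square\<close>)
  from pairing_derivative_mult[OF assms(1) this]
  have "((\<lambda>x. f x / g x) has_derivative pairing (f x *s (- (1 / (g x)\<^sup>2) *s l) + inverse (g x) *s k)) (at x)"
    by (simp only: divide_inverse)
  moreover have "f x *s (- (1 / (g x)\<^sup>2) *s l) + inverse (g x) *s k = (1 / g x) *s k - (f x / (g x)\<^sup>2) *s l"
    by (simp add: vec_eq_iff divide_inverse)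
  ultimately show ?thesis by (simp only:)
qed

lemma mholomorphic_on_iff:
  "open U \<Longrightarrow> mholomorphic_on f U \<longleftrightarrow> (\<forall>x\<in>U. \<exists>l. (f has_derivative pairing l) (at x))"
  unfolding mholomorphic_on_def by (metis at_within_open)

lemma
  assumes "open U"
  shows mholomorphic_const: "mholomorphic_on (\<lambda>x. c) U"
    and mholomorphic_nth: "mholomorphic_on (\<lambda>x. x $ i) U"
    and mholomorphic_pairing: "mholomorphic_on (pairing l) U"
    and mholomorphic_add: "mholomorphic_on f U \<Longrightarrow> mholomorphic_on g U \<Longrightarrow> mholomorphic_on (\<lambda>x. f x + g x) U"
    and mholomorphic_diff: "mholomorphic_on f U \<Longrightarrow> mholomorphic_on g U \<Longrightarrow> mholomorphic_on (\<lambda>x. f x - g x) U"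
    and mholomorphic_minus: "mholomorphic_on f U \<Longrightarrow> mholomorphic_on (\<lambda>x. - f x) U"
    and mholomorphic_mult: "mholomorphic_on f U \<Longrightarrow> mholomorphic_on g U \<Longrightarrow> mholomorphic_on (\<lambda>x. f x * g x) U"
    and mholomorphic_divide: "mholomorphic_on f U \<Longrightarrow> mholomorphic_on g U \<Longrightarrow> (\<And>x. x \<in> U \<Longrightarrow> g x \<noteq> 0) \<Longrightarrow>
      mholomorphic_on (\<lambda>x. f x / g x) U"
    and mholomorphic_chain: "mholomorphic_on f U \<Longrightarrow> \<phi> holomorphic_on S \<Longrightarrow> open S \<Longrightarrow> f ` U \<subseteq> S \<Longrightarrow>
      mholomorphic_on (\<lambda>x. \<phi> (f x)) U"
proof -
  show "mholomorphic_on (\<lambda>x. c) U" "mholomorphic_on (\<lambda>x. x $ i) U" "mholomorphic_on (pairing l) U"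
    using pairing_derivative_const pairing_derivative_nth pairing_derivative_pairing
    unfolding mholomorphic_on_def by blast+
  show "mholomorphic_on (\<lambda>x. f x + g x) U" if "mholomorphic_on f U" "mholomorphic_on g U"
    by (rule mholomorphic_onI, rule pairing_derivative_add)
       (rule mholomorphic_has_gradient[OF that(1) assms] mholomorphic_has_gradient[OF that(2) assms]
          , assumption)+
  show "mholomorphic_on (\<lambda>x. f x - g x) U" if "mholomorphic_on f U" "mholomorphic_on g U"
    by (rule mholomorphic_onI, rule pairing_derivative_diff)
       (rule mholomorphic_has_gradient[OF that(1) assms] mholomorphic_has_gradient[OF that(2) assms]
          , assumption)+
  show "mholomorphic_on (\<lambda>x. f x * g x) U" if "mholomorphic_on f U" "mholomorphic_on g U"
    by (rule mholomorphic_onI, rule pairing_derivative_mult)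
       (rule mholomorphic_has_gradient[OF that(1) assms] mholomorphic_has_gradient[OF that(2) assms]
          , assumption)+
  show "mholomorphic_on (\<lambda>x. f x / g x) U" if "mholomorphic_on f U" "mholomorphic_on g U" "\<And>x. x \<in> U \<Longrightarrow> g x \<noteq> 0"
    by (rule mholomorphic_onI, rule pairing_derivative_divide)
       (rule mholomorphic_has_gradient[OF that(1) assms] mholomorphic_has_gradient[OF that(2) assms]
          that(3), assumption)+
  show "mholomorphic_on (\<lambda>x. - f x) U" if "mholomorphic_on f U"
    by (rule mholomorphic_onI, rule pairing_derivative_minus, rule mholomorphic_has_gradient[OF that assms])
  show "mholomorphic_on (\<lambda>x. \<phi> (f x)) U"
    if "mholomorphic_on f U" "\<phi> holomorphic_on S" "open S" "f ` U \<subseteq> S"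
    unfolding mholomorphic_on_iff[OF assms]
  proof
    fix x assume x: "x \<in> U"
    have "(f has_derivative pairing (gradient f x)) (at x)"
      by (rule mholomorphic_has_gradient[OF that(1) assms x])
    moreover have "(\<phi> has_field_derivative deriv \<phi> (f x)) (at (f x))"
      using that x by (meson holomorphic_derivI image_subset_iff)
    ultimately show "\<exists>l. ((\<lambda>x. \<phi> (f x)) has_derivative pairing l) (at x)"
      using pairing_derivative_chain by blast
  qed
qed

section \<open>Intersection multiplicity with a line\<close>

text \<open>Invariance of dimension for a quotient known only through its coordinate functionals: if
  the vectors \<open>\<phi> j\<close> with \<open>j < n'\<close> form a basis of the space of sequences of length \<open>n\<close>, then the
  matrix of the \<open>\<phi> j\<close> and its inverse \<open>B\<close> satisfy \<open>n = tr (B \<phi>) = tr (\<phi> B) = n'\<close>.\<close>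

lemma basis_card_unique:
  fixes \<phi> :: "nat \<Rightarrow> nat \<Rightarrow> complex"
  assumes ex: "\<And>x :: nat \<Rightarrow> complex. \<exists>!c. (\<forall>j\<ge>n'. c j = 0) \<and> (\<forall>i<n. x i = (\<Sum>j<n'. c j * \<phi> j i))"
  shows "n = n'"
proof -
  define B where "B i = (THE c. (\<forall>j\<ge>n'. c j = 0) \<and> (\<forall>k<n. (if k = i then 1 else 0) = (\<Sum>j<n'. c j * \<phi> j k)))" for i
  have B: "(\<forall>j\<ge>n'. B i j = 0) \<and> (\<forall>k<n. (if k = i then 1 else 0) = (\<Sum>j<n'. B i j * \<phi> j k))" for i
  proof -
    have "\<exists>!c. (\<forall>j\<ge>n'. c j = 0) \<and> (\<forall>k<n. (if k = i then 1 else 0) = (\<Sum>j<n'. c j * \<phi> j k))" by (rule ex)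
    from theI'[OF this] show ?thesis by (simp only: B_def)
  qed
  have AB: "(\<Sum>j<n'. B i j * \<phi> j i) = 1" if "i < n" for i using B[of i] that by auto
  have BA: "(\<Sum>i<n. \<phi> k i * B i k) = 1" if k: "k < n'" for k
  proof -
    define c where "c j = (\<Sum>i<n. \<phi> k i * B i j)" for j
    have "\<phi> k m = (\<Sum>j<n'. c j * \<phi> j m)" if m: "m < n" for m
    proof -
      have "(\<Sum>j<n'. c j * \<phi> j m) = (\<Sum>i<n. \<phi> k i * (\<Sum>j<n'. B i j * \<phi> j m))"
        unfolding c_def sum_distrib_left sum_distrib_right by (subst sum.swap) (simp add: mult_ac)
      also have "\<dots> = (\<Sum>i<n. \<phi> k i * (if m = i then 1 else 0))"
        using B m by (intro sum.cong) auto
      also have "\<dots> = \<phi> k m" using m by (simp add: if_distrib cong: if_cong)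
      finally show ?thesis by simp
    qed
    moreover have "\<forall>j\<ge>n'. c j = 0" using B by (simp add: c_def)
    moreover have "(\<Sum>j<n'. (if j = k then 1 else 0) * \<phi> j m) = (\<Sum>j<n'. if j = k then \<phi> j m else 0)" for m
      by (rule sum.cong) auto
    then have "\<phi> k m = (\<Sum>j<n'. (if j = k then 1 else 0) * \<phi> j m)" for m
      using k by simp
    ultimately have "c = (\<lambda>j. if j = k then 1 else 0)"
      using the1_equality[OF ex[of "\<phi> k"], of c] the1_equality[OF ex[of "\<phi> k"], of "\<lambda>j. if j = k then 1 else 0"] k
      by simp
    then have "c k = 1" by simp
    then show ?thesis by (simp add: c_def)
  qed
  have "of_nat n = (\<Sum>i<n. \<Sum>j<n'. B i j * \<phi> j i)" using AB by simp
  also have "\<dots> = (\<Sum>j<n'. \<Sum>i<n. \<phi> j i * B i j)" by (subst sum.swap) (simp add: mult.commute)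
  also have "\<dots> = of_nat n'" using BA by simp
  finally show ?thesis using of_nat_eq_iff by blast
qed

definition line_fps :: "complex^'n \<Rightarrow> (complex^'n \<Rightarrow> complex) \<Rightarrow> complex fps" where
  "line_fps \<kappa> h = fps_expansion (\<lambda>t. h (t *s \<kappa>)) 0"

lemma scale_has_derivative: "((\<lambda>t::complex. t *s \<kappa> :: complex^'n) has_derivative (\<lambda>s. s *s \<kappa>)) F"
  by (rule bounded_linear_imp_has_derivative)
     (rule linear_conv_bounded_linear[THEN iffD1], unfold_locales, auto simp: vec_eq_iff algebra_simps)

lemma isCont_scale: "isCont (\<lambda>t::complex. t *s \<kappa> :: complex^'n) x"
  by (rule has_derivative_continuous[OF scale_has_derivative])

lemma line_has_field_derivative:
  assumes "(h has_derivative pairing l) (at (t *s \<kappa>))"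
  shows "((\<lambda>t. h (t *s \<kappa>)) has_field_derivative pairing l \<kappa>) (at t)"
  using diff_chain_at[OF scale_has_derivative assms]
  by (simp add: has_field_derivative_def o_def pairing_simps mult_commute_abs)

lemma eventually_on_line:
  assumes "eventually P (nhds (0::complex^'n))"
  shows "eventually (\<lambda>t. P (t *s \<kappa>)) (nhds (0::complex))"
proof -
  have "filterlim (\<lambda>t. t *s \<kappa>) (nhds (0 *s \<kappa>)) (nhds (0::complex))"
    by (rule iffD1[OF tendsto_at_iff_tendsto_nhds isCont_scale[unfolded isCont_def]])
  then show ?thesis using assms by (simp add: filterlim_iff)
qed

lemma line_expansion:
  assumes "mholomorphic_on h U" "open U" "0 \<in> U"
  shows "(\<lambda>t. h (t *s \<kappa>)) has_fps_expansion line_fps \<kappa> h"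
proof -
  define V where "V = (\<lambda>t. t *s \<kappa>) -` U"
  have "open V" unfolding V_def
    by (rule continuous_open_vimage) (use isCont_scale assms in \<open>auto intro: continuous_at_imp_continuous_on\<close>)
  moreover have "0 \<in> V" using assms by (simp add: V_def)
  moreover have "(\<lambda>t. h (t *s \<kappa>)) holomorphic_on V"
    using line_has_field_derivative[OF mholomorphic_has_gradient[OF assms(1,2)]]
    by (subst holomorphic_on_open[OF \<open>open V\<close>]) (auto simp: V_def)
  ultimately show ?thesis unfolding line_fps_def by (rule has_fps_expansion_fps_expansion)
qed

lemma germs_iff: "g \<in> germs \<longleftrightarrow> (\<exists>\<rho>>0. mholomorphic_on g (ball 0 \<rho>))"
  unfolding germs_def mem_Collect_eq
  by (meson centre_in_ball mholomorphic_subset open_ball open_contains_ball)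

lemma germs_common_ball:
  assumes "f \<in> germs" "g \<in> germs"
  obtains \<rho> where "\<rho> > 0" "mholomorphic_on f (ball 0 \<rho>)" "mholomorphic_on g (ball 0 \<rho>)"
proof -
  from assms obtain r s where "r > 0" "mholomorphic_on f (ball 0 r)" "s > 0" "mholomorphic_on g (ball 0 s)"
    unfolding germs_iff by blast
  moreover have "ball 0 (min r s) \<subseteq> ball (0 :: complex^2) r" "ball 0 (min r s) \<subseteq> ball (0 :: complex^2) s"
    by (simp_all add: subset_ball)
  ultimately show ?thesis using that[of "min r s"] mholomorphic_subset by (metis min_less_iff_conj)
qed

lemma germ_line_expansion: "h \<in> germs \<Longrightarrow> (\<lambda>t. h (t *s \<kappa>)) has_fps_expansion line_fps \<kappa> h"
  unfolding germs_iff by (elim exE conjE, rule line_expansion[OF _ open_ball], assumption) simp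

lemma
  shows germs_add: "f \<in> germs \<Longrightarrow> g \<in> germs \<Longrightarrow> (\<lambda>w. f w + g w) \<in> germs"
    and germs_diff: "f \<in> germs \<Longrightarrow> g \<in> germs \<Longrightarrow> (\<lambda>w. f w - g w) \<in> germs"
    and germs_mult: "f \<in> germs \<Longrightarrow> g \<in> germs \<Longrightarrow> (\<lambda>w. f w * g w) \<in> germs"
  unfolding germs_iff[of "\<lambda>w. _ w + _ w"] germs_iff[of "\<lambda>w. _ w - _ w"] germs_iff[of "\<lambda>w. _ w * _ w"]
  by (metis germs_common_ball mholomorphic_add[OF open_ball], metis germs_common_ball mholomorphic_diff[OF open_ball],
      metis germs_common_ball mholomorphic_mult[OF open_ball])

lemma germs_const: "(\<lambda>w. c) \<in> germs"
  using mholomorphic_const[of "ball 0 1"] by (auto simp: germs_iff intro!: exI[of _ 1])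

lemma germs_pairing: "pairing l \<in> germs"
  using mholomorphic_pairing[of "ball 0 1"] by (auto simp: germs_iff intro!: exI[of _ 1])

lemma germs_power: "f \<in> germs \<Longrightarrow> (\<lambda>w. f w ^ n) \<in> germs"
  by (induction n) (auto intro: germs_const germs_mult)

lemma germs_sum: "(\<And>i. i \<in> A \<Longrightarrow> f i \<in> germs) \<Longrightarrow> (\<lambda>w. \<Sum>i\<in>A. f i w) \<in> germs"
  by (induction A rule: infinite_finite_induct) (auto intro: germs_const germs_add)

lemma germs_chain:
  assumes "\<phi> analytic_on {0}"
  shows "(\<lambda>w. \<phi> (pairing l w)) \<in> germs"
proof -
  obtain S where S: "open S" "0 \<in> S" "\<phi> holomorphic_on S" using assms by (auto simp: analytic_at)
  have "open (pairing l -` S)"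
    by (rule continuous_open_vimage[OF S(1)])
       (rule linear_continuous_at[OF bounded_linear_pairing])
  moreover from this have "mholomorphic_on (\<lambda>w. \<phi> (pairing l w)) (pairing l -` S)"
    by (intro mholomorphic_chain[OF _ mholomorphic_pairing S(3,1)]) auto
  ultimately show ?thesis using S(2) unfolding germs_def by (auto simp: pairing_simps)
qed

lemma line_fps_eqI: "(\<lambda>t. h (t *s \<kappa>)) has_fps_expansion H \<Longrightarrow> line_fps \<kappa> h = H"
  unfolding line_fps_def by (rule fps_expansion_eqI)

lemma line_coordinates:
  fixes l :: "complex^2"
  assumes "l \<noteq> 0"
  obtains e m where "pairing l e = 1" "\<And>w. w = pairing l w *s e + pairing m w *s vector [- l $ 2, l $ 1]"
    "pairing m (vector [- l $ 2, l $ 1]) = 1" "pairing l (vector [- l $ 2, l $ 1]) = 0"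
proof -
  obtain e where e: "pairing l e = 1"
  proof (cases "l $ 1 = 0")
    case True
    then have "l $ 2 \<noteq> 0" using assms by (auto simp: vec_eq_iff forall_2)
    then show ?thesis using that[of "vector [0, 1 / l $ 2]"] by (simp add: pairing_def sum_2)
  next
    case False
    then show ?thesis using that[of "vector [1 / l $ 1, 0]"] by (simp add: pairing_def sum_2)
  qed
  then have e': "l $ 1 * e $ 1 + l $ 2 * e $ 2 = 1" by (simp add: pairing_def sum_2)
  show ?thesis
  proof (rule that[of e "vector [- e $ 2, e $ 1]"])
    fix w :: "complex^2"
    have "w $ 1 = (l $ 1 * w $ 1 + l $ 2 * w $ 2) * e $ 1 + (- e $ 2 * w $ 1 + e $ 1 * w $ 2) * - l $ 2"
      "w $ 2 = (l $ 1 * w $ 1 + l $ 2 * w $ 2) * e $ 2 + (- e $ 2 * w $ 1 + e $ 1 * w $ 2) * l $ 1"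
      using e' by algebra+
    then show "w = pairing l w *s e + pairing (vector [- e $ 2, e $ 1]) w *s vector [- l $ 2, l $ 1]"
      unfolding vec_eq_iff forall_2 pairing_def sum_2 vector_add_component vector_smult_component vector_2 by blast
  qed (use e e' in \<open>auto simp: pairing_def sum_2 algebra_simps\<close>)
qed

text \<open>Modulo the equation of a line a germ is determined by its restriction to the line, where
  the ideal generated by \<open>g\<close> consists of the power series divisible by the restriction of \<open>g\<close>.
  Given divisibility on the line, the quotient there extends to a germ constant along the
  complementary direction, and Hadamard division disposes of the remainder.\<close>

lemma germ_ideal_line:
  fixes l :: "complex^2"
  assumes l: "l \<noteq> 0" and g: "g \<in> germs" and \<kappa>: "\<kappa> = vector [- l $ 2, l $ 1]"
    and G: "line_fps \<kappa> g \<noteq> 0" and h: "h \<in> germs"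
  shows "h \<in> germ_ideal (pairing l) g \<longleftrightarrow> (\<forall>i<subdegree (line_fps \<kappa> g). fps_nth (line_fps \<kappa> h) i = 0)"
proof
  note eh = germ_line_expansion[OF h, of \<kappa>] and eg = germ_line_expansion[OF g, of \<kappa>]
  obtain e m where em: "pairing l e = 1" "\<And>w. w = pairing l w *s e + pairing m w *s \<kappa>"
    "pairing m \<kappa> = 1" "pairing l \<kappa> = 0"
    using line_coordinates[OF l] unfolding \<kappa> by metis
  {
    assume "h \<in> germ_ideal (pairing l) g"
    then obtain a b where ab: "a \<in> germs" "b \<in> germs" "\<forall>\<^sub>F w in nhds 0. h w = a w * pairing l w + b w * g w"
      unfolding germ_ideal_def by blast
    have "\<forall>\<^sub>F t in nhds 0. b (t *s \<kappa>) * g (t *s \<kappa>) = h (t *s \<kappa>)"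
      using eventually_on_line[OF ab(3), of \<kappa>] by eventually_elim (simp add: pairing_simps em)
    moreover have "(\<lambda>t. b (t *s \<kappa>) * g (t *s \<kappa>)) has_fps_expansion line_fps \<kappa> b * line_fps \<kappa> g"
      by (intro has_fps_expansion_mult germ_line_expansion ab g)
    ultimately have "(\<lambda>t. h (t *s \<kappa>)) has_fps_expansion line_fps \<kappa> b * line_fps \<kappa> g"
      by (rule iffD1[OF has_fps_expansion_cong[OF _ refl]])
    then have "line_fps \<kappa> h = line_fps \<kappa> b * line_fps \<kappa> g" by (rule line_fps_eqI)
    then show "\<forall>i<subdegree (line_fps \<kappa> g). fps_nth (line_fps \<kappa> h) i = 0"
      by (simp add: fps_mult_nth_eq0)
  }
  assume z: "\<forall>i<subdegree (line_fps \<kappa> g). fps_nth (line_fps \<kappa> h) i = 0"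
  define F where "F = line_fps \<kappa> h"
  define G where "G = line_fps \<kappa> g"
  have "\<exists>\<beta>. \<beta> analytic_on {0} \<and> (\<forall>\<^sub>F t in nhds 0. \<beta> t * g (t *s \<kappa>) = h (t *s \<kappa>))"
  proof (cases "F = 0")
    case True
    then have "\<forall>\<^sub>F t in nhds 0. 0 * g (t *s \<kappa>) = h (t *s \<kappa>)"
      using eh unfolding F_def has_fps_expansion_def by simp
    then show ?thesis by (intro exI[of _ "\<lambda>_. 0"]) (auto simp: analytic_on_const)
  next
    case False
    then have sub: "subdegree G \<le> subdegree F"
      using z unfolding F_def G_def by (metis linorder_not_less nth_subdegree_nonzero)
    define \<beta> where "\<beta> t = (if t = 0 then fps_nth F (subdegree G) / fps_nth G (subdegree G) else h (t *s \<kappa>) / g (t *s \<kappa>))" for t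
    have b: "\<beta> has_fps_expansion F / G"
      unfolding \<beta>_def F_def G_def
      by (rule has_fps_expansion_divide[OF eh eg]) (use sub G in \<open>auto simp: F_def G_def\<close>)
    have "F / G * G = F" using sub assms(4) unfolding G_def[symmetric]
      by (metis False fps_divide_times_eq fps_dvd_iff dvd_div_mult_self)
    then have "(\<lambda>t. \<beta> t * g (t *s \<kappa>)) has_fps_expansion F"
      using has_fps_expansion_mult[OF b eg] by (simp add: G_def)
    then have "\<forall>\<^sub>F t in nhds 0. \<beta> t * g (t *s \<kappa>) = h (t *s \<kappa>)"
      using eh unfolding has_fps_expansion_def F_def by (auto elim: eventually_elim2)
    then show ?thesis using has_fps_expansion_imp_analytic_0[OF b] by blast
  qed
  then obtain \<beta> where \<beta>: "\<beta> analytic_on {0}" "\<forall>\<^sub>F t in nhds 0. \<beta> t * g (t *s \<kappa>) = h (t *s \<kappa>)" by blast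
  define b where "b w = \<beta> (pairing m w)" for w
  have b: "b \<in> germs" unfolding b_def by (rule germs_chain[OF \<beta>(1)])
  define k where "k w = h w - b w * g w" for w
  have "k \<in> germs" unfolding k_def by (intro germs_diff germs_mult h b g)
  then obtain \<rho> where "\<rho> > 0" "mholomorphic_on k (ball 0 \<rho>)" by (auto simp: germs_iff)
  from hadamard_division[OF this(2) em(1) this(1)]
  obtain a \<delta> where a: "\<delta> > 0" "mholomorphic_on a (ball 0 \<delta>)"
    "\<And>w. w \<in> ball 0 \<delta> \<Longrightarrow> k w = k (w - pairing l w *s e) + pairing l w * a w" by blast
  have proj: "w - pairing l w *s e = pairing m w *s \<kappa>" for w using em(2)[of w] by (metis add_diff_cancel_left')
  have "filterlim (pairing m) (nhds (pairing m 0)) (nhds 0)"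
    using linear_continuous_at[OF bounded_linear_pairing, of 0 m]
    by (rule iffD1[OF tendsto_at_iff_tendsto_nhds, OF isCont_def[THEN iffD1]])
  then have "\<forall>\<^sub>F w in nhds 0. \<beta> (pairing m w) * g (pairing m w *s \<kappa>) = h (pairing m w *s \<kappa>)"
    using eventually_compose_filterlim[OF \<beta>(2), of "pairing m"] by (simp add: pairing_simps)
  moreover have "\<forall>\<^sub>F w in nhds 0. w \<in> ball (0::complex^2) \<delta>"
    using a(1) by (intro eventually_nhds_in_open) auto
  ultimately have "\<forall>\<^sub>F w in nhds 0. h w = a w * pairing l w + b w * g w"
  proof eventually_elim
    case (elim w)
    have "k (pairing m w *s \<kappa>) = 0" using elim(1) em by (simp add: k_def b_def pairing_simps)
    then show ?case using a(3)[OF elim(2)] unfolding proj by (simp add: k_def algebra_simps)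
  qed
  moreover have "a \<in> germs" using a by (auto simp: germs_iff)
  ultimately show "h \<in> germ_ideal (pairing l) g" using h b unfolding germ_ideal_def by blast
qed

lemma line_fps_combination:
  assumes "h \<in> germs" "\<And>i. i < n \<Longrightarrow> b i \<in> germs"
  shows "line_fps \<kappa> (\<lambda>w. h w - (\<Sum>i<n. c i * b i w)) = line_fps \<kappa> h - (\<Sum>i<n. fps_const (c i) * line_fps \<kappa> (b i))"
proof (rule line_fps_eqI, rule has_fps_expansion_diff)
  show "(\<lambda>t. h (t *s \<kappa>)) has_fps_expansion line_fps \<kappa> h" by (rule germ_line_expansion[OF assms(1)])
  show "(\<lambda>t. \<Sum>i<n. c i * b i (t *s \<kappa>)) has_fps_expansion (\<Sum>i<n. fps_const (c i) * line_fps \<kappa> (b i))"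
    by (rule has_fps_expansion_sum, rule has_fps_expansion_cmult_left, rule germ_line_expansion, rule assms(2)) simp
qed

text \<open>The powers of a coordinate on the line form a basis of the quotient, since by
  \<open>germ_ideal_line\<close> membership in the ideal is the vanishing of the first coefficients along the
  line.\<close>

lemma quotient_dim_line:
  fixes l :: "complex^2"
  assumes l: "l \<noteq> 0" and g: "g \<in> germs" and \<kappa>: "\<kappa> = vector [- l $ 2, l $ 1]"
    and G: "line_fps \<kappa> g \<noteq> 0"
  shows "quotient_dim (pairing l) g = subdegree (line_fps \<kappa> g)"
  unfolding quotient_dim_def
proof (rule the_equality)
  let ?n = "subdegree (line_fps \<kappa> g)"
  have mem: "(\<lambda>w. h w - (\<Sum>i<n. c i * b i w)) \<in> germ_ideal (pairing l) g \<longleftrightarrow>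
      (\<forall>j<?n. fps_nth (line_fps \<kappa> h) j = (\<Sum>i<n. c i * fps_nth (line_fps \<kappa> (b i)) j))"
    if "h \<in> germs" "\<forall>i<n. b i \<in> germs" for h n b c
  proof -
    have "(\<lambda>w. h w - (\<Sum>i<n. c i * b i w)) \<in> germs"
      using that by (intro germs_diff germs_sum germs_mult germs_const) auto
    from germ_ideal_line[OF l g \<kappa> G this] show ?thesis
      using that by (simp add: line_fps_combination fps_sum_nth)
  qed
  obtain e m where em: "pairing l e = 1" "\<And>w. w = pairing l w *s e + pairing m w *s \<kappa>"
    "pairing m \<kappa> = 1" "pairing l \<kappa> = 0"
    using line_coordinates[OF l] unfolding \<kappa> by metis
  define b where "b i w = pairing m w ^ i" for i :: nat and w
  have b: "b i \<in> germs" for i unfolding b_def by (intro germs_power germs_pairing)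
  have lb: "line_fps \<kappa> (b i) = fps_X ^ i" for i
    by (rule line_fps_eqI) (auto simp: b_def pairing_simps em intro: has_fps_expansion_fps_X_power)
  show ex: "\<exists>b. (\<forall>i<?n. b i \<in> germs) \<and> (\<forall>h\<in>germs. \<exists>!c. (\<forall>i\<ge>?n. c i = 0) \<and>
        (\<lambda>w. h w - (\<Sum>i<?n. c i * b i w)) \<in> germ_ideal (pairing l) g)"
  proof (intro exI[of _ b] conjI ballI)
    fix h :: "complex^2 \<Rightarrow> complex" assume h: "h \<in> germs"
    have "(\<lambda>w. h w - (\<Sum>i<?n. c i * b i w)) \<in> germ_ideal (pairing l) g \<longleftrightarrow> (\<forall>j<?n. fps_nth (line_fps \<kappa> h) j = c j)" for c
      using mem[OF h, of ?n b c] b by (simp add: lb if_distrib cong: if_cong)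
    then show "\<exists>!c. (\<forall>i\<ge>?n. c i = 0) \<and> (\<lambda>w. h w - (\<Sum>i<?n. c i * b i w)) \<in> germ_ideal (pairing l) g"
      by (intro ex1I[of _ "\<lambda>j. if j < ?n then fps_nth (line_fps \<kappa> h) j else 0"])
         (auto simp: fun_eq_iff)
  qed (use b in auto)
  fix n' :: nat assume "\<exists>b. (\<forall>i<n'. b i \<in> germs) \<and> (\<forall>h\<in>germs. \<exists>!c. (\<forall>i\<ge>n'. c i = 0) \<and>
        (\<lambda>w. h w - (\<Sum>i<n'. c i * b i w)) \<in> germ_ideal (pairing l) g)"
  then obtain b' where B: "(\<forall>i<n'. b' i \<in> germs) \<and> (\<forall>h\<in>germs. \<exists>!c. (\<forall>i\<ge>n'. c i = 0) \<and>
        (\<lambda>w. h w - (\<Sum>i<n'. c i * b' i w)) \<in> germ_ideal (pairing l) g)" ..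
  note b' = conjunct1[OF B] and u = bspec[OF conjunct2[OF B]]
  have "?n = n'"
  proof (rule basis_card_unique)
    fix x :: "nat \<Rightarrow> complex"
    define h where "h w = (\<Sum>i<?n. x i * b i w)" for w
    have h: "h \<in> germs" unfolding h_def by (intro germs_sum germs_mult germs_const b)
    have "(\<lambda>w. 0 - (\<Sum>i<?n. - x i * b i w)) = h" by (simp add: h_def fun_eq_iff sum_negf)
    then have "line_fps \<kappa> h = line_fps \<kappa> (\<lambda>w. 0) - (\<Sum>i<?n. fps_const (- x i) * line_fps \<kappa> (b i))"
      using line_fps_combination[OF germs_const[of 0], where b=b and n="?n" and \<kappa>=\<kappa> and c="\<lambda>i. - x i"] b by simp
    moreover have "line_fps \<kappa> (\<lambda>w. 0) = 0" by (rule line_fps_eqI) simp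
    ultimately have "fps_nth (line_fps \<kappa> h) j = x j" if "j < ?n" for j
      using that by (simp add: fps_sum_nth lb if_distrib cong: if_cong)
    then show "\<exists>!c. (\<forall>j\<ge>n'. c j = 0) \<and> (\<forall>i<?n. x i = (\<Sum>j<n'. c j * fps_nth (line_fps \<kappa> (b' j)) i))"
      using u[OF h] mem[OF h b'] by simp
  qed
  then show "n' = ?n" by simp
qed

section \<open>Exterior calculus and the curvature of a web\<close>

definition holomorphic_form :: "(complex^2 \<Rightarrow> complex^2) \<Rightarrow> (complex^2) set \<Rightarrow> bool" where
  "holomorphic_form X U \<longleftrightarrow> (\<forall>j. mholomorphic_on (\<lambda>m. X m $ j) U)"

lemma holomorphic_form_iff:
  "holomorphic_form X U \<longleftrightarrow> mholomorphic_on (\<lambda>m. X m $ 1) U \<and> mholomorphic_on (\<lambda>m. X m $ 2) U"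
  by (simp add: holomorphic_form_def forall_2)

lemma holomorphic_form_subset: "holomorphic_form X U \<Longrightarrow> V \<subseteq> U \<Longrightarrow> holomorphic_form X V"
  using mholomorphic_subset unfolding holomorphic_form_def by blast

lemma partial_deriv_cong:
  fixes f :: "complex^'n \<Rightarrow> complex"
  assumes "open U" "x \<in> U" "\<And>y. y \<in> U \<Longrightarrow> f y = g y"
  shows "partial_deriv i f x = partial_deriv i g x"
  unfolding partial_deriv_def
proof (rule deriv_cong_ev[OF _ refl])
  have "isCont (\<lambda>t. x + axis i t) 0"
    by (intro continuous_intros linear_continuous_at[OF bounded_linear_axis])
  then have "filterlim (\<lambda>t. x + axis i t) (nhds (x + axis i 0)) (nhds 0)"
    by (rule iffD1[OF tendsto_at_iff_tendsto_nhds, OF isCont_def[THEN iffD1]])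
  moreover have "x + axis i 0 = x" by (simp add: vec_eq_iff axis_def)
  moreover have "\<forall>\<^sub>F y in nhds x. f y = g y"
    using assms eventually_nhds by blast
  ultimately show "\<forall>\<^sub>F t in nhds 0. f (x + axis i t) = g (x + axis i t)"
    by (auto intro: eventually_compose_filterlim)
qed

lemma ext_deriv_cong:
  assumes "open U" "m \<in> U" "\<And>y. y \<in> U \<Longrightarrow> X y = Y y"
  shows "ext_deriv X m = ext_deriv Y m"
  unfolding ext_deriv_def
  using partial_deriv_cong[OF assms(1,2), of "\<lambda>m. X m $ 1" "\<lambda>m. Y m $ 1"]
    partial_deriv_cong[OF assms(1,2), of "\<lambda>m. X m $ 2" "\<lambda>m. Y m $ 2"] assms(3) by simp

lemma ext_deriv_eq:
  assumes "((\<lambda>m. X m $ 1) has_derivative pairing a) (at m)" "((\<lambda>m. X m $ 2) has_derivative pairing b) (at m)"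
  shows "ext_deriv X m = b $ 1 - a $ 2"
  unfolding ext_deriv_def by (simp add: partial_deriv_has_derivative(2)[OF assms(1)] partial_deriv_has_derivative(2)[OF assms(2)])

lemma holomorphic_form_derivatives:
  assumes "holomorphic_form X U" "open U" "m \<in> U"
  obtains a b where "((\<lambda>m. X m $ 1) has_derivative pairing a) (at m)" "((\<lambda>m. X m $ 2) has_derivative pairing b) (at m)"
    "ext_deriv X m = b $ 1 - a $ 2"
proof -
  have "((\<lambda>m. X m $ i) has_derivative pairing (gradient (\<lambda>m. X m $ i) m)) (at m)" for i
    using mholomorphic_has_gradient assms unfolding holomorphic_form_def by blast
  from that[OF this[of 1] this[of 2] ext_deriv_eq[OF this[of 1] this[of 2]]] show ?thesis .
qed

lemma ext_deriv_add:
  assumes "holomorphic_form X U" "holomorphic_form Y U" "open U" "m \<in> U"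
  shows "ext_deriv (\<lambda>m. X m + Y m) m = ext_deriv X m + ext_deriv Y m"
proof -
  obtain a b where ab: "((\<lambda>m. X m $ 1) has_derivative pairing a) (at m)" "((\<lambda>m. X m $ 2) has_derivative pairing b) (at m)"
    "ext_deriv X m = b $ 1 - a $ 2" using holomorphic_form_derivatives[OF assms(1,3,4)] .
  obtain a' b' where ab': "((\<lambda>m. Y m $ 1) has_derivative pairing a') (at m)" "((\<lambda>m. Y m $ 2) has_derivative pairing b') (at m)"
    "ext_deriv Y m = b' $ 1 - a' $ 2" using holomorphic_form_derivatives[OF assms(2,3,4)] .
  show ?thesis
    using ext_deriv_eq[of "\<lambda>m. X m + Y m", unfolded vector_add_component, OF
        pairing_derivative_add[OF ab(1) ab'(1)] pairing_derivative_add[OF ab(2) ab'(2)]] ab(3) ab'(3)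
    by simp
qed

lemma holomorphic_form_add:
  "open U \<Longrightarrow> holomorphic_form X U \<Longrightarrow> holomorphic_form Y U \<Longrightarrow> holomorphic_form (\<lambda>m. X m + Y m) U"
  unfolding holomorphic_form_def by (simp add: mholomorphic_add)

lemma holomorphic_form_diff:
  "open U \<Longrightarrow> holomorphic_form X U \<Longrightarrow> holomorphic_form Y U \<Longrightarrow> holomorphic_form (\<lambda>m. X m - Y m) U"
  unfolding holomorphic_form_def by (simp add: mholomorphic_diff)

lemma holomorphic_form_scale:
  "open U \<Longrightarrow> mholomorphic_on f U \<Longrightarrow> holomorphic_form X U \<Longrightarrow> holomorphic_form (\<lambda>m. f m *s X m) U"
  unfolding holomorphic_form_def by (simp add: mholomorphic_mult)

lemma holomorphic_form_zero: "open U \<Longrightarrow> holomorphic_form (\<lambda>m. 0) U"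
  unfolding holomorphic_form_def by (simp add: mholomorphic_const)

lemma holomorphic_form_sum:
  "open U \<Longrightarrow> (\<And>i. i \<in> A \<Longrightarrow> holomorphic_form (X i) U) \<Longrightarrow> holomorphic_form (\<lambda>m. \<Sum>i\<in>A. X i m) U"
  by (induction A rule: infinite_finite_induct) (auto intro: holomorphic_form_add holomorphic_form_zero)

lemma ext_deriv_zero: "ext_deriv (\<lambda>m. 0) m = 0"
  by (simp add: ext_deriv_def partial_deriv_def)

lemma ext_deriv_sum:
  assumes "\<And>i. i \<in> A \<Longrightarrow> holomorphic_form (X i) U" "open U" "m \<in> U"
  shows "ext_deriv (\<lambda>m. \<Sum>i\<in>A. X i m) m = (\<Sum>i\<in>A. ext_deriv (X i) m)"
  using assms(1)
  by (induction A rule: infinite_finite_induct)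
     (auto simp: ext_deriv_zero ext_deriv_add[OF _ _ assms(2,3)] holomorphic_form_sum[OF assms(2)])

lemma holomorphic_wedge:
  "open U \<Longrightarrow> holomorphic_form X U \<Longrightarrow> holomorphic_form Y U \<Longrightarrow> mholomorphic_on (\<lambda>m. wedge (X m) (Y m)) U"
  unfolding holomorphic_form_def wedge_def by (intro mholomorphic_diff mholomorphic_mult) auto

lemma holomorphic_ext_deriv:
  "open U \<Longrightarrow> holomorphic_form X U \<Longrightarrow> mholomorphic_on (ext_deriv X) U"
  unfolding holomorphic_form_def ext_deriv_def by (intro mholomorphic_diff mholomorphic_partial_deriv) auto

lemma ext_deriv_scale:
  assumes "holomorphic_form X U" "mholomorphic_on G U" "open U" "m \<in> U"
  shows "ext_deriv (\<lambda>m. G m *s X m) m = wedge (gradient G m) (X m) + G m * ext_deriv X m"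
proof -
  obtain a b where ab: "((\<lambda>m. X m $ 1) has_derivative pairing a) (at m)" "((\<lambda>m. X m $ 2) has_derivative pairing b) (at m)"
    "ext_deriv X m = b $ 1 - a $ 2" using holomorphic_form_derivatives[OF assms(1,3,4)] .
  note G = mholomorphic_has_gradient[OF assms(2-4)]
  show ?thesis
    unfolding ext_deriv_eq[of "\<lambda>m. G m *s X m", unfolded vector_smult_component, OF
        pairing_derivative_mult[OF G ab(1)] pairing_derivative_mult[OF G ab(2)]] ab(3)
    by (simp add: wedge_def algebra_simps)
qed

lemma wedge_simps:
  "wedge (a + b) c = wedge a c + wedge b c" "wedge a (b + c) = wedge a b + wedge a c"
  "wedge (a - b) c = wedge a c - wedge b c" "wedge a (b - c) = wedge a b - wedge a c"
  "wedge (x *s a) c = x * wedge a c" "wedge a (x *s c) = x * wedge a c"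
  "wedge a a = 0" "wedge 0 a = 0" "wedge a 0 = 0" "wedge (- a) c = - wedge a c" "wedge a (- c) = - wedge a c"
  by (simp_all add: wedge_def algebra_simps)

lemma wedge_commute: "wedge a b = - wedge b a"
  by (simp add: wedge_def)

lemma wedge_eq_zero:
  assumes "wedge a b \<noteq> 0" "wedge h a = 0" "wedge h b = 0"
  shows "h = 0"
proof -
  have "wedge a b * h $ 1 = wedge h b * a $ 1 - wedge h a * b $ 1"
    "wedge a b * h $ 2 = wedge h b * a $ 2 - wedge h a * b $ 2"
    by (simp_all add: wedge_def algebra_simps)
  then show ?thesis using assms by (simp add: vec_eq_iff forall_2)
qed

text \<open>One of the three equations that define \<open>web_eta\<close>; the other two arise by cyclic
  permutation of the indices.\<close>

definition eta_equation :: "(nat \<Rightarrow> complex^2 \<Rightarrow> complex^2) \<Rightarrow> nat \<Rightarrow> nat \<Rightarrow> nat \<Rightarrow> complex^2 \<Rightarrow> complex^2 \<Rightarrow> bool" where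
  "eta_equation \<theta> r s t m h \<longleftrightarrow>
     ext_deriv (\<lambda>m. wedge (\<theta> s m) (\<theta> t m) *s \<theta> r m) m = wedge h (wedge (\<theta> s m) (\<theta> t m) *s \<theta> r m)"

text \<open>Uniqueness: two of the three forms on the right are independent, and a form whose products
  with both vanish is zero.\<close>

lemma web_eta_eqI:
  assumes "wedge (\<theta> r m) (\<theta> s m) \<noteq> 0" "wedge (\<theta> s m) (\<theta> t m) \<noteq> 0" "wedge (\<theta> t m) (\<theta> r m) \<noteq> 0"
    and "eta_equation \<theta> r s t m h" "eta_equation \<theta> s t r m h" "eta_equation \<theta> t r s m h"
  shows "web_eta \<theta> r s t m = h"
  unfolding web_eta_def Let_def
proof (rule the_equality)
  fix h' assume *: "ext_deriv (\<lambda>m. wedge (\<theta> s m) (\<theta> t m) *s \<theta> r m) m = wedge h' (wedge (\<theta> s m) (\<theta> t m) *s \<theta> r m) \<and>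
     ext_deriv (\<lambda>m. wedge (\<theta> t m) (\<theta> r m) *s \<theta> s m) m = wedge h' (wedge (\<theta> t m) (\<theta> r m) *s \<theta> s m) \<and>
     ext_deriv (\<lambda>m. wedge (\<theta> r m) (\<theta> s m) *s \<theta> t m) m = wedge h' (wedge (\<theta> r m) (\<theta> s m) *s \<theta> t m)"
  have "h' - h = 0"
  proof (rule wedge_eq_zero)
    show "wedge (wedge (\<theta> s m) (\<theta> t m) *s \<theta> r m) (wedge (\<theta> t m) (\<theta> r m) *s \<theta> s m) \<noteq> 0"
      using assms by (simp add: wedge_simps)
    show "wedge (h' - h) (wedge (\<theta> s m) (\<theta> t m) *s \<theta> r m) = 0"
      "wedge (h' - h) (wedge (\<theta> t m) (\<theta> r m) *s \<theta> s m) = 0"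
      using * assms(4,5) unfolding eta_equation_def by (simp_all only: wedge_simps(3) diff_self)
  qed
  then show "h' = h" by simp
qed (use assms(4-6) in \<open>simp add: eta_equation_def\<close>)

text \<open>Existence: the first two equations are a linear system for \<open>h\<close>, solved explicitly by
  Cramer's rule, and the third follows because the three forms \<open>\<delta>\<^sub>s\<^sub>t \<theta>\<^sub>r\<close>, \<open>\<delta>\<^sub>t\<^sub>r \<theta>\<^sub>s\<close>,
  \<open>\<delta>\<^sub>r\<^sub>s \<theta>\<^sub>t\<close> add up to zero. The explicit formula also gives holomorphy.\<close>

lemma web_eta_solution:
  assumes U: "open U" "m \<in> U"
    and h: "holomorphic_form (\<theta> r) U" "holomorphic_form (\<theta> s) U" "holomorphic_form (\<theta> t) U"
    and w: "wedge (\<theta> r m) (\<theta> s m) \<noteq> 0" "wedge (\<theta> s m) (\<theta> t m) \<noteq> 0" "wedge (\<theta> t m) (\<theta> r m) \<noteq> 0"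
  defines "X \<equiv> \<lambda>m. wedge (\<theta> s m) (\<theta> t m) *s \<theta> r m" and "Y \<equiv> \<lambda>m. wedge (\<theta> t m) (\<theta> r m) *s \<theta> s m"
  shows "web_eta \<theta> r s t m = (1 / wedge (Y m) (X m)) *s (ext_deriv X m *s Y m - ext_deriv Y m *s X m)"
    and "eta_equation \<theta> r s t m (web_eta \<theta> r s t m)" "eta_equation \<theta> s t r m (web_eta \<theta> r s t m)"
      "eta_equation \<theta> t r s m (web_eta \<theta> r s t m)"
proof -
  \<comment> \<open>the third form is minus the sum of the other two\<close>
  define Z where "Z m = wedge (\<theta> r m) (\<theta> s m) *s \<theta> t m" for m
  define h where "h = (1 / wedge (Y m) (X m)) *s (ext_deriv X m *s Y m - ext_deriv Y m *s X m)"
  have hX: "holomorphic_form X U" and hY: "holomorphic_form Y U"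
    unfolding X_def Y_def using assms by (auto intro!: holomorphic_form_scale holomorphic_wedge)
  have "Z = (\<lambda>m. (-1) *s (X m + Y m))"
    by (simp add: Z_def X_def Y_def vec_eq_iff forall_2 wedge_def fun_eq_iff algebra_simps)
  then have dZ: "ext_deriv Z m = - (ext_deriv X m + ext_deriv Y m)" and Z: "Z m = - (X m + Y m)"
    using ext_deriv_scale[OF holomorphic_form_add[OF U(1) hX hY] mholomorphic_const[OF U(1)] U, of "-1"]
      ext_deriv_add[OF hX hY U] gradient_eqI[OF pairing_derivative_const, of "-1" m]
    by (simp_all add: wedge_simps)
  have YX: "wedge (Y m) (X m) \<noteq> 0"
    using w wedge_commute[of "\<theta> s m" "\<theta> r m"] unfolding X_def Y_def by (simp add: wedge_simps)
  have 1: "ext_deriv X m = wedge h (X m)" "ext_deriv Y m = wedge h (Y m)"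
    using YX wedge_commute[of "X m" "Y m"] by (simp_all add: h_def wedge_simps)
  have 2: "ext_deriv Z m = wedge h (Z m)"
    unfolding Z dZ using 1 by (simp add: wedge_simps)
  have "eta_equation \<theta> r s t m h \<and> eta_equation \<theta> s t r m h \<and> eta_equation \<theta> t r s m h"
    using 1 2 unfolding eta_equation_def X_def Y_def Z_def by blast
  moreover from this have "web_eta \<theta> r s t m = h" by (intro web_eta_eqI w) auto
  ultimately show "web_eta \<theta> r s t m = (1 / wedge (Y m) (X m)) *s (ext_deriv X m *s Y m - ext_deriv Y m *s X m)"
    "eta_equation \<theta> r s t m (web_eta \<theta> r s t m)" "eta_equation \<theta> s t r m (web_eta \<theta> r s t m)"
    "eta_equation \<theta> t r s m (web_eta \<theta> r s t m)"
    by (auto simp: h_def)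
qed

lemma mholomorphic_cong: "mholomorphic_on f U \<Longrightarrow> (\<And>x. x \<in> U \<Longrightarrow> g x = f x) \<Longrightarrow> mholomorphic_on g U"
  unfolding mholomorphic_on_def by (meson has_derivative_transform)

lemma holomorphic_form_cong:
  "holomorphic_form X U \<Longrightarrow> (\<And>x. x \<in> U \<Longrightarrow> Y x = X x) \<Longrightarrow> holomorphic_form Y U"
  unfolding holomorphic_form_def by (intro allI, rule mholomorphic_cong, erule spec, simp)

lemma holomorphic_web_eta:
  assumes U: "open U"
    and h: "holomorphic_form (\<theta> r) U" "holomorphic_form (\<theta> s) U" "holomorphic_form (\<theta> t) U"
    and w: "\<And>m. m \<in> U \<Longrightarrow> wedge (\<theta> r m) (\<theta> s m) \<noteq> 0" "\<And>m. m \<in> U \<Longrightarrow> wedge (\<theta> s m) (\<theta> t m) \<noteq> 0"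
      "\<And>m. m \<in> U \<Longrightarrow> wedge (\<theta> t m) (\<theta> r m) \<noteq> 0"
  shows "holomorphic_form (web_eta \<theta> r s t) U"
proof -
  define X where "X m = wedge (\<theta> s m) (\<theta> t m) *s \<theta> r m" for m
  define Y where "Y m = wedge (\<theta> t m) (\<theta> r m) *s \<theta> s m" for m
  have hX: "holomorphic_form X U" and hY: "holomorphic_form Y U"
    unfolding X_def Y_def using assms by (auto intro!: holomorphic_form_scale holomorphic_wedge)
  have YX: "wedge (Y m) (X m) \<noteq> 0" if "m \<in> U" for m
    using w[OF that] wedge_commute[of "\<theta> s m" "\<theta> r m"] unfolding X_def Y_def by (simp add: wedge_simps)
  have "holomorphic_form (\<lambda>m. (1 / wedge (Y m) (X m)) *s (ext_deriv X m *s Y m - ext_deriv Y m *s X m)) U"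
    using hX hY YX U
    by (intro holomorphic_form_scale holomorphic_form_diff mholomorphic_divide mholomorphic_const
        holomorphic_wedge holomorphic_ext_deriv) auto
  then show ?thesis
    by (rule holomorphic_form_cong)
       (simp only: X_def[abs_def] Y_def[abs_def] web_eta_solution(1)[OF U _ h w])
qed

definition triples :: "nat \<Rightarrow> (nat \<times> nat \<times> nat) set" where
  "triples k = {(r, s, t). r < s \<and> s < t \<and> t < k}"

lemma web_curvature_triples:
  "web_curvature k \<theta> = ext_deriv (\<lambda>m. \<Sum>(r, s, t) \<in> triples k. web_eta \<theta> r s t m)"
  by (simp add: web_curvature_def triples_def)

lemma holomorphic_total_eta:
  assumes U: "open U" and h: "\<And>i. i < k \<Longrightarrow> holomorphic_form (\<theta> i) U"
    and w: "\<And>m i j. m \<in> U \<Longrightarrow> i < k \<Longrightarrow> j < k \<Longrightarrow> i \<noteq> j \<Longrightarrow> wedge (\<theta> i m) (\<theta> j m) \<noteq> 0"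
  shows "holomorphic_form (\<lambda>m. \<Sum>(r, s, t) \<in> triples k. web_eta \<theta> r s t m) U"
proof (rule holomorphic_form_sum[OF U], clarify)
  fix r s t assume "(r, s, t) \<in> triples k"
  then have "r < k" "s < k" "t < k" "r \<noteq> s" "s \<noteq> t" "t \<noteq> r" by (auto simp: triples_def)
  then show "holomorphic_form (web_eta \<theta> r s t) U" using h w by (intro holomorphic_web_eta U)
qed

lemma web_curvature_continuous:
  assumes "web_factorization k W U \<theta>"
  shows "continuous_on U (web_curvature k \<theta>)"
  unfolding web_curvature_triples
  using assms unfolding web_factorization_def
  by (intro mholomorphic_continuous holomorphic_ext_deriv holomorphic_total_eta)
     (auto simp: holomorphic_form_def)

section \<open>Pullback of webs\<close>

text \<open>The pullback of the covector \<open>a\<close> at the point \<open>\<Phi> m\<close> to the point \<open>m\<close>.\<close>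

definition pull_form :: "(complex^2 \<Rightarrow> complex^2) \<Rightarrow> complex^2 \<Rightarrow> complex^2 \<Rightarrow> complex^2" where
  "pull_form \<Phi> m a = a $ 1 *s gradient (\<lambda>m. \<Phi> m $ 1) m + a $ 2 *s gradient (\<lambda>m. \<Phi> m $ 2) m"

definition pull_jacobian :: "(complex^2 \<Rightarrow> complex^2) \<Rightarrow> complex^2 \<Rightarrow> complex" where
  "pull_jacobian \<Phi> m = wedge (gradient (\<lambda>m. \<Phi> m $ 1) m) (gradient (\<lambda>m. \<Phi> m $ 2) m)"

lemma wedge_pull: "wedge (pull_form \<Phi> m a) (pull_form \<Phi> m b) = pull_jacobian \<Phi> m * wedge a b"
  by (simp add: pull_form_def pull_jacobian_def wedge_def algebra_simps)

lemma pull_simps: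
  "pull_form \<Phi> m (a + b) = pull_form \<Phi> m a + pull_form \<Phi> m b"
  "pull_form \<Phi> m (c *s a) = c *s pull_form \<Phi> m a"
  "pull_form \<Phi> m 0 = 0"
  by (simp_all add: pull_form_def vec_eq_iff algebra_simps)

lemma pull_sum: "pull_form \<Phi> m (\<Sum>i\<in>A. f i) = (\<Sum>i\<in>A. pull_form \<Phi> m (f i))"
  by (induction A rule: infinite_finite_induct) (auto simp: pull_simps)

lemma chain_derivative:
  fixes \<Phi> :: "complex^2 \<Rightarrow> complex^2"
  assumes "holomorphic_form \<Phi> V" "open V" "m \<in> V" "(f has_derivative pairing c) (at (\<Phi> m))"
  shows "((\<lambda>m. f (\<Phi> m)) has_derivative pairing (pull_form \<Phi> m c)) (at m)"
proof -
  define a where "a i = gradient (\<lambda>m. \<Phi> m $ i) m" for i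
  have a: "((\<lambda>m. \<Phi> m $ i) has_derivative pairing (a i)) (at m)" for i
    using assms(1-3) mholomorphic_has_gradient unfolding holomorphic_form_def a_def by blast
  have "((\<lambda>m. \<Phi> m $ 1 *s axis 1 1 + \<Phi> m $ 2 *s axis 2 1) has_derivative
      (\<lambda>v. pairing (a 1) v *s axis 1 1 + pairing (a 2) v *s (axis 2 1 :: complex^2))) (at m)"
    using diff_chain_at[OF a scale_has_derivative, unfolded o_def] by (intro has_derivative_add)
  moreover have "x $ 1 *s axis 1 1 + x $ 2 *s axis 2 1 = x" for x :: "complex^2"
    by (simp add: vec_eq_iff forall_2 axis_def)
  ultimately have "(\<Phi> has_derivative (\<lambda>v. pairing (a 1) v *s axis 1 1 + pairing (a 2) v *s axis 2 1)) (at m)" by simp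
  from diff_chain_at[OF this assms(4)]
  show ?thesis unfolding o_def
    by (rule has_derivative_eq_rhs)
       (auto simp: fun_eq_iff pull_form_def pairing_simps a_def[symmetric] pairing_def[of c] sum_2 axis_def)
qed

lemma holomorphic_pullback:
  assumes "holomorphic_form \<Phi> V" "open V" "mholomorphic_on f U" "open U" "\<Phi> ` V \<subseteq> U"
  shows "mholomorphic_on (\<lambda>m. f (\<Phi> m)) V"
  by (rule mholomorphic_onI, rule chain_derivative[OF assms(1,2)], assumption,
      rule mholomorphic_has_gradient[OF assms(3,4)]) (use assms in auto)

lemma holomorphic_pull_form:
  assumes "holomorphic_form \<Phi> V" "open V" "holomorphic_form X U" "open U" "\<Phi> ` V \<subseteq> U"
  shows "holomorphic_form (\<lambda>m. pull_form \<Phi> m (X (\<Phi> m))) V"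
proof -
  have X: "mholomorphic_on (\<lambda>m. X (\<Phi> m) $ i) V" for i
    using holomorphic_pullback[OF assms(1,2) _ assms(4,5), of "\<lambda>m. X m $ i"] assms(3)
    by (simp add: holomorphic_form_def)
  show ?thesis
    using X assms(1,2) mholomorphic_partial_deriv[OF _ assms(2)]
    unfolding holomorphic_form_def pull_form_def
    by (auto intro!: mholomorphic_add mholomorphic_mult simp: gradient_def)
qed

text \<open>Exterior derivatives commute with pullback: the second derivatives of \<open>\<Phi>\<close> cancel by the
  symmetry of mixed partial derivatives.\<close>

lemma ext_deriv_pull:
  assumes "holomorphic_form \<Phi> V" "open V" "holomorphic_form X U" "open U" "\<Phi> ` V \<subseteq> U" "m \<in> V"
  shows "ext_deriv (\<lambda>m. pull_form \<Phi> m (X (\<Phi> m))) m = pull_jacobian \<Phi> m * ext_deriv X (\<Phi> m)"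
proof -
  obtain a b where ab: "((\<lambda>m. X m $ 1) has_derivative pairing a) (at (\<Phi> m))"
    "((\<lambda>m. X m $ 2) has_derivative pairing b) (at (\<Phi> m))" "ext_deriv X (\<Phi> m) = b $ 1 - a $ 2"
    using holomorphic_form_derivatives[OF assms(3,4)] assms(5,6) by blast
  note A = chain_derivative[OF assms(1,2,6) ab(1)] and B = chain_derivative[OF assms(1,2,6) ab(2)]
  have h: "mholomorphic_on (\<lambda>m. \<Phi> m $ i) V" for i using assms(1) by (auto simp: holomorphic_form_def)
  have P: "(partial_deriv j (\<lambda>m. \<Phi> m $ i) has_derivative pairing (gradient (partial_deriv j (\<lambda>m. \<Phi> m $ i)) m)) (at m)" for i j
    by (rule mholomorphic_has_gradient[OF mholomorphic_partial_deriv[OF h assms(2)] assms(2,6)])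
  have C: "((\<lambda>m. pull_form \<Phi> m (X (\<Phi> m)) $ j) has_derivative
      pairing ((X (\<Phi> m) $ 1 *s gradient (partial_deriv j (\<lambda>m. \<Phi> m $ 1)) m + partial_deriv j (\<lambda>m. \<Phi> m $ 1) m *s pull_form \<Phi> m a) +
        (X (\<Phi> m) $ 2 *s gradient (partial_deriv j (\<lambda>m. \<Phi> m $ 2)) m + partial_deriv j (\<lambda>m. \<Phi> m $ 2) m *s pull_form \<Phi> m b))) (at m)" for j
    using pairing_derivative_add[OF pairing_derivative_mult[OF A P] pairing_derivative_mult[OF B P], of j 1 j 2]
    by (simp add: pull_form_def[of _ _ "X _"] gradient_def)
  have comm: "partial_deriv 1 (partial_deriv 2 (\<lambda>m. \<Phi> m $ i)) m = partial_deriv 2 (partial_deriv 1 (\<lambda>m. \<Phi> m $ i)) m" for i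
    by (rule partial_deriv_commute[OF h assms(2,6)])
  show ?thesis
    unfolding ext_deriv_eq[OF C C] ab(3)
    by (simp add: gradient_def pull_form_def pull_jacobian_def wedge_def comm algebra_simps)
qed

text \<open>A logarithmic derivative is closed; this is why the curvature ignores the choice of the
  forms \<open>\<theta>\<^sub>i\<close>.\<close>

lemma ext_deriv_log_derivative:
  assumes "mholomorphic_on G V" "open V" "m \<in> V" "\<And>x. x \<in> V \<Longrightarrow> G x \<noteq> 0"
  shows "ext_deriv (\<lambda>m. (1 / G m) *s gradient G m) m = 0" "holomorphic_form (\<lambda>m. (1 / G m) *s gradient G m) V"
proof -
  have hg: "holomorphic_form (gradient G) V"
    using mholomorphic_partial_deriv[OF assms(1,2)] by (simp add: holomorphic_form_def gradient_def)
  have inv: "mholomorphic_on (\<lambda>m. 1 / G m) V"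
    by (intro mholomorphic_divide mholomorphic_const assms)
  have "ext_deriv (gradient G) m = 0"
    using partial_deriv_commute[OF assms(1,2,3), of 1 2] by (simp add: ext_deriv_def gradient_def)
  moreover have "gradient (\<lambda>m. 1 / G m) m = (- 1 / (G m)\<^sup>2) *s gradient G m"
    by (rule gradient_eqI, rule has_derivative_eq_rhs,
       rule pairing_derivative_divide[OF pairing_derivative_const mholomorphic_has_gradient[OF assms(1,2,3)] assms(4)[OF assms(3)]])
       (simp add: fun_eq_iff pairing_simps)
  ultimately show "ext_deriv (\<lambda>m. (1 / G m) *s gradient G m) m = 0"
    using ext_deriv_scale[OF hg inv assms(2,3)] by (simp add: wedge_simps)
  show "holomorphic_form (\<lambda>m. (1 / G m) *s gradient G m) V"
    by (rule holomorphic_form_scale[OF assms(2) inv hg])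
qed

text \<open>If the forms are pulled back and multiplied by units \<open>g\<^sub>i\<close>, each of the three forms in the
  defining equations is multiplied by the same function \<open>G\<close>, hence \<open>\<eta>\<close> changes by the
  logarithmic derivative of \<open>G\<close>.\<close>

lemma eta_equation_pullback:
  assumes \<Phi>: "holomorphic_form \<Phi> V" "open V" "open U" "\<Phi> ` V \<subseteq> U" "m \<in> V"
    and h: "holomorphic_form (\<theta> r) U" "holomorphic_form (\<theta> s) U" "holomorphic_form (\<theta> t) U"
    and g: "mholomorphic_on (g r) V" "mholomorphic_on (g s) V" "mholomorphic_on (g t) V"
    and \<theta>': "\<And>i x. x \<in> V \<Longrightarrow> i \<in> {r, s, t} \<Longrightarrow> \<theta>' i x = g i x *s pull_form \<Phi> x (\<theta> i (\<Phi> x))"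
    and G: "\<And>x. x \<in> V \<Longrightarrow> G x = g r x * g s x * g t x * pull_jacobian \<Phi> x" "mholomorphic_on G V" "G m \<noteq> 0"
    and eq: "eta_equation \<theta> r s t (\<Phi> m) H"
  shows "eta_equation \<theta>' r s t m (pull_form \<Phi> m H + (1 / G m) *s gradient G m)"
proof -
  define X where "X m = wedge (\<theta> s m) (\<theta> t m) *s \<theta> r m" for m
  have hX: "holomorphic_form X U"
    unfolding X_def using assms by (auto intro!: holomorphic_form_scale holomorphic_wedge)
  have X': "wedge (\<theta>' s x) (\<theta>' t x) *s \<theta>' r x = G x *s pull_form \<Phi> x (X (\<Phi> x))" if "x \<in> V" for x
    using that by (simp add: \<theta>' G(1) wedge_simps wedge_pull X_def pull_simps vec_eq_iff mult_ac)
  have "ext_deriv (\<lambda>m. wedge (\<theta>' s m) (\<theta>' t m) *s \<theta>' r m) m = ext_deriv (\<lambda>x. G x *s pull_form \<Phi> x (X (\<Phi> x))) m"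
    by (rule ext_deriv_cong[OF \<Phi>(2,5) X'])
  also have "\<dots> = wedge (gradient G m) (pull_form \<Phi> m (X (\<Phi> m))) + G m * (pull_jacobian \<Phi> m * ext_deriv X (\<Phi> m))"
    using ext_deriv_scale[OF holomorphic_pull_form[OF \<Phi>(1,2) hX \<Phi>(3,4)] G(2) \<Phi>(2,5)]
      ext_deriv_pull[OF \<Phi>(1,2) hX \<Phi>(3,4,5)] by simp
  also have "ext_deriv X (\<Phi> m) = wedge H (X (\<Phi> m))"
    using eq by (simp add: eta_equation_def X_def[abs_def])
  also have "wedge (gradient G m) (pull_form \<Phi> m (X (\<Phi> m))) + G m * (pull_jacobian \<Phi> m * wedge H (X (\<Phi> m)))
      = wedge (pull_form \<Phi> m H + (1 / G m) *s gradient G m) (G m *s pull_form \<Phi> m (X (\<Phi> m)))"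
    using G(3) by (simp add: wedge_simps wedge_pull algebra_simps)
  finally show ?thesis using X'[OF \<Phi>(5)] by (simp add: eta_equation_def)
qed

text \<open>The curvature is a 2-form attached to the web itself: it is compatible with changes of
  coordinates and insensitive to multiplying the defining forms by units. Both follow from
  \<open>eta_equation_pullback\<close>, since the logarithmic derivatives are closed.\<close>

theorem web_curvature_pullback:
  assumes \<Phi>: "holomorphic_form \<Phi> V" "open V" "open U" "\<Phi> ` V \<subseteq> U" "m \<in> V"
    and J: "\<And>x. x \<in> V \<Longrightarrow> pull_jacobian \<Phi> x \<noteq> 0"
    and h: "\<And>i. i < k \<Longrightarrow> holomorphic_form (\<theta> i) U"
    and w: "\<And>m i j. m \<in> U \<Longrightarrow> i < k \<Longrightarrow> j < k \<Longrightarrow> i \<noteq> j \<Longrightarrow> wedge (\<theta> i m) (\<theta> j m) \<noteq> 0"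
    and g: "\<And>i. i < k \<Longrightarrow> mholomorphic_on (g i) V" "\<And>i x. i < k \<Longrightarrow> x \<in> V \<Longrightarrow> g i x \<noteq> 0"
    and \<theta>': "\<And>i x. x \<in> V \<Longrightarrow> i < k \<Longrightarrow> \<theta>' i x = g i x *s pull_form \<Phi> x (\<theta> i (\<Phi> x))"
  shows "web_curvature k \<theta>' m = pull_jacobian \<Phi> m * web_curvature k \<theta> (\<Phi> m)"
proof -
  define G where "G = (\<lambda>(r, s, t) x. g r x * g s x * g t x * pull_jacobian \<Phi> x)"
  define H where "H m = (\<Sum>(r, s, t) \<in> triples k. web_eta \<theta> r s t m)" for m
  have hJ: "mholomorphic_on (pull_jacobian \<Phi>) V"
    using \<Phi>(1) mholomorphic_partial_deriv[OF _ \<Phi>(2)] unfolding pull_jacobian_def holomorphic_form_def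
    by (intro holomorphic_wedge[OF \<Phi>(2)]) (auto simp: holomorphic_form_def gradient_def)
  have hG: "mholomorphic_on (G z) V" "x \<in> V \<Longrightarrow> G z x \<noteq> 0" if "z \<in> triples k" for z x
    using that hJ g J by (auto simp: G_def triples_def intro!: mholomorphic_mult \<Phi>)
  have hH: "holomorphic_form H U" unfolding H_def by (rule holomorphic_total_eta[OF \<Phi>(3) h w])
  have eta: "web_eta \<theta>' r s t x = pull_form \<Phi> x (web_eta \<theta> r s t (\<Phi> x)) + (1 / G (r, s, t) x) *s gradient (G (r, s, t)) x"
    if rst: "(r, s, t) \<in> triples k" and x: "x \<in> V" for r s t x
  proof -
    have lt: "r < k" "s < k" "t < k" "r \<noteq> s" "s \<noteq> t" "t \<noteq> r" "s \<noteq> r" "t \<noteq> s" "r \<noteq> t"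
      using rst by (auto simp: triples_def)
    have \<Phi>x: "\<Phi> x \<in> U" using \<Phi>(4) x by auto
    have w': "wedge (\<theta>' i x) (\<theta>' j x) \<noteq> 0" if "i < k" "j < k" "i \<noteq> j" for i j
      using that x w[OF \<Phi>x] g(2) J by (simp add: \<theta>' wedge_simps wedge_pull)
    note sol = web_eta_solution(2-4)[OF \<Phi>(3) \<Phi>x, of \<theta> r s t, OF h[OF lt(1)] h[OF lt(2)] h[OF lt(3)]
        w[OF \<Phi>x lt(1,2,4)] w[OF \<Phi>x lt(2,3,5)] w[OF \<Phi>x lt(3,1,6)]]
    show ?thesis
    proof (rule web_eta_eqI)
      show "eta_equation \<theta>' r s t x (pull_form \<Phi> x (web_eta \<theta> r s t (\<Phi> x)) + (1 / G (r, s, t) x) *s gradient (G (r, s, t)) x)"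
        by (rule eta_equation_pullback[where G="G (r, s, t)" and g=g, OF \<Phi>(1-4) x _ _ _ _ _ _ _ _ _ _ sol(1)])
           (use h g lt \<theta>' hG[OF rst] x in \<open>auto simp: G_def mult_ac\<close>)
      show "eta_equation \<theta>' s t r x (pull_form \<Phi> x (web_eta \<theta> r s t (\<Phi> x)) + (1 / G (r, s, t) x) *s gradient (G (r, s, t)) x)"
        by (rule eta_equation_pullback[where G="G (r, s, t)" and g=g, OF \<Phi>(1-4) x _ _ _ _ _ _ _ _ _ _ sol(2)])
           (use h g lt \<theta>' hG[OF rst] x in \<open>auto simp: G_def mult_ac\<close>)
      show "eta_equation \<theta>' t r s x (pull_form \<Phi> x (web_eta \<theta> r s t (\<Phi> x)) + (1 / G (r, s, t) x) *s gradient (G (r, s, t)) x)"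
        by (rule eta_equation_pullback[where G="G (r, s, t)" and g=g, OF \<Phi>(1-4) x _ _ _ _ _ _ _ _ _ _ sol(3)])
           (use h g lt \<theta>' hG[OF rst] x in \<open>auto simp: G_def mult_ac\<close>)
    qed (use w' lt in auto)
  qed
  have "web_curvature k \<theta>' m = ext_deriv (\<lambda>x. pull_form \<Phi> x (H (\<Phi> x)) + (\<Sum>z \<in> triples k. (1 / G z x) *s gradient (G z) x)) m"
    unfolding web_curvature_triples
  proof (rule ext_deriv_cong[OF \<Phi>(2,5)])
    fix x assume x: "x \<in> V"
    have "(\<Sum>(r, s, t) \<in> triples k. web_eta \<theta>' r s t x) =
      (\<Sum>z \<in> triples k. (case z of (r, s, t) \<Rightarrow> pull_form \<Phi> x (web_eta \<theta> r s t (\<Phi> x))) + (1 / G z x) *s gradient (G z) x)"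
      using eta[OF _ x] by (intro sum.cong) auto
    then show "(\<Sum>(r, s, t) \<in> triples k. web_eta \<theta>' r s t x) =
      pull_form \<Phi> x (H (\<Phi> x)) + (\<Sum>z \<in> triples k. (1 / G z x) *s gradient (G z) x)"
      by (simp add: sum.distrib H_def pull_sum split_beta)
  qed
  also have "\<dots> = ext_deriv (\<lambda>x. pull_form \<Phi> x (H (\<Phi> x))) m + ext_deriv (\<lambda>x. \<Sum>z \<in> triples k. (1 / G z x) *s gradient (G z) x) m"
    by (rule ext_deriv_add[OF holomorphic_pull_form[OF \<Phi>(1,2) hH \<Phi>(3,4)] holomorphic_form_sum[OF \<Phi>(2)] \<Phi>(2,5)])
       (rule ext_deriv_log_derivative(2)[OF hG(1) \<Phi>(2,5) hG(2)])
  also have "ext_deriv (\<lambda>x. \<Sum>z \<in> triples k. (1 / G z x) *s gradient (G z) x) m = (\<Sum>z \<in> triples k. 0)"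
    by (subst ext_deriv_sum[OF _ \<Phi>(2,5)])
       (use ext_deriv_log_derivative[OF hG(1) \<Phi>(2,5) hG(2)] in auto)
  also have "ext_deriv (\<lambda>x. pull_form \<Phi> x (H (\<Phi> x))) m = pull_jacobian \<Phi> m * ext_deriv H (\<Phi> m)"
    by (rule ext_deriv_pull[OF \<Phi>(1,2) hH \<Phi>(3,4,5)])
  finally show ?thesis by (simp add: web_curvature_triples H_def[abs_def])
qed

section \<open>The polynomial of directions and its roots\<close>

lemma linear_factor_derivatives:
  fixes G :: "complex poly"
  shows "poly (pderiv ([:- a, 1:] * G)) x = poly G x + (x - a) * poly (pderiv G) x"
    and "poly (pderiv (pderiv ([:- a, 1:] * G))) x = 2 * poly (pderiv G) x + (x - a) * poly (pderiv (pderiv G)) x"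
    and "poly (pderiv (pderiv (pderiv ([:- a, 1:] * G)))) x
      = 3 * poly (pderiv (pderiv G)) x + (x - a) * poly (pderiv (pderiv (pderiv G))) x"
proof -
  have *: "pderiv ([:- a, 1:] * G) = G + [:- a, 1:] * pderiv G" for G :: "complex poly"
    by (simp add: pderiv_mult pderiv_pCons one_pCons[symmetric] del: mult_pCons_left)
  show "poly (pderiv ([:- a, 1:] * G)) x = poly G x + (x - a) * poly (pderiv G) x"
    "poly (pderiv (pderiv ([:- a, 1:] * G))) x = 2 * poly (pderiv G) x + (x - a) * poly (pderiv (pderiv G)) x"
    "poly (pderiv (pderiv (pderiv ([:- a, 1:] * G)))) x
      = 3 * poly (pderiv (pderiv G)) x + (x - a) * poly (pderiv (pderiv (pderiv G))) x"
    unfolding * pderiv_add by (simp_all add: algebra_simps del: mult_pCons_left)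
qed

lemma linear_product_derivatives:
  fixes \<tau> :: "'i \<Rightarrow> complex"
  assumes "finite A" "\<And>s. s \<in> A \<Longrightarrow> x \<noteq> \<tau> s"
  shows "poly (pderiv (\<Prod>s\<in>A. [:- \<tau> s, 1:])) x = poly (\<Prod>s\<in>A. [:- \<tau> s, 1:]) x * (\<Sum>s\<in>A. 1 / (x - \<tau> s))"
    and "poly (pderiv (pderiv (\<Prod>s\<in>A. [:- \<tau> s, 1:]))) x
      = poly (\<Prod>s\<in>A. [:- \<tau> s, 1:]) x * ((\<Sum>s\<in>A. 1 / (x - \<tau> s))\<^sup>2 - (\<Sum>s\<in>A. 1 / (x - \<tau> s)\<^sup>2))"
  using assms
proof (induction A rule: finite_induct)
  case empty
  { case 1 show ?case by simp }
  { case 2 show ?case by simp }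
next
  case (insert a A)
  { case 1
    have a: "x - \<tau> a \<noteq> 0" using 1 by auto
    show ?case using insert a 1
      by (simp add: linear_factor_derivatives distrib_left del: mult_pCons_left) }
  { case 2
    define u S T P where "u = 1 / (x - \<tau> a)" and "S = (\<Sum>s\<in>A. 1 / (x - \<tau> s))"
      and "T = (\<Sum>s\<in>A. 1 / (x - \<tau> s)\<^sup>2)" and "P = poly (\<Prod>s\<in>A. [:- \<tau> s, 1:]) x"
    have "x - \<tau> a \<noteq> 0" using 2 by auto
    then have u: "(x - \<tau> a) * u = 1" "1 / (x - \<tau> a)\<^sup>2 = u\<^sup>2" by (simp_all add: u_def power_divide)
    have IH: "poly (pderiv (\<Prod>s\<in>A. [:- \<tau> s, 1:])) x = P * S"
      "poly (pderiv (pderiv (\<Prod>s\<in>A. [:- \<tau> s, 1:]))) x = P * (S\<^sup>2 - T)"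
      using insert 2 by (simp_all add: S_def T_def P_def)
    have "poly (pderiv (pderiv (\<Prod>s\<in>insert a A. [:- \<tau> s, 1:]))) x = 2 * (P * S) + (x - \<tau> a) * (P * (S\<^sup>2 - T))"
      using insert(1,2) by (simp add: linear_factor_derivatives IH del: mult_pCons_left)
    also have "\<dots> = (x - \<tau> a) * P * ((u + S)\<^sup>2 - (u\<^sup>2 + T))" using u(1) by algebra
    also have "(x - \<tau> a) * P = poly (\<Prod>s\<in>insert a A. [:- \<tau> s, 1:]) x"
      using insert(1,2) by (simp add: P_def algebra_simps)
    also have "u + S = (\<Sum>s\<in>insert a A. 1 / (x - \<tau> s))" using insert(1,2) by (simp add: S_def u_def)
    also have "u\<^sup>2 + T = (\<Sum>s\<in>insert a A. 1 / (x - \<tau> s)\<^sup>2)" using insert(1,2) u(2) by (simp add: T_def)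
    finally show ?case . }
qed

text \<open>The summand on the left is the sum of \<open>g\<close> over the three choices of a distinguished index
  in an unordered triple; the factor 2 counts the two orders of the other indices.\<close>

lemma triples_sum:
  fixes g :: "nat \<Rightarrow> nat \<Rightarrow> nat \<Rightarrow> complex"
  assumes sym: "\<And>r s t. g r s t = g r t s"
  shows "2 * (\<Sum>(r, s, t) \<in> {(r, s, t). r < s \<and> s < t \<and> t < k}. g r s t + g s t r + g t r s)
    = (\<Sum>r<k. \<Sum>s\<in>{..<k} - {r}. \<Sum>t\<in>{..<k} - {r, s}. g r s t)"
proof -
  define I where "I P = (if P then 1 else 0 :: complex)" for P
  let ?S = "\<lambda>h :: nat \<Rightarrow> nat \<Rightarrow> nat \<Rightarrow> complex. \<Sum>r<k. \<Sum>s<k. \<Sum>t<k. h r s t"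
  have R: "(\<Sum>r<k. \<Sum>s\<in>{..<k} - {r}. \<Sum>t\<in>{..<k} - {r, s}. g r s t)
      = ?S (\<lambda>r s t. I (s \<noteq> r \<and> t \<noteq> r \<and> t \<noteq> s) * g r s t)"
  proof (rule sum.cong[OF refl])
    fix r
    have "(\<Sum>s\<in>{..<k} - {r}. \<Sum>t\<in>{..<k} - {r, s}. g r s t) = (\<Sum>s\<in>{..<k} - {r}. \<Sum>t<k. I (s \<noteq> r \<and> t \<noteq> r \<and> t \<noteq> s) * g r s t)"
      by (intro sum.cong refl sum.mono_neutral_cong_left) (auto simp: I_def)
    also have "\<dots> = (\<Sum>s<k. \<Sum>t<k. I (s \<noteq> r \<and> t \<noteq> r \<and> t \<noteq> s) * g r s t)"
      by (intro sum.mono_neutral_left) (auto simp: I_def intro!: sum.neutral)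
    finally show "(\<Sum>s\<in>{..<k} - {r}. \<Sum>t\<in>{..<k} - {r, s}. g r s t) = (\<Sum>s<k. \<Sum>t<k. I (s \<noteq> r \<and> t \<noteq> r \<and> t \<noteq> s) * g r s t)" .
  qed
  have L: "(\<Sum>(r, s, t) \<in> {(r, s, t). r < s \<and> s < t \<and> t < k}. h r s t) = ?S (\<lambda>r s t. I (r < s \<and> s < t) * h r s t)" for h
  proof -
    have "(\<Sum>(r, s, t) \<in> {(r, s, t). r < s \<and> s < t \<and> t < k}. h r s t)
        = (\<Sum>(r, s, t) \<in> {..<k} \<times> {..<k} \<times> {..<k}. I (r < s \<and> s < t) * h r s t)"
      by (rule sum.mono_neutral_cong_left) (auto simp: I_def split: if_splits)
    then show ?thesis by (simp add: sum.cartesian_product)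
  qed
  have swap1: "?S h = ?S (\<lambda>r s t. h s r t)" for h by (rule sum.swap)
  have swap2: "?S h = ?S (\<lambda>r s t. h r t s)" for h by (rule sum.cong[OF refl], rule sum.swap)
  have split: "I (s \<noteq> r \<and> t \<noteq> r \<and> t \<noteq> s) = I (r < s \<and> s < t) + I (r < t \<and> t < s) + I (s < r \<and> r < t) + I (s < t \<and> t < r)
      + I (t < r \<and> r < s) + I (t < s \<and> s < r)" for r s t :: nat
    by (auto simp: I_def)
  have "?S (\<lambda>r s t. I (s \<noteq> r \<and> t \<noteq> r \<and> t \<noteq> s) * g r s t)
    = ?S (\<lambda>r s t. I (r < s \<and> s < t) * g r s t) + ?S (\<lambda>r s t. I (r < t \<and> t < s) * g r s t)
     + ?S (\<lambda>r s t. I (s < r \<and> r < t) * g r s t) + ?S (\<lambda>r s t. I (s < t \<and> t < r) * g r s t)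
     + ?S (\<lambda>r s t. I (t < r \<and> r < s) * g r s t) + ?S (\<lambda>r s t. I (t < s \<and> s < r) * g r s t)"
    unfolding split by (simp only: distrib_right sum.distrib)
  also have "?S (\<lambda>r s t. I (r < t \<and> t < s) * g r s t) = ?S (\<lambda>r s t. I (r < s \<and> s < t) * g r s t)"
    by (subst swap2) (simp add: sym)
  also have "?S (\<lambda>r s t. I (s < r \<and> r < t) * g r s t) = ?S (\<lambda>r s t. I (r < s \<and> s < t) * g s t r)"
    by (subst swap1) (simp add: sym)
  also have "?S (\<lambda>r s t. I (t < r \<and> r < s) * g r s t) = ?S (\<lambda>r s t. I (r < s \<and> s < t) * g s t r)"
    by (subst swap2, subst swap1) simp
  also have "?S (\<lambda>r s t. I (s < t \<and> t < r) * g r s t) = ?S (\<lambda>r s t. I (r < s \<and> s < t) * g t r s)"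
    by (subst swap1, subst swap2) simp
  also have "?S (\<lambda>r s t. I (t < s \<and> s < r) * g r s t) = ?S (\<lambda>r s t. I (r < s \<and> s < t) * g t r s)"
    by (subst swap2, subst swap1, subst swap2) (simp add: sym)
  finally show ?thesis
    unfolding R L by (simp add: distrib_left sum.distrib)
qed

text \<open>The low part of \<open>(1 + \<tau>)\<^sup>d\<close>.\<close>

definition Qpoly :: "nat \<Rightarrow> nat \<Rightarrow> complex poly" where
  "Qpoly d \<nu> = (\<Sum>i\<le>\<nu>. monom (of_nat (d choose i)) i)"

text \<open>The polynomial whose roots are the values of \<open>y / x\<close> at the points where a line of slope
  \<open>p\<close> is tangent to the model foliation with parameter \<open>\<mu>\<close>; it equals \<open>\<mu>\<close> times the high part
  plus \<open>p\<close> times the low part of \<open>(1 + \<tau>)\<^sup>d\<close>.\<close>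

definition Fpoly :: "nat \<Rightarrow> nat \<Rightarrow> complex \<Rightarrow> complex \<Rightarrow> complex poly" where
  "Fpoly d \<nu> \<mu> p = smult \<mu> ([:1, 1:] ^ d) + smult (p - \<mu>) (Qpoly d \<nu>)"

definition kappa :: "nat \<Rightarrow> nat \<Rightarrow> complex" where
  "kappa d \<nu> = of_nat ((d - \<nu>) * (d choose \<nu>))"

lemma coeff_Qpoly: "coeff (Qpoly d \<nu>) i = (if i \<le> \<nu> then of_nat (d choose i) else 0)"
  by (simp add: Qpoly_def coeff_sum if_distrib cong: if_cong)

lemma degree_Qpoly: "degree (Qpoly d \<nu>) \<le> \<nu>"
  by (rule degree_le) (simp add: coeff_Qpoly)

text \<open>The full binomial expansion satisfies \<open>(1 + \<tau>) y' = d y\<close>; truncating it leaves exactly one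
  boundary term.\<close>

lemma Qpoly_ode: "[:1, 1:] * pderiv (Qpoly d \<nu>) = smult (of_nat d) (Qpoly d \<nu>) - monom (kappa d \<nu>) \<nu>"
proof (rule poly_eqI)
  fix j
  have rec: "Suc i * (d choose Suc i) = (d - i) * (d choose i)" for i
    using binomial_absorb_comp[of d i] binomial_absorption[of i d] by (metis)
  have rec': "of_nat (Suc i) * of_nat (d choose Suc i) = (of_nat d - of_nat i) * (of_nat (d choose i) :: complex)" for i
  proof (cases "i \<le> d")
    case True
    then show ?thesis using arg_cong[OF rec[of i], of "of_nat :: nat \<Rightarrow> complex"] by (simp only: of_nat_mult of_nat_diff)
  qed (simp add: binomial_eq_0)
  have k: "kappa d \<nu> = (of_nat d - of_nat \<nu>) * of_nat (d choose \<nu>)"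
    unfolding kappa_def by (cases "\<nu> \<le> d") (simp_all add: of_nat_diff binomial_eq_0)
  show "coeff ([:1, 1:] * pderiv (Qpoly d \<nu>)) j = coeff (smult (of_nat d) (Qpoly d \<nu>) - monom (kappa d \<nu>) \<nu>) j"
  proof (cases j)
    case 0
    then show ?thesis using rec'[of 0] k by (cases "\<nu> = 0") (auto simp: coeff_pderiv coeff_Qpoly coeff_pCons)
  next
    case (Suc i)
    have "coeff ([:1, 1:] * pderiv (Qpoly d \<nu>)) j = of_nat (Suc j) * coeff (Qpoly d \<nu>) (Suc j) + of_nat j * coeff (Qpoly d \<nu>) j"
      using Suc by (simp add: coeff_pderiv)
    then show ?thesis using rec'[of j] k
      by (auto simp: coeff_Qpoly not_less_eq_eq algebra_simps)
  qed
qed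

lemma kappa_nonzero: "\<nu> < d \<Longrightarrow> kappa d \<nu> \<noteq> 0"
  by (simp add: kappa_def)

lemma Fpoly_ode:
  "[:1, 1:] * pderiv (Fpoly d \<nu> \<mu> p) = smult (of_nat d) (Fpoly d \<nu> \<mu> p) - monom ((p - \<mu>) * kappa d \<nu>) \<nu>"
proof -
  have "[:1, 1:] * pderiv ([:1, 1:] ^ d) = smult (of_nat d) ([:1, 1:] ^ d :: complex poly)"
  proof (cases d)
    case (Suc n)
    then show ?thesis unfolding Suc by (subst pderiv_power_Suc) (simp add: pderiv_pCons)
  qed (simp add: one_pCons)
  then have "[:1, 1:] * pderiv (Fpoly d \<nu> \<mu> p) = smult \<mu> (smult (of_nat d) ([:1, 1:] ^ d))
      + smult (p - \<mu>) ([:1, 1:] * pderiv (Qpoly d \<nu>))"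
    unfolding Fpoly_def pderiv_add pderiv_smult distrib_left mult_smult_right by simp
  then show ?thesis unfolding Qpoly_ode
    by (simp add: Fpoly_def smult_add_right smult_diff_right smult_monom mult.commute)
qed

text \<open>Eliminating the boundary term, which is an eigenvector of \<open>x d/dx\<close>, gives a homogeneous
  equation of second order for \<open>F\<close>. It and its derivative express the second and third
  derivatives of \<open>F\<close> at a root through the first.\<close>

lemma Fpoly_ode2:
  fixes x \<mu> p :: complex and d \<nu> :: nat
  assumes "\<nu> \<ge> 1"
  defines "F \<equiv> Fpoly d \<nu> \<mu> p"
  shows "x * ((1 + x) * poly (pderiv (pderiv F)) x + (1 - of_nat d) * poly (pderiv F) x)
      = of_nat \<nu> * ((1 + x) * poly (pderiv F) x - of_nat d * poly F x)" (is ?A)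
    and "(1 + x) * poly (pderiv (pderiv F)) x + (1 - of_nat d) * poly (pderiv F) x
      + x * (poly (pderiv (pderiv F)) x + (1 + x) * poly (pderiv (pderiv (pderiv F))) x + (1 - of_nat d) * poly (pderiv (pderiv F)) x)
      = of_nat \<nu> * (poly (pderiv F) x + (1 + x) * poly (pderiv (pderiv F)) x - of_nat d * poly (pderiv F) x)" (is ?B)
proof -
  define E where "E = [:1, 1:] * pderiv F - smult (of_nat d) F"
  have "E = - monom ((p - \<mu>) * kappa d \<nu>) \<nu>"
    unfolding E_def F_def Fpoly_ode by simp
  moreover have "[:0, 1:] * pderiv (monom c \<nu>) = smult (of_nat \<nu>) (monom c \<nu>)" for c :: complex
    using assms(1) by (cases \<nu>) (simp_all add: pderiv_monom smult_monom mult.commute flip: monom_Suc)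
  ultimately have *: "[:0, 1:] * pderiv E = smult (of_nat \<nu>) E"
    by (simp only: pderiv_minus mult_minus_right smult_minus_right)
  have lin: "pderiv ([:a, 1:] * G) = G + [:a, 1:] * pderiv G" for G :: "complex poly" and a
    by (simp add: pderiv_mult pderiv_pCons one_pCons[symmetric] del: mult_pCons_left)
  have dE: "pderiv E = [:1, 1:] * pderiv (pderiv F) + smult (1 - of_nat d) (pderiv F)"
    unfolding E_def pderiv_diff lin pderiv_smult by (simp add: smult_diff_left del: mult_pCons_left)
  have ddE: "pderiv (pderiv E) = pderiv (pderiv F) + [:1, 1:] * pderiv (pderiv (pderiv F)) + smult (1 - of_nat d) (pderiv (pderiv F))"
    unfolding dE pderiv_add lin pderiv_smult ..
  from arg_cong[OF *, of "\<lambda>q. poly q x"] show ?A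
    unfolding dE by (simp add: E_def algebra_simps)
  from arg_cong[OF *, of "\<lambda>q. poly (pderiv q) x"] show ?B
    unfolding lin pderiv_smult ddE unfolding dE by (simp add: algebra_simps)
qed

text \<open>The value at 0 of the quadratic polynomial that takes the values \<open>f r\<close>, \<open>f s\<close>, \<open>f t\<close> at
  \<open>y r\<close>, \<open>y s\<close>, \<open>y t\<close>.\<close>

definition f0 where
  "f0 f y r s t = f r * y s * y t / ((y r - y s) * (y r - y t)) + f s * y t * y r / ((y s - y t) * (y s - y r))
     + f t * y r * y s / ((y t - y r) * (y t - y s))" for f y :: "nat \<Rightarrow> complex"

lemma Fpoly_degree:
  assumes "\<nu> < d" "\<mu> \<noteq> 0"
  shows "degree (Fpoly d \<nu> \<mu> p) = d" "coeff (Fpoly d \<nu> \<mu> p) d = \<mu>"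
proof -
  have dq: "degree (Qpoly d \<nu>) < d" using degree_Qpoly[of d \<nu>] assms(1) by linarith
  have dp: "degree ([:1, 1:] ^ d :: complex poly) = d" by (simp add: degree_power_eq)
  have "coeff ([:1, 1:] ^ d :: complex poly) d = 1"
    using lead_coeff_power[of "[:1, 1:] :: complex poly" d] dp by simp
  then show c: "coeff (Fpoly d \<nu> \<mu> p) d = \<mu>" using coeff_eq_0[OF dq] by (simp add: Fpoly_def)
  have "degree (Fpoly d \<nu> \<mu> p) \<le> d" unfolding Fpoly_def
    by (intro degree_add_le) (use dp dq degree_smult_le[of "p - \<mu>" "Qpoly d \<nu>"] in auto)
  then show "degree (Fpoly d \<nu> \<mu> p) = d" using c assms(2) le_degree[of "Fpoly d \<nu> \<mu> p" d] by simp
qed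

lemma Qpoly_at_0: "poly (Qpoly d \<nu>) 0 = 1"
  by (simp add: poly_0_coeff_0 coeff_Qpoly)

lemma Fpoly_at_0: "poly (Fpoly d \<nu> \<mu> p) 0 = p"
  by (simp add: Fpoly_def Qpoly_at_0 poly_power)

lemma Qpoly_at_minus_1: "\<nu> < d \<Longrightarrow> poly (Qpoly d \<nu>) (- 1) \<noteq> 0"
  using arg_cong[OF Qpoly_ode, of "\<lambda>q. poly q (- 1)" d \<nu>] kappa_nonzero[of \<nu> d]
  by (auto simp: poly_monom)

lemma pderiv_sum: "pderiv (\<Sum>i\<in>A. f i) = (\<Sum>i\<in>A. pderiv (f i))"
  by (induction A rule: infinite_finite_induct) (auto simp: pderiv_add)

text \<open>The roots of \<open>F\<close> over one point \<open>p\<close> outside the discriminant. All the sums over the roots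
  that enter the curvature are evaluated here.\<close>

locale root_system =
  fixes d \<nu> :: nat and \<mu> p :: complex and \<tau> :: "nat \<Rightarrow> complex"
  assumes d: "d \<ge> 3" and \<nu>: "1 \<le> \<nu>" "\<nu> + 2 \<le> d" and \<mu>: "\<mu> \<noteq> 0" and p: "p \<noteq> 0" "p \<noteq> \<mu>"
    and inj: "inj_on \<tau> {..<d}" and root: "\<And>r. r < d \<Longrightarrow> poly (Fpoly d \<nu> \<mu> p) (\<tau> r) = 0"
begin

abbreviation "F \<equiv> Fpoly d \<nu> \<mu> p"
abbreviation "Q \<equiv> Qpoly d \<nu>"

lemma coeff_F: "coeff F d = \<mu>" and degree_F: "degree F = d"
  using Fpoly_degree[of \<nu> d \<mu> p] \<nu> \<mu> by auto

lemma vanishing_at_roots: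
  assumes "\<And>i. i \<ge> d \<Longrightarrow> coeff R i = 0" "\<And>s. s < d \<Longrightarrow> poly R (\<tau> s) = 0"
  shows "R = 0"
proof (rule ccontr)
  assume R: "R \<noteq> 0"
  have "degree R < d" using assms(1)[of "degree R"] R by (metis leading_coeff_0_iff linorder_not_less)
  moreover have "\<tau> ` {..<d} \<subseteq> {x. poly R x = 0}" using assms(2) by auto
  then have "card (\<tau> ` {..<d}) \<le> card {x. poly R x = 0}"
    using poly_roots_finite[OF R] card_mono by blast
  moreover have "card (\<tau> ` {..<d}) = d" using inj by (simp add: card_image)
  ultimately show False using card_poly_roots_bound[OF R] by linarith
qed

lemma degree_linear_product: "finite A \<Longrightarrow> degree (\<Prod>s\<in>A. [:- \<tau> s, 1:]) = card A"
  by (subst degree_prod_eq_sum_degree) auto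

lemma lead_coeff_linear_product: "finite A \<Longrightarrow> coeff (\<Prod>s\<in>A. [:- \<tau> s, 1:]) (card A) = 1"
  using lead_coeff_prod[of "\<lambda>s. [:- \<tau> s, 1:]" A] by (simp add: degree_linear_product)

lemma F_factors: "F = smult \<mu> (\<Prod>s<d. [:- \<tau> s, 1:])"
proof -
  define R where "R = F - smult \<mu> (\<Prod>s<d. [:- \<tau> s, 1:])"
  have "R = 0"
  proof (rule vanishing_at_roots)
    fix i assume "i \<ge> d"
    then consider "i = d" | "i > d" by linarith
    then show "coeff R i = 0"
    proof cases
      case 1
      then show ?thesis using lead_coeff_linear_product[of "{..<d}"] by (simp add: R_def coeff_F)
    next
      case 2
      then have "i > degree F" "i > degree (\<Prod>s<d. [:- \<tau> s, 1:])"
        using degree_linear_product[of "{..<d}"] by (simp_all add: degree_F)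
      then show ?thesis using coeff_eq_0[of F i] coeff_eq_0[of "\<Prod>s<d. [:- \<tau> s, 1:]" i] by (simp add: R_def)
    qed
  next
    fix s assume "s < d"
    then show "poly R (\<tau> s) = 0" using root by (auto simp: R_def poly_prod)
  qed
  then show ?thesis by (simp add: R_def)
qed

text \<open>The cofactor of the root \<open>\<tau> r\<close> in \<open>F\<close>.\<close>

definition H where "H r = smult \<mu> (\<Prod>s\<in>{..<d} - {r}. [:- \<tau> s, 1:])"

lemma F_H: "r < d \<Longrightarrow> F = [:- \<tau> r, 1:] * H r"
  unfolding F_factors H_def by (subst prod.remove[of "{..<d}" r]) auto

lemma degree_H: "r < d \<Longrightarrow> degree (H r) = d - 1" and coeff_H: "r < d \<Longrightarrow> coeff (H r) (d - 1) = \<mu>"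
proof -
  assume r: "r < d"
  let ?G = "\<Prod>s\<in>{..<d} - {r}. [:- \<tau> s, 1:]"
  have "degree ?G = d - 1" "coeff ?G (d - 1) = 1"
    using r degree_linear_product[of "{..<d} - {r}"] lead_coeff_linear_product[of "{..<d} - {r}"] by simp_all
  then show "degree (H r) = d - 1" "coeff (H r) (d - 1) = \<mu>" using \<mu> by (simp_all add: H_def)
qed

lemma H_root: "r < d \<Longrightarrow> s < d \<Longrightarrow> s \<noteq> r \<Longrightarrow> poly (H r) (\<tau> s) = 0"
  by (auto simp: H_def poly_prod intro!: prod_zero)

lemma H_nonzero: "r < d \<Longrightarrow> poly (H r) (\<tau> r) \<noteq> 0"
  using inj \<mu> by (auto simp: H_def poly_prod inj_on_def)

lemma derivatives_at_root:
  assumes "r < d"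
  shows "poly (pderiv F) (\<tau> r) = poly (H r) (\<tau> r)"
    and "poly (pderiv (pderiv F)) (\<tau> r) = 2 * poly (pderiv (H r)) (\<tau> r)"
    and "poly (pderiv (pderiv (pderiv F))) (\<tau> r) = 3 * poly (pderiv (pderiv (H r))) (\<tau> r)"
  unfolding F_H[OF assms] linear_factor_derivatives by simp_all

text \<open>The quantities \<open>H'/H\<close> and \<open>H''/H\<close> at the root \<open>\<tau> r\<close>, written as power sums (see
  \<open>H_derivatives\<close>).\<close>

definition e1 where "e1 r = (\<Sum>s\<in>{..<d} - {r}. 1 / (\<tau> r - \<tau> s))"
definition n2 where "n2 r = (e1 r)\<^sup>2 - (\<Sum>s\<in>{..<d} - {r}. 1 / (\<tau> r - \<tau> s)\<^sup>2)"

lemma H_derivatives: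
  assumes "r < d"
  shows "poly (pderiv (H r)) (\<tau> r) = poly (H r) (\<tau> r) * e1 r"
    and "poly (pderiv (pderiv (H r))) (\<tau> r) = poly (H r) (\<tau> r) * n2 r"
proof -
  have ne: "\<tau> r \<noteq> \<tau> s" if "s \<in> {..<d} - {r}" for s using that assms inj by (auto simp: inj_on_def)
  note * = linear_product_derivatives[of "{..<d} - {r}" "\<tau> r" \<tau>, OF _ ne]
  show "poly (pderiv (H r)) (\<tau> r) = poly (H r) (\<tau> r) * e1 r"
    using *(1) by (simp add: H_def e1_def pderiv_smult)
  show "poly (pderiv (pderiv (H r))) (\<tau> r) = poly (H r) (\<tau> r) * n2 r"
    using *(2) by (simp add: H_def e1_def n2_def pderiv_smult)
qed

lemma poly_Q_0: "poly Q 0 = 1" and poly_pderiv_Q_0: "poly (pderiv Q) 0 = of_nat d"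
  using \<nu> by (simp_all add: Qpoly_at_0 poly_0_coeff_0 coeff_pderiv coeff_Qpoly)

lemma poly_Q_neg1: "poly Q (- 1) \<noteq> 0"
  using Qpoly_at_minus_1[of \<nu> d] \<nu> by simp

lemma F_0: "poly F 0 = p" "poly (pderiv F) 0 = p * of_nat d"
proof -
  show 0: "poly F 0 = p" by (rule Fpoly_at_0)
  show "poly (pderiv F) 0 = p * of_nat d"
    using arg_cong[OF Fpoly_ode, of "\<lambda>q. poly q 0" d \<nu> \<mu> p] \<nu> by (simp add: poly_monom 0 mult.commute)
qed

lemma F_neg1: "poly F (- 1) = (p - \<mu>) * poly Q (- 1)" "poly (pderiv F) (- 1) = (p - \<mu>) * poly (pderiv Q) (- 1)"
proof -
  obtain n where n: "d = Suc (Suc n)" using that[of "d - 2"] d by simp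
  show "poly F (- 1) = (p - \<mu>) * poly Q (- 1)" using d by (simp add: Fpoly_def poly_power)
  show "poly (pderiv F) (- 1) = (p - \<mu>) * poly (pderiv Q) (- 1)"
    by (simp add: Fpoly_def pderiv_add pderiv_smult n pderiv_power_Suc poly_power del: power_Suc)
qed

lemma root_avoids: "r < d \<Longrightarrow> \<tau> r \<noteq> 0" "r < d \<Longrightarrow> 1 + \<tau> r \<noteq> 0"
proof -
  assume r: "r < d"
  show "\<tau> r \<noteq> 0" using root[OF r] F_0 p by auto
  show "1 + \<tau> r \<noteq> 0"
  proof
    assume "1 + \<tau> r = 0"
    then have "\<tau> r = - 1" by (simp add: eq_neg_iff_add_eq_0 add.commute)
    then show False using root[OF r] F_neg1(1) poly_Q_neg1 p by simp
  qed
qed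

text \<open>The differential equation for \<open>F\<close> turns these sums over the other roots into rational
  functions of the root \<open>\<tau> r\<close> alone: at a root the derivatives of \<open>F\<close> are multiples of those of
  \<open>H\<close>, so the two equations of \<open>Fpoly_ode2\<close> become linear equations for \<open>e1\<close> and \<open>n2\<close>.\<close>

lemma symmetric_sums:
  assumes r: "r < d"
  shows "2 * e1 r = (of_nat d - 1) / (1 + \<tau> r) + of_nat \<nu> / \<tau> r"
    and "3 * n2 r = of_nat \<nu> * (of_nat \<nu> - 1) / (\<tau> r)\<^sup>2 + of_nat \<nu> * (of_nat d - 2) / (\<tau> r * (1 + \<tau> r))
      + (of_nat d - 1) * (of_nat d - 2) / (1 + \<tau> r)\<^sup>2"
proof -
  define h where "h = poly (H r) (\<tau> r)"
  define t where "t = \<tau> r"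
  define D N where "D = (of_nat d :: complex)" and "N = (of_nat \<nu> :: complex)"
  have t: "t \<noteq> 0" "1 + t \<noteq> 0" using root_avoids[OF r] by (auto simp: t_def)
  have h: "h \<noteq> 0" using H_nonzero[OF r] by (simp add: h_def)
  have A: "t * ((1 + t) * (2 * (h * e1 r)) + (1 - D) * h) = N * ((1 + t) * h)"
    using Fpoly_ode2(1)[OF \<nu>(1), of "\<tau> r" d \<mu> p] root[OF r]
    unfolding derivatives_at_root[OF r] H_derivatives[OF r] by (simp add: h_def t_def D_def N_def)
  then have "h * (2 * e1 r * (t * (1 + t))) = h * ((D - 1) * t + N * (1 + t))" by algebra
  then have e: "2 * e1 r * (t * (1 + t)) = (D - 1) * t + N * (1 + t)" using h by simp
  have "2 * e1 r = 2 * e1 r * (t * (1 + t)) / (t * (1 + t))" using t by simp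
  also have "\<dots> = (D - 1) / (1 + t) + N / t" unfolding e using t by (simp add: add_divide_distrib)
  finally show "2 * e1 r = (of_nat d - 1) / (1 + \<tau> r) + of_nat \<nu> / \<tau> r" by (simp add: t_def D_def N_def)
  have B: "(1 + t) * (2 * (h * e1 r)) + (1 - D) * h + t * (2 * (h * e1 r) + (1 + t) * (3 * (h * n2 r)) + (1 - D) * (2 * (h * e1 r)))
      = N * (h + (1 + t) * (2 * (h * e1 r)) - D * h)"
    using Fpoly_ode2(2)[OF \<nu>(1), of "\<tau> r" d \<mu> p] root[OF r]
    unfolding derivatives_at_root[OF r] H_derivatives[OF r] by (simp add: h_def t_def D_def N_def)
  then have "h * (t * (1 + t) * (3 * n2 r)) = h * (N * (1 + (1 + t) * (2 * e1 r) - D) - (1 + t) * (2 * e1 r) - (1 - D) - t * (2 * e1 r) * (2 - D))"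
    by algebra
  then have n: "t * (1 + t) * (3 * n2 r) = N * (1 + (1 + t) * (2 * e1 r) - D) - (1 + t) * (2 * e1 r) - (1 - D) - t * (2 * e1 r) * (2 - D)"
    using h by simp
  have "(t * (1 + t))\<^sup>2 * (3 * n2 r) = t * (1 + t) * (N - N * D - 1 + D) + (N * (1 + t) - (1 + t) - t * (2 - D)) * (2 * e1 r * (t * (1 + t)))"
    using n by algebra
  also have "\<dots> = N * (N - 1) * (1 + t)\<^sup>2 + N * (D - 2) * (t * (1 + t)) + (D - 1) * (D - 2) * t\<^sup>2"
    unfolding e by algebra
  finally have X: "(t * (1 + t))\<^sup>2 * (3 * n2 r) = N * (N - 1) * (1 + t)\<^sup>2 + N * (D - 2) * (t * (1 + t)) + (D - 1) * (D - 2) * t\<^sup>2" .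
  have "3 * n2 r = (t * (1 + t))\<^sup>2 * (3 * n2 r) / (t * (1 + t))\<^sup>2" using t by simp
  also have "\<dots> = (N * (N - 1) * (1 + t)\<^sup>2 + N * (D - 2) * (t * (1 + t)) + (D - 1) * (D - 2) * t\<^sup>2) / (t * (1 + t))\<^sup>2"
    unfolding X ..
  also have "\<dots> = N * (N - 1) / t\<^sup>2 + N * (D - 2) / (t * (1 + t)) + (D - 1) * (D - 2) / (1 + t)\<^sup>2"
  proof -
    have "(a * v\<^sup>2 + b * (t * v) + c * t\<^sup>2) / (t * v)\<^sup>2 = a / t\<^sup>2 + b / (t * v) + c / v\<^sup>2" if "v \<noteq> 0" for a b c v
      using t(1) that by (simp add: field_simps power2_eq_square)
    then show ?thesis using t(2) .
  qed
  finally show "3 * n2 r = of_nat \<nu> * (of_nat \<nu> - 1) / (\<tau> r)\<^sup>2 + of_nat \<nu> * (of_nat d - 2) / (\<tau> r * (1 + \<tau> r))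
      + (of_nat d - 1) * (of_nat d - 2) / (1 + \<tau> r)\<^sup>2" by (simp add: t_def D_def N_def)
qed

text \<open>The derivative of the root with respect to \<open>p\<close>, by implicit differentiation of \<open>F = 0\<close>.\<close>

definition velocity where "velocity r = - poly Q (\<tau> r) / poly (pderiv F) (\<tau> r)"

lemma pderiv_F_root_nonzero: "r < d \<Longrightarrow> poly (pderiv F) (\<tau> r) \<noteq> 0"
  using H_nonzero derivatives_at_root(1) by simp

text \<open>Lagrange interpolation of \<open>Q\<close> at the roots of \<open>F\<close>, which is possible because \<open>Q\<close> has
  smaller degree.\<close>

lemma lagrange: "Q = - (\<Sum>r<d. smult (velocity r) (H r))"
proof -
  \<comment> \<open>the difference has degree below \<open>d\<close> and vanishes at all \<open>d\<close> roots\<close>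
  define R where "R = Q + (\<Sum>r<d. smult (velocity r) (H r))"
  have "R = 0"
  proof (rule vanishing_at_roots)
    fix i assume i: "i \<ge> d"
    have "coeff (H r) i = 0" if "r < d" for r
      using degree_H[OF that] i d by (intro coeff_eq_0) linarith
    then show "coeff R i = 0" using i \<nu> by (simp add: R_def coeff_sum coeff_Qpoly)
  next
    fix s assume s: "s < d"
    have "poly (\<Sum>r<d. smult (velocity r) (H r)) (\<tau> s) = (\<Sum>r<d. if r = s then velocity s * poly (H s) (\<tau> s) else 0)"
      unfolding poly_sum using s H_root by (intro sum.cong) auto
    then show "poly R (\<tau> s) = 0" using s pderiv_F_root_nonzero[OF s]
      by (simp add: R_def velocity_def derivatives_at_root(1))
  qed
  then show ?thesis unfolding R_def by (simp add: add_eq_0_iff2)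
qed

lemma velocity_sum: "(\<Sum>r<d. velocity r) = 0"
proof -
  have "coeff Q (d - 1) = - (\<Sum>r<d. velocity r * coeff (H r) (d - 1))"
    by (subst lagrange) (simp add: coeff_sum)
  also have "(\<Sum>r<d. velocity r * coeff (H r) (d - 1)) = (\<Sum>r<d. velocity r * \<mu>)" using coeff_H by simp
  finally have "coeff Q (d - 1) = - (\<Sum>r<d. velocity r) * \<mu>" by (simp add: sum_distrib_right)
  moreover have "\<not> d - 1 \<le> \<nu>" using \<nu> by linarith
  ultimately show ?thesis using \<mu> by (simp add: coeff_Qpoly)
qed

text \<open>The interpolation formula divided by \<open>F\<close>, and its derivative.\<close>

lemma velocity_sums:
  assumes "poly F x \<noteq> 0"
  shows "(\<Sum>r<d. velocity r / (x - \<tau> r)) = - poly Q x / poly F x"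
    and "(\<Sum>r<d. velocity r / (x - \<tau> r)\<^sup>2) = (poly (pderiv Q) x * poly F x - poly Q x * poly (pderiv F) x) / (poly F x)\<^sup>2"
proof -
  have ne: "x - \<tau> r \<noteq> 0" if "r < d" for r using assms root[OF that] by auto
  have H0: "poly (H r) x = poly F x / (x - \<tau> r)" if "r < d" for r
    using arg_cong[OF F_H[OF that], of "\<lambda>q. poly q x"] ne[OF that] by (simp add: field_simps)
  have H1: "poly (pderiv (H r)) x = poly (pderiv F) x / (x - \<tau> r) - poly F x / (x - \<tau> r)\<^sup>2" if "r < d" for r
  proof -
    have "poly (pderiv F) x = poly F x / (x - \<tau> r) + (x - \<tau> r) * poly (pderiv (H r)) x"
      using arg_cong[OF F_H[OF that], of "\<lambda>q. poly (pderiv q) x"] unfolding linear_factor_derivatives H0[OF that] .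
    then have "(x - \<tau> r) * poly (pderiv (H r)) x = poly (pderiv F) x - poly F x / (x - \<tau> r)" by simp
    then have "poly (pderiv (H r)) x = (poly (pderiv F) x - poly F x / (x - \<tau> r)) / (x - \<tau> r)"
      using ne[OF that] by (metis nonzero_mult_div_cancel_left)
    then show ?thesis by (simp add: diff_divide_distrib power2_eq_square)
  qed
  have "poly Q x = - (\<Sum>r<d. velocity r * poly (H r) x)"
    by (subst lagrange) (simp add: poly_sum)
  also have "(\<Sum>r<d. velocity r * poly (H r) x) = poly F x * (\<Sum>r<d. velocity r / (x - \<tau> r))"
    unfolding sum_distrib_left using H0 by (intro sum.cong) auto
  finally show 1: "(\<Sum>r<d. velocity r / (x - \<tau> r)) = - poly Q x / poly F x"
    using assms by (simp add: field_simps)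
  have "poly (pderiv Q) x = - (\<Sum>r<d. velocity r * poly (pderiv (H r)) x)"
    by (subst lagrange) (simp add: poly_sum pderiv_sum pderiv_minus pderiv_smult)
  also have "(\<Sum>r<d. velocity r * poly (pderiv (H r)) x)
      = poly (pderiv F) x * (\<Sum>r<d. velocity r / (x - \<tau> r)) - poly F x * (\<Sum>r<d. velocity r / (x - \<tau> r)\<^sup>2)"
    unfolding sum_distrib_left sum_subtractf[symmetric] by (rule sum.cong) (simp_all add: H1 right_diff_distrib mult_ac)
  finally have "poly F x * (\<Sum>r<d. velocity r / (x - \<tau> r)\<^sup>2) = poly (pderiv Q) x + poly (pderiv F) x * (- poly Q x / poly F x)"
    unfolding 1 by simp
  then show "(\<Sum>r<d. velocity r / (x - \<tau> r)\<^sup>2) = (poly (pderiv Q) x * poly F x - poly Q x * poly (pderiv F) x) / (poly F x)\<^sup>2"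
    using assms by (simp add: field_simps power2_eq_square)
qed

text \<open>By \<open>symmetric_sums\<close> only poles at 0 and -1 occur. At these points \<open>Q\<close> and \<open>F\<close> are
  proportional to first order, since \<open>(1 + \<tau>)\<^sup>d\<close> vanishes at -1 to order \<open>d\<close> and \<open>F = p Q\<close> at 0
  up to order \<open>\<nu> + 1\<close>; hence the sums with double poles vanish.\<close>

lemma velocity_special_sums:
  shows "(\<Sum>r<d. velocity r / \<tau> r) = 1 / p" "(\<Sum>r<d. velocity r / (\<tau> r)\<^sup>2) = 0"
    "(\<Sum>r<d. velocity r / (1 + \<tau> r)) = 1 / (p - \<mu>)" "(\<Sum>r<d. velocity r / (1 + \<tau> r)\<^sup>2) = 0"
proof -
  have 0: "poly F 0 \<noteq> 0" and 1: "poly F (- 1) \<noteq> 0" using F_0 F_neg1 p poly_Q_neg1 by auto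
  show "(\<Sum>r<d. velocity r / \<tau> r) = 1 / p" "(\<Sum>r<d. velocity r / (\<tau> r)\<^sup>2) = 0"
    using velocity_sums[OF 0] unfolding F_0 poly_Q_0 poly_pderiv_Q_0 by (simp_all add: sum_negf)
  have e: "velocity r / (- 1 - \<tau> r) = - (velocity r / (1 + \<tau> r))" "(- 1 - \<tau> r)\<^sup>2 = (1 + \<tau> r)\<^sup>2" for r
  proof -
    have "- 1 - \<tau> r = - (1 + \<tau> r)" by simp
    then show "velocity r / (- 1 - \<tau> r) = - (velocity r / (1 + \<tau> r))" by (simp only: minus_divide_right)
  qed (simp add: power2_eq_square algebra_simps)
  show "(\<Sum>r<d. velocity r / (1 + \<tau> r)) = 1 / (p - \<mu>)" "(\<Sum>r<d. velocity r / (1 + \<tau> r)\<^sup>2) = 0"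
    using velocity_sums[OF 1] poly_Q_neg1 unfolding F_neg1 e sum_negf by simp_all
qed

text \<open>Partial fractions in \<open>\<tau> r\<close>: the weight is a combination of 1 and of simple and double
  poles at 0 and -1, and of the corresponding sums only those with simple poles survive.\<close>

lemma velocity_weighted_sum:
  "(\<Sum>r<d. velocity r * ((of_nat d - 1) * (of_nat d - 2) + 2 * (of_nat d - 2) * (p - \<tau> r) * e1 r + (p - \<tau> r)\<^sup>2 * n2 r))
   = (of_nat d - 2) * of_nat \<nu> - 2 / 3 * of_nat \<nu> * (of_nat \<nu> - 1)
     + (of_nat d - 2) / 3 * (of_nat \<nu> * \<mu> + (of_nat d - 1) - 2 * of_nat \<nu> * (\<mu> + 1))
     + (of_nat d - 2) / 3 * (\<mu> + 1) * (of_nat d - 1 - of_nat \<nu> * (\<mu> + 1)) / (p - \<mu>)"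
proof -
  define D N where "D = (of_nat d :: complex)" and "N = (of_nat \<nu> :: complex)"
  \<comment> \<open>coefficients of the partial fraction expansion of the weight\<close>
  define K0 where "K0 = (D - 1) * (D - 2) - (D - 2) * (D - 1) - (D - 2) * N + (N * (N - 1) + N * (D - 2) + (D - 1) * (D - 2)) / 3"
  define K1 where "K1 = (D - 2) * N * p + (N * (D - 2) * (p * (p + 1) - p) - 2 * N * (N - 1) * p) / 3"
  define K2 where "K2 = N * (N - 1) * p\<^sup>2 / 3"
  define K3 where "K3 = (D - 2) * (D - 1) * (p + 1) + (- N * (D - 2) * (p * (p + 1) + (p + 1)) - 2 * (D - 1) * (D - 2) * (p + 1)) / 3"
  define K4 where "K4 = (D - 1) * (D - 2) * (p + 1)\<^sup>2 / 3"
  have expand: "velocity r * ((D - 1) * (D - 2) + 2 * (D - 2) * (p - \<tau> r) * e1 r + (p - \<tau> r)\<^sup>2 * n2 r)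
      = K0 * velocity r + K1 * (velocity r / \<tau> r) + K2 * (velocity r / (\<tau> r)\<^sup>2)
       + K3 * (velocity r / (1 + \<tau> r)) + K4 * (velocity r / (1 + \<tau> r)\<^sup>2)" if r: "r < d" for r
  proof -
    define t where "t = \<tau> r"
    define u v where "u = 1 / t" and "v = 1 / (1 + t)"
    have t: "t \<noteq> 0" "1 + t \<noteq> 0" using root_avoids[OF r] by (auto simp: t_def)
    have uv: "u * t = 1" "v * (1 + t) = 1" using t by (simp_all add: u_def v_def)
    have e: "2 * e1 r = (D - 1) * v + N * u"
      using symmetric_sums(1)[OF r] by (simp add: D_def N_def u_def v_def t_def)
    have n: "3 * n2 r = N * (N - 1) * u\<^sup>2 + N * (D - 2) * (u * v) + (D - 1) * (D - 2) * v\<^sup>2"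
      using symmetric_sums(2)[OF r] by (simp add: D_def N_def u_def v_def t_def power_divide)
    have pt: "(p - t) * u = p * u - 1" "(p - t) * v = (p + 1) * v - 1" "u * v = u - v" using uv by algebra+
    have "2 * (p - t) * e1 r = (D - 1) * ((p + 1) * v - 1) + N * (p * u - 1)"
      using e pt by algebra
    moreover have "3 * ((p - t)\<^sup>2 * n2 r) = N * (N - 1) * (p * u - 1)\<^sup>2 + N * (D - 2) * ((p * u - 1) * ((p + 1) * v - 1))
       + (D - 1) * (D - 2) * ((p + 1) * v - 1)\<^sup>2"
      using n unfolding pt[symmetric] by algebra
    moreover have "(p * u - 1) * ((p + 1) * v - 1) = p * (p + 1) * (u - v) - p * u - (p + 1) * v + 1"
      using pt(3) by algebra
    ultimately have "3 * ((D - 1) * (D - 2) + 2 * (D - 2) * (p - t) * e1 r + (p - t)\<^sup>2 * n2 r)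
        = 3 * (K0 + K1 * u + K2 * u\<^sup>2 + K3 * v + K4 * v\<^sup>2)"
      unfolding K0_def K1_def K2_def K3_def K4_def by (simp add: power2_eq_square) algebra
    then have "(D - 1) * (D - 2) + 2 * (D - 2) * (p - t) * e1 r + (p - t)\<^sup>2 * n2 r
        = K0 + K1 * u + K2 * u\<^sup>2 + K3 * v + K4 * v\<^sup>2"
      by (rule mult_left_cancel[THEN iffD1, rotated]) simp
    then show ?thesis unfolding t_def[symmetric]
      by (simp only:) (simp add: u_def v_def algebra_simps power_divide)
  qed
  have "(\<Sum>r<d. velocity r * ((D - 1) * (D - 2) + 2 * (D - 2) * (p - \<tau> r) * e1 r + (p - \<tau> r)\<^sup>2 * n2 r))
      = K0 * (\<Sum>r<d. velocity r) + K1 * (\<Sum>r<d. velocity r / \<tau> r) + K2 * (\<Sum>r<d. velocity r / (\<tau> r)\<^sup>2)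
       + K3 * (\<Sum>r<d. velocity r / (1 + \<tau> r)) + K4 * (\<Sum>r<d. velocity r / (1 + \<tau> r)\<^sup>2)"
    using expand by (simp add: sum_distrib_left flip: sum.distrib)
  also have "\<dots> = K1 / p + K3 / (p - \<mu>)" by (simp add: velocity_sum velocity_special_sums)
  also have "\<dots> = (D - 2) * N - 2 / 3 * N * (N - 1)
     + (D - 2) / 3 * (N * \<mu> + (D - 1) - 2 * N * (\<mu> + 1))
     + (D - 2) / 3 * (\<mu> + 1) * (D - 1 - N * (\<mu> + 1)) / (p - \<mu>)"
  proof -
    define w where "w = p - \<mu>"
    have w: "w \<noteq> 0" "p = w + \<mu>" using p by (auto simp: w_def)
    have "K1 / p = (D - 2) * N + (N * (D - 2) * p - 2 * N * (N - 1)) / 3"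
      using p unfolding K1_def by (simp add: field_simps)
    moreover have "K3 / (p - \<mu>) = (D - 2) / 3 * ((p + 1) * ((D - 1) - N * (p + 1))) / w"
      unfolding K3_def w_def by (simp add: field_simps)
    ultimately have "K1 / p + K3 / (p - \<mu>) = (D - 2) * N + (N * (D - 2) * p - 2 * N * (N - 1)) / 3
        + (D - 2) / 3 * ((p + 1) * ((D - 1) - N * (p + 1))) / w" by (simp only:)
    also have "\<dots> = (D - 2) * N - 2 / 3 * N * (N - 1)
     + (D - 2) / 3 * (N * \<mu> + (D - 1) - 2 * N * (\<mu> + 1))
     + (D - 2) / 3 * (\<mu> + 1) * (D - 1 - N * (\<mu> + 1)) / w"
      using w(1) unfolding w(2) by (simp add: field_simps)
    finally show ?thesis unfolding w_def .
  qed
  finally show ?thesis by (simp add: D_def N_def)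
qed

text \<open>The limit of the sum over triples as \<open>p\<close> tends to infinity.\<close>

definition constant_part where
  "constant_part = ((of_nat d - 2) * of_nat \<nu> - 2 / 3 * of_nat \<nu> * (of_nat \<nu> - 1)
     + (of_nat d - 2) / 3 * (of_nat \<nu> * \<mu> + (of_nat d - 1) - 2 * of_nat \<nu> * (\<mu> + 1))) / 2"

text \<open>Writing \<open>y\<^sub>s / (y\<^sub>s - y\<^sub>r) = 1 + y\<^sub>r / (\<tau>\<^sub>r - \<tau>\<^sub>s)\<close>, the sum over pairs of other roots is
  the square of a sum minus the sum of squares, thus a polynomial in \<open>e1\<close> and \<open>n2\<close>.\<close>

theorem interpolation_sum:
  "(\<Sum>(r, s, t) \<in> {(r, s, t). r < s \<and> s < t \<and> t < d}. f0 velocity (\<lambda>r. p - \<tau> r) r s t)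
    = constant_part + (of_nat d - 2) * (\<mu> + 1) * (of_nat d - 1 - of_nat \<nu> * (\<mu> + 1)) / (6 * (p - \<mu>))"
proof -
  define y where "y r = p - \<tau> r" for r
  define g where "g r s t = velocity r * ((y s / (y s - y r)) * (y t / (y t - y r)))" for r s t
  have g': "g r s t = velocity r * y s * y t / ((y r - y s) * (y r - y t))" for r s t
  proof -
    have "(y s - y r) * (y t - y r) = (y r - y s) * (y r - y t)" by (simp add: algebra_simps)
    then show ?thesis by (simp add: g_def)
  qed
  have "2 * (\<Sum>(r, s, t) \<in> {(r, s, t). r < s \<and> s < t \<and> t < d}. f0 velocity (\<lambda>r. p - \<tau> r) r s t)
      = 2 * (\<Sum>(r, s, t) \<in> {(r, s, t). r < s \<and> s < t \<and> t < d}. g r s t + g s t r + g t r s)"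
    unfolding f0_def y_def[symmetric] g' ..
  also have "\<dots> = (\<Sum>r<d. \<Sum>s\<in>{..<d} - {r}. \<Sum>t\<in>{..<d} - {r, s}. g r s t)"
    by (rule triples_sum) (simp add: g_def mult_ac)
  also have "\<dots> = (\<Sum>r<d. velocity r * ((of_nat d - 1) * (of_nat d - 2) + 2 * (of_nat d - 2) * (p - \<tau> r) * e1 r + (p - \<tau> r)\<^sup>2 * n2 r))"
  proof (rule sum.cong[OF refl])
    fix r assume "r \<in> {..<d}"
    then have r: "r < d" by simp
    define A where "A = {..<d} - {r}"
    define w where "w s = 1 / (\<tau> r - \<tau> s)" for s
    define z where "z s = 1 + y r * w s" for s
    have cA: "finite A" "of_nat (card A) = (of_nat d - 1 :: complex)" using r d by (auto simp: A_def of_nat_diff)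
    have z: "y s / (y s - y r) = z s" if "s \<in> A" for s
    proof -
      have "\<tau> r - \<tau> s \<noteq> 0" using that r inj by (auto simp: A_def inj_on_def)
      then show ?thesis by (simp add: z_def y_def w_def field_simps)
    qed
    have "(\<Sum>s\<in>{..<d} - {r}. \<Sum>t\<in>{..<d} - {r, s}. g r s t) = (\<Sum>s\<in>A. velocity r * (z s * ((\<Sum>t\<in>A. z t) - z s)))"
    proof (rule sum.cong)
      fix s assume s: "s \<in> A"
      have "{..<d} - {r, s} = A - {s}" by (auto simp: A_def)
      then have "(\<Sum>t\<in>{..<d} - {r, s}. g r s t) = (\<Sum>t\<in>A - {s}. velocity r * (z s * z t))"
        using z s by (auto simp: g_def intro!: sum.cong)
      also have "\<dots> = velocity r * (z s * (\<Sum>t\<in>A - {s}. z t))" by (simp add: sum_distrib_left)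
      also have "(\<Sum>t\<in>A - {s}. z t) = (\<Sum>t\<in>A. z t) - z s" using s cA by (simp add: sum_diff1)
      finally show "(\<Sum>t\<in>{..<d} - {r, s}. g r s t) = velocity r * (z s * ((\<Sum>t\<in>A. z t) - z s))" .
    qed (simp add: A_def)
    also have "\<dots> = velocity r * ((\<Sum>s\<in>A. z s)\<^sup>2 - (\<Sum>s\<in>A. (z s)\<^sup>2))"
      by (simp add: power2_eq_square sum_distrib_left sum_distrib_right sum_subtractf algebra_simps)
    also have "(\<Sum>s\<in>A. z s) = (of_nat d - 1) + y r * e1 r"
      using cA by (simp add: z_def e1_def sum.distrib sum_distrib_left A_def w_def)
    also have "(\<Sum>s\<in>A. (z s)\<^sup>2) = (of_nat d - 1) + 2 * y r * e1 r + (y r)\<^sup>2 * ((e1 r)\<^sup>2 - n2 r)"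
    proof -
      have "(\<Sum>s\<in>A. (z s)\<^sup>2) = (\<Sum>s\<in>A. 1 + 2 * y r * w s + (y r)\<^sup>2 * (1 / (\<tau> r - \<tau> s)\<^sup>2))"
        by (intro sum.cong) (auto simp: z_def w_def power2_eq_square algebra_simps)
      also have "\<dots> = (of_nat d - 1) + 2 * y r * (\<Sum>s\<in>A. w s) + (y r)\<^sup>2 * (\<Sum>s\<in>A. 1 / (\<tau> r - \<tau> s)\<^sup>2)"
        using cA by (simp add: sum.distrib sum_distrib_left)
      finally show ?thesis by (simp add: e1_def n2_def A_def w_def)
    qed
    also have "velocity r * (((of_nat d - 1) + y r * e1 r)\<^sup>2 - ((of_nat d - 1) + 2 * y r * e1 r + (y r)\<^sup>2 * ((e1 r)\<^sup>2 - n2 r)))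
        = velocity r * ((of_nat d - 1) * (of_nat d - 2) + 2 * (of_nat d - 2) * y r * e1 r + (y r)\<^sup>2 * n2 r)" by algebra
    finally show "(\<Sum>s\<in>{..<d} - {r}. \<Sum>t\<in>{..<d} - {r, s}. g r s t) =
        velocity r * ((of_nat d - 1) * (of_nat d - 2) + 2 * (of_nat d - 2) * (p - \<tau> r) * e1 r + (p - \<tau> r)\<^sup>2 * n2 r)"
      unfolding y_def .
  qed
  finally have sum2: "2 * (\<Sum>(r, s, t) \<in> {(r, s, t). r < s \<and> s < t \<and> t < d}. f0 velocity (\<lambda>r. p - \<tau> r) r s t) = \<dots>" .
  have "S = a / 2 + b * c * e / (6 * u)" if "2 * S = a + b / 3 * c * e / u" for S a b c e u :: complex
    using that by (cases "u = 0") (simp_all add: field_simps)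
  from this[OF sum2[unfolded velocity_weighted_sum]] show ?thesis
    unfolding constant_part_def .
qed

end

section \<open>The model foliations\<close>

text \<open>The normal form of both types. The two components are, up to the factor \<open>\<mu>\<close>, the parts of
  \<open>(x + y)\<^sup>d\<close> above and below the exponent \<open>\<nu>\<close>.\<close>

definition model :: "nat \<Rightarrow> nat \<Rightarrow> complex \<Rightarrow> complex^2 \<Rightarrow> complex^2" where
  "model d \<nu> \<mu> w = vector
     [\<mu> * (\<Sum>i=\<nu>+1..d. of_nat (d choose i) * w $ 1 ^ (d - i) * w $ 2 ^ i),
      \<Sum>i=0..\<nu>. of_nat (d choose i) * w $ 1 ^ (d - i) * w $ 2 ^ i]"

text \<open>The contraction of the model form at \<open>(x, y)\<close> with the vector \<open>(1, p)\<close>.\<close>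

definition direction_form :: "nat \<Rightarrow> nat \<Rightarrow> complex \<Rightarrow> complex \<Rightarrow> complex \<Rightarrow> complex \<Rightarrow> complex" where
  "direction_form d \<nu> \<mu> p x y = \<mu> * (\<Sum>i=\<nu>+1..d. of_nat (d choose i) * x ^ (d - i) * y ^ i)
     + p * (\<Sum>i=0..\<nu>. of_nat (d choose i) * x ^ (d - i) * y ^ i)"

lemma binomial_split:
  fixes x y :: complex
  assumes "\<nu> \<le> d"
  shows "(\<Sum>i=\<nu>+1..d. of_nat (d choose i) * x ^ (d - i) * y ^ i) + (\<Sum>i=0..\<nu>. of_nat (d choose i) * x ^ (d - i) * y ^ i)
    = (x + y) ^ d"
proof -
  have "(\<Sum>i=0..\<nu>. of_nat (d choose i) * x ^ (d - i) * y ^ i) + (\<Sum>i=\<nu>+1..d. of_nat (d choose i) * x ^ (d - i) * y ^ i)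
      = (\<Sum>i=0..d. of_nat (d choose i) * x ^ (d - i) * y ^ i)"
    using assms sum.ub_add_nat[of 0 \<nu> "\<lambda>i. of_nat (d choose i) * x ^ (d - i) * y ^ i" "d - \<nu>"] by simp
  also have "\<dots> = (y + x) ^ d" by (subst binomial_ring) (simp add: atMost_atLeast0 mult_ac)
  finally show ?thesis by (simp add: add.commute)
qed

lemma direction_form_poly:
  assumes "\<nu> \<le> d"
  shows "direction_form d \<nu> \<mu> p x (t * x) = x ^ d * poly (Fpoly d \<nu> \<mu> p) t"
proof -
  have Q: "(\<Sum>i=0..\<nu>. of_nat (d choose i) * x ^ (d - i) * (t * x) ^ i) = x ^ d * poly (Qpoly d \<nu>) t"
    unfolding Qpoly_def poly_sum sum_distrib_left atMost_atLeast0 poly_monom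
  proof (rule sum.cong[OF refl])
    fix i assume "i \<in> {0..\<nu>}"
    then have "x ^ d = x ^ (d - i) * x ^ i" using assms by (simp flip: power_add)
    then show "of_nat (d choose i) * x ^ (d - i) * (t * x) ^ i = x ^ d * (of_nat (d choose i) * t ^ i)"
      by (simp add: power_mult_distrib mult_ac)
  qed
  have "direction_form d \<nu> \<mu> p x (t * x) = \<mu> * (x + t * x) ^ d + (p - \<mu>) * (x ^ d * poly (Qpoly d \<nu>) t)"
    unfolding direction_form_def Q[symmetric] binomial_split[OF assms, symmetric] by (simp add: algebra_simps)
  also have "(x + t * x) ^ d = x ^ d * (1 + t) ^ d"
    unfolding power_mult_distrib[symmetric] by (simp add: distrib_left mult.commute)
  finally show ?thesis by (simp add: Fpoly_def poly_power distrib_left mult.left_commute mult.commute)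
qed

lemma legendre_model:
  assumes "d \<ge> 1" "\<nu> < d"
  shows "legendre_form (projective_form (model d \<nu> \<mu>)) m v
    = direction_form d \<nu> \<mu> (m $ 1) (v $ 2) (m $ 1 * v $ 2 - m $ 2 * v $ 1)"
proof (cases "v $ 1 = 0")
  case False
  then show ?thesis
    by (simp add: legendre_form_def Let_def projective_form_def model_def direction_form_def vector_3 divide_simps)
       (simp add: algebra_simps)
next
  case True
  show ?thesis
  proof (cases "v $ 2 = 0")
    case True
    have "(\<Sum>i=\<nu>+1..d. of_nat (d choose i) * 0 ^ (d - i) * 0 ^ i) = (0::complex)"
      "(\<Sum>i=0..\<nu>. of_nat (d choose i) * 0 ^ (d - i) * 0 ^ i) = (0::complex)"
      using assms by (auto intro!: sum.neutral simp: power_0_left)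
    then show ?thesis using True \<open>v $ 1 = 0\<close>
      by (simp add: legendre_form_def Let_def direction_form_def)
  next
    case False
    then show ?thesis using \<open>v $ 1 = 0\<close>
      by (simp add: legendre_form_def Let_def projective_form_def model_def direction_form_def vector_3 divide_simps)
         (simp add: algebra_simps)
  qed
qed

section \<open>Curvature of the model web\<close>

text \<open>Independence of the second coordinate, to first order at a point. This pointwise form is
  all that an exterior derivative sees and is available for roots known only as implicit
  functions.\<close>

definition second_free :: "(complex^2 \<Rightarrow> complex) \<Rightarrow> complex^2 \<Rightarrow> bool" where
  "second_free f m \<longleftrightarrow> (\<exists>a. (f has_derivative pairing (vector [a, 0])) (at m))"

lemma second_free_iff: "second_free f m \<longleftrightarrow> (\<exists>l. (f has_derivative pairing l) (at m) \<and> l $ 2 = 0)"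
proof -
  have "l = vector [l $ 1, 0]" if "l $ 2 = 0" for l :: "complex^2"
    using that by (simp add: vec_eq_iff forall_2)
  then show ?thesis unfolding second_free_def by (metis vector_2(2))
qed

lemma
  shows second_free_const: "second_free (\<lambda>m. c) m"
    and second_free_nth: "second_free (\<lambda>m. m $ 1) m"
    and second_free_add: "second_free f m \<Longrightarrow> second_free g m \<Longrightarrow> second_free (\<lambda>m. f m + g m) m"
    and second_free_diff: "second_free f m \<Longrightarrow> second_free g m \<Longrightarrow> second_free (\<lambda>m. f m - g m) m"
    and second_free_minus: "second_free f m \<Longrightarrow> second_free (\<lambda>m. - f m) m"
    and second_free_mult: "second_free f m \<Longrightarrow> second_free g m \<Longrightarrow> second_free (\<lambda>m. f m * g m) m"
    and second_free_divide: "second_free f m \<Longrightarrow> second_free g m \<Longrightarrow> g m \<noteq> 0 \<Longrightarrow> second_free (\<lambda>m. f m / g m) m"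
    and second_free_poly: "second_free f m \<Longrightarrow> second_free (\<lambda>m. poly q (f m)) m"
    and second_free_sum: "(\<And>i. i \<in> A \<Longrightarrow> second_free (h i) m) \<Longrightarrow> second_free (\<lambda>m. \<Sum>i\<in>A. h i m) m"
proof -
  show c: "second_free (\<lambda>m. c) m" for c
    unfolding second_free_iff using pairing_derivative_const by (intro exI[of _ 0]) auto
  show "second_free (\<lambda>m. m $ 1) m"
    unfolding second_free_iff using pairing_derivative_nth[of 1] by (intro exI[of _ "axis 1 1"]) (auto simp: axis_def)
  show add: "second_free f m \<Longrightarrow> second_free g m \<Longrightarrow> second_free (\<lambda>m. f m + g m) m" for f g
    unfolding second_free_iff by (elim exE conjE, intro exI conjI, erule (1) pairing_derivative_add) simp
  show "second_free f m \<Longrightarrow> second_free g m \<Longrightarrow> second_free (\<lambda>m. f m - g m) m"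
    unfolding second_free_iff by (elim exE conjE, intro exI conjI, erule (1) pairing_derivative_diff) simp
  show "second_free f m \<Longrightarrow> second_free (\<lambda>m. - f m) m"
    unfolding second_free_iff by (elim exE conjE, intro exI conjI, erule pairing_derivative_minus) simp
  show "second_free f m \<Longrightarrow> second_free g m \<Longrightarrow> second_free (\<lambda>m. f m * g m) m"
    unfolding second_free_iff by (elim exE conjE, intro exI conjI, erule (1) pairing_derivative_mult) simp
  show "second_free f m \<Longrightarrow> second_free g m \<Longrightarrow> g m \<noteq> 0 \<Longrightarrow> second_free (\<lambda>m. f m / g m) m"
    unfolding second_free_iff by (elim exE conjE, intro exI conjI, erule (2) pairing_derivative_divide) simp
  show "second_free f m \<Longrightarrow> second_free (\<lambda>m. poly q (f m)) m"
    unfolding second_free_iff by (elim exE conjE, intro exI conjI, erule pairing_derivative_chain, rule poly_DERIV) simp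
  show "(\<And>i. i \<in> A \<Longrightarrow> second_free (h i) m) \<Longrightarrow> second_free (\<lambda>m. \<Sum>i\<in>A. h i m) m"
    by (induction A rule: infinite_finite_induct) (auto intro: c add)
qed

text \<open>Together with \<open>f0\<close>, the coefficients of the interpolating quadratic polynomial in the
  variable \<open>y\<close>.\<close>

definition f1 where
  "f1 f y r s t = - (f r * (y s + y t) / ((y r - y s) * (y r - y t)) + f s * (y t + y r) / ((y s - y t) * (y s - y r))
     + f t * (y r + y s) / ((y t - y r) * (y t - y s)))" for f y :: "nat \<Rightarrow> complex"

definition f2 where
  "f2 f y r s t = f r / ((y r - y s) * (y r - y t)) + f s / ((y s - y t) * (y s - y r))
     + f t / ((y t - y r) * (y t - y s))" for f y :: "nat \<Rightarrow> complex"

lemma f_cyclic: "f0 f y s t r = f0 f y r s t" "f1 f y s t r = f1 f y r s t" "f2 f y s t r = f2 f y r s t"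
  by (simp_all add: f0_def f1_def f2_def add_ac)

lemma quadratic_interpolation:
  assumes "y r \<noteq> y s" "y s \<noteq> y t" "y t \<noteq> y r"
  shows "f r = f0 f y r s t + f1 f y r s t * y r + f2 f y r s t * (y r)\<^sup>2"
proof -
  define a b c where "a = 1 / (y r - y s)" and "b = 1 / (y s - y t)" and "c = 1 / (y t - y r)"
  have abc: "a * (y r - y s) = 1" "b * (y s - y t) = 1" "c * (y t - y r) = 1"
    using assms by (simp_all add: a_def b_def c_def)
  have inv: "1 / ((y r - y s) * (y r - y t)) = - a * c" "1 / ((y s - y t) * (y s - y r)) = - a * b"
    "1 / ((y t - y r) * (y t - y s)) = - b * c"
    using assms by (simp_all add: a_def b_def c_def divide_simps)
  have F0: "f0 f y r s t = - (f r * y s * y t * a * c + f s * y t * y r * a * b + f t * y r * y s * b * c)"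
    unfolding f0_def divide_inverse using inv by (simp add: divide_inverse mult_ac)
  have F1: "f1 f y r s t = f r * (y s + y t) * a * c + f s * (y t + y r) * a * b + f t * (y r + y s) * b * c"
    unfolding f1_def divide_inverse using inv by (simp add: divide_inverse mult_ac)
  have F2: "f2 f y r s t = - (f r * a * c + f s * a * b + f t * b * c)"
    unfolding f2_def divide_inverse using inv by (simp add: divide_inverse mult_ac)
  show ?thesis unfolding F0 F1 F2 using abc by algebra
qed

text \<open>The leaf through the line \<open>(p, q)\<close> belonging to the slope \<open>\<tau>\<close> has direction \<open>(dp, dq)\<close>
  with \<open>p x - q = \<tau> x\<close> and \<open>x = dq / dp\<close>.\<close>

definition model_theta :: "(nat \<Rightarrow> complex^2 \<Rightarrow> complex) \<Rightarrow> nat \<Rightarrow> complex^2 \<Rightarrow> complex^2" where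
  "model_theta \<tau> i m = vector [- m $ 2, m $ 1 - \<tau> i m]"

text \<open>Because the roots do not depend on \<open>q\<close>, the three equations for \<open>\<eta>\<close> become one equation
  for the velocity \<open>f\<close> as a function of \<open>y = p - \<tau>\<close>, which is solved by interpolating \<open>f\<close> by a
  quadratic polynomial. Only its constant term \<open>F0\<close> enters the component along \<open>dq\<close>.\<close>

lemma eta_equation_model:
  assumes \<tau>: "\<And>i. i \<in> {r, s, t} \<Longrightarrow> (\<tau> i has_derivative pairing (vector [f i, 0])) (at m)"
    and q: "m $ 2 \<noteq> 0"
    and y: "\<And>i. y i = m $ 1 - \<tau> i m"
    and int: "\<And>i. i \<in> {r, s, t} \<Longrightarrow> f i = F0 + F1 * y i + F2 * (y i)\<^sup>2"
  shows "eta_equation (model_theta \<tau>) r s t m (vector [- 2 * F1 - F2 * (y r + y s + y t), (3 - F0) / m $ 2])"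
proof -
  have t: "(\<tau> r has_derivative pairing (vector [f r, 0])) (at m)" "(\<tau> s has_derivative pairing (vector [f s, 0])) (at m)"
    "(\<tau> t has_derivative pairing (vector [f t, 0])) (at m)" using \<tau> by auto
  note P = pairing_derivative_nth[of 1 "at m"] and Q = pairing_derivative_nth[of 2 "at m"]
  have X: "(\<lambda>m. wedge (model_theta \<tau> s m) (model_theta \<tau> t m) *s model_theta \<tau> r m)
      = (\<lambda>m. vector [- (m $ 2 * m $ 2 * (\<tau> t m - \<tau> s m)), m $ 2 * (\<tau> t m - \<tau> s m) * (m $ 1 - \<tau> r m)])"
    by (simp add: fun_eq_iff vec_eq_iff forall_2 model_theta_def wedge_def algebra_simps)
  note d1 = pairing_derivative_minus[OF pairing_derivative_mult[OF pairing_derivative_mult[OF Q Q] pairing_derivative_diff[OF t(3,2)]]]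
  note d2 = pairing_derivative_mult[OF pairing_derivative_mult[OF Q pairing_derivative_diff[OF t(3,2)]] pairing_derivative_diff[OF P t(1)]]
  define z where "z = y s - y t"
  define h where "h = - 2 * F1 - F2 * (y r + y s + y t)"
  have z: "\<tau> t m - \<tau> s m = z" by (simp add: y z_def)
  have "ext_deriv (\<lambda>m. vector [- (m $ 2 * m $ 2 * (\<tau> t m - \<tau> s m)), m $ 2 * (\<tau> t m - \<tau> s m) * (m $ 1 - \<tau> r m)]) m
     = m $ 2 * ((f t - f s) * y r + (\<tau> t m - \<tau> s m) * (1 - f r)) + 2 * m $ 2 * (\<tau> t m - \<tau> s m)"
    by (subst ext_deriv_eq[of "\<lambda>m. vector [_ m, _ m]" , unfolded vector_2, OF d1 d2])
       (simp add: axis_def y algebra_simps)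
  also have "\<dots> = m $ 2 * ((f t - f s) * y r + z * (3 - f r))" unfolding z by algebra
  also have "(f t - f s) * y r + z * (3 - f r) = z * (h * y r + (3 - F0))"
  proof -
    have "f r = F0 + F1 * y r + F2 * (y r)\<^sup>2" "f s = F0 + F1 * y s + F2 * (y s)\<^sup>2" "f t = F0 + F1 * y t + F2 * (y t)\<^sup>2"
      using int by auto
    then show ?thesis unfolding z_def h_def by algebra
  qed
  also have "m $ 2 * (z * (h * y r + (3 - F0))) = wedge (vector [h, (3 - F0) / m $ 2]) (vector [- (m $ 2 * m $ 2 * z), m $ 2 * z * y r])"
    using q by (simp add: wedge_def field_simps)
  finally show ?thesis
    unfolding eta_equation_def X fun_cong[OF X, of m] y[of r, symmetric] z h_def .
qed

text \<open>In the total \<open>\<eta>\<close> the component along \<open>dp\<close> depends on \<open>p\<close> alone, and the component along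
  \<open>dq\<close> is \<open>1 / q\<close> times the function of \<open>p\<close> evaluated by \<open>interpolation_sum\<close>. The curvature is
  the derivative of the latter in \<open>p\<close>.\<close>

lemma model_curvature:
  fixes d \<nu> :: nat and \<mu> :: complex
  assumes d: "d \<ge> 3" "1 \<le> \<nu>" "\<nu> + 2 \<le> d" and \<mu>: "\<mu> \<noteq> 0"
    and U: "open U" "m \<in> U" and good: "\<And>x. x \<in> U \<Longrightarrow> x $ 1 \<noteq> 0 \<and> x $ 1 \<noteq> \<mu> \<and> x $ 2 \<noteq> 0"
    and hol: "\<And>i. i < d \<Longrightarrow> mholomorphic_on (\<tau> i) U"
    and inj: "\<And>x. x \<in> U \<Longrightarrow> inj_on (\<lambda>i. \<tau> i x) {..<d}"
    and root: "\<And>i x. i < d \<Longrightarrow> x \<in> U \<Longrightarrow> poly (Fpoly d \<nu> \<mu> (x $ 1)) (\<tau> i x) = 0"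
  shows "web_curvature d (model_theta \<tau>) m
    = (of_nat d - 2) * (\<mu> + 1) * (of_nat d - 1 - of_nat \<nu> * (\<mu> + 1)) / (6 * m $ 2 * (m $ 1 - \<mu>)\<^sup>2)"
proof -
  define f where "f i x = - poly (Qpoly d \<nu>) (\<tau> i x) / poly (pderiv (Fpoly d \<nu> \<mu> (x $ 1))) (\<tau> i x)" for i x
  define y where "y i x = x $ 1 - \<tau> i x" for i x
  have rs: "root_system d \<nu> \<mu> (x $ 1) (\<lambda>i. \<tau> i x)" if "x \<in> U" for x
    using d \<mu> good[OF that] inj[OF that] root that by unfold_locales auto
  have f_vel: "f i x = root_system.velocity d \<nu> \<mu> (x $ 1) (\<lambda>i. \<tau> i x) i" if "x \<in> U" for i x
    by (simp add: f_def root_system.velocity_def[OF rs[OF that]])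
  have F'0: "poly (pderiv (Fpoly d \<nu> \<mu> (x $ 1))) (\<tau> i x) \<noteq> 0" if "i < d" "x \<in> U" for i x
    using root_system.pderiv_F_root_nonzero[OF rs[OF that(2)] that(1)] .
  have der: "(\<tau> i has_derivative pairing (vector [f i x, 0])) (at x)" if i: "i < d" and x: "x \<in> U" for i x
  proof -
    define l where "l = gradient (\<tau> i) x"
    have l: "(\<tau> i has_derivative pairing l) (at x)"
      unfolding l_def by (rule mholomorphic_has_gradient[OF hol[OF i] U(1) x])
    note A = pairing_derivative_chain[OF l poly_DERIV]
    have "((\<lambda>x. \<mu> * poly ([:1, 1:] ^ d) (\<tau> i x) + (x $ 1 - \<mu>) * poly (Qpoly d \<nu>) (\<tau> i x)) has_derivative
        pairing ((\<mu> *s (poly (pderiv ([:1, 1:] ^ d)) (\<tau> i x) *s l) + poly ([:1, 1:] ^ d) (\<tau> i x) *s 0) +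
        ((x $ 1 - \<mu>) *s (poly (pderiv (Qpoly d \<nu>)) (\<tau> i x) *s l) + poly (Qpoly d \<nu>) (\<tau> i x) *s (axis 1 1 - 0)))) (at x)"
      by (intro pairing_derivative_add pairing_derivative_mult pairing_derivative_diff pairing_derivative_const
          pairing_derivative_nth A)
    moreover have "((\<lambda>x. \<mu> * poly ([:1, 1:] ^ d) (\<tau> i x) + (x $ 1 - \<mu>) * poly (Qpoly d \<nu>) (\<tau> i x)) has_derivative pairing 0) (at x)"
    proof (rule has_derivative_transform_within_open[OF pairing_derivative_const[of 0] U(1) x])
      fix z assume "z \<in> U"
      then show "0 = \<mu> * poly ([:1, 1:] ^ d) (\<tau> i z) + (z $ 1 - \<mu>) * poly (Qpoly d \<nu>) (\<tau> i z)"
        using root[OF i, of z] by (simp add: Fpoly_def)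
    qed
    ultimately have "(\<mu> *s (poly (pderiv ([:1, 1:] ^ d)) (\<tau> i x) *s l) + poly ([:1, 1:] ^ d) (\<tau> i x) *s 0) +
        ((x $ 1 - \<mu>) *s (poly (pderiv (Qpoly d \<nu>)) (\<tau> i x) *s l) + poly (Qpoly d \<nu>) (\<tau> i x) *s (axis 1 1 - 0)) = 0"
      by (rule trans[OF sym[OF gradient_eqI] gradient_eqI])
    then have "poly (pderiv (Fpoly d \<nu> \<mu> (x $ 1))) (\<tau> i x) *s l + poly (Qpoly d \<nu>) (\<tau> i x) *s axis 1 1 = 0"
      by (simp add: Fpoly_def pderiv_add pderiv_smult vec_eq_iff algebra_simps)
    then have "l = vector [f i x, 0]"
      using F'0[OF i x] by (simp add: vec_eq_iff forall_2 f_def axis_def field_simps add_eq_0_iff)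
    then show ?thesis using l by simp
  qed
  have ydist: "y i x \<noteq> y j x" if "x \<in> U" "i < d" "j < d" "i \<noteq> j" for x i j
    using inj[OF that(1)] that by (auto simp: y_def inj_on_def)
  define G where "G x = (\<Sum>(r, s, t) \<in> triples d. - 2 * f1 (\<lambda>i. f i x) (\<lambda>i. y i x) r s t
     - f2 (\<lambda>i. f i x) (\<lambda>i. y i x) r s t * (y r x + y s x + y t x))" for x
  define c0 where "c0 = 3 * of_nat (card (triples d)) - root_system.constant_part d \<nu> \<mu>"
  define c1 where "c1 = (of_nat d - 2) * (\<mu> + 1) * (of_nat d - 1 - of_nat \<nu> * (\<mu> + 1)) / 6"
  have eta: "web_eta (model_theta \<tau>) r s t x = vector [- 2 * f1 (\<lambda>i. f i x) (\<lambda>i. y i x) r s t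
     - f2 (\<lambda>i. f i x) (\<lambda>i. y i x) r s t * (y r x + y s x + y t x), (3 - f0 (\<lambda>i. f i x) (\<lambda>i. y i x) r s t) / x $ 2]"
    if x: "x \<in> U" and rst: "(r, s, t) \<in> triples d" for r s t x
  proof -
    have lt: "r < d" "s < d" "t < d" "r \<noteq> s" "s \<noteq> t" "t \<noteq> r" using rst by (auto simp: triples_def)
    have w: "wedge (model_theta \<tau> i x) (model_theta \<tau> j x) \<noteq> 0" if "i < d" "j < d" "i \<noteq> j" for i j
    proof -
      have "wedge (model_theta \<tau> i x) (model_theta \<tau> j x) = x $ 2 * (y i x - y j x)"
        by (simp add: wedge_def model_theta_def y_def algebra_simps)
      then show ?thesis using good[OF x] ydist[OF x that] by simp
    qed
    have yd: "y r x \<noteq> y s x" "y s x \<noteq> y t x" "y t x \<noteq> y r x" using ydist[OF x] lt by auto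
    have int: "f i x = f0 (\<lambda>i. f i x) (\<lambda>i. y i x) r s t + f1 (\<lambda>i. f i x) (\<lambda>i. y i x) r s t * y i x
        + f2 (\<lambda>i. f i x) (\<lambda>i. y i x) r s t * (y i x)\<^sup>2" if "i \<in> {r, s, t}" for i
      using that quadratic_interpolation[of "\<lambda>i. y i x" r s t "\<lambda>i. f i x", OF yd]
        quadratic_interpolation[of "\<lambda>i. y i x" s t r "\<lambda>i. f i x", OF yd(2,3,1)]
        quadratic_interpolation[of "\<lambda>i. y i x" t r s "\<lambda>i. f i x", OF yd(3,1,2)]
      by (auto simp: f_cyclic)
    have q: "x $ 2 \<noteq> 0" using good[OF x] by simp
    have E: "eta_equation (model_theta \<tau>) a b c x (vector [- 2 * f1 (\<lambda>i. f i x) (\<lambda>i. y i x) r s t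
     - f2 (\<lambda>i. f i x) (\<lambda>i. y i x) r s t * (y a x + y b x + y c x), (3 - f0 (\<lambda>i. f i x) (\<lambda>i. y i x) r s t) / x $ 2])"
      if "{a, b, c} = {r, s, t}" for a b c
    proof (rule eta_equation_model[where f="\<lambda>i. f i x" and y="\<lambda>i. y i x" and m=x and \<tau>=\<tau>])
      fix i assume "i \<in> {a, b, c}"
      then have i: "i \<in> {r, s, t}" using that by simp
      then have "i < d" using lt by auto
      then show "(\<tau> i has_derivative pairing (vector [f i x, 0])) (at x)" by (rule der[OF _ x])
      show "f i x = f0 (\<lambda>i. f i x) (\<lambda>i. y i x) r s t + f1 (\<lambda>i. f i x) (\<lambda>i. y i x) r s t * y i x
        + f2 (\<lambda>i. f i x) (\<lambda>i. y i x) r s t * (y i x)\<^sup>2" by (rule int[OF i])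
    qed (simp_all add: q y_def)
    have E': "eta_equation (model_theta \<tau>) a b c x (vector [- 2 * f1 (\<lambda>i. f i x) (\<lambda>i. y i x) r s t
     - f2 (\<lambda>i. f i x) (\<lambda>i. y i x) r s t * (y r x + y s x + y t x), (3 - f0 (\<lambda>i. f i x) (\<lambda>i. y i x) r s t) / x $ 2])"
      if "{a, b, c} = {r, s, t}" "y a x + y b x + y c x = y r x + y s x + y t x" for a b c
      using E[OF that(1)] unfolding that(2) .
    show ?thesis
      by (intro web_eta_eqI w lt E') auto
  qed
  have total: "(\<Sum>(r, s, t) \<in> triples d. web_eta (model_theta \<tau>) r s t x) = vector [G x, (c0 - c1 / (x $ 1 - \<mu>)) / x $ 2]"
    if x: "x \<in> U" for x
  proof -
    have v: "(\<Sum>z\<in>A. vector [a z, b z]) = (vector [\<Sum>z\<in>A. a z, \<Sum>z\<in>A. b z] :: complex^2)"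
      for A :: "(nat \<times> nat \<times> nat) set" and a b :: "_ \<Rightarrow> complex"
      by (simp add: vec_eq_iff forall_2 sum_component)
    have "(\<Sum>(r, s, t) \<in> triples d. (3 - f0 (\<lambda>i. f i x) (\<lambda>i. y i x) r s t) / x $ 2)
      = (\<Sum>(r, s, t) \<in> triples d. 3 - f0 (\<lambda>i. f i x) (\<lambda>i. y i x) r s t) / x $ 2"
      by (simp add: sum_divide_distrib split_beta)
    also have "(\<Sum>(r, s, t) \<in> triples d. 3 - f0 (\<lambda>i. f i x) (\<lambda>i. y i x) r s t)
        = 3 * of_nat (card (triples d)) - (\<Sum>(r, s, t) \<in> triples d. f0 (\<lambda>i. f i x) (\<lambda>i. y i x) r s t)"
      by (simp add: sum_subtractf split_beta)
    also have "(\<Sum>(r, s, t) \<in> triples d. f0 (\<lambda>i. f i x) (\<lambda>i. y i x) r s t)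
        = root_system.constant_part d \<nu> \<mu> + c1 / (x $ 1 - \<mu>)"
      using root_system.interpolation_sum[OF rs[OF x]] unfolding triples_def
      by (simp add: f_vel[OF x] y_def c1_def)
    finally have 2: "(\<Sum>(r, s, t) \<in> triples d. (3 - f0 (\<lambda>i. f i x) (\<lambda>i. y i x) r s t) / x $ 2) = (c0 - c1 / (x $ 1 - \<mu>)) / x $ 2"
      by (simp add: c0_def)
    have "(\<Sum>(r, s, t) \<in> triples d. web_eta (model_theta \<tau>) r s t x)
      = (\<Sum>z \<in> triples d. vector [case z of (r, s, t) \<Rightarrow> - 2 * f1 (\<lambda>i. f i x) (\<lambda>i. y i x) r s t
     - f2 (\<lambda>i. f i x) (\<lambda>i. y i x) r s t * (y r x + y s x + y t x),
       case z of (r, s, t) \<Rightarrow> (3 - f0 (\<lambda>i. f i x) (\<lambda>i. y i x) r s t) / x $ 2])"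
      using eta[OF x] by (intro sum.cong) auto
    then show ?thesis unfolding v G_def 2 .
  qed
  have "second_free G m"
  proof -
    have t: "second_free (\<tau> i) m" if "i < d" for i
      unfolding second_free_def using der[OF that U(2)] by blast
    have yf: "second_free (y i) m" if "i < d" for i
      unfolding y_def by (intro second_free_diff second_free_nth t that)
    have ff: "second_free (f i) m" if "i < d" for i
    proof -
      have "f i = (\<lambda>x. - poly (Qpoly d \<nu>) (\<tau> i x) / (\<mu> * poly (pderiv ([:1, 1:] ^ d)) (\<tau> i x) + (x $ 1 - \<mu>) * poly (pderiv (Qpoly d \<nu>)) (\<tau> i x)))"
        by (simp add: f_def Fpoly_def pderiv_add pderiv_smult fun_eq_iff)
      moreover have "second_free \<dots> m"
        by (intro second_free_divide second_free_minus second_free_add second_free_mult second_free_poly second_free_diff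
            second_free_nth second_free_const t that)
           (use F'0[OF that U(2)] in \<open>simp add: Fpoly_def pderiv_add pderiv_smult\<close>)
      ultimately show ?thesis by simp
    qed
    show ?thesis
      unfolding G_def split_beta f1_def f2_def
    proof (rule second_free_sum)
      fix z assume z: "z \<in> triples d"
      then have lt: "fst z < d" "fst (snd z) < d" "snd (snd z) < d" "fst z \<noteq> fst (snd z)" "fst (snd z) \<noteq> snd (snd z)" "snd (snd z) \<noteq> fst z"
        by (auto simp: triples_def)
      show "second_free (\<lambda>x. - 2 * - (f (fst z) x * (y (fst (snd z)) x + y (snd (snd z)) x) /
           ((y (fst z) x - y (fst (snd z)) x) * (y (fst z) x - y (snd (snd z)) x)) +
           f (fst (snd z)) x * (y (snd (snd z)) x + y (fst z) x) /
           ((y (fst (snd z)) x - y (snd (snd z)) x) * (y (fst (snd z)) x - y (fst z) x)) +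
           f (snd (snd z)) x * (y (fst z) x + y (fst (snd z)) x) /
           ((y (snd (snd z)) x - y (fst z) x) * (y (snd (snd z)) x - y (fst (snd z)) x))) -
          (f (fst z) x / ((y (fst z) x - y (fst (snd z)) x) * (y (fst z) x - y (snd (snd z)) x)) +
           f (fst (snd z)) x / ((y (fst (snd z)) x - y (snd (snd z)) x) * (y (fst (snd z)) x - y (fst z) x)) +
           f (snd (snd z)) x / ((y (snd (snd z)) x - y (fst z) x) * (y (snd (snd z)) x - y (fst (snd z)) x))) *
          (y (fst z) x + y (fst (snd z)) x + y (snd (snd z)) x)) m"
        by (intro second_free_divide second_free_minus second_free_add second_free_mult second_free_diff
            second_free_const ff yf lt)
           (use ydist[OF U(2)] lt in auto)
    qed
  qed
  then obtain a where a: "(G has_derivative pairing (vector [a, 0])) (at m)" unfolding second_free_def by blast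
  have m: "m $ 1 \<noteq> \<mu>" "m $ 2 \<noteq> 0" using good[OF U(2)] by auto
  note P = pairing_derivative_nth[of 1 "at m"] and Q = pairing_derivative_nth[of 2 "at m"]
  have b: "((\<lambda>x. (c0 - c1 / (x $ 1 - \<mu>)) / x $ 2) has_derivative
      pairing (vector [c1 / ((m $ 1 - \<mu>)\<^sup>2 * m $ 2), - ((c0 - c1 / (m $ 1 - \<mu>)) / (m $ 2)\<^sup>2)])) (at m)"
  proof -
    have "((\<lambda>x. (c0 - c1 / (x $ 1 - \<mu>)) / x $ 2) has_derivative pairing ((1 / m $ 2) *s
         (0 - (1 / (m $ 1 - \<mu>) *s 0 - c1 / (m $ 1 - \<mu>)\<^sup>2 *s (axis 1 1 - 0))) -
         (c0 - c1 / (m $ 1 - \<mu>)) / (m $ 2)\<^sup>2 *s axis 2 1 :: complex^2)) (at m)"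
      by (intro pairing_derivative_divide pairing_derivative_diff pairing_derivative_const P Q) (use m in auto)
    moreover have "(1 / m $ 2) *s (0 - (1 / (m $ 1 - \<mu>) *s 0 - c1 / (m $ 1 - \<mu>)\<^sup>2 *s (axis 1 1 - 0))) -
         (c0 - c1 / (m $ 1 - \<mu>)) / (m $ 2)\<^sup>2 *s (axis 2 1 :: complex^2)
       = vector [c1 / ((m $ 1 - \<mu>)\<^sup>2 * m $ 2), - ((c0 - c1 / (m $ 1 - \<mu>)) / (m $ 2)\<^sup>2)]"
      by (simp add: vec_eq_iff forall_2 axis_def)
    ultimately show ?thesis by simp
  qed
  have "web_curvature d (model_theta \<tau>) m = ext_deriv (\<lambda>x. vector [G x, (c0 - c1 / (x $ 1 - \<mu>)) / x $ 2]) m"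
    unfolding web_curvature_triples by (rule ext_deriv_cong[OF U total])
  also have "\<dots> = c1 / ((m $ 1 - \<mu>)\<^sup>2 * m $ 2)"
    by (subst ext_deriv_eq[of "\<lambda>x. vector [_ x, _ x]", unfolded vector_2, OF a b]) simp
  finally show ?thesis by (simp add: c1_def mult_ac)
qed

section \<open>The Legendre transform under a change of linear coordinates\<close>

text \<open>The cross product. It meets two lines of the projective plane in a point, and joins two
  points by a line.\<close>

definition ccross :: "complex^3 \<Rightarrow> complex^3 \<Rightarrow> complex^3" where
  "ccross a b = vector [a $ 2 * b $ 3 - a $ 3 * b $ 2, a $ 3 * b $ 1 - a $ 1 * b $ 3, a $ 1 * b $ 2 - a $ 2 * b $ 1]"

text \<open>Coordinates of the line \<open>y = p x - q\<close> in the dual plane, and below their differential.\<close>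

definition line_coords :: "complex^2 \<Rightarrow> complex^3" where
  "line_coords m = vector [m $ 1, -1, - m $ 2]"

definition line_tangent :: "complex^2 \<Rightarrow> complex^3" where
  "line_tangent v = vector [v $ 1, 0, - v $ 2]"

lemma ccross_simps:
  "ccross (c *s a) b = c *s ccross a b" "ccross a (c *s b) = c *s ccross a b"
  "ccross a (b + b') = ccross a b + ccross a b'" "ccross a a = 0"
  by (simp_all add: ccross_def vec_eq_iff forall_3 algebra_simps)

lemma contact_point: "ccross (line_coords m) (line_tangent v) = vector [v $ 2, m $ 1 * v $ 2 - m $ 2 * v $ 1, v $ 1]"
  by (simp add: ccross_def line_coords_def line_tangent_def vec_eq_iff forall_3)

lemma contact_point_nonzero: "v \<noteq> 0 \<Longrightarrow> ccross (line_coords m) (line_tangent v) \<noteq> 0"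
  unfolding contact_point by (auto simp: vec_eq_iff forall_2 forall_3)

text \<open>A description of the Legendre form free of coordinates: the tangent direction \<open>v\<close> at the
  line singles out a point \<open>P\<close> of it, the tangent \<open>\<omega> P\<close> of the foliation at \<open>P\<close> is a second line
  through \<open>P\<close>, and the intersection of both lines is a multiple of \<open>P\<close>, the factor being the
  value of the form.\<close>

lemma legendre_form_cross:
  assumes \<omega>: "\<And>x. pairing x (\<omega> x) = 0" and v0: "v \<noteq> 0"
    and P_def: "P = ccross (line_coords m) (line_tangent v)"
  shows "ccross (line_coords m) (\<omega> P) = legendre_form \<omega> m v *s P"
proof -
  obtain p q where m: "m $ 1 = p" "m $ 2 = q" by simp
  obtain dp dq where v: "v $ 1 = dp" "v $ 2 = dq" by simp
  have v0': "dp \<noteq> 0 \<or> dq \<noteq> 0" using v0 v by (auto simp: vec_eq_iff forall_2)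
  define a where "a = \<omega> P"
  have P: "P = vector [dq, p * dq - q * dp, dp]" unfolding P_def contact_point m v ..
  have z: "dq * a $ 1 + (p * dq - q * dp) * a $ 2 + dp * a $ 3 = 0"
    using \<omega>[of P] unfolding a_def[symmetric] by (simp add: pairing_def sum_3 P)
  have L: "legendre_form \<omega> m v = (if dp \<noteq> 0 then (a $ 1 + p * a $ 2) / dp else (q * a $ 2 - a $ 3) / dq)"
    by (simp add: legendre_form_def Let_def m v a_def P)
  have AB: "a $ 1 + p * a $ 2 = legendre_form \<omega> m v * dp \<and> q * a $ 2 - a $ 3 = legendre_form \<omega> m v * dq"
  proof (cases "dp = 0")
    case True
    then have "dq \<noteq> 0" using v0' by simp
    have "dq * (a $ 1 + p * a $ 2) = 0" using z True by algebra
    then have "a $ 1 + p * a $ 2 = 0" using \<open>dq \<noteq> 0\<close> by simp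
    then show ?thesis using True \<open>dq \<noteq> 0\<close> by (simp add: L)
  next
    case False
    have "(a $ 1 + p * a $ 2) * dq = (q * a $ 2 - a $ 3) * dp" using z by algebra
    then show ?thesis using False by (simp add: L field_simps)
  qed
  then have "- q * a $ 1 - p * a $ 3 = legendre_form \<omega> m v * (p * dq - q * dp)" by algebra
  then show ?thesis
    using AB unfolding a_def[symmetric] unfolding P
    by (simp add: ccross_def line_coords_def m vec_eq_iff forall_3 add.commute)
qed

lemma cross_transpose:
  "M *v ccross (transpose M *v a) (transpose M *v b) = det M *s ccross a b"
  by (simp add: ccross_def matrix_vector_mult_def transpose_def sum_3 det_3 vec_eq_iff forall_3 algebra_simps)

lemma matrix_scale: "M *v (c *s x) = c *s (M *v (x :: complex^'n))" for M :: "complex^'n^'m"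
  by (simp add: matrix_vector_mult_def vec_eq_iff sum_distrib_left mult_ac)

lemma pairing_pullback: "pairing x (pullback M \<omega> x) = pairing (M *v x) (\<omega> (M *v x))"
proof -
  have "pairing x (transpose M *v y) = pairing (M *v x) y" for y
    by (simp add: pairing_def matrix_vector_mult_def transpose_def sum_3 algebra_simps)
  then show ?thesis by (simp add: pullback_def)
qed

text \<open>The cross product transforms by the determinant (\<open>cross_transpose\<close>), so
  \<open>legendre_form_cross\<close> compares the Legendre forms in two charts. The factor \<open>\<rho>\<close> is the ratio
  of the two normalisations of the coordinates of a line, and a multiple of the line may be
  added to its tangent vector without moving \<open>P\<close>.\<close>

lemma legendre_form_chart:
  assumes \<omega>: "\<And>x. pairing x (\<omega> x) = 0" and hom: "\<And>c x. \<omega> (c *s x) = c ^ n *s \<omega> x"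
    and M: "invertible M"
    and L: "transpose M *v line_coords m = \<rho> *s line_coords m'"
    and V: "transpose M *v line_tangent v = \<rho> *s line_tangent v' + \<sigma> *s line_coords m'"
    and nz: "\<rho> \<noteq> 0" "v \<noteq> 0" "v' \<noteq> 0"
  shows "\<rho> ^ (2 * n + 1) * legendre_form (pullback M \<omega>) m' v' = det M ^ n * \<rho>\<^sup>2 * legendre_form \<omega> m v"
proof -
  define P where "P = ccross (line_coords m) (line_tangent v)"
  define P' where "P' = ccross (line_coords m') (line_tangent v')"
  have "ccross (transpose M *v line_coords m) (transpose M *v line_tangent v) = \<rho>\<^sup>2 *s P'"
    unfolding L V by (simp add: ccross_simps P'_def power2_eq_square)
  then have MP: "M *v (\<rho>\<^sup>2 *s P') = det M *s P"
    using cross_transpose[of M "line_coords m" "line_tangent v"] by (simp add: P_def)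
  have pz: "pairing x (pullback M \<omega> x) = 0" for x by (simp add: pairing_pullback \<omega>)
  have ph: "pullback M \<omega> (c *s x) = c ^ n *s pullback M \<omega> x" for c x
    by (simp add: pullback_def matrix_scale hom)
  have "pullback M \<omega> (\<rho>\<^sup>2 *s P') = det M ^ n *s (transpose M *v \<omega> P)"
    unfolding pullback_def MP unfolding hom matrix_scale ..
  then have "\<rho> ^ (2 * n) *s pullback M \<omega> P' = det M ^ n *s (transpose M *v \<omega> P)"
    by (simp add: ph power_mult)
  then have "ccross (transpose M *v line_coords m) (\<rho> ^ (2 * n) *s pullback M \<omega> P')
    = det M ^ n *s ccross (transpose M *v line_coords m) (transpose M *v \<omega> P)"
    by (simp only: ccross_simps)
  moreover have "ccross (transpose M *v line_coords m) (\<rho> ^ (2 * n) *s pullback M \<omega> P')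
    = (\<rho> ^ (2 * n + 1) * legendre_form (pullback M \<omega>) m' v') *s P'"
    using legendre_form_cross[of "pullback M \<omega>", OF pz nz(3) P'_def]
    unfolding L by (simp add: ccross_simps vec_eq_iff mult_ac)
  ultimately have 1: "(\<rho> ^ (2 * n + 1) * legendre_form (pullback M \<omega>) m' v') *s (M *v P')
    = det M ^ n *s (M *v ccross (transpose M *v line_coords m) (transpose M *v \<omega> P))"
    by (metis matrix_scale)
  also have "\<dots> = (det M ^ n * legendre_form \<omega> m v) *s (det M *s P)"
    unfolding cross_transpose legendre_form_cross[of \<omega>, OF \<omega> nz(2) P_def] by (simp add: vec_eq_iff mult_ac)
  also have "\<dots> = (det M ^ n * \<rho>\<^sup>2 * legendre_form \<omega> m v) *s (M *v P')"
    unfolding MP[symmetric] matrix_scale by (simp add: vec_eq_iff mult_ac)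
  finally have "(\<rho> ^ (2 * n + 1) * legendre_form (pullback M \<omega>) m' v' - det M ^ n * \<rho>\<^sup>2 * legendre_form \<omega> m v) *s (M *v P') = 0"
    by (simp add: vec_eq_iff algebra_simps)
  moreover have "M *v P' \<noteq> 0"
    using M contact_point_nonzero[OF nz(3)] unfolding P'_def
    by (metis invertible_eq_bij bij_is_inj injD matrix_vector_mult_0_right)
  ultimately show ?thesis by simp
qed

text \<open>The change of charts \<open>(p, q) \<mapsto> (p', q')\<close> of the dual plane induced by the linear
  coordinates \<open>M\<close>; it is defined where the line is not vertical in the new chart.\<close>

definition chart_map :: "complex^3^3 \<Rightarrow> complex^2 \<Rightarrow> complex^2" where
  "chart_map M m = (let L = transpose M *v line_coords m in vector [- L $ 1 / L $ 2, L $ 3 / L $ 2])"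

lemma line_coords_chart_map:
  assumes "(transpose M *v line_coords m) $ 2 \<noteq> 0"
  shows "transpose M *v line_coords m = (- (transpose M *v line_coords m) $ 2) *s line_coords (chart_map M m)"
  using assms by (simp add: chart_map_def Let_def line_coords_def vec_eq_iff forall_3)

lemma chart_map_unique: "c \<noteq> 0 \<Longrightarrow> transpose M *v line_coords m = c *s line_coords m' \<Longrightarrow> chart_map M m = m'"
  by (simp add: chart_map_def Let_def line_coords_def vec_eq_iff forall_2)

lemma chart_line_derivative:
  "((\<lambda>m. (transpose M *v line_coords m) $ i) has_derivative pairing (vector [M $ 1 $ i, - M $ 3 $ i])) F"
proof -
  have "(\<lambda>m. (transpose M *v line_coords m) $ i) = (\<lambda>m. pairing (vector [M $ 1 $ i, - M $ 3 $ i]) m + (- M $ 2 $ i))"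
    by (simp add: fun_eq_iff matrix_vector_mult_def transpose_def sum_3 line_coords_def pairing_def sum_2)
  then show ?thesis
    using pairing_derivative_add[OF pairing_derivative_pairing[of "vector [M $ 1 $ i, - M $ 3 $ i]"]
        pairing_derivative_const[of "- M $ 2 $ i"]] by simp
qed

lemma chart_map_derivatives:
  assumes "(transpose M *v line_coords m) $ 2 \<noteq> 0"
  defines "L \<equiv> transpose M *v line_coords m" and "k \<equiv> \<lambda>i. vector [M $ 1 $ i, - M $ 3 $ i] :: complex^2"
  shows "((\<lambda>m. chart_map M m $ 1) has_derivative pairing ((1 / L $ 2) *s (- k 1) - (- L $ 1 / (L $ 2)\<^sup>2) *s k 2)) (at m)"
    and "((\<lambda>m. chart_map M m $ 2) has_derivative pairing ((1 / L $ 2) *s k 3 - (L $ 3 / (L $ 2)\<^sup>2) *s k 2)) (at m)"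
  unfolding chart_map_def Let_def vector_2 L_def k_def
  by (intro pairing_derivative_divide pairing_derivative_minus chart_line_derivative assms(1))+

lemma chart_map_jacobian:
  assumes "(transpose M *v line_coords m) $ 2 \<noteq> 0"
  shows "pull_jacobian (chart_map M) m = - det M / ((transpose M *v line_coords m) $ 2) ^ 3"
proof -
  define L where "L = transpose M *v line_coords m"
  define k :: "3 \<Rightarrow> complex^2" where "k i = vector [M $ 1 $ i, - M $ 3 $ i]" for i
  have L2: "L $ 2 \<noteq> 0" using assms by (simp add: L_def)
  have "pull_jacobian (chart_map M) m = wedge ((1 / L $ 2) *s (- k 1) - (- L $ 1 / (L $ 2)\<^sup>2) *s k 2) ((1 / L $ 2) *s k 3 - (L $ 3 / (L $ 2)\<^sup>2) *s k 2)"
    unfolding pull_jacobian_def gradient_eqI[OF chart_map_derivatives(1)[OF assms]] gradient_eqI[OF chart_map_derivatives(2)[OF assms]]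
    by (simp add: L_def k_def)
  also have "\<dots> = (L $ 1 * wedge (k 2) (k 3) - L $ 2 * wedge (k 1) (k 3) + L $ 3 * wedge (k 1) (k 2)) / L $ 2 ^ 3"
    using L2 by (simp add: wedge_simps field_simps power2_eq_square power3_eq_cube)
  also have "L $ 1 * wedge (k 2) (k 3) - L $ 2 * wedge (k 1) (k 3) + L $ 3 * wedge (k 1) (k 2) = - det M"
    by (simp add: L_def k_def wedge_def det_3 matrix_vector_mult_def transpose_def sum_3 line_coords_def algebra_simps)
  finally show ?thesis by (simp add: L_def)
qed

lemma line_tangent_chart_map:
  assumes "(transpose M *v line_coords m) $ 2 \<noteq> 0"
  shows "transpose M *v line_tangent v = (- (transpose M *v line_coords m) $ 2) *s
      line_tangent (vector [pairing (gradient (\<lambda>m. chart_map M m $ 1) m) v, pairing (gradient (\<lambda>m. chart_map M m $ 2) m) v])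
     + (- (transpose M *v line_tangent v) $ 2) *s line_coords (chart_map M m)"
proof -
  define L where "L = transpose M *v line_coords m"
  define k :: "3 \<Rightarrow> complex^2" where "k i = vector [M $ 1 $ i, - M $ 3 $ i]" for i
  have L2: "L $ 2 \<noteq> 0" using assms by (simp add: L_def)
  have V: "(transpose M *v line_tangent v) $ i = pairing (k i) v" for i
    by (simp add: matrix_vector_mult_def transpose_def sum_3 line_tangent_def pairing_def sum_2 k_def)
  have g: "gradient (\<lambda>m. chart_map M m $ 1) m = (1 / L $ 2) *s (- k 1) - (- L $ 1 / (L $ 2)\<^sup>2) *s k 2"
    "gradient (\<lambda>m. chart_map M m $ 2) m = (1 / L $ 2) *s k 3 - (L $ 3 / (L $ 2)\<^sup>2) *s k 2"
    using gradient_eqI[OF chart_map_derivatives(1)[OF assms]] gradient_eqI[OF chart_map_derivatives(2)[OF assms]]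
    by (simp_all add: L_def k_def)
  show ?thesis
  proof -
    define a where "a i = pairing (k i) v" for i
    have p: "pairing (gradient (\<lambda>m. chart_map M m $ 1) m) v = (L $ 1 * a 2 / L $ 2 - a 1) / L $ 2"
      "pairing (gradient (\<lambda>m. chart_map M m $ 2) m) v = (a 3 - L $ 3 * a 2 / L $ 2) / L $ 2"
      unfolding g pairing_simps a_def[symmetric] using L2 by (simp_all add: field_simps power2_eq_square)
    have cm: "chart_map M m $ 1 = - L $ 1 / L $ 2" "chart_map M m $ 2 = L $ 3 / L $ 2"
      by (simp_all add: chart_map_def Let_def L_def)
    show ?thesis
      unfolding vec_eq_iff forall_3 vector_add_component vector_smult_component V a_def[symmetric] p L_def[symmetric]
      using L2 by (simp add: cm line_tangent_def line_coords_def)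
  qed
qed

text \<open>The complement of a line of the dual plane is dense.\<close>

lemma dual_line_complement:
  fixes O' :: "(complex^2) set" and c :: "complex^3"
  assumes "open O'" "O' \<noteq> {}" "c \<noteq> 0"
  shows "open {x \<in> O'. pairing c (line_coords x) \<noteq> 0} \<and> {x \<in> O'. pairing c (line_coords x) \<noteq> 0} \<noteq> {}"
proof
  define k :: "complex^2" where "k = vector [c $ 1, - c $ 3]"
  have e: "pairing c (line_coords x) = pairing k x - c $ 2" for x
    by (simp add: pairing_def sum_3 sum_2 line_coords_def k_def)
  have "open ((\<lambda>x. pairing c (line_coords x)) -` (- {0}))"
    unfolding e
    by (rule open_vimage)
       (auto intro: continuous_on_diff linear_continuous_on[OF bounded_linear_pairing] continuous_on_const)
  from open_Int[OF assms(1) this] show "open {x \<in> O'. pairing c (line_coords x) \<noteq> 0}"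
    by (simp add: vimage_def Int_def)
  obtain x where x: "x \<in> O'" using assms(2) by blast
  show "{x \<in> O'. pairing c (line_coords x) \<noteq> 0} \<noteq> {}"
  proof
    assume "{x \<in> O'. pairing c (line_coords x) \<noteq> 0} = {}"
    then have z: "pairing k y = c $ 2" if "y \<in> O'" for y using that e by auto
    have "((\<lambda>y. pairing k y) has_derivative pairing 0) (at x)"
      by (rule has_derivative_transform_within_open[OF pairing_derivative_const[of "c $ 2"] assms(1) x]) (simp add: z)
    then have "k = 0" by (rule trans[OF sym[OF gradient_eqI[OF pairing_derivative_pairing]] gradient_eqI])
    moreover from this have "c $ 2 = 0" using z[OF x] by (simp add: pairing_simps)
    ultimately show False using assms(3) by (auto simp: k_def vec_eq_iff forall_3 forall_2)
  qed
qed

section \<open>Flatness of the model web\<close>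

lemma projective_form_incident: "pairing x (projective_form \<eta> x) = 0"
  by (simp add: projective_form_def Let_def pairing_def sum_3 algebra_simps)

lemma projective_model_homogeneous:
  assumes "\<nu> < d"
  shows "projective_form (model d \<nu> \<mu>) (c *s x) = c ^ (d + 1) *s projective_form (model d \<nu> \<mu>) x"
proof -
  have S: "(\<Sum>i\<in>A. of_nat (d choose i) * (c * x $ 1) ^ (d - i) * (c * x $ 2) ^ i)
      = c ^ d * (\<Sum>i\<in>A. of_nat (d choose i) * x $ 1 ^ (d - i) * x $ 2 ^ i)" if "\<forall>i\<in>A. i \<le> d" for A
    unfolding sum_distrib_left
  proof (rule sum.cong[OF refl])
    fix i assume "i \<in> A"
    then have "c ^ d = c ^ (d - i) * c ^ i" using that by (simp flip: power_add)
    then show "of_nat (d choose i) * (c * x $ 1) ^ (d - i) * (c * x $ 2) ^ i = c ^ d * (of_nat (d choose i) * x $ 1 ^ (d - i) * x $ 2 ^ i)"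
      by (simp add: power_mult_distrib mult_ac)
  qed
  have "model d \<nu> \<mu> (vector [c * x $ 1, c * x $ 2]) = c ^ d *s model d \<nu> \<mu> (vector [x $ 1, x $ 2])"
    using assms by (simp add: model_def vec_eq_iff forall_2 S)
  then show ?thesis
    by (simp add: projective_form_def Let_def vec_eq_iff forall_3 algebra_simps)
qed

text \<open>A linear factor of the web annihilates a direction whose associated slope is a root of
  \<open>F\<close>. The factor has a component along \<open>dp\<close>, since the form does not vanish on the direction
  \<open>dq = 0\<close> when \<open>q \<noteq> 0\<close>.\<close>

lemma factor_directions:
  fixes \<theta> :: "nat \<Rightarrow> complex^2"
  assumes d: "\<nu> < d" and \<mu>: "\<mu> \<noteq> 0" and m: "m $ 2 \<noteq> 0" and c: "c \<noteq> 0"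
    and i: "i < d"
    and W: "\<And>v. v \<noteq> 0 \<Longrightarrow> (\<Prod>i<d. pairing (\<theta> i) v) = c * legendre_form (projective_form (model d \<nu> \<mu>)) m v"
  shows "\<theta> i $ 1 \<noteq> 0" "poly (Fpoly d \<nu> \<mu> (m $ 1)) ((m $ 1 * \<theta> i $ 1 + m $ 2 * \<theta> i $ 2) / \<theta> i $ 1) = 0"
proof -
  let ?W = "\<lambda>v. direction_form d \<nu> \<mu> (m $ 1) (v $ 2) (m $ 1 * v $ 2 - m $ 2 * v $ 1)"
  have W: "(\<Prod>i<d. pairing (\<theta> i) v) = c * ?W v" if "v \<noteq> 0" for v
    using W[OF that] legendre_model[of d \<nu> \<mu> m v] d by simp
  show 1: "\<theta> i $ 1 \<noteq> 0"
  proof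
    assume z: "\<theta> i $ 1 = 0"
    define v :: "complex^2" where "v = vector [1, 0]"
    have "v \<noteq> 0" by (simp add: v_def vec_eq_iff forall_2)
    moreover have "pairing (\<theta> i) v = 0" using z by (simp add: v_def pairing_def sum_2)
    ultimately have "?W v = 0" using W[of v] c i by (metis finite_lessThan lessThan_iff mult_eq_0_iff prod_zero)
    moreover have "?W v = \<mu> * (- m $ 2) ^ d"
    proof -
      have "(\<Sum>i=\<nu>+1..d. of_nat (d choose i) * 0 ^ (d - i) * (- m $ 2) ^ i) = (\<Sum>i\<in>{d}. of_nat (d choose i) * 0 ^ (d - i) * (- m $ 2) ^ i)"
        using d by (intro sum.mono_neutral_right) auto
      moreover have "(\<Sum>i=0..\<nu>. of_nat (d choose i) * 0 ^ (d - i) * (- m $ 2) ^ i) = 0"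
        using d by (intro sum.neutral) auto
      ultimately show ?thesis by (simp add: direction_form_def v_def)
    qed
    ultimately show False using \<mu> m by simp
  qed
  define v :: "complex^2" where "v = vector [\<theta> i $ 2, - \<theta> i $ 1]"
  define t where "t = (m $ 1 * \<theta> i $ 1 + m $ 2 * \<theta> i $ 2) / \<theta> i $ 1"
  have "v \<noteq> 0" using 1 by (simp add: v_def vec_eq_iff forall_2)
  moreover have "pairing (\<theta> i) v = 0" by (simp add: v_def pairing_def sum_2)
  ultimately have "?W v = 0" using W[of v] c i by (metis finite_lessThan lessThan_iff mult_eq_0_iff prod_zero)
  moreover have "m $ 1 * v $ 2 - m $ 2 * v $ 1 = t * v $ 2" using 1 by (simp add: v_def t_def field_simps)
  ultimately have "v $ 2 ^ d * poly (Fpoly d \<nu> \<mu> (m $ 1)) t = 0"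
    using direction_form_poly[of \<nu> d \<mu> "m $ 1" "v $ 2" t] d by simp
  then show "poly (Fpoly d \<nu> \<mu> (m $ 1)) ((m $ 1 * \<theta> i $ 1 + m $ 2 * \<theta> i $ 2) / \<theta> i $ 1) = 0"
    using 1 by (simp add: v_def t_def)
qed

text \<open>Pulling the factors \<open>\<theta>\<close> back to the chart \<open>(p, q)\<close> of the model and normalising them gives
  the forms of \<open>model_theta\<close> for holomorphic roots \<open>\<tau>\<close>, whose curvature is known.\<close>

lemma model_flat_at_good_point:
  assumes d: "d \<ge> 3" "1 \<le> \<nu>" "\<nu> + 2 \<le> d" and \<mu>: "\<mu> \<noteq> 0"
    and flat: "(\<mu> + 1) * (of_nat d - 1 - of_nat \<nu> * (\<mu> + 1)) = 0"
    and M: "invertible M"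
    and W: "web_factorization d (legendre_form (pullback M (projective_form (model d \<nu> \<mu>)))) U \<theta>"
    and m: "(transpose M *v line_coords m) $ 2 \<noteq> 0" "m $ 1 \<noteq> 0" "m $ 1 \<noteq> \<mu>" "m $ 2 \<noteq> 0" "chart_map M m \<in> U"
  shows "web_curvature d \<theta> (chart_map M m) = 0"
proof -
  let ?\<omega> = "projective_form (model d \<nu> \<mu>)"
  let ?L = "\<lambda>m. transpose M *v line_coords m"
  \<comment> \<open>\<open>\<Phi>\<close> leads from the chart of the model to the chart of \<open>M\<close>\<close>
  define \<Phi> where "\<Phi> = chart_map M"
  have U: "open U" and hol: "\<And>i. i < d \<Longrightarrow> holomorphic_form (\<theta> i) U"
    and w: "\<And>m i j. m \<in> U \<Longrightarrow> i < d \<Longrightarrow> j < d \<Longrightarrow> i \<noteq> j \<Longrightarrow> wedge (\<theta> i m) (\<theta> j m) \<noteq> 0"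
    and fac: "\<And>m v. m \<in> U \<Longrightarrow> legendre_form (pullback M ?\<omega>) m v = (\<Prod>i<d. pairing (\<theta> i m) v)"
    using W unfolding web_factorization_def holomorphic_form_def by auto
  define V0 where "V0 = {m. (?L m) $ 2 \<noteq> 0 \<and> m $ 1 \<noteq> 0 \<and> m $ 1 \<noteq> \<mu> \<and> m $ 2 \<noteq> 0}"
  have o: "open {m. (?L m) $ 2 \<noteq> 0}"
  proof -
    have "continuous_on UNIV (\<lambda>m. (?L m) $ 2)"
      by (rule continuous_at_imp_continuous_on) (use has_derivative_continuous[OF chart_line_derivative] in auto)
    then show ?thesis by (rule open_Collect_neq) (rule continuous_on_const)
  qed
  have "open {m :: complex^2. m $ 1 \<noteq> 0 \<and> m $ 1 \<noteq> \<mu> \<and> m $ 2 \<noteq> 0}"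
    by (intro open_Collect_conj open_Collect_neq continuous_intros)
  from open_Int[OF o this] have V0: "open V0" unfolding V0_def by (simp add: Int_def)
  have h0: "holomorphic_form \<Phi> V0"
    unfolding holomorphic_form_iff \<Phi>_def V0_def
    by (intro conjI mholomorphic_onI) (use chart_map_derivatives in blast)+
  define V where "V = V0 \<inter> \<Phi> -` U"
  have "continuous_on V0 \<Phi>"
  proof -
    have "continuous_on V0 (\<lambda>m. \<Phi> m $ i)" for i
      using h0 mholomorphic_continuous unfolding holomorphic_form_def by blast
    then have "continuous_on V0 (\<lambda>m. \<chi> i. \<Phi> m $ i)" by (rule continuous_on_vec_lambda)
    then show ?thesis by simp
  qed
  then have V: "open V" unfolding V_def using V0 U by (simp add: continuous_open_preimage)
  have hV: "holomorphic_form \<Phi> V" using holomorphic_form_subset[OF h0] by (simp add: V_def)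
  have mV: "m \<in> V" using m by (simp add: V_def V0_def \<Phi>_def)
  have im: "\<Phi> ` V \<subseteq> U" by (auto simp: V_def)
  have J: "pull_jacobian \<Phi> x \<noteq> 0" if "x \<in> V" for x
    using that M chart_map_jacobian[of M x] by (auto simp: V_def V0_def \<Phi>_def invertible_det_nz)
  define \<theta>' where "\<theta>' i x = pull_form \<Phi> x (\<theta> i (\<Phi> x))" for i x
  have h': "holomorphic_form (\<theta>' i) V" if "i < d" for i
    unfolding \<theta>'_def by (rule holomorphic_pull_form[OF hV V hol[OF that] U im])
  have fac': "\<exists>c. c \<noteq> 0 \<and> (\<forall>v. v \<noteq> 0 \<longrightarrow> (\<Prod>i<d. pairing (\<theta>' i x) v) = c * legendre_form ?\<omega> x v)" if x: "x \<in> V" for x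
  proof -
    define \<rho> where "\<rho> = - (?L x) $ 2"
    have L2: "(?L x) $ 2 \<noteq> 0" using x by (simp add: V_def V0_def)
    have \<rho>: "\<rho> \<noteq> 0" using L2 by (simp add: \<rho>_def)
    have "(\<Prod>i<d. pairing (\<theta>' i x) v) = det M ^ (d + 1) * \<rho>\<^sup>2 / \<rho> ^ (2 * (d + 1) + 1) * legendre_form ?\<omega> x v" if v: "v \<noteq> 0" for v
    proof -
      define v' :: "complex^2" where "v' = vector [pairing (gradient (\<lambda>m. \<Phi> m $ 1) x) v, pairing (gradient (\<lambda>m. \<Phi> m $ 2) x) v]"
      have p: "pairing (\<theta>' i x) v = pairing (\<theta> i (\<Phi> x)) v'" for i
        by (simp add: \<theta>'_def pull_form_def pairing_simps pairing_def[of "\<theta> i (\<Phi> x)"] sum_2 v'_def)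
      have v': "v' \<noteq> 0"
      proof
        assume "v' = 0"
        then have "pairing (gradient (\<lambda>m. \<Phi> m $ 1) x) v = 0" "pairing (gradient (\<lambda>m. \<Phi> m $ 2) x) v = 0"
          by (simp_all add: v'_def vec_eq_iff forall_2)
        then have "wedge (vector [v $ 2, - v $ 1]) (gradient (\<lambda>m. \<Phi> m $ 1) x) = 0" "wedge (vector [v $ 2, - v $ 1]) (gradient (\<lambda>m. \<Phi> m $ 2) x) = 0"
          by (simp_all add: wedge_def pairing_def sum_2 algebra_simps)
        from wedge_eq_zero[OF _ this] J[OF x] have "(vector [v $ 2, - v $ 1] :: complex^2) = 0" by (simp add: pull_jacobian_def)
        then show False using v by (auto simp: vec_eq_iff forall_2)
      qed
      have "\<rho> ^ (2 * (d + 1) + 1) * legendre_form (pullback M ?\<omega>) (\<Phi> x) v' = det M ^ (d + 1) * \<rho>\<^sup>2 * legendre_form ?\<omega> x v"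
        by (rule legendre_form_chart[OF projective_form_incident projective_model_homogeneous M
              line_coords_chart_map[OF L2, folded \<rho>_def \<Phi>_def] line_tangent_chart_map[OF L2, of v, folded \<rho>_def \<Phi>_def, folded v'_def] \<rho> v v'])
           (use d in simp)
      moreover have "legendre_form (pullback M ?\<omega>) (\<Phi> x) v' = (\<Prod>i<d. pairing (\<theta>' i x) v)"
        using fac[of "\<Phi> x" v'] im x by (simp add: p image_subset_iff)
      ultimately show ?thesis using \<rho> by (simp add: field_simps)
    qed
    moreover have "det M ^ (d + 1) * \<rho>\<^sup>2 / \<rho> ^ (2 * (d + 1) + 1) \<noteq> 0" using \<rho> M by (simp add: invertible_det_nz)
    ultimately show ?thesis by blast
  qed
  have good: "x $ 1 \<noteq> 0 \<and> x $ 1 \<noteq> \<mu> \<and> x $ 2 \<noteq> 0" if "x \<in> V" for x using that by (simp add: V_def V0_def)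
  define \<tau> where "\<tau> i x = (x $ 1 * \<theta>' i x $ 1 + x $ 2 * \<theta>' i x $ 2) / \<theta>' i x $ 1" for i and x :: "complex^2"
  have nz: "\<theta>' i x $ 1 \<noteq> 0" and root: "poly (Fpoly d \<nu> \<mu> (x $ 1)) (\<tau> i x) = 0" if i: "i < d" and x: "x \<in> V" for i x
  proof -
    obtain c where c: "c \<noteq> 0" "\<And>v. v \<noteq> 0 \<Longrightarrow> (\<Prod>i<d. pairing (\<theta>' i x) v) = c * legendre_form ?\<omega> x v"
      using fac'[OF x] by blast
    show "\<theta>' i x $ 1 \<noteq> 0" "poly (Fpoly d \<nu> \<mu> (x $ 1)) (\<tau> i x) = 0"
      using factor_directions[where \<theta>="\<lambda>i. \<theta>' i x" and m=x and c=c and \<mu>=\<mu> and \<nu>=\<nu>, OF _ \<mu> _ c(1) i c(2)] d good[OF x]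
      unfolding \<tau>_def by auto
  qed
  have h\<tau>: "mholomorphic_on (\<tau> i) V" if "i < d" for i
    unfolding \<tau>_def using h'[OF that] nz[OF that]
    by (intro mholomorphic_divide mholomorphic_add mholomorphic_mult mholomorphic_nth V) (auto simp: holomorphic_form_def)
  have wd: "wedge (\<theta>' i x) (\<theta>' j x) \<noteq> 0" if "x \<in> V" "i < d" "j < d" "i \<noteq> j" for x i j
    using w[of "\<Phi> x" i j] im that J[OF that(1)] by (auto simp: \<theta>'_def wedge_pull)
  have inj: "inj_on (\<lambda>i. \<tau> i x) {..<d}" if x: "x \<in> V" for x
  proof (rule inj_onI, rule ccontr)
    fix i j assume ij: "i \<in> {..<d}" "j \<in> {..<d}" "\<tau> i x = \<tau> j x" "i \<noteq> j"
    have "\<theta>' i x $ 2 * \<theta>' j x $ 1 = \<theta>' j x $ 2 * \<theta>' i x $ 1"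
    proof -
      have "x $ 2 * \<theta>' i x $ 2 / \<theta>' i x $ 1 = x $ 2 * \<theta>' j x $ 2 / \<theta>' j x $ 1"
        using ij nz[OF _ x] by (simp add: \<tau>_def add_divide_distrib)
      then show ?thesis using ij nz[OF _ x] good[OF x] by (simp add: frac_eq_eq)
    qed
    then show False using wd[OF x] ij by (auto simp: wedge_def mult.commute)
  qed
  have "web_curvature d (model_theta \<tau>) m = 0"
    using model_curvature[OF d \<mu> V mV good h\<tau> inj root] flat by auto
  moreover have "web_curvature d (model_theta \<tau>) m = pull_jacobian \<Phi> m * web_curvature d \<theta> (\<Phi> m)"
  proof (rule web_curvature_pullback[OF hV V U im mV J hol w, where g="\<lambda>i x. - x $ 2 / \<theta>' i x $ 1"])
    fix i assume i: "i < d"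
    show "mholomorphic_on (\<lambda>x. - x $ 2 / \<theta>' i x $ 1) V"
      using h'[OF i] nz[OF i]
      by (intro mholomorphic_divide mholomorphic_minus mholomorphic_nth V) (auto simp: holomorphic_form_def)
  next
    fix i x assume "i < d" "x \<in> V"
    then show "- x $ 2 / \<theta>' i x $ 1 \<noteq> 0" using nz good by simp
  next
    fix i x assume x: "x \<in> V" and i: "i < d"
    show "model_theta \<tau> i x = (- x $ 2 / \<theta>' i x $ 1) *s pull_form \<Phi> x (\<theta> i (\<Phi> x))"
      unfolding \<theta>'_def[symmetric] using nz[OF i x]
      by (simp add: model_theta_def \<tau>_def vec_eq_iff forall_2 field_simps)
  qed
  ultimately show ?thesis using J[OF mV] by (simp add: \<Phi>_def)
qed

text \<open>The points of a chart that correspond to \<open>p \<in> {0, \<mu>}\<close>, to \<open>q = 0\<close> or to no point of the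
  chart \<open>(p, q)\<close> lie on four lines of the dual plane. Their complement is dense, and the
  curvature is continuous.\<close>

theorem model_flat_web:
  assumes d: "d \<ge> 3" "1 \<le> \<nu>" "\<nu> + 2 \<le> d" and \<mu>: "\<mu> \<noteq> 0"
    and flat: "(\<mu> + 1) * (of_nat d - 1 - of_nat \<nu> * (\<mu> + 1)) = 0"
    and M: "invertible M"
  shows "flat_web d (legendre_form (pullback M (projective_form (model d \<nu> \<mu>))))"
  unfolding flat_web_def
proof (intro allI impI ballI, rule ccontr)
  fix U \<theta> x0 assume W: "web_factorization d (legendre_form (pullback M (projective_form (model d \<nu> \<mu>)))) U \<theta>"
    and x0: "x0 \<in> U" "web_curvature d \<theta> x0 \<noteq> 0"
  \<comment> \<open>an open set of points with nonzero curvature would meet the complement of the four lines\<close>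
  define O0 where "O0 = {x \<in> U. web_curvature d \<theta> x \<noteq> 0}"
  have "open U" using W by (simp add: web_factorization_def)
  then have "open O0" unfolding O0_def
    using continuous_open_preimage[OF web_curvature_continuous[OF W] _ open_Compl[OF closed_singleton[of 0]]]
    by (simp add: vimage_def Int_def)
  moreover have "O0 \<noteq> {}" using x0 by (auto simp: O0_def)
  moreover
  obtain N where N: "N ** transpose M = mat 1" "transpose M ** N = mat 1"
  proof -
    obtain M' where "M ** M' = mat 1" "M' ** M = mat 1" using M unfolding invertible_def by blast
    then show ?thesis using that[of "transpose M'"] by (metis matrix_transpose_mul transpose_mat)
  qed
  define c where "c i = N $ i" for i
  have NL: "(N *v y) $ i = pairing (c i) y" for i y by (simp add: matrix_vector_mult_def pairing_def c_def)
  have c_pair: "pairing (c i) (transpose M *v axis j 1) = (if i = j then 1 else 0)" for i j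
  proof -
    have "pairing (c i) (transpose M *v axis j 1) = (N *v (transpose M *v axis j 1)) $ i" by (simp add: NL)
    also have "\<dots> = axis j 1 $ i" by (simp add: matrix_vector_mul_assoc N del: transpose_matrix_vector)
    finally show ?thesis by (simp add: axis_def)
  qed
  have cnz: "c 1 \<noteq> 0" "c 2 \<noteq> 0" "c 3 \<noteq> 0" "c 1 + \<mu> *s c 2 \<noteq> 0"
  proof -
    have "c i \<noteq> 0" for i using c_pair[of i i] by (auto simp: pairing_simps)
    then show "c 1 \<noteq> 0" "c 2 \<noteq> 0" "c 3 \<noteq> 0" by blast+
    have "pairing (c 1 + \<mu> *s c 2) (transpose M *v axis 1 1) = 1" by (simp only: pairing_simps c_pair) simp
    moreover have "pairing 0 (transpose M *v axis 1 1) = 0" by (rule pairing_simps)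
    ultimately show "c 1 + \<mu> *s c 2 \<noteq> 0" by (metis zero_neq_one)
  qed
  ultimately have "\<exists>x\<in>O0. pairing (c 1) (line_coords x) \<noteq> 0 \<and> pairing (c 2) (line_coords x) \<noteq> 0 \<and>
      pairing (c 3) (line_coords x) \<noteq> 0 \<and> pairing (c 1 + \<mu> *s c 2) (line_coords x) \<noteq> 0"
  proof -
    assume o: "open O0" "O0 \<noteq> {}"
    note 1 = dual_line_complement[OF o cnz(1)]
    note 2 = dual_line_complement[OF conjunct1[OF 1] conjunct2[OF 1] cnz(2)]
    note 3 = dual_line_complement[OF conjunct1[OF 2] conjunct2[OF 2] cnz(3)]
    note 4 = dual_line_complement[OF conjunct1[OF 3] conjunct2[OF 3] cnz(4)]
    show ?thesis using conjunct2[OF 4] by auto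
  qed
  then obtain x where x: "x \<in> O0" "pairing (c 1) (line_coords x) \<noteq> 0" "pairing (c 2) (line_coords x) \<noteq> 0"
      "pairing (c 3) (line_coords x) \<noteq> 0" "pairing (c 1 + \<mu> *s c 2) (line_coords x) \<noteq> 0" by blast
  define l where "l = N *v line_coords x"
  have l: "l $ 1 \<noteq> 0" "l $ 2 \<noteq> 0" "l $ 3 \<noteq> 0" "l $ 1 + \<mu> * l $ 2 \<noteq> 0"
    using x by (simp_all add: l_def NL pairing_simps)
  define m :: "complex^2" where "m = vector [- l $ 1 / l $ 2, l $ 3 / l $ 2]"
  have lm: "line_coords m = (- 1 / l $ 2) *s l"
    using l by (simp add: line_coords_def m_def vec_eq_iff forall_3)
  have "transpose M *v l = line_coords x" unfolding l_def by (simp add: matrix_vector_mul_assoc N del: transpose_matrix_vector)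
  then have Lm: "transpose M *v line_coords m = (- 1 / l $ 2) *s line_coords x"
    unfolding lm matrix_scale by simp
  then have \<Phi>: "chart_map M m = x" using l by (intro chart_map_unique[of "- 1 / l $ 2"]) auto
  have "web_curvature d \<theta> (chart_map M m) = 0"
  proof (rule model_flat_at_good_point[OF d \<mu> flat M W])
    show "(transpose M *v line_coords m) $ 2 \<noteq> 0" unfolding Lm using l by (simp add: line_coords_def)
    show "m $ 1 \<noteq> 0" "m $ 2 \<noteq> 0" using l by (simp_all add: m_def)
    show "m $ 1 \<noteq> \<mu>"
    proof
      assume "m $ 1 = \<mu>"
      then have "- l $ 1 = \<mu> * l $ 2" using l by (simp add: m_def field_simps)
      then have "l $ 1 + \<mu> * l $ 2 = 0" by algebra
      then show False using l by simp
    qed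
    show "chart_map M m \<in> U" using x(1) by (simp add: \<Phi> O0_def)
  qed
  then show False using x(1) by (simp add: \<Phi> O0_def)
qed

section \<open>A model web that is not flat\<close>

lemma Fpoly_simple_roots:
  assumes "\<nu> < d" "p \<noteq> 0" "p \<noteq> \<mu>" "poly (Fpoly d \<nu> \<mu> p) x = 0"
  shows "poly (pderiv (Fpoly d \<nu> \<mu> p)) x \<noteq> 0"
proof
  assume z: "poly (pderiv (Fpoly d \<nu> \<mu> p)) x = 0"
  have "(p - \<mu>) * kappa d \<nu> * x ^ \<nu> = 0"
    using arg_cong[OF Fpoly_ode, of "\<lambda>q. poly q x" d \<nu> \<mu> p] z assms(4) by (simp add: poly_monom)
  then have "x = 0" using assms kappa_nonzero by simp
  then show False using assms Fpoly_at_0 by simp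
qed

lemma Fpoly_roots:
  assumes "\<nu> < d" "\<mu> \<noteq> 0" "p \<noteq> 0" "p \<noteq> \<mu>"
  obtains \<tau> where "inj_on \<tau> {..<d}" "\<And>i. i < d \<Longrightarrow> poly (Fpoly d \<nu> \<mu> p) (\<tau> i) = 0"
proof -
  let ?F = "Fpoly d \<nu> \<mu> p"
  let ?R = "{z. poly ?F z = 0}"
  have F0: "?F \<noteq> 0" using Fpoly_degree[OF assms(1,2), of p] assms(2) by auto
  have "rsquarefree ?F" using Fpoly_simple_roots[OF assms(1,3,4)] by (auto simp: rsquarefree_roots)
  from complex_poly_decompose_rsquarefree[OF this]
  have "?F = smult (lead_coeff ?F) (\<Prod>z\<in>?R. [:- z, 1:])" ..
  then have "degree ?F = degree (\<Prod>z\<in>?R. [:- z, 1:])" using F0 by (metis (no_types) degree_smult_eq leading_coeff_0_iff)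
  also have "\<dots> = card ?R" by (subst degree_prod_eq_sum_degree) auto
  finally have "card ?R = d" using Fpoly_degree(1)[OF assms(1,2)] by simp
  with ex_bij_betw_nat_finite[OF poly_roots_finite[OF F0]] obtain \<tau> where \<tau>: "bij_betw \<tau> {0..<d} ?R" by auto
  show ?thesis
  proof (rule that[of \<tau>])
    show "inj_on \<tau> {..<d}" using \<tau> by (simp add: bij_betw_def atLeast0LessThan)
    show "poly ?F (\<tau> i) = 0" if "i < d" for i using bij_betwE[OF \<tau>] that by auto
  qed
qed

lemma direction_form_factors:
  assumes "root_system d \<nu> \<mu> p \<tau>"
  shows "direction_form d \<nu> \<mu> p x y = \<mu> * (\<Prod>i<d. (y - \<tau> i * x))"
proof (cases "x = 0")
  case True
  have "(\<Sum>i=\<nu>+1..d. of_nat (d choose i) * 0 ^ (d - i) * y ^ i) = (\<Sum>i\<in>{d}. of_nat (d choose i) * 0 ^ (d - i) * y ^ i)"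
    using root_system.\<nu>[OF assms] by (intro sum.mono_neutral_right) auto
  moreover have "(\<Sum>i=0..\<nu>. of_nat (d choose i) * 0 ^ (d - i) * y ^ i) = 0"
    using root_system.\<nu>[OF assms] by (intro sum.neutral) auto
  ultimately show ?thesis using True by (simp add: direction_form_def)
next
  case False
  have "direction_form d \<nu> \<mu> p x (y / x * x) = x ^ d * (\<mu> * (\<Prod>s<d. (y / x - \<tau> s)))"
    using direction_form_poly[of \<nu> d \<mu> p x "y / x"] root_system.\<nu>[OF assms] root_system.F_factors[OF assms]
    by (simp add: poly_prod)
  also have "\<dots> = \<mu> * (\<Prod>s<d. x * (y / x - \<tau> s))" by (simp add: prod.distrib)
  finally show ?thesis using False by (simp add: right_diff_distrib mult.commute)
qed

text \<open>Off the zeros of \<open>Q\<close> the equation \<open>F = 0\<close> can be solved for \<open>p\<close> as a function \<open>g\<close> of the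
  root. At a simple root \<open>g\<close> is locally invertible, and its inverse is the root as a function of
  \<open>p\<close>.\<close>

lemma local_root:
  assumes "\<nu> < d" "\<mu> \<noteq> 0" "p \<noteq> 0" "p \<noteq> \<mu>" and root: "poly (Fpoly d \<nu> \<mu> p) z = 0"
  shows "\<exists>S h. open S \<and> p \<in> S \<and> h holomorphic_on S \<and> h p = z \<and> (\<forall>s\<in>S. poly (Fpoly d \<nu> \<mu> s) (h s) = 0)"
proof -
  define Q where "Q = Qpoly d \<nu>"
  define E :: "complex poly" where "E = [:1, 1:] ^ d"
  define g where "g x = \<mu> - \<mu> * poly E x / poly Q x" for x
  have F: "poly (Fpoly d \<nu> \<mu> s) x = poly Q x * (s - g x)" if "poly Q x \<noteq> 0" for s x
    using that by (simp add: Fpoly_def g_def Q_def E_def field_simps)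
  have Qz: "poly Q z \<noteq> 0"
  proof
    assume *: "poly Q z = 0"
    then have "(1 + z) ^ d = 0" using root assms(2) by (simp add: Fpoly_def Q_def poly_power)
    then have "z + 1 = 0" by (simp add: add.commute)
    then have "z = - 1" by (simp only: eq_neg_iff_add_eq_0)
    then show False using * Qpoly_at_minus_1[OF assms(1)] by (simp add: Q_def)
  qed
  define T where "T = {x. poly Q x \<noteq> 0}"
  have T: "open T" "z \<in> T" unfolding T_def using Qz by (auto intro!: open_Collect_neq continuous_intros)
  have gT: "g holomorphic_on T" unfolding g_def T_def by (intro holomorphic_intros) auto
  have gz: "g z = p" using F[OF Qz, of p] root Qz by simp
  have "deriv g z \<noteq> 0"
  proof
    assume z0: "deriv g z = 0"
    have dg: "(g has_field_derivative 0) (at z)" using holomorphic_derivI[OF gT T] z0 by simp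
    have "((\<lambda>x. poly Q x * (p - g x)) has_field_derivative poly (pderiv Q) z * (p - g z) + (0 - 0) * poly Q z) (at z)"
      by (intro DERIV_mult poly_DERIV DERIV_diff DERIV_const dg)
    then have "((\<lambda>x. poly Q x * (p - g x)) has_field_derivative 0) (at z)" by (simp add: gz)
    then have "((\<lambda>x. poly (Fpoly d \<nu> \<mu> p) x) has_field_derivative 0) (at z)"
      by (rule has_field_derivative_transform_within_open[OF _ T]) (simp add: F T_def)
    then have "poly (pderiv (Fpoly d \<nu> \<mu> p)) z = 0" using DERIV_unique poly_DERIV by blast
    then show False using Fpoly_simple_roots[OF assms(1,3,4) root] by simp
  qed
  from has_complex_derivative_locally_invertible[OF gT T(2,1) this]
  obtain r where r: "r > 0" "ball z r \<subseteq> T" "open (g ` ball z r)" "inj_on g (ball z r)" by blast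
  obtain h where h: "h holomorphic_on (g ` ball z r)" "\<And>x. x \<in> ball z r \<Longrightarrow> h (g x) = x"
    using holomorphic_has_inverse[OF holomorphic_on_subset[OF gT r(2)] open_ball r(4)] by metis
  show ?thesis
  proof (intro exI conjI ballI)
    show "open (g ` ball z r)" by (rule r(3))
    show "p \<in> g ` ball z r" using r(1) gz by (intro image_eqI[of _ _ z]) auto
    show "h holomorphic_on (g ` ball z r)" by (rule h(1))
    show "h p = z" using h(2)[of z] r(1) gz by simp
    fix s assume "s \<in> g ` ball z r"
    then obtain x where x: "x \<in> ball z r" "s = g x" by blast
    then have "poly Q x \<noteq> 0" using r(2) by (auto simp: T_def)
    then show "poly (Fpoly d \<nu> \<mu> s) (h s) = 0" using F h(2)[OF x(1)] x(2) by simp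
  qed
qed

text \<open>The roots continue holomorphically from \<open>p = 2 \<mu>\<close>, a value outside the discriminant, so
  the web does split there and the closed formula for the curvature applies. The constant \<open>\<mu>\<close> is
  absorbed into one of the factors.\<close>

theorem model_not_flat_web:
  assumes d: "d \<ge> 3" "1 \<le> \<nu>" "\<nu> + 2 \<le> d" and \<mu>: "\<mu> \<noteq> 0"
    and nf: "(\<mu> + 1) * (of_nat d - 1 - of_nat \<nu> * (\<mu> + 1)) \<noteq> 0"
  shows "\<not> flat_web d (legendre_form (projective_form (model d \<nu> \<mu>)))"
proof -
  have \<nu>d: "\<nu> < d" using d by simp
  \<comment> \<open>any value other than 0 and \<open>\<mu>\<close> would do\<close>
  define p0 where "p0 = 2 * \<mu>"
  have p0: "p0 \<noteq> 0" "p0 \<noteq> \<mu>" using \<mu> by (auto simp: p0_def)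
  obtain \<tau>0 where \<tau>0: "inj_on \<tau>0 {..<d}" "\<And>i. i < d \<Longrightarrow> poly (Fpoly d \<nu> \<mu> p0) (\<tau>0 i) = 0"
    using Fpoly_roots[OF \<nu>d \<mu> p0] by blast
  have "\<forall>i\<in>{..<d}. \<exists>Sh. open (fst Sh) \<and> p0 \<in> fst Sh \<and> snd Sh holomorphic_on fst Sh \<and> snd Sh p0 = \<tau>0 i \<and>
      (\<forall>s\<in>fst Sh. poly (Fpoly d \<nu> \<mu> s) (snd Sh s) = 0)"
    using local_root[OF \<nu>d \<mu> p0 \<tau>0(2)] by fastforce
  from bchoice[OF this] obtain Sh where Sh: "\<And>i. i < d \<Longrightarrow> open (fst (Sh i)) \<and> p0 \<in> fst (Sh i) \<and> snd (Sh i) holomorphic_on fst (Sh i) \<and>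
      snd (Sh i) p0 = \<tau>0 i \<and> (\<forall>s\<in>fst (Sh i). poly (Fpoly d \<nu> \<mu> s) (snd (Sh i) s) = 0)" by auto
  define h where "h i = snd (Sh i)" for i
  define S where "S = (\<Inter>i\<in>{..<d}. fst (Sh i)) \<inter> {s. s \<noteq> 0 \<and> s \<noteq> \<mu>}"
  have S: "open S" "p0 \<in> S"
    unfolding S_def using Sh p0
    by (auto intro!: open_Int open_INT open_Collect_conj open_Collect_neq continuous_intros)
  have hS: "h i holomorphic_on S" "h i p0 = \<tau>0 i" "\<And>s. s \<in> S \<Longrightarrow> poly (Fpoly d \<nu> \<mu> s) (h i s) = 0" if "i < d" for i
    using Sh[OF that] that unfolding h_def S_def by (auto elim: holomorphic_on_subset)
  define S' where "S' = (\<Inter>z\<in>{(i, j). i < d \<and> j < d \<and> i \<noteq> j}. {s \<in> S. h (fst z) s - h (snd z) s \<noteq> 0}) \<inter> S"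
  have fin: "finite {(i, j). i < d \<and> j < d \<and> i \<noteq> j}"
    by (rule finite_subset[of _ "{..<d} \<times> {..<d}"]) auto
  have S': "open S'" "p0 \<in> S'"
  proof -
    have "open {s \<in> S. h i s - h j s \<noteq> 0}" if "i < d" "j < d" for i j
    proof -
      have "continuous_on S (\<lambda>s. h i s - h j s)"
        by (intro continuous_intros holomorphic_on_imp_continuous_on hS that)
      from continuous_open_preimage[OF this S(1) open_Compl[OF closed_singleton[of 0]]]
      show ?thesis by (simp add: vimage_def Int_def)
    qed
    then show "open S'" unfolding S'_def by (intro open_Int open_INT fin S) auto
    show "p0 \<in> S'" unfolding S'_def using S hS(2) \<tau>0(1) by (auto simp: inj_on_def)
  qed
  define U where "U = {m :: complex^2. m $ 1 \<in> S' \<and> m $ 2 \<noteq> 0}"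
  have U: "open U"
  proof -
    have "open ((\<lambda>m :: complex^2. m $ 1) -` S')" by (rule open_vimage[OF S'(1)]) (intro continuous_intros)
    moreover have "open {m :: complex^2. m $ 2 \<noteq> 0}" by (intro open_Collect_neq continuous_intros)
    ultimately have "open (((\<lambda>m :: complex^2. m $ 1) -` S') \<inter> {m. m $ 2 \<noteq> 0})" by (rule open_Int)
    then show ?thesis by (simp add: U_def vimage_def Int_def)
  qed
  define m :: "complex^2" where "m = vector [p0, 1]"
  have m: "m \<in> U" using S' by (simp add: m_def U_def)
  define \<tau> where "\<tau> i m = h i (m $ 1)" for i and m :: "complex^2"
  have good: "x $ 1 \<noteq> 0 \<and> x $ 1 \<noteq> \<mu> \<and> x $ 2 \<noteq> 0" if "x \<in> U" for x
    using that by (auto simp: U_def S'_def S_def)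
  have h\<tau>: "mholomorphic_on (\<tau> i) U" if "i < d" for i
    unfolding \<tau>_def by (rule mholomorphic_chain[OF U mholomorphic_nth[OF U] hS(1)[OF that] S(1)]) (auto simp: U_def S'_def)
  have inj: "inj_on (\<lambda>i. \<tau> i x) {..<d}" if "x \<in> U" for x
    using that by (fastforce simp: inj_on_def \<tau>_def U_def S'_def)
  have root: "poly (Fpoly d \<nu> \<mu> (x $ 1)) (\<tau> i x) = 0" if "i < d" "x \<in> U" for i x
    using hS(3)[OF that(1)] that(2) by (auto simp: \<tau>_def U_def S'_def)
  have "web_curvature d (model_theta \<tau>) m \<noteq> 0"
  proof -
    have "(of_nat d :: complex) \<noteq> of_nat 2" using d(1) by (subst of_nat_eq_iff) simp
    then show ?thesis
      using model_curvature[OF d \<mu> U m good h\<tau> inj root] nf good[OF m] by (auto simp: m_def)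
  qed
  moreover
  have h\<theta>: "holomorphic_form (model_theta \<tau> i) U" if "i < d" for i
    unfolding holomorphic_form_iff model_theta_def vector_2
    by (intro conjI mholomorphic_minus mholomorphic_diff mholomorphic_nth h\<tau> that U)
  have w\<theta>: "wedge (model_theta \<tau> i x) (model_theta \<tau> j x) \<noteq> 0" if "x \<in> U" "i < d" "j < d" "i \<noteq> j" for x i j
  proof -
    have "wedge (model_theta \<tau> i x) (model_theta \<tau> j x) = x $ 2 * (\<tau> j x - \<tau> i x)"
      by (simp add: wedge_def model_theta_def algebra_simps)
    moreover have "\<tau> j x \<noteq> \<tau> i x" using inj[OF that(1)] that by (auto simp: inj_on_def)
    ultimately show ?thesis using good[OF that(1)] by simp
  qed
  \<comment> \<open>\<open>c\<close> puts the leading coefficient \<open>\<mu>\<close> of the web into the factor with index 0\<close>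
  define c where "c i = (if i = (0::nat) then \<mu> else 1)" for i
  define \<theta> where "\<theta> i m = c i *s model_theta \<tau> i m" for i m
  have cnz: "c i \<noteq> 0" for i using \<mu> by (simp add: c_def)
  have pull_id: "pull_form (\<lambda>m. m) x a = a" "pull_jacobian (\<lambda>m. m) x = 1" for x a
    by (simp_all add: pull_form_def pull_jacobian_def gradient_eqI[OF pairing_derivative_nth] vec_eq_iff forall_2 axis_def wedge_def)
  have hid: "holomorphic_form (\<lambda>m. m) U" unfolding holomorphic_form_def by (intro allI mholomorphic_nth U)
  have "web_curvature d \<theta> m = pull_jacobian (\<lambda>m. m) m * web_curvature d (model_theta \<tau>) m"
    by (rule web_curvature_pullback[OF hid U U _ m _ h\<theta> w\<theta>, where g="\<lambda>i x. c i"])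
       (auto simp: pull_id \<theta>_def cnz intro!: mholomorphic_const U)
  ultimately have "web_curvature d \<theta> m \<noteq> 0" by (simp add: pull_id)
  moreover have "web_factorization d (legendre_form (projective_form (model d \<nu> \<mu>))) U \<theta>"
    unfolding web_factorization_def
  proof (intro conjI allI impI ballI)
    show "open U" by (rule U)
    show "mholomorphic_on (\<lambda>m. \<theta> i m $ j) U" if "i < d" for i j
      using holomorphic_form_scale[OF U mholomorphic_const[OF U] h\<theta>[OF that]] unfolding \<theta>_def holomorphic_form_def by blast
    show "wedge (\<theta> i x) (\<theta> j x) \<noteq> 0" if "x \<in> U" "i < d" "j < d" "i \<noteq> j" for x i j
      using w\<theta>[OF that] cnz by (simp add: \<theta>_def wedge_simps)
    fix x v assume x: "x \<in> U"
    have c_prod: "(\<Prod>i<d. c i) = \<mu>" using d by (simp add: c_def prod.If_cases)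
    have "legendre_form (projective_form (model d \<nu> \<mu>)) x v = direction_form d \<nu> \<mu> (x $ 1) (v $ 2) (x $ 1 * v $ 2 - x $ 2 * v $ 1)"
      using legendre_model \<nu>d by simp
    also have "\<dots> = \<mu> * (\<Prod>i<d. (x $ 1 * v $ 2 - x $ 2 * v $ 1) - \<tau> i x * v $ 2)"
      by (rule direction_form_factors) (use d \<mu> good[OF x] inj[OF x] root[OF _ x] in unfold_locales, auto)
    also have "(\<Prod>i<d. (x $ 1 * v $ 2 - x $ 2 * v $ 1) - \<tau> i x * v $ 2) = (\<Prod>i<d. pairing (model_theta \<tau> i x) v)"
      by (intro prod.cong) (simp_all add: model_theta_def pairing_def sum_2 algebra_simps)
    finally show "legendre_form (projective_form (model d \<nu> \<mu>)) x v = (\<Prod>i<d. pairing (\<theta> i x) v)"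
      by (simp add: \<theta>_def pairing_simps prod.distrib c_prod)
  qed
  ultimately show ?thesis using m unfolding flat_web_def by blast
qed

section \<open>Linear conjugation\<close>

lemma pullback_mat_1: "pullback (mat 1) \<omega> = \<omega>"
  by (simp add: pullback_def fun_eq_iff transpose_mat)

lemma pullback_pullback: "pullback M (pullback N \<omega>) = pullback (N ** M) \<omega>"
  by (simp add: pullback_def fun_eq_iff matrix_transpose_mul matrix_vector_mul_assoc del: transpose_matrix_vector)

theorem model_legendre_flat_iff:
  assumes "d \<ge> 3" "1 \<le> \<nu>" "\<nu> + 2 \<le> d" and "\<mu> \<noteq> 0"
  shows "legendre_flat d (projective_form (model d \<nu> \<mu>)) \<longleftrightarrow> (\<mu> + 1) * (of_nat d - 1 - of_nat \<nu> * (\<mu> + 1)) = 0"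
proof
  assume "legendre_flat d (projective_form (model d \<nu> \<mu>))"
  then have "flat_web d (legendre_form (pullback (mat 1) (projective_form (model d \<nu> \<mu>))))"
    unfolding legendre_flat_def by (simp add: invertible_det_nz)
  then show "(\<mu> + 1) * (of_nat d - 1 - of_nat \<nu> * (\<mu> + 1)) = 0"
    using model_not_flat_web[OF assms] by (auto simp: pullback_mat_1)
next
  assume "(\<mu> + 1) * (of_nat d - 1 - of_nat \<nu> * (\<mu> + 1)) = 0"
  then show "legendre_flat d (projective_form (model d \<nu> \<mu>))"
    unfolding legendre_flat_def using model_flat_web[OF assms] by blast
qed

lemma legendre_flat_pullback:
  assumes "invertible N"
  shows "legendre_flat d (pullback N \<omega>) \<longleftrightarrow> legendre_flat d \<omega>"
proof -
  obtain N' where N': "N ** N' = mat 1" "N' ** N = mat 1" using assms unfolding invertible_def by blast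
  have "invertible N'" using N' unfolding invertible_def by blast
  show ?thesis
  proof
    assume "legendre_flat d \<omega>"
    then show "legendre_flat d (pullback N \<omega>)"
      unfolding legendre_flat_def pullback_pullback using invertible_mult[OF assms] by blast
  next
    assume *: "legendre_flat d (pullback N \<omega>)"
    show "legendre_flat d \<omega>" unfolding legendre_flat_def
    proof (intro allI impI)
      fix M :: "complex^3^3" assume "invertible M"
      then have "flat_web d (legendre_form (pullback (N' ** M) (pullback N \<omega>)))"
        using * invertible_mult[OF \<open>invertible N'\<close>] unfolding legendre_flat_def by blast
      then show "flat_web d (legendre_form (pullback M \<omega>))"
        by (simp add: pullback_pullback matrix_mul_assoc N')
    qed
  qed
qed

text \<open>A scalar matrix rescales a homogeneous form, so the constant in \<open>same_foliation\<close> can be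
  realised by a change of coordinates.\<close>

lemma scalar_pullback:
  assumes hom: "\<And>c x. \<omega> (c *s x) = c ^ n *s \<omega> x" and c: "c \<noteq> 0"
  obtains N where "invertible N" "pullback N \<omega> = (\<lambda>x. c *s \<omega> x)"
proof -
  obtain s where s: "s ^ (n + 1) = c" using exists_complex_root[of "n + 1" c] by auto
  then have "s \<noteq> 0" using c by auto
  define N :: "complex^3^3" where "N = mat s"
  have N: "N *v x = s *s x" for x
    by (simp add: N_def mat_def matrix_vector_mult_def vec_eq_iff if_distrib if_distribR cong: if_cong)
  have tN: "transpose N = N" by (simp add: N_def transpose_mat)
  have "invertible N" using \<open>s \<noteq> 0\<close> by (simp add: invertible_det_nz N_def det_3 mat_def)
  moreover have "pullback N \<omega> = (\<lambda>x. c *s \<omega> x)"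
    using s by (simp add: pullback_def tN N hom fun_eq_iff vec_eq_iff del: transpose_matrix_vector)
  ultimately show ?thesis using that by blast
qed

lemma linearly_conjugate_flat:
  assumes hom: "\<And>c x. \<omega> (c *s x) = c ^ n *s \<omega> x" and conj: "linearly_conjugate \<omega> \<omega>'"
  shows "legendre_flat d \<omega> \<longleftrightarrow> legendre_flat d \<omega>'"
proof -
  obtain M c where M: "invertible M" "c \<noteq> 0" "\<omega>' = (\<lambda>x. c *s pullback M \<omega> x)"
    using conj unfolding linearly_conjugate_def same_foliation_def by blast
  have "pullback M \<omega> (a *s x) = a ^ n *s pullback M \<omega> x" for a x
    by (simp add: pullback_def matrix_scale hom)
  from scalar_pullback[OF this M(2)] obtain N where N: "invertible N" "pullback N (pullback M \<omega>) = (\<lambda>x. c *s pullback M \<omega> x)"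
    by blast
  show ?thesis
    unfolding M(3) N(2)[symmetric] legendre_flat_pullback[OF N(1)] legendre_flat_pullback[OF M(1)] ..
qed

section \<open>Homogeneous polynomial functions\<close>

lemma finite_exponents: "finite {e :: 'n::finite \<Rightarrow> nat. (\<Sum>i\<in>UNIV. e i) = n}"
proof (rule finite_subset)
  show "{e :: 'n \<Rightarrow> nat. (\<Sum>i\<in>UNIV. e i) = n} \<subseteq> PiE UNIV (\<lambda>_. {..n})"
  proof
    fix e :: "'n \<Rightarrow> nat" assume "e \<in> {e. (\<Sum>i\<in>UNIV. e i) = n}"
    then have "e i \<le> n" for i using member_le_sum[of i UNIV e] by auto
    then show "e \<in> PiE UNIV (\<lambda>_. {..n})" by auto
  qed
qed (auto intro: finite_PiE)

lemma hom_poly_zero: "hom_poly n (\<lambda>x. 0)"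
  unfolding hom_poly_def by (rule exI[of _ "\<lambda>_. 0"]) simp

lemma hom_poly_add: "hom_poly n f \<Longrightarrow> hom_poly n g \<Longrightarrow> hom_poly n (\<lambda>x. f x + g x)"
  unfolding hom_poly_def
proof (elim exE)
  fix c c' assume "f = (\<lambda>x. \<Sum>e | (\<Sum>i\<in>UNIV. e i) = n. c e * (\<Prod>i\<in>UNIV. x $ i ^ e i))"
    "g = (\<lambda>x. \<Sum>e | (\<Sum>i\<in>UNIV. e i) = n. c' e * (\<Prod>i\<in>UNIV. x $ i ^ e i))"
  then show "\<exists>c. (\<lambda>x. f x + g x) = (\<lambda>x. \<Sum>e | (\<Sum>i\<in>UNIV. e i) = n. c e * (\<Prod>i\<in>UNIV. x $ i ^ e i))"
    by (intro exI[of _ "\<lambda>e. c e + c' e"]) (simp add: distrib_right sum.distrib)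
qed

lemma hom_poly_monomial:
  fixes e :: "'n::finite \<Rightarrow> nat"
  assumes "(\<Sum>i\<in>UNIV. e i) = n"
  shows "hom_poly n (\<lambda>x. c * (\<Prod>i\<in>UNIV. x $ i ^ e i))"
  unfolding hom_poly_def
proof (rule exI[of _ "\<lambda>e'. if e' = e then c else 0"], rule ext)
  fix x :: "complex^'n"
  have "(\<Sum>e' | (\<Sum>i\<in>UNIV. e' i) = n. (if e' = e then c else 0) * (\<Prod>i\<in>UNIV. x $ i ^ e' i))
    = (\<Sum>e'\<in>{e}. (if e' = e then c else 0) * (\<Prod>i\<in>UNIV. x $ i ^ e' i))"
    using finite_exponents[of n] assms by (intro sum.mono_neutral_right) auto
  then show "c * (\<Prod>i\<in>UNIV. x $ i ^ e i) = (\<Sum>e' | (\<Sum>i\<in>UNIV. e' i) = n. (if e' = e then c else 0) * (\<Prod>i\<in>UNIV. x $ i ^ e' i))"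
    by simp
qed

lemma hom_poly_sum: "(\<And>i. i \<in> A \<Longrightarrow> hom_poly n (f i)) \<Longrightarrow> hom_poly n (\<lambda>x. \<Sum>i\<in>A. f i x)"
  by (induction A rule: infinite_finite_induct) (auto intro: hom_poly_zero hom_poly_add)

text \<open>Closure properties of homogeneous polynomials are proved by induction over sums of
  monomials, without touching exponent functions again.\<close>

lemma hom_poly_induct [consumes 1, case_names zero add monomial]:
  fixes f :: "complex^'n \<Rightarrow> complex"
  assumes "hom_poly n f" and zero: "\<Phi> (\<lambda>x. 0)" and add: "\<And>f g. \<Phi> f \<Longrightarrow> \<Phi> g \<Longrightarrow> \<Phi> (\<lambda>x. f x + g x)"
    and mon: "\<And>c e. (\<Sum>i\<in>UNIV. e i) = n \<Longrightarrow> \<Phi> (\<lambda>x. c * (\<Prod>i\<in>UNIV. x $ i ^ e i))"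
  shows "\<Phi> f"
proof -
  obtain c where f: "f = (\<lambda>x. \<Sum>e | (\<Sum>i\<in>UNIV. e i) = n. c e * (\<Prod>i\<in>UNIV. x $ i ^ e i))"
    using assms(1) unfolding hom_poly_def by blast
  have "\<Phi> (\<lambda>x. \<Sum>e\<in>A. c e * (\<Prod>i\<in>UNIV. x $ i ^ e i))" if "A \<subseteq> {e. (\<Sum>i\<in>UNIV. e i) = n}" for A
    using finite_subset[OF that finite_exponents] that
    by (induction A rule: finite_induct) (auto intro: zero add mon)
  then show ?thesis unfolding f by simp
qed

lemma hom_poly_mult:
  assumes "hom_poly m f" "hom_poly n g"
  shows "hom_poly (m + n) (\<lambda>x. f x * g x)"
  using assms(1)
proof (induction rule: hom_poly_induct)
  case zero show ?case by (simp add: hom_poly_zero)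
next
  case (add f h) then show ?case by (simp add: distrib_right hom_poly_add)
next
  case (monomial c e)
  from assms(2) show ?case
  proof (induction rule: hom_poly_induct)
    case zero show ?case by (simp add: hom_poly_zero)
  next
    case (add f h) then show ?case by (simp add: distrib_left hom_poly_add)
  next
    case (monomial c' e')
    have "hom_poly (m + n) (\<lambda>x. (c * c') * (\<Prod>i\<in>UNIV. x $ i ^ (e i + e' i)))"
      by (rule hom_poly_monomial) (simp add: sum.distrib monomial \<open>sum e UNIV = m\<close>)
    then show ?case by (simp add: power_add prod.distrib mult_ac)
  qed
qed

lemma hom_poly_const: "hom_poly 0 (\<lambda>x :: complex^'n. c)"
  using hom_poly_monomial[of "\<lambda>_ :: 'n. 0" 0 c] by simp

lemma hom_poly_nth: "hom_poly 1 (\<lambda>x :: complex^'n. x $ i)"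
proof -
  have "hom_poly 1 (\<lambda>x :: complex^'n. 1 * (\<Prod>j\<in>UNIV. x $ j ^ (if j = i then 1 else 0)))"
    by (rule hom_poly_monomial) simp
  moreover have "(\<Prod>j\<in>UNIV. x $ j ^ (if j = i then 1 else 0)) = x $ i" for x :: "complex^'n"
    by (simp add: if_distrib cong: if_cong)
  ultimately show ?thesis by simp
qed

lemma hom_poly_cmult: "hom_poly n f \<Longrightarrow> hom_poly n (\<lambda>x. c * f x)"
  using hom_poly_mult[OF hom_poly_const] by fastforce

lemma hom_poly_minus: "hom_poly n f \<Longrightarrow> hom_poly n (\<lambda>x. - f x)"
  using hom_poly_cmult[of n f "-1"] by simp

lemma hom_poly_diff: "hom_poly n f \<Longrightarrow> hom_poly n g \<Longrightarrow> hom_poly n (\<lambda>x. f x - g x)"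
  using hom_poly_add[OF _ hom_poly_minus] by fastforce

lemma hom_poly_power: "hom_poly n f \<Longrightarrow> hom_poly (k * n) (\<lambda>x. f x ^ k)"
proof (induction k)
  case 0 show ?case using hom_poly_const[of 1] by simp
next
  case (Suc k) then show ?case using hom_poly_mult[of n f "k * n"] by simp
qed

lemma hom_poly_prod:
  "(\<And>i. i \<in> A \<Longrightarrow> hom_poly (n i) (f i)) \<Longrightarrow> hom_poly (\<Sum>i\<in>A. n i) (\<lambda>x. \<Prod>i\<in>A. f i x)"
proof (induction A rule: infinite_finite_induct)
  case (insert a A)
  then show ?case using hom_poly_mult[of "n a" "f a"] by simp
qed (use hom_poly_const[of 1] in simp_all)

lemma hom_poly_linear: "hom_poly 1 (\<lambda>x. (M *v x) $ i)"
  unfolding matrix_vector_mult_def vec_lambda_beta by (intro hom_poly_sum hom_poly_cmult hom_poly_nth)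

lemma hom_poly_substitute:
  fixes M :: "complex^'m^'n"
  assumes "hom_poly n f"
  shows "hom_poly n (\<lambda>x. f (M *v x))"
  using assms
proof (induction rule: hom_poly_induct)
  case zero show ?case by (rule hom_poly_zero)
next
  case (add f h) then show ?case by (rule hom_poly_add)
next
  case (monomial c e)
  have "hom_poly (\<Sum>i\<in>UNIV. e i * 1) (\<lambda>x. \<Prod>i\<in>UNIV. (M *v x) $ i ^ e i)"
    by (intro hom_poly_prod hom_poly_power hom_poly_linear)
  then show ?case using monomial by (simp add: hom_poly_cmult)
qed

lemma hom_poly_scale:
  assumes "hom_poly n f"
  shows "f (c *s x) = c ^ n * f x"
  using assms
proof (induction rule: hom_poly_induct)
  case (add f h) then show ?case by (simp add: distrib_left)
next
  case (monomial a e)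
  then show ?case by (simp add: power_mult_distrib prod.distrib flip: power_sum)
qed simp

lemma hom_poly_pairing: "(\<And>i. hom_poly n (\<lambda>x. \<eta> x $ i)) \<Longrightarrow> hom_poly n (\<lambda>x. pairing u (\<eta> x))"
  unfolding pairing_def by (intro hom_poly_sum hom_poly_cmult)

lemma hom_poly_pairing_scale:
  assumes "\<And>i. hom_poly n (\<lambda>x. \<eta> x $ i)"
  shows "pairing u (\<eta> (c *s x)) = c ^ n * pairing u (\<eta> x)"
  by (rule hom_poly_scale[OF hom_poly_pairing[OF assms]])

lemma binary_form_exists:
  fixes f :: "complex^2 \<Rightarrow> complex"
  assumes "hom_poly n f"
  shows "\<exists>a. \<forall>x. f x = (\<Sum>i\<le>n. a i * x $ 1 ^ (n - i) * x $ 2 ^ i)"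
  using assms
proof (induction rule: hom_poly_induct)
  case zero show ?case by (rule exI[of _ "\<lambda>_. 0"]) simp
next
  case (add f g)
  then obtain a b where "\<forall>x. f x = (\<Sum>i\<le>n. a i * x $ 1 ^ (n - i) * x $ 2 ^ i)"
    "\<forall>x. g x = (\<Sum>i\<le>n. b i * x $ 1 ^ (n - i) * x $ 2 ^ i)" by blast
  then show ?case by (intro exI[of _ "\<lambda>i. a i + b i"]) (simp add: distrib_right sum.distrib)
next
  case (monomial c e)
  have e: "e 1 = n - e 2" "e 2 \<le> n" using monomial by (auto simp: sum_2)
  have "(\<Sum>i\<le>n. (if i = e 2 then c else 0) * x $ 1 ^ (n - i) * x $ 2 ^ i) = c * (x $ 1 ^ e 1 * x $ 2 ^ e 2)" for x :: "complex^2"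
    using e by (simp add: if_distrib if_distribR cong: if_cong)
  then show ?case
    by (intro exI[of _ "\<lambda>i. if i = e 2 then c else 0"]) (simp add: UNIV_2)
qed

lemma hom_poly_binary:
  "hom_poly n (\<lambda>x :: complex^2. \<Sum>i\<le>n. a i * x $ 1 ^ (n - i) * x $ 2 ^ i)"
proof (rule hom_poly_sum)
  fix i assume "i \<in> {..n}"
  then have "hom_poly ((n - i) * 1 + i * 1) (\<lambda>x :: complex^2. (a i * x $ 1 ^ (n - i)) * x $ 2 ^ i)"
    by (intro hom_poly_mult hom_poly_cmult hom_poly_power hom_poly_nth)
  then show "hom_poly n (\<lambda>x :: complex^2. a i * x $ 1 ^ (n - i) * x $ 2 ^ i)" using \<open>i \<in> {..n}\<close> by simp
qed

lemma hom_poly_two_to_three: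
  fixes f :: "complex^2 \<Rightarrow> complex"
  assumes "hom_poly n f"
  shows "hom_poly n (\<lambda>x :: complex^3. f (vector [x $ 1, x $ 2]))"
proof -
  define E :: "complex^3^2" where "E = vector [axis 1 1, axis 2 1]"
  have "E *v x = vector [x $ 1, x $ 2]" for x
    by (simp add: E_def matrix_vector_mult_def vec_eq_iff forall_2 sum_3 axis_def)
  then show ?thesis using hom_poly_substitute[OF assms, of E] by simp
qed

lemma ternary_decomposition:
  fixes f :: "complex^3 \<Rightarrow> complex"
  assumes "hom_poly n f"
  shows "\<exists>g :: nat \<Rightarrow> complex^2 \<Rightarrow> complex. (\<forall>j\<le>n. hom_poly j (g j)) \<and> (\<forall>x. f x = (\<Sum>j\<le>n. g j (vector [x $ 1, x $ 2]) * x $ 3 ^ (n - j)))"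
  using assms
proof (induction rule: hom_poly_induct)
  case zero show ?case by (rule exI[of _ "\<lambda>_ _. 0"]) (simp add: hom_poly_zero)
next
  case (add f g)
  from add.IH(1) obtain u :: "nat \<Rightarrow> complex^2 \<Rightarrow> complex" where "(\<forall>j\<le>n. hom_poly j (u j)) \<and> (\<forall>x. f x = (\<Sum>j\<le>n. u j (vector [x $ 1, x $ 2]) * x $ 3 ^ (n - j)))" ..
  moreover from add.IH(2) obtain v :: "nat \<Rightarrow> complex^2 \<Rightarrow> complex" where "(\<forall>j\<le>n. hom_poly j (v j)) \<and> (\<forall>x. g x = (\<Sum>j\<le>n. v j (vector [x $ 1, x $ 2]) * x $ 3 ^ (n - j)))" ..
  ultimately show ?case
    by (intro exI[of _ "\<lambda>j w. u j w + v j w"]) (simp add: distrib_right sum.distrib hom_poly_add)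
next
  case (monomial c e)
  define k where "k = e 1 + e 2"
  have e: "k \<le> n" "e 3 = n - k" using monomial by (auto simp: sum_3 k_def)
  define g where "g j w = (if j = k then c * (w $ 1 ^ e 1 * w $ 2 ^ e 2) else 0)" for j and w :: "complex^2"
  have "hom_poly (e 1 * 1 + e 2 * 1) (\<lambda>w :: complex^2. w $ 1 ^ e 1 * w $ 2 ^ e 2)"
    by (intro hom_poly_mult hom_poly_power hom_poly_nth)
  then have "hom_poly k (\<lambda>w :: complex^2. c * (w $ 1 ^ e 1 * w $ 2 ^ e 2))"
    unfolding k_def by (intro hom_poly_cmult) simp
  then have "hom_poly j (g j)" for j
    unfolding g_def by (cases "j = k") (simp_all add: hom_poly_zero)
  moreover have "c * (\<Prod>i\<in>UNIV. x $ i ^ e i) = (\<Sum>j\<le>n. g j (vector [x $ 1, x $ 2]) * x $ 3 ^ (n - j))" for x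
  proof -
    have "(\<Sum>j\<le>n. g j (vector [x $ 1, x $ 2]) * x $ 3 ^ (n - j)) = (\<Sum>j\<in>{k}. g j (vector [x $ 1, x $ 2]) * x $ 3 ^ (n - j))"
      using e by (intro sum.mono_neutral_right) (auto simp: g_def)
    also have "\<dots> = c * (x $ 1 ^ e 1 * x $ 2 ^ e 2) * x $ 3 ^ e 3" by (simp add: g_def e(2))
    also have "\<dots> = c * (\<Prod>i\<in>UNIV. x $ i ^ e i)"
    proof -
      have "(\<Prod>i\<in>(UNIV :: 3 set). x $ i ^ e i) = x $ 1 ^ e 1 * (x $ 2 ^ e 2 * x $ 3 ^ e 3)"
        by (simp only: UNIV_3) simp
      then show ?thesis by (simp only: mult.assoc)
    qed
    finally show ?thesis ..
  qed
  ultimately show ?case by (intro exI[of _ g]) simp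
qed

lemma polynomial_coefficients_zero:
  fixes a :: "nat \<Rightarrow> complex"
  assumes "\<And>z. z \<noteq> 0 \<Longrightarrow> (\<Sum>j\<le>n. a j * z ^ j) = 0" and "j \<le> n"
  shows "a j = 0"
proof -
  define p where "p = (\<Sum>j\<le>n. monom (a j) j)"
  have c: "coeff p i = (if i \<le> n then a i else 0)" for i
    by (simp add: p_def coeff_sum if_distrib cong: if_cong)
  have "poly p z = 0" if "z \<noteq> 0" for z using assms(1)[OF that] by (simp add: p_def poly_sum poly_monom)
  then have "{z. z \<noteq> 0} \<subseteq> {z. poly p z = 0}" by auto
  moreover have "infinite {z :: complex. z \<noteq> 0}"
    using infinite_UNIV_char_0[where 'a=complex] by (simp add: Collect_neg_eq finite_Diff2[of "{0}" UNIV, simplified Compl_eq_Diff_UNIV[symmetric]] )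
  ultimately have "infinite {z. poly p z = 0}" using finite_subset by blast
  then have "p = 0" using poly_roots_finite by blast
  then show ?thesis using c[of j] assms(2) by simp
qed

lemma polynomial_coefficients_zero_rev:
  fixes a :: "nat \<Rightarrow> complex"
  assumes "\<And>z. z \<noteq> 0 \<Longrightarrow> (\<Sum>j\<le>n. a j * z ^ (n - j)) = 0" and "j \<le> n"
  shows "a j = 0"
proof -
  have "(\<Sum>j\<le>n. a (n - j) * z ^ j) = 0" if "z \<noteq> 0" for z
  proof -
    have "(\<Sum>j\<le>n. a (n - j) * z ^ j) = (\<Sum>j\<le>n. a j * z ^ (n - j))"
      by (rule sum.reindex_bij_witness[of _ "\<lambda>j. n - j" "\<lambda>j. n - j"]) auto
    then show ?thesis using assms(1)[OF that] by simp
  qed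
  from polynomial_coefficients_zero[where a="\<lambda>j. a (n - j)", OF this, of "n - j"] show ?thesis using assms(2) by simp
qed

text \<open>A binary form is divisible by the linear form of each of its zeros: in a basis starting
  with the zero \<open>w\<close> the leading coefficient vanishes.\<close>

lemma binary_form_root:
  fixes f :: "complex^2 \<Rightarrow> complex"
  assumes f: "hom_poly (Suc n) f" and w: "w \<noteq> 0" "f w = 0"
  shows "\<exists>h. hom_poly n h \<and> (\<forall>x. f x = (w $ 1 * x $ 2 - w $ 2 * x $ 1) * h x)"
proof -
  obtain b where b: "wedge w b = 1"
  proof (cases "w $ 1 = 0")
    case True
    then have "w $ 2 \<noteq> 0" using w by (auto simp: vec_eq_iff forall_2)
    then show ?thesis using that[of "vector [- 1 / w $ 2, 0]"] by (simp add: wedge_def)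
  next
    case False
    then show ?thesis using that[of "vector [0, 1 / w $ 1]"] by (simp add: wedge_def)
  qed
  define N :: "complex^2^2" where "N = vector [vector [w $ 1, b $ 1], vector [w $ 2, b $ 2]]"
  define N' :: "complex^2^2" where "N' = vector [vector [b $ 2, - b $ 1], vector [- w $ 2, w $ 1]]"
  have N: "N *v y = y $ 1 *s w + y $ 2 *s b" for y
    by (simp add: N_def matrix_vector_mult_def sum_2 vec_eq_iff forall_2 mult.commute)
  have N': "N' *v x = vector [wedge x b, wedge w x]" for x
    by (simp add: N'_def matrix_vector_mult_def sum_2 vec_eq_iff forall_2 wedge_def)
  have inv: "N *v (N' *v x) = x" for x
  proof -
    have "(wedge x b * w $ 1 + wedge w x * b $ 1) = wedge w b * x $ 1" "(wedge x b * w $ 2 + wedge w x * b $ 2) = wedge w b * x $ 2"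
      by (simp_all add: wedge_def algebra_simps)
    then show ?thesis using b by (simp add: N N' vec_eq_iff forall_2)
  qed
  obtain a where a: "\<And>y. f (N *v y) = (\<Sum>i\<le>Suc n. a i * y $ 1 ^ (Suc n - i) * y $ 2 ^ i)"
    using binary_form_exists[OF hom_poly_substitute[OF f, of N]] by blast
  have "a 0 = 0"
  proof -
    have "f (N *v vector [1, 0]) = 0" using w by (simp add: N)
    moreover have "(\<Sum>i\<le>Suc n. a i * (1::complex) ^ (Suc n - i) * 0 ^ i) = a 0"
      by (subst sum.atMost_Suc_shift) simp
    ultimately show ?thesis using a[of "vector [1, 0]"] by simp
  qed
  define k where "k y = (\<Sum>i\<le>n. a (Suc i) * y $ 1 ^ (n - i) * y $ 2 ^ i)" for y :: "complex^2"
  have "hom_poly n (\<lambda>x. k (N' *v x))" unfolding k_def[abs_def]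
    by (rule hom_poly_substitute[OF hom_poly_binary])
  moreover have "f x = (w $ 1 * x $ 2 - w $ 2 * x $ 1) * k (N' *v x)" for x
  proof -
    have "f x = (\<Sum>i\<le>Suc n. a i * (N' *v x) $ 1 ^ (Suc n - i) * (N' *v x) $ 2 ^ i)"
      using a[of "N' *v x"] by (simp add: inv)
    also have "\<dots> = (\<Sum>i\<le>n. a (Suc i) * (N' *v x) $ 1 ^ (n - i) * (N' *v x) $ 2 ^ Suc i)"
      by (subst sum.atMost_Suc_shift) (simp add: \<open>a 0 = 0\<close>)
    also have "\<dots> = (N' *v x) $ 2 * k (N' *v x)"
      unfolding k_def sum_distrib_left by (intro sum.cong) auto
    also have "(N' *v x) $ 2 = w $ 1 * x $ 2 - w $ 2 * x $ 1" by (simp add: N' wedge_def mult.commute)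
    finally show ?thesis .
  qed
  ultimately show ?thesis by blast
qed

section \<open>The shape of a homogeneous foliation\<close>

lemma hom_poly_pullback:
  assumes "\<And>i. hom_poly n (\<lambda>x. \<omega> x $ i)"
  shows "hom_poly n (\<lambda>x. pullback M \<omega> x $ i)"
proof -
  have "(\<lambda>x. pullback M \<omega> x $ i) = (\<lambda>x. \<Sum>j\<in>UNIV. M $ j $ i * \<omega> (M *v x) $ j)"
    by (simp add: fun_eq_iff pullback_def matrix_vector_mult_def transpose_def)
  then show ?thesis by (simp only:) (intro hom_poly_sum hom_poly_cmult hom_poly_substitute[of n "\<lambda>x. \<omega> x $ _"] assms)
qed

lemma foliation_pullback:
  assumes "foliation d \<omega>" "invertible M"
  shows "foliation d (pullback M \<omega>)"
  unfolding foliation_def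
proof (intro conjI allI)
  show "hom_poly (d + 1) (\<lambda>x. pullback M \<omega> x $ i)" for i
    by (rule hom_poly_pullback) (use assms(1) in \<open>simp add: foliation_def\<close>)
  show "pairing x (pullback M \<omega> x) = 0" for x
    using assms(1) by (simp add: pairing_pullback foliation_def)
  obtain N where N: "M ** N = mat 1" using assms(2) unfolding invertible_def by blast
  show "no_common_factor (pullback M \<omega>)"
    unfolding no_common_factor_def
  proof (rule notI, elim exE conjE)
    fix m n R Q assume *: "m \<ge> 1" "hom_poly m R" "\<forall>i. hom_poly n (\<lambda>x. Q x $ i)" "pullback M \<omega> = (\<lambda>x. R x *s Q x)"
    have "\<omega> = pullback N (pullback M \<omega>)" by (simp add: pullback_pullback N pullback_mat_1)
    also have "\<dots> = (\<lambda>x. R (N *v x) *s pullback N Q x)"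
      unfolding *(4) by (simp add: pullback_def matrix_scale fun_eq_iff)
    finally have "\<omega> = (\<lambda>x. R (N *v x) *s pullback N Q x)" .
    moreover have "hom_poly m (\<lambda>x. R (N *v x))" by (rule hom_poly_substitute[OF *(2)])
    moreover have "\<forall>i. hom_poly n (\<lambda>x. pullback N Q x $ i)" using hom_poly_pullback *(3) by blast
    ultimately have "\<not> no_common_factor \<omega>" unfolding no_common_factor_def using *(1)
      by (intro notI, elim notE) (intro exI conjI; assumption)
    then show False using assms(1) by (simp add: foliation_def)
  qed
qed

lemma hom_poly_zero_off_line:
  fixes f :: "complex^2 \<Rightarrow> complex"
  assumes "hom_poly n f" "\<And>x. x $ 2 \<noteq> 0 \<Longrightarrow> f x = 0"
  shows "f x = 0"
proof -
  obtain a where a: "\<And>x. f x = (\<Sum>i\<le>n. a i * x $ 1 ^ (n - i) * x $ 2 ^ i)"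
    using binary_form_exists[OF assms(1)] by blast
  have "a i = 0" if "i \<le> n" for i
  proof (rule polynomial_coefficients_zero[OF _ that])
    fix z :: complex assume "z \<noteq> 0"
    then show "(\<Sum>j\<le>n. a j * z ^ j) = 0"
      using assms(2)[of "vector [1, z]"] a[of "vector [1, z]"] by simp
  qed
  then show ?thesis using a by simp
qed

text \<open>Comparing coefficients of the powers of \<open>x $ 3\<close> shows which parts of an expansion can be
  multiplied by the same constant under the homothety.\<close>

lemma homothety_weights:
  fixes g :: "nat \<Rightarrow> complex^2 \<Rightarrow> complex"
  assumes g: "\<And>j. j \<le> n \<Longrightarrow> hom_poly j (g j)"
    and f: "\<And>x. f x = (\<Sum>j\<le>n. g j (vector [x $ 1, x $ 2]) * x $ 3 ^ (n - j))"
    and eq: "\<And>x :: complex^3. k * f (vector [2 * x $ 1, 2 * x $ 2, x $ 3]) = c * f x"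
    and j: "j \<le> n"
  shows "k * 2 ^ j * g j w = c * g j w"
proof -
  have "(k * 2 ^ j - c) * g j w = 0"
  proof (rule polynomial_coefficients_zero_rev[OF _ j])
    fix z :: complex assume "z \<noteq> 0"
    have w2: "vector [2 * w $ 1, 2 * w $ 2] = 2 *s w" "vector [w $ 1, w $ 2] = w" by (simp_all add: vec_eq_iff forall_2)
    have "k * (\<Sum>j\<le>n. g j (2 *s w) * z ^ (n - j)) = c * (\<Sum>j\<le>n. g j w * z ^ (n - j))"
      using eq[of "vector [w $ 1, w $ 2, z]"] by (simp add: f w2)
    moreover have "(\<Sum>j\<le>n. g j (2 *s w) * z ^ (n - j)) = (\<Sum>j\<le>n. 2 ^ j * g j w * z ^ (n - j))"
      using hom_poly_scale[OF g] by (intro sum.cong) auto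
    ultimately show "(\<Sum>j\<le>n. (k * 2 ^ j - c) * g j w * z ^ (n - j)) = 0"
      by (simp add: left_diff_distrib sum_subtractf sum_distrib_left mult.assoc)
  qed
  then show ?thesis by (simp add: algebra_simps)
qed

lemma no_common_factorD:
  assumes "no_common_factor \<omega>" "m \<ge> 1" "hom_poly m R" "\<And>i. hom_poly n (\<lambda>x. Q x $ i)" "\<And>x. \<omega> x = R x *s Q x"
  shows False
  using assms unfolding no_common_factor_def by blast

lemma hom_poly_vector3:
  "hom_poly n f \<Longrightarrow> hom_poly n g \<Longrightarrow> hom_poly n h \<Longrightarrow> hom_poly n (\<lambda>x :: complex^3. (vector [f x, g x, h x] :: complex^3) $ i)"
  using exhaust_3[of i] by auto

text \<open>Invariance under a single homothety of infinite order leaves one term in the expansion of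
  the first two coefficients in powers of \<open>x $ 3\<close>, say the term of degree \<open>j0\<close> in
  \<open>(x $ 1, x $ 2)\<close>. The identity \<open>x \<alpha> + y \<beta> + z \<gamma> = 0\<close> then shows that for \<open>j0 = d + 1\<close> the
  coefficients share a factor of degree \<open>d\<close> and that for \<open>j0 < d\<close> they are all divisible by
  \<open>x $ 3\<close>. For \<open>j0 = d\<close> the form is the projective form of a binary one; a zero of the latter
  would produce a common linear factor.\<close>

theorem homogeneous_normal_form:
  assumes fol: "foliation d \<omega>" and d: "d \<ge> 1"
    and inv: "same_foliation \<omega> (pullback (homothety 2) \<omega>)"
  obtains \<eta> where "\<And>i. hom_poly d (\<lambda>w. \<eta> w $ i)" "\<omega> = projective_form \<eta>" "\<And>w. w \<noteq> 0 \<Longrightarrow> \<eta> w \<noteq> 0"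
proof -
  let ?v = "\<lambda>x :: complex^3. vector [x $ 1, x $ 2] :: complex^2"
  let ?n = "d + 1"
  have hom: "hom_poly ?n (\<lambda>x. \<omega> x $ i)" and ncf: "no_common_factor \<omega>" and inc: "pairing x (\<omega> x) = 0" for i x
    using fol by (auto simp: foliation_def)
  obtain A where A: "\<And>j. j \<le> ?n \<Longrightarrow> hom_poly j (A j)" "\<And>x. \<omega> x $ 1 = (\<Sum>j\<le>?n. A j (?v x) * x $ 3 ^ (?n - j))"
    using ternary_decomposition[OF hom[of 1]] by blast
  obtain B where B: "\<And>j. j \<le> ?n \<Longrightarrow> hom_poly j (B j)" "\<And>x. \<omega> x $ 2 = (\<Sum>j\<le>?n. B j (?v x) * x $ 3 ^ (?n - j))"
    using ternary_decomposition[OF hom[of 2]] by blast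
  obtain G where G: "\<And>j. j \<le> ?n \<Longrightarrow> hom_poly j (G j)" "\<And>x. \<omega> x $ 3 = (\<Sum>j\<le>?n. G j (?v x) * x $ 3 ^ (?n - j))"
    using ternary_decomposition[OF hom[of 3]] by blast
  have vw: "vector [w $ 1, w $ 2] = w" for w :: "complex^2" by (simp add: vec_eq_iff forall_2)
  have inc': "x $ 1 * \<omega> x $ 1 + x $ 2 * \<omega> x $ 2 + x $ 3 * \<omega> x $ 3 = 0" for x
    using inc[of x] by (simp add: pairing_def sum_3)
  obtain c where c: "pullback (homothety 2) \<omega> = (\<lambda>x. c *s \<omega> x)"
    using inv unfolding same_foliation_def by blast
  have H: "homothety 2 *v x = vector [2 * x $ 1, 2 * x $ 2, x $ 3]" for x
    by (simp add: homothety_def matrix_vector_mult_def sum_3 vec_eq_iff forall_3)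
  have pb: "pullback (homothety 2) \<omega> x = vector [2 * \<omega> (homothety 2 *v x) $ 1, 2 * \<omega> (homothety 2 *v x) $ 2, \<omega> (homothety 2 *v x) $ 3]" for x
    by (simp add: pullback_def homothety_def matrix_vector_mult_def transpose_def sum_3 vec_eq_iff forall_3)
  have eq1: "2 * \<omega> (vector [2 * x $ 1, 2 * x $ 2, x $ 3]) $ 1 = c * \<omega> x $ 1"
    and eq2: "2 * \<omega> (vector [2 * x $ 1, 2 * x $ 2, x $ 3]) $ 2 = c * \<omega> x $ 2" for x
    using fun_cong[OF c, of x] unfolding pb H by (simp_all add: vec_eq_iff forall_3)
  have wA: "2 * 2 ^ j * A j w = c * A j w" and wB: "2 * 2 ^ j * B j w = c * B j w" if "j \<le> ?n" for j w
  proof -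
    show "2 * 2 ^ j * A j w = c * A j w"
      by (rule homothety_weights[where f="\<lambda>x. \<omega> x $ 1" and g=A and n="?n"]) (fact A eq1 that)+
    show "2 * 2 ^ j * B j w = c * B j w"
      by (rule homothety_weights[where f="\<lambda>x. \<omega> x $ 2" and g=B and n="?n"]) (fact B eq2 that)+
  qed
  have G_zero: "\<omega> x $ 3 = 0" if z: "\<And>x. x $ 3 \<noteq> 0 \<Longrightarrow> \<omega> x $ 3 = 0" for x
  proof -
    have "G j w = 0" if "j \<le> ?n" for j w
    proof (rule polynomial_coefficients_zero_rev[OF _ that])
      fix y :: complex assume "y \<noteq> 0"
      then show "(\<Sum>j\<le>?n. G j w * y ^ (?n - j)) = 0"
        using z[of "vector [w $ 1, w $ 2, y]"] G(2)[of "vector [w $ 1, w $ 2, y]"] by (simp add: vw)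
    qed
    then show ?thesis by (simp add: G(2))
  qed
  show ?thesis
  proof (cases "\<exists>j w. j \<le> ?n \<and> (A j w \<noteq> 0 \<or> B j w \<noteq> 0)")
    case False
    then have 0: "\<omega> x $ 1 = 0" "\<omega> x $ 2 = 0" for x by (simp_all add: A(2) B(2))
    have "\<omega> x $ 3 = 0" for x
    proof (rule G_zero)
      fix y :: "complex^3" assume "y $ 3 \<noteq> 0"
      then show "\<omega> y $ 3 = 0" using inc'[of y] 0 by simp
    qed
    then have "\<omega> x = x $ 1 *s (0 :: complex^3)" for x using 0 by (simp add: vec_eq_iff forall_3)
    from no_common_factorD[OF ncf order_refl hom_poly_nth, of 0 "\<lambda>x. 0", OF _ this] show ?thesis
      by (simp add: hom_poly_zero)
  next
    case True
    then obtain j0 w0 where j0: "j0 \<le> ?n" "A j0 w0 \<noteq> 0 \<or> B j0 w0 \<noteq> 0" by blast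
    have c0: "c = 2 * 2 ^ j0" using wA[OF j0(1), of w0] wB[OF j0(1), of w0] j0(2) by auto
    have pow: "(2::complex) ^ j \<noteq> 2 ^ j0" if "j \<noteq> j0" for j
    proof
      assume "(2::complex) ^ j = 2 ^ j0"
      then have "of_nat (2 ^ j) = (of_nat (2 ^ j0) :: complex)" by simp
      then have "(2::nat) ^ j = 2 ^ j0" by (simp only: of_nat_eq_iff)
      then show False using that by simp
    qed
    have z: "A j w = 0" "B j w = 0" if "j \<le> ?n" "j \<noteq> j0" for j w
      using wA[OF that(1), of w] wB[OF that(1), of w] pow[OF that(2)] unfolding c0 by auto
    have a: "\<omega> x $ 1 = A j0 (?v x) * x $ 3 ^ (?n - j0)" and b: "\<omega> x $ 2 = B j0 (?v x) * x $ 3 ^ (?n - j0)" for x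
    proof -
      have "(\<Sum>j\<le>?n. A j (?v x) * x $ 3 ^ (?n - j)) = (\<Sum>j\<in>{j0}. A j (?v x) * x $ 3 ^ (?n - j))"
        "(\<Sum>j\<le>?n. B j (?v x) * x $ 3 ^ (?n - j)) = (\<Sum>j\<in>{j0}. B j (?v x) * x $ 3 ^ (?n - j))"
        by (intro sum.mono_neutral_right; use j0(1) z in simp)+
      then show "\<omega> x $ 1 = A j0 (?v x) * x $ 3 ^ (?n - j0)" "\<omega> x $ 2 = B j0 (?v x) * x $ 3 ^ (?n - j0)"
        by (simp_all add: A(2) B(2))
    qed
    define E where "E w = w $ 1 * A j0 w + w $ 2 * B j0 w" for w :: "complex^2"
    have hE: "hom_poly (1 + j0) E" unfolding E_def[abs_def]
      by (intro hom_poly_add hom_poly_mult hom_poly_nth A(1) B(1) j0(1))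
    have E: "E (?v x) * x $ 3 ^ (?n - j0) + x $ 3 * \<omega> x $ 3 = 0" for x
      using inc'[of x] unfolding a b by (simp add: E_def algebra_simps)
    \<comment> \<open>the weight \<open>j0\<close> must be \<open>d\<close>; the other two cases contradict \<open>no_common_factor\<close>\<close>
    consider "j0 = ?n" | "j0 < d" | "j0 = d" using j0(1) by linarith
    then show ?thesis
    proof cases
      case 1
      have E0: "E w = 0" for w using E[of "vector [w $ 1, w $ 2, 0]"] 1 by (simp add: vw)
      have g: "\<omega> x $ 3 = 0" for x
      proof (rule G_zero)
        fix y :: "complex^3" assume "y $ 3 \<noteq> 0"
        then show "\<omega> y $ 3 = 0" using E[of y] by (simp add: E0)
      qed
      have hA: "hom_poly (Suc d) (A j0)" and hB: "hom_poly (Suc d) (B j0)" using A(1)[OF j0(1)] B(1)[OF j0(1)] 1 by auto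
      have "A j0 (vector [1, 0]) = 0" using E0[of "vector [1, 0]"] by (simp add: E_def)
      moreover have "vector [1, 0] \<noteq> (0 :: complex^2)" by (simp add: vec_eq_iff forall_2)
      ultimately obtain h where h: "hom_poly d h" "\<And>x. A j0 x = x $ 2 * h x"
        using binary_form_root[OF hA, of "vector [1, 0]"] by auto
      have "B j0 x + x $ 1 * h x = 0" for x
      proof (rule hom_poly_zero_off_line[of "Suc d"])
        show "hom_poly (Suc d) (\<lambda>x. B j0 x + x $ 1 * h x)"
          using hom_poly_mult[OF hom_poly_nth h(1)] by (intro hom_poly_add hB) simp
        fix x :: "complex^2" assume "x $ 2 \<noteq> 0"
        moreover have "x $ 2 * (B j0 x + x $ 1 * h x) = 0" using E0[of x] by (simp add: E_def h(2) algebra_simps)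
        ultimately show "B j0 x + x $ 1 * h x = 0" by simp
      qed
      then have Bh: "B j0 x = - (x $ 1 * h x)" for x by (simp add: eq_neg_iff_add_eq_0)
      have e: "?n - j0 = 0" using 1 by simp
      have "\<omega> x = h (?v x) *s vector [x $ 2, - x $ 1, 0]" for x
        unfolding vec_eq_iff forall_3 vector_smult_component vector_3 a b g h(2) Bh e by simp
      moreover have "hom_poly 1 (\<lambda>x :: complex^3. (vector [x $ 2, - x $ 1, 0] :: complex^3) $ i)" for i
        by (intro hom_poly_vector3 hom_poly_nth hom_poly_minus hom_poly_zero)
      ultimately have False
        by (intro no_common_factorD[OF ncf d hom_poly_two_to_three[OF h(1)],
              where Q = "\<lambda>x. vector [x $ 2, - x $ 1, 0]" and n = 1])
      then show ?thesis ..
    next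
      case 2
      have g: "\<omega> x $ 3 = - (E (?v x)) * x $ 3 ^ (d - j0)" for x
      proof -
        have "G j w + (if j = j0 + 1 then E w else 0) = 0" if "j \<le> ?n" for j w
        proof (rule polynomial_coefficients_zero_rev[OF _ that])
          fix y :: complex assume y: "y \<noteq> 0"
          have "E w * y ^ (?n - j0) + y * (\<Sum>j\<le>?n. G j w * y ^ (?n - j)) = 0"
            using E[of "vector [w $ 1, w $ 2, y]"] G(2)[of "vector [w $ 1, w $ 2, y]"] by (simp add: vw)
          moreover have "?n - j0 = Suc (d - j0)" using 2 by simp
          ultimately have "y * (E w * y ^ (d - j0) + (\<Sum>j\<le>?n. G j w * y ^ (?n - j))) = 0" by (simp add: algebra_simps)
          moreover have "(\<Sum>j\<le>?n. (if j = j0 + 1 then E w else 0) * y ^ (?n - j)) = E w * y ^ (d - j0)"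
            using 2 by (simp add: if_distribR if_distrib cong: if_cong)
          ultimately show "(\<Sum>j\<le>?n. (G j w + (if j = j0 + 1 then E w else 0)) * y ^ (?n - j)) = 0"
            using y by (simp add: distrib_right sum.distrib add.commute)
        qed
        note Gj0 = this
        have Gj: "G j w = (if j = j0 + 1 then - E w else 0)" if "j \<le> ?n" for j w
          using Gj0[OF that, of w] by (cases "j = j0 + 1") (simp_all add: eq_neg_iff_add_eq_0)
        have "\<omega> x $ 3 = (\<Sum>j\<le>?n. (if j = j0 + 1 then - E (?v x) else 0) * x $ 3 ^ (?n - j))"
          unfolding G(2) by (intro sum.cong) (simp_all add: Gj)
        then show ?thesis using 2 by (simp add: if_distribR if_distrib cong: if_cong)
      qed
      define q where "q x = (vector [A j0 (?v x) * x $ 3 ^ (d - j0), B j0 (?v x) * x $ 3 ^ (d - j0), - (E (?v x)) * x $ 3 ^ (d - j0 - 1)] :: complex^3)" for x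
      have "?n - j0 = Suc (d - j0)" "d - j0 = Suc (d - j0 - 1)" using 2 by auto
      then have "\<omega> x = x $ 3 *s q x" for x
        unfolding q_def vec_eq_iff forall_3 vector_smult_component vector_3 a b g by (simp only: power_Suc mult_ac) simp
      moreover have "hom_poly d (\<lambda>x. q x $ i)" for i
        unfolding q_def
      proof (rule hom_poly_vector3)
        have p: "hom_poly (k * 1) (\<lambda>x :: complex^3. x $ 3 ^ k)" for k by (intro hom_poly_power hom_poly_nth)
        show "hom_poly d (\<lambda>x. A j0 (?v x) * x $ 3 ^ (d - j0))" "hom_poly d (\<lambda>x. B j0 (?v x) * x $ 3 ^ (d - j0))"
          using hom_poly_mult[OF hom_poly_two_to_three[OF A(1)[OF j0(1)]] p[of "d - j0"]]
            hom_poly_mult[OF hom_poly_two_to_three[OF B(1)[OF j0(1)]] p[of "d - j0"]] 2 by simp_all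
        show "hom_poly d (\<lambda>x. - E (?v x) * x $ 3 ^ (d - j0 - 1))"
          using hom_poly_mult[OF hom_poly_minus[OF hom_poly_two_to_three[OF hE]] p[of "d - j0 - 1"]] 2 by simp
      qed
      ultimately have False by (intro no_common_factorD[OF ncf order_refl hom_poly_nth, where Q = q])
      then show ?thesis ..
    next
      case 3
      define \<eta> where "\<eta> w = (vector [A d w, B d w] :: complex^2)" for w
      have h\<eta>: "hom_poly d (\<lambda>w. \<eta> w $ i)" for i
        using exhaust_2[of i] A(1)[of d] B(1)[of d] by (auto simp: \<eta>_def)
      have g: "\<omega> x $ 3 + E (?v x) = 0" for x
      proof -
        have z: "\<omega> x $ 3 + E (?v x) = 0" if "x $ 3 \<noteq> 0" for x
        proof -
          have "x $ 3 * (\<omega> x $ 3 + E (?v x)) = 0" using E[of x] 3 by (simp add: algebra_simps)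
          then show ?thesis using that by (metis mult_eq_0_iff)
        qed
        have "G j w + (if j = ?n then E w else 0) = 0" if "j \<le> ?n" for j w
        proof (rule polynomial_coefficients_zero_rev[OF _ that])
          fix y :: complex assume y: "y \<noteq> 0"
          have "(\<Sum>j\<le>?n. (if j = ?n then E w else 0) * y ^ (?n - j)) = E w"
            by (simp add: if_distribR if_distrib cong: if_cong)
          then show "(\<Sum>j\<le>?n. (G j w + (if j = ?n then E w else 0)) * y ^ (?n - j)) = 0"
            using z[of "vector [w $ 1, w $ 2, y]"] G(2)[of "vector [w $ 1, w $ 2, y]"] y
            by (simp only: distrib_right sum.distrib) (simp add: vw)
        qed
        note Gj0 = this
        have Gj: "G j w = (if j = ?n then - E w else 0)" if "j \<le> ?n" for j w
          using Gj0[OF that, of w] by (cases "j = ?n") (simp_all add: eq_neg_iff_add_eq_0)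
        have "\<omega> x $ 3 = (\<Sum>j\<le>?n. (if j = ?n then - E (?v x) else 0) * x $ 3 ^ (?n - j))"
          unfolding G(2) by (intro sum.cong) (simp_all add: Gj)
        then show ?thesis by (simp add: if_distribR if_distrib cong: if_cong)
      qed
      have \<omega>: "\<omega> = projective_form \<eta>"
      proof
        fix x
        have "\<omega> x $ 3 = - E (?v x)" using g[of x] by (simp add: eq_neg_iff_add_eq_0)
        then show "\<omega> x = projective_form \<eta> x"
          using 3 by (simp add: projective_form_def Let_def \<eta>_def vec_eq_iff forall_3 a b E_def mult.commute)
      qed
      have "\<eta> w \<noteq> 0" if w: "w \<noteq> 0" for w
      proof
        assume "\<eta> w = 0"
        then have AB: "A d w = 0" "B d w = 0" by (simp_all add: \<eta>_def vec_eq_iff forall_2)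
        obtain d' where d': "d = Suc d'" using d by (cases d) auto
        obtain h where h: "hom_poly d' h" "\<And>x. A d x = (w $ 1 * x $ 2 - w $ 2 * x $ 1) * h x"
          using binary_form_root[of d' "A d", OF _ w AB(1)] A(1)[of d] d' by auto
        obtain k where k: "hom_poly d' k" "\<And>x. B d x = (w $ 1 * x $ 2 - w $ 2 * x $ 1) * k x"
          using binary_form_root[of d' "B d", OF _ w AB(2)] B(1)[of d] d' by auto
        define q where "q x = (vector [x $ 3 * h (?v x), x $ 3 * k (?v x), - (x $ 1 * h (?v x) + x $ 2 * k (?v x))] :: complex^3)" for x
        have "\<omega> x = (w $ 1 * x $ 2 - w $ 2 * x $ 1) *s q x" for x
          by (simp add: \<omega> projective_form_def Let_def \<eta>_def q_def vec_eq_iff forall_3 h k algebra_simps)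
        moreover have "hom_poly 1 (\<lambda>x :: complex^3. w $ 1 * x $ 2 - w $ 2 * x $ 1)"
          by (intro hom_poly_diff hom_poly_cmult hom_poly_nth)
        moreover have "hom_poly (1 + d') (\<lambda>x. q x $ i)" for i
          unfolding q_def
          by (intro hom_poly_vector3 hom_poly_minus hom_poly_add hom_poly_mult hom_poly_nth hom_poly_two_to_three h(1) k(1))
        ultimately show False by (intro no_common_factorD[OF ncf order_refl, where Q = q])
      qed
      with that h\<eta> \<omega> show ?thesis by blast
    qed
  qed
qed

section \<open>Vanishing orders of polynomial vector fields\<close>

text \<open>Polynomials with coefficient array \<open>c\<close>. Arrays supported below \<open>N\<close> are stable under
  shifts, so one bound serves all derivatives.\<close>

definition bipoly :: "(nat \<Rightarrow> nat \<Rightarrow> complex) \<Rightarrow> nat \<Rightarrow> complex^2 \<Rightarrow> complex" where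
  "bipoly c N w = (\<Sum>a\<le>N. \<Sum>b\<le>N. c a b * w $ 1 ^ a * w $ 2 ^ b)"

definition bipoly_support :: "(nat \<Rightarrow> nat \<Rightarrow> complex) \<Rightarrow> nat \<Rightarrow> bool" where
  "bipoly_support c N \<longleftrightarrow> (\<forall>a b. a > N \<or> b > N \<longrightarrow> c a b = 0)"

lemma sum_shift:
  fixes f :: "nat \<Rightarrow> complex"
  assumes "f 0 = 0" "f (Suc N) = 0"
  shows "(\<Sum>a\<le>N. f a) = (\<Sum>a\<le>N. f (Suc a))"
  using sum.atMost_Suc_shift[of f N] sum.atMost_Suc[of f N] assms by simp

lemma partial_deriv_bipoly:
  assumes "bipoly_support c N"
  shows "partial_deriv 1 (bipoly c N) = bipoly (\<lambda>a b. of_nat (Suc a) * c (Suc a) b) N"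
    and "partial_deriv 2 (bipoly c N) = bipoly (\<lambda>a b. of_nat (Suc b) * c a (Suc b)) N"
proof -
  have 1: "(x + axis 1 t) $ 1 = x $ 1 + t" "(x + axis 1 t) $ 2 = x $ 2" "(x + axis 2 t) $ 1 = x $ 1" "(x + axis 2 t) $ 2 = x $ 2 + t"
    for x :: "complex^2" and t by (simp_all add: axis_def)
  show "partial_deriv 1 (bipoly c N) = bipoly (\<lambda>a b. of_nat (Suc a) * c (Suc a) b) N"
  proof
    fix x :: "complex^2"
    have "((\<lambda>t. \<Sum>a\<le>N. \<Sum>b\<le>N. c a b * (x $ 1 + t) ^ a * x $ 2 ^ b) has_field_derivative
        (\<Sum>a\<le>N. \<Sum>b\<le>N. c a b * (of_nat a * (x $ 1 + 0) ^ (a - Suc 0)) * x $ 2 ^ b)) (at 0)"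
      by (auto intro!: derivative_eq_intros sum.cong)
    then have "partial_deriv 1 (bipoly c N) x = (\<Sum>a\<le>N. \<Sum>b\<le>N. c a b * (of_nat a * (x $ 1 + 0) ^ (a - Suc 0)) * x $ 2 ^ b)"
      unfolding partial_deriv_def bipoly_def 1 by (rule DERIV_imp_deriv)
    also have "\<dots> = (\<Sum>a\<le>N. \<Sum>b\<le>N. c (Suc a) b * (of_nat (Suc a) * (x $ 1 + 0) ^ a) * x $ 2 ^ b)"
      by (subst sum_shift) (use assms in \<open>auto simp: bipoly_support_def\<close>)
    finally show "partial_deriv 1 (bipoly c N) x = bipoly (\<lambda>a b. of_nat (Suc a) * c (Suc a) b) N x"
      by (simp add: bipoly_def mult_ac)
  qed
  show "partial_deriv 2 (bipoly c N) = bipoly (\<lambda>a b. of_nat (Suc b) * c a (Suc b)) N"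
  proof
    fix x :: "complex^2"
    have "((\<lambda>t. \<Sum>a\<le>N. \<Sum>b\<le>N. c a b * x $ 1 ^ a * (x $ 2 + t) ^ b) has_field_derivative
        (\<Sum>a\<le>N. \<Sum>b\<le>N. c a b * x $ 1 ^ a * (of_nat b * (x $ 2 + 0) ^ (b - Suc 0)))) (at 0)"
      by (auto intro!: derivative_eq_intros sum.cong)
    then have "partial_deriv 2 (bipoly c N) x = (\<Sum>a\<le>N. \<Sum>b\<le>N. c a b * x $ 1 ^ a * (of_nat b * (x $ 2 + 0) ^ (b - Suc 0)))"
      unfolding partial_deriv_def bipoly_def 1 by (rule DERIV_imp_deriv)
    also have "\<dots> = (\<Sum>a\<le>N. \<Sum>b\<le>N. c a (Suc b) * x $ 1 ^ a * (of_nat (Suc b) * (x $ 2 + 0) ^ b))"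
      by (rule sum.cong[OF refl], subst sum_shift) (use assms in \<open>auto simp: bipoly_support_def\<close>)
    finally show "partial_deriv 2 (bipoly c N) x = bipoly (\<lambda>a b. of_nat (Suc b) * c a (Suc b)) N x"
      by (simp add: bipoly_def mult_ac)
  qed
qed

lemma iterated_partial_deriv_bipoly:
  assumes "bipoly_support c N"
  shows "\<exists>K. (\<forall>a b. K a b \<noteq> 0) \<and> (partial_deriv 1 ^^ i) ((partial_deriv 2 ^^ j) (bipoly c N)) = bipoly (\<lambda>a b. K a b * c (a + i) (b + j)) N"
proof (induction i)
  case 0
  show ?case
  proof (induction j)
    case 0 show ?case by (rule exI[of _ "\<lambda>_ _. 1"]) simp
  next
    case (Suc j)
    then obtain K where K: "\<forall>a b. K a b \<noteq> 0" "(partial_deriv 2 ^^ j) (bipoly c N) = bipoly (\<lambda>a b. K a b * c a (b + j)) N" by auto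
    have "bipoly_support (\<lambda>a b. K a b * c a (b + j)) N" using assms by (auto simp: bipoly_support_def)
    from partial_deriv_bipoly(2)[OF this] K show ?case
      by (intro exI[of _ "\<lambda>a b. of_nat (Suc b) * K a (Suc b)"]) (auto simp: mult.assoc simp del: of_nat_Suc)
  qed
next
  case (Suc i)
  then obtain K where K: "\<forall>a b. K a b \<noteq> 0" "(partial_deriv 1 ^^ i) ((partial_deriv 2 ^^ j) (bipoly c N)) = bipoly (\<lambda>a b. K a b * c (a + i) (b + j)) N" by auto
  have "bipoly_support (\<lambda>a b. K a b * c (a + i) (b + j)) N" using assms by (auto simp: bipoly_support_def)
  from partial_deriv_bipoly(1)[OF this] K show ?case
    by (intro exI[of _ "\<lambda>a b. of_nat (Suc a) * K (Suc a) b"]) (auto simp: mult.assoc simp del: of_nat_Suc)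
qed

lemma bipoly_at_0: "bipoly c N 0 = c 0 0"
proof -
  have "bipoly c N 0 = (\<Sum>a\<le>N. if a = 0 then c 0 0 else 0)"
    unfolding bipoly_def by (rule sum.cong) (auto simp: power_0_left if_distrib cong: if_cong)
  then show ?thesis by simp
qed

lemma iterated_partial_deriv_zero_iff:
  assumes "bipoly_support c N"
  shows "(partial_deriv 1 ^^ i) ((partial_deriv 2 ^^ j) (bipoly c N)) 0 = 0 \<longleftrightarrow> c i j = 0"
  using iterated_partial_deriv_bipoly[OF assms, of i j] by (auto simp: bipoly_at_0)

text \<open>Since \<open>f\<close> is not zero, some derivative of order \<open>d\<close> survives at the origin, so the order
  is attained; no derivative of order 1 does, because there is no linear part.\<close>

lemma vanishing_order_not_1:
  assumes d: "d \<ge> 2" and X: "\<And>w k. X w $ k = f k w + g k w"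
    and f: "\<And>k. hom_poly d (f k)" and g: "\<And>k. hom_poly (d + 1) (g k)" and nz: "f k0 w0 \<noteq> 0"
  shows "vanishing_order X \<noteq> 1"
proof -
  obtain \<alpha> where \<alpha>: "\<And>k x. f k x = (\<Sum>i\<le>d. \<alpha> k i * x $ 1 ^ (d - i) * x $ 2 ^ i)"
    using binary_form_exists[OF f] by metis
  obtain \<beta> where \<beta>: "\<And>k x. g k x = (\<Sum>i\<le>d+1. \<beta> k i * x $ 1 ^ (d + 1 - i) * x $ 2 ^ i)"
    using binary_form_exists[OF g] by metis
  define N where "N = d + 1"
  have hom: "(\<Sum>i\<le>n. \<gamma> i * x $ 1 ^ (n - i) * x $ 2 ^ i) = bipoly (\<lambda>a b. if a + b = n then \<gamma> b else 0) N x" if "n \<le> N" for n \<gamma> and x :: "complex^2"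
  proof -
    have "bipoly (\<lambda>a b. if a + b = n then \<gamma> b else 0) N x = (\<Sum>b\<le>N. \<Sum>a\<le>N. (if a + b = n then \<gamma> b else 0) * x $ 1 ^ a * x $ 2 ^ b)"
      unfolding bipoly_def by (rule sum.swap)
    also have "\<dots> = (\<Sum>b\<le>N. if b \<le> n then \<gamma> b * x $ 1 ^ (n - b) * x $ 2 ^ b else 0)"
    proof (rule sum.cong[OF refl])
      fix b
      show "(\<Sum>a\<le>N. (if a + b = n then \<gamma> b else 0) * x $ 1 ^ a * x $ 2 ^ b) = (if b \<le> n then \<gamma> b * x $ 1 ^ (n - b) * x $ 2 ^ b else 0)"
      proof (cases "b \<le> n")
        case True
        have "(\<Sum>a\<le>N. (if a + b = n then \<gamma> b else 0) * x $ 1 ^ a * x $ 2 ^ b) = (\<Sum>a\<in>{n - b}. (if a + b = n then \<gamma> b else 0) * x $ 1 ^ a * x $ 2 ^ b)"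
          using True \<open>n \<le> N\<close> by (intro sum.mono_neutral_right) auto
        then show ?thesis using True by simp
      qed (auto intro: sum.neutral)
    qed
    also have "\<dots> = (\<Sum>b\<le>n. \<gamma> b * x $ 1 ^ (n - b) * x $ 2 ^ b)"
      using that by (intro sum.mono_neutral_cong_right) auto
    finally show ?thesis ..
  qed
  define c where "c k a b = (if a + b = d then \<alpha> k b else 0) + (if a + b = d + 1 then \<beta> k b else 0)" for k a b
  have sup: "bipoly_support (c k) N" for k by (auto simp: bipoly_support_def c_def N_def)
  have Xc: "(\<lambda>w. X w $ k) = bipoly (c k) N" for k
  proof
    fix w
    have "X w $ k = bipoly (\<lambda>a b. if a + b = d then \<alpha> k b else 0) N w + bipoly (\<lambda>a b. if a + b = d + 1 then \<beta> k b else 0) N w"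
      using hom[of d] hom[of "d + 1"] by (simp add: X \<alpha> \<beta> N_def)
    then show "X w $ k = bipoly (c k) N w" by (simp add: bipoly_def c_def distrib_right sum.distrib)
  qed
  let ?P = "\<lambda>n. \<exists>i j k. i + j = n \<and> (partial_deriv 1 ^^ i) ((partial_deriv 2 ^^ j) (\<lambda>w. X w $ k)) 0 \<noteq> 0"
  have P: "?P n \<longleftrightarrow> (\<exists>i j k. i + j = n \<and> c k i j \<noteq> 0)" for n
    unfolding Xc iterated_partial_deriv_zero_iff[OF sup] ..
  obtain i where i: "i \<le> d" "\<alpha> k0 i \<noteq> 0"
    using nz unfolding \<alpha> by (metis (no_types, lifting) atMost_iff mult_eq_0_iff sum.neutral)
  then have "c k0 (d - i) i \<noteq> 0" by (simp add: c_def)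
  then have "?P d" unfolding P using i(1) by (metis le_add_diff_inverse2)
  then have "?P (vanishing_order X)" unfolding vanishing_order_def by (rule LeastI)
  moreover have "\<not> ?P 1" unfolding P using d by (auto simp: c_def)
  ultimately show ?thesis by metis
qed

section \<open>Radial singularities of a homogeneous foliation\<close>

text \<open>On the line \<open>l\<close> spanned by \<open>\<kappa>\<close> the derivative of \<open>l\<close> along the kernel field is the value
  of \<open>\<eta>\<close> on \<open>\<kappa>\<close>, so the tangency order is the order of vanishing of this polynomial at the
  origin.\<close>

lemma tangency_eqI:
  assumes l: "l \<noteq> 0" and g: "\<And>i. (\<lambda>w. \<eta> w $ i) \<in> germs" and \<kappa>: "\<kappa> = vector [- l $ 2, l $ 1]"
    and R: "\<And>t. pairing \<kappa> (\<eta> (t *s \<kappa>)) = t ^ n * poly R t" "poly R 0 \<noteq> 0"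
  shows "tangency \<eta> l = n"
proof -
  define g where "g w = pairing l (kernel_field \<eta> w)" for w
  have gk: "g w = l $ 1 * \<eta> w $ 2 - l $ 2 * \<eta> w $ 1" for w
    by (simp add: g_def kernel_field_def pairing_def sum_2)
  have g\<kappa>: "g w = pairing \<kappa> (\<eta> w)" for w
    by (simp add: gk \<kappa> pairing_def sum_2)
  have gg: "g \<in> germs" unfolding gk[abs_def] by (intro germs_diff germs_mult germs_const g)
  define p where "p = monom 1 n * R"
  have c: "coeff p i = (if i < n then 0 else coeff R (i - n))" for i
    by (simp add: p_def coeff_monom_mult)
  have "(\<lambda>t. g (t *s \<kappa>)) = (\<lambda>t. poly p t)"
    using R(1) by (simp add: g\<kappa> p_def poly_monom fun_eq_iff)
  then have "(\<lambda>t. g (t *s \<kappa>)) has_fps_expansion fps_of_poly p"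
    by (simp add: has_fps_expansion_def)
  then have F: "line_fps \<kappa> g = fps_of_poly p" by (rule line_fps_eqI)
  have "fps_nth (fps_of_poly p) n \<noteq> 0" using R(2) by (simp add: c poly_0_coeff_0)
  moreover have "fps_nth (fps_of_poly p) i = 0" if "i < n" for i using that by (simp add: c)
  ultimately have "subdegree (line_fps \<kappa> g) = n" "line_fps \<kappa> g \<noteq> 0"
    unfolding F by (auto intro: subdegreeI)
  then show ?thesis
    using quotient_dim_line[OF l gg \<kappa>] by (simp add: tangency_def g_def[abs_def])
qed

lemma poly_order_at_0:
  fixes p :: "complex poly"
  assumes "p \<noteq> 0"
  obtains n R where "\<And>t. poly p t = t ^ n * poly R t" "poly R 0 \<noteq> 0"
proof -
  obtain q where q: "p = [:- 0, 1:] ^ order 0 p * q" "\<not> [:- 0, 1:] dvd q"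
    using order_decomp[OF assms, of 0] by blast
  have "poly p t = t ^ order 0 p * poly q t" for t by (subst q(1)) (simp add: poly_power)
  moreover have "poly q 0 \<noteq> 0" using q(2) by (simp add: poly_eq_0_iff_dvd)
  ultimately show ?thesis using that by blast
qed

lemma kernel_field_on_line: "pairing l (kernel_field \<eta> w) = pairing (vector [- l $ 2, l $ 1]) (\<eta> w)"
  by (simp add: kernel_field_def pairing_def sum_2)

text \<open>The minimal tangency order is attained by some line. On the empty set the infimum would be
  unspecified, hence the assumption that some line is not invariant.\<close>

lemma radial_line_expansion:
  assumes g: "\<And>i. (\<lambda>w. \<eta> w $ i) \<in> germs"
    and line: "\<And>\<kappa>. \<exists>p. \<forall>t. pairing \<kappa> (\<eta> (t *s \<kappa>)) = poly p t"
    and rad: "radial_at_origin k \<eta>" and ex: "\<exists>l. l \<noteq> 0 \<and> \<not> invariant_line \<eta> l"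
  obtains \<kappa> R where "\<And>t. pairing \<kappa> (\<eta> (t *s \<kappa>)) = t ^ (k + 1) * poly R t" "poly R 0 \<noteq> 0"
proof -
  let ?S = "{tangency \<eta> l | l. l \<noteq> 0 \<and> \<not> invariant_line \<eta> l}"
  have m: "Inf ?S = k + 1" "Inf ?S \<ge> 2"
    using rad by (auto simp: radial_at_origin_def min_tangency_def)
  have "?S \<noteq> {}" using ex by auto
  then have "Inf ?S \<in> ?S" by (rule Inf_nat_def1)
  then obtain l where l: "l \<noteq> 0" "\<not> invariant_line \<eta> l" "tangency \<eta> l = k + 1" using m(1) by auto
  define \<kappa> :: "complex^2" where "\<kappa> = vector [- l $ 2, l $ 1]"
  obtain p where p: "\<And>t. pairing \<kappa> (\<eta> (t *s \<kappa>)) = poly p t" using line[of \<kappa>] by blast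
  obtain w where w: "pairing l w = 0" "pairing l (kernel_field \<eta> w) \<noteq> 0"
    using l(2) unfolding invariant_line_def by blast
  obtain e m where "\<And>w. w = pairing l w *s e + pairing m w *s \<kappa>"
    using line_coordinates[OF l(1)] unfolding \<kappa>_def by metis
  then have "w = pairing m w *s \<kappa>" using w(1) by (metis add.left_neutral vector_smult_lzero)
  moreover have "pairing l (kernel_field \<eta> w) = pairing \<kappa> (\<eta> w)"
    by (simp add: kernel_field_def pairing_def sum_2 \<kappa>_def)
  ultimately have "poly p (pairing m w) \<noteq> 0" using w(2) p by metis
  then have "p \<noteq> 0" by auto
  then obtain n R where R: "\<And>t. poly p t = t ^ n * poly R t" "poly R 0 \<noteq> 0" using poly_order_at_0 by blast
  have "tangency \<eta> l = n"
    by (rule tangency_eqI[OF l(1) g \<kappa>_def _ R(2)]) (simp add: p R(1))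
  then have "n = k + 1" using l(3) by simp
  then show ?thesis using that[of \<kappa> R] p R by simp
qed

lemma affine_hom_poly:
  fixes f :: "complex^3 \<Rightarrow> complex"
  assumes "hom_poly n f"
  shows "(\<lambda>w :: complex^2. f (vector [w $ 1, w $ 2, 1])) \<in> germs"
    and "\<exists>p. \<forall>t. f (vector [t * a, t * b, 1]) = poly p t"
proof -
  have P: "(\<Prod>i\<in>(UNIV :: 3 set). x $ i ^ e i) = x $ 1 ^ e 1 * (x $ 2 ^ e 2 * x $ 3 ^ e 3)" for x :: "complex^3" and e
    by (simp only: UNIV_3) simp
  have nth: "(\<lambda>w :: complex^2. w $ i) \<in> germs" for i
  proof -
    have "(\<lambda>w :: complex^2. w $ i) = pairing (axis i 1)"
      by (simp add: fun_eq_iff pairing_def axis_def if_distrib if_distribR cong: if_cong)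
    then show ?thesis by (simp add: germs_pairing)
  qed
  show "(\<lambda>w :: complex^2. f (vector [w $ 1, w $ 2, 1])) \<in> germs"
    using assms
  proof (induction rule: hom_poly_induct)
    case zero show ?case by (rule germs_const)
  next
    case (add f g) then show ?case by (rule germs_add)
  next
    case (monomial c e)
    show ?case unfolding P by (simp, intro germs_mult germs_const germs_power nth)
  qed
  show "\<exists>p. \<forall>t. f (vector [t * a, t * b, 1]) = poly p t"
    using assms
  proof (induction rule: hom_poly_induct)
    case zero show ?case by (rule exI[of _ 0]) simp
  next
    case (add f g)
    then obtain p q where "\<forall>t. f (vector [t * a, t * b, 1]) = poly p t" "\<forall>t. g (vector [t * a, t * b, 1]) = poly q t" by blast
    then show ?case by (intro exI[of _ "p + q"]) simp
  next
    case (monomial c e)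
    show ?case unfolding P
      by (rule exI[of _ "[:c:] * ([:0, a:] ^ e 1 * [:0, b:] ^ e 2)"]) (simp add: poly_power)
  qed
qed

lemma hom_poly_projective_form:
  assumes "\<And>i. hom_poly d (\<lambda>w. \<eta> w $ i)"
  shows "hom_poly (d + 1) (\<lambda>x. projective_form \<eta> x $ i)"
proof -
  have h: "hom_poly (1 + d) (\<lambda>x :: complex^3. x $ j * \<eta> (vector [x $ 1, x $ 2]) $ k)" for j k
    using hom_poly_mult[OF hom_poly_nth hom_poly_two_to_three[OF assms]] .
  have "hom_poly (1 + d) (\<lambda>x. projective_form \<eta> x $ i)"
    unfolding projective_form_def Let_def
    by (intro hom_poly_vector3 hom_poly_minus hom_poly_add h)
  then show ?thesis by simp
qed

text \<open>The incidence relation of \<open>projective_form\<close> eliminates its third component. What remains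
  is the value of \<open>\<eta>\<close> at the moving point on a vector built from the velocity \<open>v\<close> and the base
  point \<open>s\<close>.\<close>

lemma affine_form_on_line:
  fixes M :: "complex^3^3" and \<kappa> :: "complex^2"
  defines "v \<equiv> M *v vector [\<kappa> $ 1, \<kappa> $ 2, 0]" and "s \<equiv> M *v axis 3 1"
  shows "pairing \<kappa> (affine_form (pullback M (projective_form \<eta>)) (t *s \<kappa>))
    = pairing (s $ 3 *s vector [v $ 1, v $ 2] - v $ 3 *s vector [s $ 1, s $ 2]) (\<eta> (vector [s $ 1, s $ 2] + t *s vector [v $ 1, v $ 2]))"
proof -
  define x where "x = M *v vector [t * \<kappa> $ 1, t * \<kappa> $ 2, 1]"
  have x: "x $ i = s $ i + t * v $ i" for i
    by (simp add: x_def s_def v_def matrix_vector_mult_def sum_3 axis_def algebra_simps)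
  define y where "y = projective_form \<eta> x"
  have "pairing \<kappa> (affine_form (pullback M (projective_form \<eta>)) (t *s \<kappa>)) = v $ 1 * y $ 1 + v $ 2 * y $ 2 + v $ 3 * y $ 3"
    by (simp add: pairing_def sum_2 affine_form_def Let_def pullback_def matrix_vector_mult_def transpose_def sum_3
        y_def x_def v_def algebra_simps del: transpose_matrix_vector)
  also have "\<dots> = (s $ 3 * v $ 1 - v $ 3 * s $ 1) * \<eta> (vector [x $ 1, x $ 2]) $ 1 + (s $ 3 * v $ 2 - v $ 3 * s $ 2) * \<eta> (vector [x $ 1, x $ 2]) $ 2"
    by (simp add: y_def projective_form_def Let_def x algebra_simps)
  also have "vector [x $ 1, x $ 2] = vector [s $ 1, s $ 2] + t *s (vector [v $ 1, v $ 2] :: complex^2)"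
    by (simp add: vec_eq_iff forall_2 x)
  finally show ?thesis by (simp add: pairing_def sum_2)
qed

text \<open>The binary form \<open>w \<mapsto> pairing s (\<eta> w)\<close> vanishes along the direction \<open>s\<close> to order exactly
  \<open>k + 1\<close>, stated through its coefficients in a basis \<open>s\<close>, \<open>b\<close>. This is the trace that a radial
  singularity of order \<open>k\<close> at the point at infinity \<open>s\<close> leaves in the affine form.\<close>

definition contact :: "nat \<Rightarrow> (complex^2 \<Rightarrow> complex^2) \<Rightarrow> complex^2 \<Rightarrow> nat \<Rightarrow> bool" where
  "contact d \<eta> s k \<longleftrightarrow> s \<noteq> 0 \<and> k + 1 \<le> d \<and> (\<forall>b. wedge s b \<noteq> 0 \<longrightarrow>
     (\<exists>c. (\<forall>x y. pairing s (\<eta> (x *s s + y *s b)) = (\<Sum>i\<le>d. c i * x ^ (d - i) * y ^ i)) \<and> (\<forall>i\<le>k. c i = 0) \<and> c (k + 1) \<noteq> 0))"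

lemma binary_form_in_basis:
  fixes \<eta> :: "complex^2 \<Rightarrow> complex^2"
  assumes "\<And>i. hom_poly d (\<lambda>w. \<eta> w $ i)"
  obtains c where "\<And>x y. pairing u (\<eta> (x *s a + y *s b)) = (\<Sum>i\<le>d. c i * x ^ (d - i) * y ^ i)"
proof -
  define N :: "complex^2^2" where "N = vector [vector [a $ 1, b $ 1], vector [a $ 2, b $ 2]]"
  have N: "N *v w = w $ 1 *s a + w $ 2 *s b" for w
    by (simp add: N_def matrix_vector_mult_def sum_2 vec_eq_iff forall_2 mult.commute)
  have "hom_poly d (\<lambda>w. pairing u (\<eta> w))"
    by (rule hom_poly_pairing[OF assms])
  from binary_form_exists[OF hom_poly_substitute[OF this, of N]]
  obtain c where c: "\<And>w. pairing u (\<eta> (N *v w)) = (\<Sum>i\<le>d. c i * w $ 1 ^ (d - i) * w $ 2 ^ i)" by blast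
  have "pairing u (\<eta> (x *s a + y *s b)) = (\<Sum>i\<le>d. c i * x ^ (d - i) * y ^ i)" for x y
    using c[of "vector [x, y]"] by (simp add: N)
  then show ?thesis using that by blast
qed

lemma basis_decomposition:
  assumes "wedge a b \<noteq> 0"
  shows "w = (wedge w b / wedge a b) *s a + (wedge a w / wedge a b) *s b"
proof -
  have "wedge a b * w $ 1 = wedge w b * a $ 1 + wedge a w * b $ 1" "wedge a b * w $ 2 = wedge w b * a $ 2 + wedge a w * b $ 2"
    by (simp_all add: wedge_def algebra_simps)
  then show ?thesis using assms by (simp add: vec_eq_iff forall_2 field_simps)
qed

lemma polynomial_coefficients_unique:
  fixes a b :: "nat \<Rightarrow> complex"
  assumes "\<And>z. (\<Sum>j\<le>n. a j * z ^ j) = (\<Sum>j\<le>n. b j * z ^ j)" "j \<le> n"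
  shows "a j = b j"
proof -
  have "a j - b j = 0"
    by (rule polynomial_coefficients_zero[where n = n and a = "\<lambda>j. a j - b j"])
       (use assms in \<open>auto simp: left_diff_distrib sum_subtractf\<close>)
  then show ?thesis by simp
qed

lemma coefficients_of_multiple:
  fixes c :: "nat \<Rightarrow> complex"
  assumes "\<And>y. (\<Sum>i\<le>d. c i * y ^ i) = y ^ n * poly R y"
  shows "i < n \<Longrightarrow> i \<le> d \<Longrightarrow> c i = 0" "n \<le> d \<Longrightarrow> c n = poly R 0" "poly R 0 \<noteq> 0 \<Longrightarrow> n \<le> d"
proof -
  define P where "P = (\<Sum>i\<le>d. monom (c i) i)"
  have cP: "coeff P i = (if i \<le> d then c i else 0)" for i
    by (simp add: P_def coeff_sum if_distrib cong: if_cong)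
  have "P = monom 1 n * R"
    by (rule poly_ext) (simp add: P_def poly_sum poly_monom assms)
  then have cR: "coeff P i = (if i < n then 0 else coeff R (i - n))" for i by (simp add: coeff_monom_mult)
  show "i < n \<Longrightarrow> i \<le> d \<Longrightarrow> c i = 0" using cP[of i] cR[of i] by simp
  show "n \<le> d \<Longrightarrow> c n = poly R 0" using cP[of n] cR[of n] by (simp add: poly_0_coeff_0)
  show "poly R 0 \<noteq> 0 \<Longrightarrow> n \<le> d" using cP[of n] cR[of n] by (simp add: poly_0_coeff_0 split: if_splits)
qed

lemma pairing_basis_zero:
  fixes a b c :: "complex^2"
  assumes "wedge a b \<noteq> 0" "pairing a c = 0" "pairing b c = 0"
  shows "c = 0"
proof -
  have "wedge a b * c $ 1 = pairing a c * b $ 2 - pairing b c * a $ 2" "wedge a b * c $ 2 = a $ 1 * pairing b c - b $ 1 * pairing a c"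
    by (simp_all add: wedge_def pairing_def sum_2 algebra_simps)
  then show ?thesis using assms by (simp add: vec_eq_iff forall_2)
qed

text \<open>It suffices to test one complementary vector \<open>b0\<close>: the order of vanishing does not change
  when the second basis vector is replaced.\<close>

lemma contactI:
  assumes hom: "\<And>i. hom_poly d (\<lambda>w. \<eta> w $ i)" and b0: "wedge s b0 \<noteq> 0"
    and R: "\<And>y. pairing s (\<eta> (s + y *s b0)) = y ^ (k + 1) * poly R y" "poly R 0 \<noteq> 0"
  shows "contact d \<eta> s k"
  unfolding contact_def
proof (intro conjI allI impI)
  show "s \<noteq> 0" using b0 by (auto simp: wedge_simps)
  obtain c where c: "\<And>x y. pairing s (\<eta> (x *s s + y *s b0)) = (\<Sum>i\<le>d. c i * x ^ (d - i) * y ^ i)"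
    using binary_form_in_basis[OF hom] by blast
  have "(\<Sum>i\<le>d. c i * y ^ i) = y ^ (k + 1) * poly R y" for y using c[of 1 y] R(1)[of y] by simp
  note cc = coefficients_of_multiple[OF this]
  show kd: "k + 1 \<le> d" by (rule cc(3)[OF R(2)])
  have c0: "c i = 0" if "i \<le> k" for i using cc(1)[of i] kd that by simp
  have c1: "c (k + 1) \<noteq> 0" using cc(2)[OF kd] R(2) by simp
  fix b assume b: "wedge s b \<noteq> 0"
  obtain c' where c': "\<And>x y. pairing s (\<eta> (x *s s + y *s b)) = (\<Sum>i\<le>d. c' i * x ^ (d - i) * y ^ i)"
    using binary_form_in_basis[OF hom] by blast
  define \<alpha> \<beta> where "\<alpha> = wedge b b0 / wedge s b0" and "\<beta> = wedge s b / wedge s b0"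
  have \<beta>: "\<beta> \<noteq> 0" using b b0 by (simp add: \<beta>_def)
  have bb: "b = \<alpha> *s s + \<beta> *s b0" unfolding \<alpha>_def \<beta>_def by (rule basis_decomposition[OF b0])
  define R2 where "R2 = (\<Sum>i=k+1..d. smult (c i * \<beta> ^ i) ([:1, \<alpha>:] ^ (d - i) * monom 1 (i - (k + 1))))"
  have "(\<Sum>i\<le>d. c' i * y ^ i) = y ^ (k + 1) * poly R2 y" for y
  proof -
    have "(\<Sum>i\<le>d. c' i * y ^ i) = pairing s (\<eta> (1 *s s + y *s b))" using c'[of 1 y] by simp
    also have "1 *s s + y *s b = (1 + \<alpha> * y) *s s + (\<beta> * y) *s b0"
      by (subst bb) (simp add: vec_eq_iff algebra_simps)
    also have "pairing s (\<eta> \<dots>) = (\<Sum>i\<le>d. c i * (1 + \<alpha> * y) ^ (d - i) * (\<beta> * y) ^ i)" by (rule c)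
    also have "\<dots> = (\<Sum>i=k+1..d. c i * (1 + \<alpha> * y) ^ (d - i) * (\<beta> * y) ^ i)"
      by (rule sum.mono_neutral_right) (auto simp: c0 not_le less_Suc_eq_le)
    also have "\<dots> = (\<Sum>i=k+1..d. y ^ (k + 1) * (c i * \<beta> ^ i * ((1 + y * \<alpha>) ^ (d - i) * y ^ (i - (k + 1)))))"
    proof (rule sum.cong[OF refl])
      fix i assume "i \<in> {k+1..d}"
      then have "y ^ i = y ^ (k + 1) * y ^ (i - (k + 1))"
        by (metis atLeastAtMost_iff le_add_diff_inverse power_add)
      then show "c i * (1 + \<alpha> * y) ^ (d - i) * (\<beta> * y) ^ i = y ^ (k + 1) * (c i * \<beta> ^ i * ((1 + y * \<alpha>) ^ (d - i) * y ^ (i - (k + 1))))"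
        by (simp add: power_mult_distrib mult_ac)
    qed
    also have "\<dots> = y ^ (k + 1) * poly R2 y"
      by (simp add: R2_def poly_sum poly_power poly_monom sum_distrib_left)
    finally show ?thesis .
  qed
  note cc' = coefficients_of_multiple[OF this]
  have "poly R2 0 = (\<Sum>i=k+1..d. if i = k + 1 then c i * \<beta> ^ i else 0)"
    unfolding R2_def poly_sum by (rule sum.cong) (auto simp: poly_power poly_monom power_0_left)
  also have "\<dots> = c (k + 1) * \<beta> ^ (k + 1)" using kd by simp
  finally have "poly R2 0 \<noteq> 0" using c1 \<beta> by simp
  then show "\<exists>c. (\<forall>x y. pairing s (\<eta> (x *s s + y *s b)) = (\<Sum>i\<le>d. c i * x ^ (d - i) * y ^ i)) \<and> (\<forall>i\<le>k. c i = 0) \<and> c (k + 1) \<noteq> 0"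
    using c' cc'(1,2) kd by (intro exI[of _ c']) auto
qed

lemma wedge_complement:
  assumes "s \<noteq> (0 :: complex^2)"
  obtains b where "wedge s b \<noteq> 0"
proof (cases "s $ 1 = 0")
  case True
  then have "s $ 2 \<noteq> 0" using assms by (auto simp: vec_eq_iff forall_2)
  then show ?thesis using that[of "vector [1, 0]"] by (simp add: wedge_def)
next
  case False
  then show ?thesis using that[of "vector [0, 1]"] by (simp add: wedge_def)
qed

lemma wedge_zero_multiple:
  assumes "s \<noteq> 0" "wedge s s' = 0"
  obtains \<gamma> where "s' = \<gamma> *s s"
proof -
  obtain b where b: "wedge s b \<noteq> 0" using wedge_complement[OF assms(1)] .
  show ?thesis using that[of "wedge s' b / wedge s b"] basis_decomposition[OF b, of s'] assms(2) by simp
qed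

lemma contact_unique:
  assumes 1: "contact d \<eta> s k" and 2: "contact d \<eta> s' k'" and w: "wedge s s' = 0"
  shows "k = k'"
proof -
  have s: "s \<noteq> 0" "s' \<noteq> 0" "k + 1 \<le> d" "k' + 1 \<le> d" using 1 2 by (auto simp: contact_def)
  obtain \<gamma> where \<gamma>: "s' = \<gamma> *s s" using wedge_zero_multiple[OF s(1) w] .
  have g0: "\<gamma> \<noteq> 0" using s(2) \<gamma> by auto
  obtain b where b: "wedge s b \<noteq> 0" using wedge_complement[OF s(1)] .
  then have b': "wedge s' b \<noteq> 0" using \<gamma> g0 by (simp add: wedge_simps)
  obtain c where c: "\<And>x y. pairing s (\<eta> (x *s s + y *s b)) = (\<Sum>i\<le>d. c i * x ^ (d - i) * y ^ i)" "\<And>i. i \<le> k \<Longrightarrow> c i = 0" "c (k + 1) \<noteq> 0"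
    using 1 b unfolding contact_def by blast
  obtain c' where c': "\<And>x y. pairing s' (\<eta> (x *s s' + y *s b)) = (\<Sum>i\<le>d. c' i * x ^ (d - i) * y ^ i)" "\<And>i. i \<le> k' \<Longrightarrow> c' i = 0" "c' (k' + 1) \<noteq> 0"
    using 2 b' unfolding contact_def by blast
  have cc: "c' i = \<gamma> * c i * \<gamma> ^ (d - i)" if "i \<le> d" for i
  proof (rule polynomial_coefficients_unique[OF _ that])
    fix z
    have "(\<Sum>j\<le>d. c' j * z ^ j) = \<gamma> * pairing s (\<eta> (\<gamma> *s s + z *s b))"
      using c'(1)[of 1 z] by (simp add: \<gamma> pairing_simps)
    then show "(\<Sum>j\<le>d. c' j * z ^ j) = (\<Sum>j\<le>d. \<gamma> * c j * \<gamma> ^ (d - j) * z ^ j)"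
      by (simp add: c(1) sum_distrib_left mult.assoc)
  qed
  have "\<not> k < k'" using cc[of "k + 1"] c(3) c'(2)[of "k + 1"] g0 s by auto
  moreover have "\<not> k' < k" using cc[of "k' + 1"] c'(3) c(2)[of "k' + 1"] g0 s by auto
  ultimately show ?thesis by simp
qed

text \<open>Over the complex numbers a binary form splits into linear factors.\<close>

lemma binary_form_nontrivial_zero:
  fixes f :: "complex^2 \<Rightarrow> complex"
  assumes "hom_poly d f" "d \<ge> 1"
  obtains w where "w \<noteq> 0" "f w = 0"
proof -
  obtain c where c: "\<And>w. f w = (\<Sum>i\<le>d. c i * w $ 1 ^ (d - i) * w $ 2 ^ i)"
    using binary_form_exists[OF assms(1)] by blast
  define p where "p = (\<Sum>i\<le>d. monom (c i) i)"
  have p: "poly p z = f (vector [1, z])" for z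
    by (simp add: p_def c poly_sum poly_monom)
  have cp: "coeff p d = c d" by (simp add: p_def coeff_sum if_distrib cong: if_cong)
  show ?thesis
  proof (cases "c d = 0")
    case True
    have "f (vector [0, 1]) = (\<Sum>i\<le>d. if i = d then c i else 0)"
      unfolding c by (rule sum.cong) (auto simp: power_0_left)
    then show ?thesis using True that[of "vector [0, 1]"] by (simp add: vec_eq_iff forall_2)
  next
    case False
    then have "degree p \<noteq> 0" using cp assms(2) le_degree[of p d] by simp
    then have "\<not> constant (poly p)" by (simp add: constant_degree)
    then obtain z where "poly p z = 0" using fundamental_theorem_of_algebra by blast
    then show ?thesis using that[of "vector [1, z]"] by (simp add: p vec_eq_iff forall_2)
  qed
qed

text \<open>If the binary form \<open>w \<mapsto> pairing u (\<eta> w)\<close> were zero on the line, it would vanish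
  identically, and a zero of another component would be a common zero of \<open>\<eta>\<close>.\<close>

lemma hom_poly_not_zero_on_line:
  fixes \<eta> :: "complex^2 \<Rightarrow> complex^2"
  assumes hom: "\<And>i. hom_poly d (\<lambda>w. \<eta> w $ i)" and nz: "\<And>w. w \<noteq> 0 \<Longrightarrow> \<eta> w \<noteq> 0" and d: "d \<ge> 1"
    and b: "wedge a b \<noteq> 0" and u: "u \<noteq> 0"
  shows "\<exists>t. pairing u (\<eta> (a + t *s b)) \<noteq> 0"
proof (rule ccontr)
  assume "\<not> ?thesis"
  then have z: "pairing u (\<eta> (a + t *s b)) = 0" for t by blast
  obtain c where c: "\<And>x y. pairing u (\<eta> (x *s a + y *s b)) = (\<Sum>i\<le>d. c i * x ^ (d - i) * y ^ i)"
    using binary_form_in_basis[OF hom] by blast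
  have "c i = 0" if "i \<le> d" for i
  proof (rule polynomial_coefficients_zero[where n = d and a = c, OF _ that])
    fix t :: complex
    show "(\<Sum>j\<le>d. c j * t ^ j) = 0" using c[of 1 t] z[of t] by simp
  qed
  then have "pairing u (\<eta> (x *s a + y *s b)) = 0" for x y by (simp add: c)
  then have z: "pairing u (\<eta> w) = 0" for w by (subst basis_decomposition[OF b, of w])
  obtain e where e: "wedge u e \<noteq> 0" using wedge_complement[OF u] .
  have "hom_poly d (\<lambda>w. pairing e (\<eta> w))" by (rule hom_poly_pairing[OF hom])
  then obtain w where w: "w \<noteq> 0" "pairing e (\<eta> w) = 0" using binary_form_nontrivial_zero[OF _ d] by blast
  have "\<eta> w = 0" by (rule pairing_basis_zero[OF e z w(2)])
  then show False using nz[OF w(1)] by simp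
qed

text \<open>Three cases for the position of the point \<open>s\<close>. The centre of the affine chart is singular
  with vanishing order \<open>d \<ge> 2\<close>, so it is not radial. Any other affine point would be a
  nontrivial zero of \<open>\<eta>\<close>. At a point at infinity the value of the form along a line in direction
  \<open>\<kappa>\<close> is a constant multiple of \<open>pairing s (\<eta> (s + t v))\<close>, so its order in \<open>t\<close> is the same for
  all transverse lines and measures the contact.\<close>

theorem radial_contact:
  assumes hom: "\<And>i. hom_poly d (\<lambda>w. \<eta> w $ i)" and nz: "\<And>w. w \<noteq> 0 \<Longrightarrow> \<eta> w \<noteq> 0" and d: "d \<ge> 2"
    and M: "invertible M" and rad: "radial_at_origin k (affine_form (pullback M (projective_form \<eta>)))"
  defines "s \<equiv> M *v axis 3 1"
  shows "s $ 3 = 0" "contact d \<eta> (vector [s $ 1, s $ 2]) k"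
proof -
  let ?aff = "affine_form (pullback M (projective_form \<eta>))"
  define s' :: "complex^2" where "s' = vector [s $ 1, s $ 2]"
  define v where "v \<kappa> = M *v vector [\<kappa> $ 1, \<kappa> $ 2, 0]" for \<kappa> :: "complex^2"
  define v' where "v' \<kappa> = (vector [v \<kappa> $ 1, v \<kappa> $ 2] :: complex^2)" for \<kappa>
  have T: "pairing \<kappa> (?aff (t *s \<kappa>)) = pairing (s $ 3 *s v' \<kappa> - v \<kappa> $ 3 *s s') (\<eta> (s' + t *s v' \<kappa>))" for \<kappa> t
    unfolding s'_def v'_def v_def s_def by (rule affine_form_on_line)
  have hp: "hom_poly (d + 1) (\<lambda>x. pullback M (projective_form \<eta>) x $ i)" for i
    by (rule hom_poly_pullback[OF hom_poly_projective_form[OF hom]])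
  have affi: "?aff w $ 1 = pullback M (projective_form \<eta>) (vector [w $ 1, w $ 2, 1]) $ 1"
    "?aff w $ 2 = pullback M (projective_form \<eta>) (vector [w $ 1, w $ 2, 1]) $ 2" for w
    by (simp_all add: affine_form_def Let_def)
  have germ: "(\<lambda>w. ?aff w $ i) \<in> germs" for i
    using exhaust_2[of i] affine_hom_poly(1)[OF hp] by (auto simp: affi)
  have line: "\<exists>p. \<forall>t. pairing \<kappa> (?aff (t *s \<kappa>)) = poly p t" for \<kappa>
  proof -
    obtain p q where "\<forall>t. pullback M (projective_form \<eta>) (vector [t * \<kappa> $ 1, t * \<kappa> $ 2, 1]) $ 1 = poly p t"
      "\<forall>t. pullback M (projective_form \<eta>) (vector [t * \<kappa> $ 1, t * \<kappa> $ 2, 1]) $ 2 = poly q t"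
      using affine_hom_poly(2)[OF hp] by blast
    then show ?thesis
      by (intro exI[of _ "smult (\<kappa> $ 1) p + smult (\<kappa> $ 2) q"]) (simp add: pairing_def sum_2 affi)
  qed
  have aff0: "?aff 0 = 0" and vo: "vanishing_order (kernel_field ?aff) = 1"
    using rad by (simp_all add: radial_at_origin_def)
  have detM: "det M \<noteq> 0" using M by (simp add: invertible_det_nz)
  have e1: "v (axis 1 1) $ i = M $ i $ 1" and e2: "v (axis 2 1) $ i = M $ i $ 2" and e3: "s $ i = M $ i $ 3" for i
    by (simp_all add: v_def s_def matrix_vector_mult_def sum_3 axis_def)
  \<comment> \<open>at the centre of the affine chart the vector field has no linear part\<close>
  have s'0: "s' \<noteq> 0"
  proof
    assume "s' = 0"
    then have s12: "M $ 1 $ 3 = 0" "M $ 2 $ 3 = 0" by (simp_all add: s'_def vec_eq_iff forall_2 e3)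
    define N :: "complex^2^2" where "N = vector [vector [M $ 1 $ 1, M $ 1 $ 2], vector [M $ 2 $ 1, M $ 2 $ 2]]"
    define r where "r w = M $ 3 $ 1 * w $ 1 + M $ 3 $ 2 * w $ 2" for w :: "complex^2"
    define \<zeta> where "\<zeta> j w = (if j = 1 then M $ 1 $ 1 * \<eta> (N *v w) $ 1 + M $ 2 $ 1 * \<eta> (N *v w) $ 2
        else M $ 1 $ 2 * \<eta> (N *v w) $ 1 + M $ 2 $ 2 * \<eta> (N *v w) $ 2)" for j :: 2 and w
    define E where "E w = (N *v w) $ 1 * \<eta> (N *v w) $ 1 + (N *v w) $ 2 * \<eta> (N *v w) $ 2" for w
    have Mw: "M *v vector [w $ 1, w $ 2, 1] = vector [(N *v w) $ 1, (N *v w) $ 2, r w + M $ 3 $ 3]" for w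
      by (simp add: N_def r_def matrix_vector_mult_def sum_3 sum_2 vec_eq_iff forall_3 s12)
    have Nw: "vector [(N *v w) $ 1, (N *v w) $ 2] = N *v w" for w by (simp add: vec_eq_iff forall_2)
    have aff: "?aff w $ 1 = (r w + M $ 3 $ 3) * \<zeta> 1 w - M $ 3 $ 1 * E w" "?aff w $ 2 = (r w + M $ 3 $ 3) * \<zeta> 2 w - M $ 3 $ 2 * E w" for w
    proof -
      have p: "pullback M (projective_form \<eta>) x $ i = M $ 1 $ i * projective_form \<eta> (M *v x) $ 1 + M $ 2 $ i * projective_form \<eta> (M *v x) $ 2
          + M $ 3 $ i * projective_form \<eta> (M *v x) $ 3" for x i
        by (simp add: pullback_def matrix_vector_mult_def transpose_def sum_3 del: transpose_matrix_vector)
      show "?aff w $ 1 = (r w + M $ 3 $ 3) * \<zeta> 1 w - M $ 3 $ 1 * E w" "?aff w $ 2 = (r w + M $ 3 $ 3) * \<zeta> 2 w - M $ 3 $ 2 * E w"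
        unfolding affi p Mw by (simp_all add: projective_form_def Let_def Nw \<zeta>_def E_def algebra_simps)
    qed
    have hN: "hom_poly d (\<lambda>w. \<eta> (N *v w) $ i)" for i using hom_poly_substitute[OF hom, of N] .
    have h\<zeta>: "hom_poly d (\<zeta> j)" for j
      unfolding \<zeta>_def[abs_def] by (cases "j = 1") (simp_all add: hom_poly_add hom_poly_cmult hN)
    have hE: "hom_poly (1 + d) E" unfolding E_def[abs_def]
      by (intro hom_poly_add hom_poly_mult hom_poly_linear hN)
    have hr: "hom_poly 1 r" unfolding r_def[abs_def] by (intro hom_poly_add hom_poly_cmult hom_poly_nth)
    define f where "f k w = (if k = 1 then M $ 3 $ 3 * \<zeta> 2 w else - (M $ 3 $ 3 * \<zeta> 1 w))" for k :: 2 and w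
    define g where "g k w = (if k = 1 then r w * \<zeta> 2 w - M $ 3 $ 2 * E w else - (r w * \<zeta> 1 w - M $ 3 $ 1 * E w))" for k :: 2 and w
    have hf: "hom_poly d (f k)" for k
      unfolding f_def[abs_def] by (cases "k = 1") (simp_all add: hom_poly_minus hom_poly_cmult h\<zeta>)
    have gg: "g k = (if k = 1 then (\<lambda>w. r w * \<zeta> 2 w - M $ 3 $ 2 * E w) else (\<lambda>w. - (r w * \<zeta> 1 w - M $ 3 $ 1 * E w)))" for k
      by (simp add: g_def fun_eq_iff)
    have "hom_poly (1 + d) (g k)" for k
      unfolding gg using hom_poly_mult[OF hr h\<zeta>] hE
      by (cases "k = 1") (auto intro!: hom_poly_minus hom_poly_diff hom_poly_cmult)
    then have hg: "hom_poly (d + 1) (g k)" for k by simp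
    have X: "kernel_field ?aff w $ k = f k w + g k w" for w k
      using exhaust_2[of k] by (auto simp: kernel_field_def aff f_def g_def algebra_simps)
    have det: "det M = M $ 3 $ 3 * (M $ 1 $ 1 * M $ 2 $ 2 - M $ 1 $ 2 * M $ 2 $ 1)"
      by (simp add: det_3 s12 algebra_simps)
    then have m33: "M $ 3 $ 3 \<noteq> 0" and dN: "M $ 1 $ 1 * M $ 2 $ 2 - M $ 1 $ 2 * M $ 2 $ 1 \<noteq> 0" using detM by auto
    have "\<exists>w k. f k w \<noteq> 0"
    proof (rule ccontr)
      assume "\<not> (\<exists>w k. f k w \<noteq> 0)"
      then have "f 1 w = 0" "f 2 w = 0" for w by auto
      then have z: "\<zeta> 1 w = 0" "\<zeta> 2 w = 0" for w using m33 by (auto simp: f_def)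
      define w where "w = (vector [1, 0] :: complex^2)"
      have "wedge (\<eta> (N *v w)) (vector [- M $ 2 $ 1, M $ 1 $ 1]) = 0" "wedge (\<eta> (N *v w)) (vector [- M $ 2 $ 2, M $ 1 $ 2]) = 0"
        using z[of w] by (simp_all add: \<zeta>_def wedge_def algebra_simps)
      moreover have "wedge (vector [- M $ 2 $ 1, M $ 1 $ 1]) (vector [- M $ 2 $ 2, M $ 1 $ 2]) \<noteq> 0"
        using dN by (simp add: wedge_def algebra_simps)
      ultimately have "\<eta> (N *v w) = 0" using wedge_eq_zero by blast
      moreover have "N *v w \<noteq> 0" using dN by (auto simp: w_def N_def matrix_vector_mult_def sum_2 vec_eq_iff forall_2)
      ultimately show False using nz by blast
    qed
    then obtain w0 k0 where "f k0 w0 \<noteq> 0" by blast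
    from vanishing_order_not_1[OF d X hf hg this] vo show False by simp
  qed
  \<comment> \<open>elsewhere in the affine chart a singular point is a zero of \<open>\<eta>\<close>\<close>
  show s3: "s $ 3 = 0"
  proof (rule ccontr)
    assume s3: "s $ 3 \<noteq> 0"
    define u where "u \<kappa> = s $ 3 *s v' \<kappa> - v \<kappa> $ 3 *s s'" for \<kappa>
    have "pairing (u \<kappa>) (\<eta> s') = 0" for \<kappa>
      using T[of \<kappa> 0] aff0 by (simp add: u_def pairing_simps)
    then have "wedge (\<eta> s') (vector [- u \<kappa> $ 2, u \<kappa> $ 1]) = 0" for \<kappa> by (simp add: wedge_def pairing_def sum_2 algebra_simps)
    moreover have "wedge (vector [- u (axis 1 1) $ 2, u (axis 1 1) $ 1]) (vector [- u (axis 2 1) $ 2, u (axis 2 1) $ 1]) = s $ 3 * det M"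
      by (simp add: u_def wedge_def v'_def s'_def e1 e2 e3 det_3 algebra_simps)
    ultimately have "\<eta> s' = 0" using wedge_eq_zero s3 detM by (metis mult_eq_0_iff)
    then show False using nz s'0 by blast
  qed
  \<comment> \<open>some direction \<open>\<kappa>\<close> leaves the line at infinity, with a velocity transverse to \<open>s\<close>: two
    linear functions that are independent on the plane of directions are both nonzero somewhere\<close>
  have "\<exists>l. l \<noteq> 0 \<and> \<not> invariant_line ?aff l"
  proof -
    define \<phi> \<psi> where "\<phi> \<kappa> = v \<kappa> $ 3" and "\<psi> \<kappa> = wedge s' (v' \<kappa>)" for \<kappa>
    define \<phi>1 \<phi>2 \<psi>1 \<psi>2 where "\<phi>1 = M $ 3 $ 1" and "\<phi>2 = M $ 3 $ 2"
      and "\<psi>1 = M $ 1 $ 3 * M $ 2 $ 1 - M $ 2 $ 3 * M $ 1 $ 1" and "\<psi>2 = M $ 1 $ 3 * M $ 2 $ 2 - M $ 2 $ 3 * M $ 1 $ 2"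
    have \<phi>: "\<phi> (vector [a, b]) = a * \<phi>1 + b * \<phi>2" and \<psi>: "\<psi> (vector [a, b]) = a * \<psi>1 + b * \<psi>2" for a b
      by (simp_all add: \<phi>_def \<psi>_def \<phi>1_def \<phi>2_def \<psi>1_def \<psi>2_def v_def v'_def s'_def e3 wedge_def matrix_vector_mult_def sum_3 algebra_simps)
    have "det M = \<phi>2 * \<psi>1 - \<phi>1 * \<psi>2"
      using s3 by (simp add: e3 det_3 \<phi>1_def \<phi>2_def \<psi>1_def \<psi>2_def algebra_simps)
    then have "\<phi>2 * \<psi>1 \<noteq> 0 \<or> \<phi>1 * \<psi>2 \<noteq> 0" using detM by auto
    then have "\<exists>a b. \<phi> (vector [a, b]) \<noteq> 0 \<and> \<psi> (vector [a, b]) \<noteq> 0"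
    proof (cases "\<phi>1 * \<psi>1 \<noteq> 0 \<or> \<phi>2 * \<psi>2 \<noteq> 0")
      case True
      then show ?thesis by (rule_tac exI[of _ "if \<phi>1 * \<psi>1 \<noteq> 0 then 1 else 0"], rule_tac exI[of _ "if \<phi>1 * \<psi>1 \<noteq> 0 then 0 else 1"]) (auto simp: \<phi> \<psi>)
    next
      case False
      then have "\<phi> (vector [1, 1]) \<noteq> 0 \<and> \<psi> (vector [1, 1]) \<noteq> 0"
        using \<open>\<phi>2 * \<psi>1 \<noteq> 0 \<or> \<phi>1 * \<psi>2 \<noteq> 0\<close> unfolding \<phi> \<psi> by auto
      then show ?thesis by auto
    qed
    then obtain \<kappa> where k: "v \<kappa> $ 3 \<noteq> 0" "wedge s' (v' \<kappa>) \<noteq> 0" unfolding \<phi>_def \<psi>_def by auto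
    obtain t where t: "pairing s' (\<eta> (s' + t *s v' \<kappa>)) \<noteq> 0"
      using hom_poly_not_zero_on_line[OF hom nz _ k(2) s'0] d by auto
    have "pairing \<kappa> (?aff (t *s \<kappa>)) \<noteq> 0" unfolding T using t k(1) by (simp add: s3 pairing_simps)
    moreover have "(vector [- (vector [\<kappa> $ 2, - \<kappa> $ 1] :: complex^2) $ 2, (vector [\<kappa> $ 2, - \<kappa> $ 1] :: complex^2) $ 1] :: complex^2) = \<kappa>"
      by (simp add: vec_eq_iff forall_2)
    ultimately have "pairing (vector [\<kappa> $ 2, - \<kappa> $ 1]) (kernel_field ?aff (t *s \<kappa>)) \<noteq> 0"
      unfolding kernel_field_on_line by simp
    moreover have "pairing (vector [\<kappa> $ 2, - \<kappa> $ 1]) (t *s \<kappa>) = 0" by (simp add: pairing_def sum_2)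
    ultimately have "\<not> invariant_line ?aff (vector [\<kappa> $ 2, - \<kappa> $ 1])" unfolding invariant_line_def by blast
    moreover have "vector [\<kappa> $ 2, - \<kappa> $ 1] \<noteq> (0 :: complex^2)"
      using k(2) by (auto simp: vec_eq_iff forall_2 v'_def v_def matrix_vector_mult_def sum_3 wedge_def)
    ultimately show ?thesis by blast
  qed
  then obtain \<kappa> R where R: "\<And>t. pairing \<kappa> (?aff (t *s \<kappa>)) = t ^ (k + 1) * poly R t" "poly R 0 \<noteq> 0"
    using radial_line_expansion[OF germ line rad] by blast
  define z where "z = v \<kappa> $ 3"
  have T': "- z * pairing s' (\<eta> (s' + t *s v' \<kappa>)) = t ^ (k + 1) * poly R t" for t
    using T[of \<kappa> t] R(1)[of t] by (simp add: s3 pairing_simps z_def)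
  have Rne: "\<exists>t. t ^ (k + 1) * poly R t \<noteq> 0"
  proof (rule ccontr)
    assume "\<not> (\<exists>t. t ^ (k + 1) * poly R t \<noteq> 0)"
    then have "poly (monom 1 (k + 1) * R) t = poly 0 t" for t by (simp add: poly_monom)
    then have "monom 1 (k + 1) * R = 0" by (rule poly_ext)
    then show False using R(2) by (auto simp: monom_eq_0_iff)
  qed
  have z: "z \<noteq> 0" using Rne T' by force
  have wv: "wedge s' (v' \<kappa>) \<noteq> 0"
  proof
    assume "wedge s' (v' \<kappa>) = 0"
    then obtain \<gamma> where \<gamma>: "v' \<kappa> = \<gamma> *s s'" using wedge_zero_multiple[OF s'0] by blast
    have "pairing s' (\<eta> s') = 0" using T'[of 0] z by simp
    moreover have m: "s' + t *s v' \<kappa> = (1 + t * \<gamma>) *s s'" for t by (simp add: \<gamma> vec_eq_iff algebra_simps)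
    ultimately have "t ^ (k + 1) * poly R t = 0" for t using T'[of t] unfolding m hom_poly_pairing_scale[OF hom] by simp
    then show False using Rne by blast
  qed
  have "contact d \<eta> s' k"
  proof (rule contactI[OF hom wv])
    show "pairing s' (\<eta> (s' + y *s v' \<kappa>)) = y ^ (k + 1) * poly (smult (- 1 / z) R) y" for y
    proof -
      have "pairing s' (\<eta> (s' + y *s v' \<kappa>)) = - 1 / z * (- z * pairing s' (\<eta> (s' + y *s v' \<kappa>)))" using z by simp
      then show ?thesis unfolding T' by simp
    qed
    show "poly (smult (- 1 / z) R) 0 \<noteq> 0" using R(2) z by simp
  qed
  then show "contact d \<eta> (vector [s $ 1, s $ 2]) k" by (simp add: s'_def)
qed

section \<open>A transverse inflection line of maximal order\<close>

lemma hom_poly_has_gradient: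
  assumes "hom_poly n f"
  shows "(f has_derivative pairing (gradient f x)) (at x)"
proof -
  have "\<exists>l. (f has_derivative pairing l) (at x)"
    using assms
  proof (induction rule: hom_poly_induct)
    case zero show ?case using pairing_derivative_const by (rule exI)
  next
    case (add f g)
    then obtain k l where "(f has_derivative pairing k) (at x)" "(g has_derivative pairing l) (at x)" by blast
    then show ?case by (intro exI[of _ "k + l"] pairing_derivative_add)
  next
    case (monomial c e)
    have "finite A \<Longrightarrow> \<exists>l. ((\<lambda>x. \<Prod>i\<in>A. x $ i ^ e i) has_derivative pairing l) (at x)" for A
    proof (induction A rule: finite_induct)
      case empty show ?case using pairing_derivative_const[of 1] by (auto simp del: one_neq_zero)
    next
      case (insert j A)
      then obtain l where l: "((\<lambda>x. \<Prod>i\<in>A. x $ i ^ e i) has_derivative pairing l) (at x)" by blast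
      have "((\<lambda>z. z ^ e j) has_field_derivative of_nat (e j) * (x $ j) ^ (e j - 1)) (at (x $ j))"
        by (auto intro!: derivative_eq_intros)
      from pairing_derivative_mult[OF pairing_derivative_chain[OF pairing_derivative_nth this] l]
      show ?case by (auto simp: insert.hyps)
    qed
    then obtain l where "((\<lambda>x. \<Prod>i\<in>UNIV. x $ i ^ e i) has_derivative pairing l) (at x)" using finite_class.finite_UNIV by blast
    from pairing_derivative_mult[OF pairing_derivative_const[of c] this] show ?case by (rule exI)
  qed
  then show ?thesis using gradient_eqI by metis
qed

lemma affine_line_derivative:
  assumes "(h has_derivative pairing l) (at (u + t *s e))"
  shows "((\<lambda>t. h (u + t *s e)) has_field_derivative pairing l e) (at t)"
proof -
  have "((\<lambda>t. u + t *s e) has_derivative (\<lambda>t. t *s e)) (at t)"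
    by (rule has_derivative_eq_rhs, rule has_derivative_add[OF has_derivative_const scale_has_derivative]) simp
  from diff_chain_at[OF this assms] show ?thesis
    by (simp add: has_field_derivative_def o_def pairing_simps mult_commute_abs)
qed

lemma euler_identity:
  assumes "hom_poly n f" "(f has_derivative pairing l) (at x)"
  shows "pairing l x = of_nat n * f x"
proof -
  have "((\<lambda>t. f (t *s x)) has_field_derivative pairing l x) (at 1)"
    using line_has_field_derivative[of f l 1 x] assms(2) by simp
  moreover have "((\<lambda>t. f (t *s x)) has_field_derivative of_nat n * f x) (at 1)"
    unfolding hom_poly_scale[OF assms(1)] by (auto intro!: derivative_eq_intros)
  ultimately show ?thesis by (rule DERIV_unique)
qed

lemma jacobian_det_gradient: "jacobian_det \<eta> w = wedge (gradient (\<lambda>w. \<eta> w $ 1) w) (gradient (\<lambda>w. \<eta> w $ 2) w)"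
  by (simp add: jacobian_det_def wedge_def gradient_def)

text \<open>If \<open>p\<close> vanishes at 0 to order \<open>n \<ge> 1\<close> and \<open>q\<close> does not vanish there, then \<open>p q' - p' q\<close>
  vanishes to order exactly \<open>n - 1\<close>.\<close>

lemma wronskian_order:
  fixes p q r :: "complex poly"
  assumes p: "poly p 0 = 0" and q: "poly q 0 \<noteq> 0" and W: "p * pderiv q - pderiv p * q = monom 1 m * r" and i: "i \<le> m"
  shows "coeff p i = 0"
proof (cases "p = 0")
  case False
  obtain n s where s: "p = [:- 0, 1:] ^ n * s" "\<not> [:- 0, 1:] dvd s"
    using order_decomp[OF False, of 0] by blast
  have s0: "poly s 0 \<noteq> 0" using s(2) by (simp add: poly_eq_0_iff_dvd)
  have pm: "p = monom 1 n * s" using s(1) by (simp add: monom_altdef)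
  have "n \<noteq> 0" using p s0 by (auto simp: pm poly_monom)
  then obtain n' where n': "n = Suc n'" by (cases n) auto
  have x: "monom 1 n = monom 1 n' * [:0, 1 :: complex:]" by (simp add: n' monom_Suc)
  have d: "pderiv (monom 1 n :: complex poly) = smult (of_nat n) (monom 1 n')" by (simp add: n' pderiv_monom smult_monom)
  have e: "monom 1 n' * ([:0, 1:] * s * pderiv q - (smult (of_nat n) s + [:0, 1:] * pderiv s) * q) = monom 1 m * r" (is "_ * ?B = _")
    unfolding W[symmetric] pm pderiv_mult d by (simp add: x algebra_simps)
  have "poly ?B 0 \<noteq> 0" using s0 q by (simp add: n' del: of_nat_Suc)
  then have "coeff (monom 1 n' * ?B) n' \<noteq> 0" by (simp only: coeff_monom_mult) (simp add: poly_0_coeff_0)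
  then have "m \<le> n'" unfolding e by (auto simp: coeff_monom_mult not_le split: if_splits)
  then show ?thesis using i by (simp add: pm coeff_monom_mult n')
qed simp

lemma hom_poly_on_line:
  fixes f :: "complex^2 \<Rightarrow> complex"
  assumes "hom_poly n f"
  shows "\<exists>p. \<forall>t. f (u + t *s e) = poly p t"
proof -
  obtain c where c: "\<And>w. f w = (\<Sum>i\<le>n. c i * w $ 1 ^ (n - i) * w $ 2 ^ i)"
    using binary_form_exists[OF assms] by blast
  show ?thesis
    by (rule exI[of _ "\<Sum>i\<le>n. [:c i:] * [:u $ 1, e $ 1:] ^ (n - i) * [:u $ 2, e $ 2:] ^ i"])
       (simp add: c poly_sum poly_power algebra_simps)
qed

lemma binary_form_last_coefficient:
  fixes c :: "nat \<Rightarrow> complex"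
  assumes "\<And>i. i < d \<Longrightarrow> c i = 0"
  shows "(\<Sum>i\<le>d. c i * x ^ (d - i) * y ^ i) = c d * y ^ d"
proof -
  have "(\<Sum>i\<le>d. c i * x ^ (d - i) * y ^ i) = (\<Sum>i\<le>d. if i = d then c d * y ^ d else 0)"
    by (rule sum.cong) (use assms in auto)
  then show ?thesis by simp
qed

text \<open>Let \<open>u\<close> span the inflection line and let \<open>a\<close> annihilate \<open>\<eta> u\<close>. By Euler's identity the
  Jacobian determinant of the forms \<open>C = pairing a (\<eta> w)\<close> and \<open>D = pairing u (\<eta> w)\<close>, restricted
  to a line transverse to \<open>u\<close>, is their Wronskian up to a constant. Since \<open>C\<close> vanishes on \<open>u\<close>
  and \<open>D\<close> does not, the Wronskian has order one less than \<open>C\<close>; the order being at least \<open>d - 1\<close>,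
  the form \<open>C\<close> of degree \<open>d\<close> is a \<open>d\<close>-th power.\<close>

theorem inflection_form:
  fixes \<eta> :: "complex^2 \<Rightarrow> complex^2"
  assumes hom: "\<And>i. hom_poly d (\<lambda>w. \<eta> w $ i)" and d: "d \<ge> 1"
    and l: "l \<noteq> 0" "\<not> invariant_line \<eta> l" and dvd: "line_power_dvd l (d - 1) (jacobian_det \<eta>)"
  obtains a u \<gamma> where "a \<noteq> 0" "pairing u (\<eta> u) \<noteq> 0" "\<And>w. pairing a (\<eta> w) = \<gamma> * (wedge u w) ^ d"
proof -
  note hp = hom_poly_pairing[where \<eta> = \<eta>, OF hom]
  define u :: "complex^2" where "u = vector [- l $ 2, l $ 1]"
  define a :: "complex^2" where "a = vector [\<eta> u $ 2, - \<eta> u $ 1]"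
  have lu: "pairing l w = - wedge u w" for w by (simp add: u_def wedge_def pairing_def sum_2)
  have u0: "u \<noteq> 0" using l(1) by (auto simp: u_def vec_eq_iff forall_2)
  obtain w where w: "pairing l w = 0" "pairing u (\<eta> w) \<noteq> 0"
    using l(2) unfolding invariant_line_def kernel_field_on_line u_def[symmetric] by blast
  obtain t where "w = t *s u" using wedge_zero_multiple[OF u0] w(1) lu by (metis neg_equal_0_iff_equal)
  then have uu: "pairing u (\<eta> u) \<noteq> 0" using w(2) hom_poly_pairing_scale[OF hom, of u t u] by auto
  have a0: "a \<noteq> 0" using uu by (auto simp: a_def vec_eq_iff forall_2 pairing_def sum_2)
  have au: "pairing a (\<eta> u) = 0" by (simp add: a_def pairing_def sum_2)
  obtain e where e: "wedge u e \<noteq> 0" using wedge_complement[OF u0] .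
  obtain n Q where Q: "hom_poly n Q" "jacobian_det \<eta> = (\<lambda>w. pairing l w ^ (d - 1) * Q w)"
    using dvd unfolding line_power_dvd_def by blast
  obtain p where p: "\<And>t. pairing a (\<eta> (u + t *s e)) = poly p t" using hom_poly_on_line[OF hp] by blast
  obtain q where q: "\<And>t. pairing u (\<eta> (u + t *s e)) = poly q t" using hom_poly_on_line[OF hp] by blast
  obtain r where r: "\<And>t. Q (u + t *s e) = poly r t" using hom_poly_on_line[OF Q(1)] by blast
  define g where "g i w = gradient (\<lambda>w. \<eta> w $ i) w" for i w
  have G: "((\<lambda>w. pairing b (\<eta> w)) has_derivative pairing (b $ 1 *s g 1 w + b $ 2 *s g 2 w)) (at w)" for b w
  proof -
    have "((\<lambda>w. b $ i * \<eta> w $ i) has_derivative pairing (b $ i *s g i w)) (at w)" for i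
      using pairing_derivative_mult[OF pairing_derivative_const[of "b $ i"] hom_poly_has_gradient[OF hom, of i w]]
      by (simp add: g_def)
    from pairing_derivative_add[OF this[of 1] this[of 2]] show ?thesis by (simp add: pairing_def[of b] sum_2)
  qed
  \<comment> \<open>the constant factor between the Wronskian and the Jacobian determinant\<close>
  define K where "K = wedge a u * wedge u e * (- wedge u e) ^ (d - 1) / of_nat d"
  have "poly (p * pderiv q - pderiv p * q) t = poly (monom 1 (d - 1) * smult K r) t" for t
  proof -
    define w where "w = u + t *s e"
    define A B where "A = a $ 1 *s g 1 w + a $ 2 *s g 2 w" and "B = u $ 1 *s g 1 w + u $ 2 *s g 2 w"
    have D: "poly (pderiv p) t = pairing A e" "poly (pderiv q) t = pairing B e"
    proof -
      have "((\<lambda>t. poly p t) has_field_derivative pairing A e) (at t)"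
        unfolding p[symmetric] by (rule affine_line_derivative) (use G[of a w] in \<open>simp add: A_def w_def\<close>)
      then show "poly (pderiv p) t = pairing A e" by (rule DERIV_unique[OF poly_DERIV])
      have "((\<lambda>t. poly q t) has_field_derivative pairing B e) (at t)"
        unfolding q[symmetric] by (rule affine_line_derivative) (use G[of u w] in \<open>simp add: B_def w_def\<close>)
      then show "poly (pderiv q) t = pairing B e" by (rule DERIV_unique[OF poly_DERIV])
    qed
    have E: "pairing A w = of_nat d * poly p t" "pairing B w = of_nat d * poly q t"
      using euler_identity[OF hp G, of a w] euler_identity[OF hp G, of u w] by (simp_all add: A_def B_def p[symmetric] q[symmetric] w_def)
    have "pairing A w * pairing B e - pairing A e * pairing B w = wedge A B * wedge w e"
      by (simp add: pairing_def sum_2 wedge_def algebra_simps)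
    also have "wedge A B = wedge a u * wedge (g 1 w) (g 2 w)"
      by (simp add: A_def B_def wedge_def algebra_simps)
    also have "wedge (g 1 w) (g 2 w) = (- t * wedge u e) ^ (d - 1) * poly r t"
      using Q(2) by (simp add: g_def jacobian_det_gradient[symmetric] lu r[symmetric] w_def wedge_simps)
    also have "wedge w e = wedge u e" by (simp add: w_def wedge_simps)
    finally have "of_nat d * (poly p t * poly (pderiv q) t - poly (pderiv p) t * poly q t)
        = wedge a u * ((- t * wedge u e) ^ (d - 1) * poly r t) * wedge u e"
      by (simp add: D E algebra_simps)
    also have "(- t * wedge u e) ^ (d - 1) = t ^ (d - 1) * (- wedge u e) ^ (d - 1)"
      by (simp flip: power_mult_distrib)
    finally show ?thesis using d by (simp add: K_def poly_monom field_simps)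
  qed
  then have W: "p * pderiv q - pderiv p * q = monom 1 (d - 1) * smult K r" by (rule poly_ext)
  have p0: "poly p 0 = 0" and q0: "poly q 0 \<noteq> 0" using p[of 0] q[of 0] au uu by simp_all
  obtain c where c: "\<And>x y. pairing a (\<eta> (x *s u + y *s e)) = (\<Sum>i\<le>d. c i * x ^ (d - i) * y ^ i)"
    using binary_form_in_basis[OF hom] by blast
  have P: "p = (\<Sum>i\<le>d. monom (c i) i)"
    by (rule poly_ext) (use c[of 1] p in \<open>simp add: poly_sum poly_monom\<close>)
  have "c i = 0" if "i < d" for i
  proof -
    have "coeff p i = c i" using that by (simp add: P coeff_sum if_distrib cong: if_cong)
    then show ?thesis using wronskian_order[OF p0 q0 W, of i] that by simp
  qed
  then have c': "pairing a (\<eta> (x *s u + y *s e)) = c d * y ^ d" for x y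
    unfolding c by (rule binary_form_last_coefficient)
  have "pairing a (\<eta> w) = c d / wedge u e ^ d * (wedge u w) ^ d" for w
    by (subst basis_decomposition[OF e, of w], subst c') (simp add: power_divide)
  from that[OF a0 uu this] show ?thesis .
qed

section \<open>Normal form with one parameter\<close>

lemma contact_scale:
  assumes "contact d \<eta> s k" and \<alpha>: "\<alpha> \<noteq> 0"
  shows "contact d \<eta> (\<alpha> *s s) k"
  unfolding contact_def
proof (intro conjI allI impI)
  show "\<alpha> *s s \<noteq> 0" "k + 1 \<le> d" using assms by (simp_all add: contact_def)
  fix b assume "wedge (\<alpha> *s s) b \<noteq> 0"
  then have "wedge s b \<noteq> 0" by (simp add: wedge_simps)
  then obtain c where c: "\<And>x y. pairing s (\<eta> (x *s s + y *s b)) = (\<Sum>i\<le>d. c i * x ^ (d - i) * y ^ i)"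
    "\<And>i. i \<le> k \<Longrightarrow> c i = 0" "c (k + 1) \<noteq> 0"
    using assms(1) unfolding contact_def by blast
  have "pairing (\<alpha> *s s) (\<eta> (x *s (\<alpha> *s s) + y *s b)) = (\<Sum>i\<le>d. (\<alpha> * \<alpha> ^ (d - i) * c i) * x ^ (d - i) * y ^ i)" for x y
    using c(1)[of "x * \<alpha>" y] by (simp add: pairing_simps sum_distrib_left power_mult_distrib mult_ac)
  then show "\<exists>c. (\<forall>x y. pairing (\<alpha> *s s) (\<eta> (x *s (\<alpha> *s s) + y *s b)) = (\<Sum>i\<le>d. c i * x ^ (d - i) * y ^ i))
      \<and> (\<forall>i\<le>k. c i = 0) \<and> c (k + 1) \<noteq> 0"
    using c(2,3) \<alpha> by (intro exI[of _ "\<lambda>i. \<alpha> * \<alpha> ^ (d - i) * c i"]) auto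
qed

lemma contact_pairing: "contact d \<eta> s k \<Longrightarrow> pairing s (\<eta> s) = 0"
proof -
  assume s: "contact d \<eta> s k"
  obtain b where "wedge s b \<noteq> 0" using s wedge_complement unfolding contact_def by blast
  then obtain c where c: "\<And>x y. pairing s (\<eta> (x *s s + y *s b)) = (\<Sum>i\<le>d. c i * x ^ (d - i) * y ^ i)" "\<And>i. i \<le> k \<Longrightarrow> c i = 0"
    using s unfolding contact_def by blast
  have "pairing s (\<eta> s) = (\<Sum>i\<le>d. c i * 1 ^ (d - i) * 0 ^ i)" using c(1)[of 1 0] by simp
  also have "\<dots> = 0" by (rule sum.neutral) (use c(2)[of 0] in \<open>auto simp: power_0_left\<close>)
  finally show ?thesis .
qed

lemma sum_above: "(\<nu> :: nat) \<le> d \<Longrightarrow> (\<Sum>i\<le>d. if \<nu> < i then f i else (0 :: complex)) = (\<Sum>i=\<nu>+1..d. f i)"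
  by (rule sum.mono_neutral_cong_right) auto

lemma sum_below: "(\<nu> :: nat) \<le> d \<Longrightarrow> (\<Sum>i\<le>d. if i \<le> \<nu> then f i else (0 :: complex)) = (\<Sum>i=0..\<nu>. f i)"
  by (rule sum.mono_neutral_cong_right) auto

text \<open>In the basis \<open>s\<close>, \<open>t\<close> of the two directions of contact, the contact orders say that the
  two components of \<open>\<eta>\<close> involve complementary sets of monomials. Scaling the basis so that
  \<open>u = s - t\<close> makes \<open>wedge u w\<close> a multiple of \<open>x + y\<close>; comparing coefficients in
  \<open>a\<^sub>1 A + a\<^sub>2 B = \<gamma>' (x + y)\<^sup>d\<close> then determines both components, with \<open>\<mu> = a\<^sub>2 / a\<^sub>1\<close>.\<close>

theorem contacts_normal_form:
  fixes \<eta> :: "complex^2 \<Rightarrow> complex^2"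
  assumes s1: "contact d \<eta> s1 \<nu>" and s2: "contact d \<eta> s2 (d - \<nu> - 1)" and \<nu>: "\<nu> + 1 \<le> d"
    and w: "wedge s1 s2 \<noteq> 0" "wedge s1 u \<noteq> 0" "wedge s2 u \<noteq> 0"
    and a: "a \<noteq> 0" "\<And>w. pairing a (\<eta> w) = \<gamma> * (wedge u w) ^ d"
  obtains s t c \<mu> where "wedge s t \<noteq> 0" "c \<noteq> 0" "\<mu> \<noteq> 0" "\<mu> = - 1 \<longleftrightarrow> wedge a u = 0"
    "\<And>x y. pairing s (\<eta> (x *s s + y *s t)) = c * model d \<nu> \<mu> (vector [x, y]) $ 1"
    "\<And>x y. pairing t (\<eta> (x *s s + y *s t)) = c * model d \<nu> \<mu> (vector [x, y]) $ 2"
proof -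
  define s t where "s = (wedge u s2 / wedge s1 s2) *s s1" and "t = (- (wedge s1 u / wedge s1 s2)) *s s2"
  have ust: "u = s - t" using basis_decomposition[OF w(1), of u] by (simp add: s_def t_def)
  have us2: "wedge u s2 \<noteq> 0" using w(3) by (simp add: wedge_def algebra_simps)
  have cs: "contact d \<eta> s \<nu>" unfolding s_def by (rule contact_scale[OF s1]) (use us2 w in simp)
  have ct: "contact d \<eta> t (d - \<nu> - 1)" unfolding t_def by (rule contact_scale[OF s2]) (use w in simp)
  \<comment> \<open>in the basis \<open>s\<close>, \<open>t\<close> the linear form \<open>wedge u\<close> is \<open>W (x + y)\<close>\<close>
  define W where "W = wedge s t"
  have W: "W \<noteq> 0" using w us2 by (simp add: W_def s_def t_def wedge_simps)
  then have "wedge t s \<noteq> 0" by (simp add: W_def wedge_def algebra_simps)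
  then obtain e where e: "\<And>x y. pairing t (\<eta> (x *s t + y *s s)) = (\<Sum>i\<le>d. e i * x ^ (d - i) * y ^ i)"
    "\<And>i. i \<le> d - \<nu> - 1 \<Longrightarrow> e i = 0" "e (d - \<nu> - 1 + 1) \<noteq> 0"
    using ct unfolding contact_def by blast
  obtain f where f: "\<And>x y. pairing s (\<eta> (x *s s + y *s t)) = (\<Sum>i\<le>d. f i * x ^ (d - i) * y ^ i)"
    "\<And>i. i \<le> \<nu> \<Longrightarrow> f i = 0" "f (\<nu> + 1) \<noteq> 0"
    using cs W unfolding contact_def W_def by blast
  define g where "g i = e (d - i)" for i
  have g: "pairing t (\<eta> (x *s s + y *s t)) = (\<Sum>i\<le>d. g i * x ^ (d - i) * y ^ i)" for x y
  proof -
    have "pairing t (\<eta> (x *s s + y *s t)) = (\<Sum>i\<le>d. e i * y ^ (d - i) * x ^ i)" using e(1)[of y x] by (simp add: add.commute)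
    also have "\<dots> = (\<Sum>i\<le>d. e (d - i) * y ^ (d - (d - i)) * x ^ (d - i))"
      by (rule sum.reindex_bij_witness[where i = "\<lambda>i. d - i" and j = "\<lambda>i. d - i"]) auto
    also have "\<dots> = (\<Sum>i\<le>d. g i * x ^ (d - i) * y ^ i)"
      by (rule sum.cong) (auto simp: g_def mult_ac)
    finally show ?thesis .
  qed
  have g0: "g i = 0" if "\<nu> < i" for i using e(2)[of "d - i"] that by (simp add: g_def)
  have "d - \<nu> - 1 + 1 = d - \<nu>" using \<nu> by simp
  then have g1: "g \<nu> \<noteq> 0" using e(3) unfolding g_def by metis
  define a1 a2 where "a1 = wedge a t / W" and "a2 = wedge s a / W"
  have ast: "a = a1 *s s + a2 *s t" unfolding a1_def a2_def W_def by (rule basis_decomposition) (use W in \<open>simp add: W_def\<close>)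
  define \<gamma>' where "\<gamma>' = \<gamma> * W ^ d"
  have co: "a1 * f i + a2 * g i = \<gamma>' * of_nat (d choose i)" if "i \<le> d" for i
  proof (rule polynomial_coefficients_unique[OF _ that])
    fix z
    have "(\<Sum>j\<le>d. (a1 * f j + a2 * g j) * z ^ j) = pairing a (\<eta> (1 *s s + z *s t))"
      unfolding ast using f(1)[of 1 z] g[of 1 z] by (simp add: pairing_simps sum_distrib_left sum.distrib algebra_simps)
    also have "\<dots> = \<gamma> * (W * (z + 1)) ^ d"
      unfolding a(2) ust W_def by (simp add: wedge_simps) (simp add: wedge_def algebra_simps)
    also have "\<dots> = (\<Sum>j\<le>d. \<gamma>' * of_nat (d choose j) * z ^ j)"
      unfolding \<gamma>'_def power_mult_distrib by (subst binomial_ring) (simp add: sum_distrib_left mult_ac)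
    finally show "(\<Sum>j\<le>d. (a1 * f j + a2 * g j) * z ^ j) = (\<Sum>j\<le>d. \<gamma>' * of_nat (d choose j) * z ^ j)" .
  qed
  have low: "a2 * g i = \<gamma>' * of_nat (d choose i)" if "i \<le> \<nu>" for i using co[of i] f(2)[OF that] that \<nu> by simp
  have high: "a1 * f i = \<gamma>' * of_nat (d choose i)" if "\<nu> < i" "i \<le> d" for i using co[of i] g0[OF that(1)] that by simp
  have "\<gamma>' \<noteq> 0"
  proof
    assume "\<gamma>' = 0"
    then have "a1 = 0" "a2 = 0" using low[of \<nu>] high[of "\<nu> + 1"] g1 f(3) \<nu> by auto
    then show False using a(1) ast by simp
  qed
  moreover from this have "a1 \<noteq> 0" "a2 \<noteq> 0" using low[of \<nu>] high[of "\<nu> + 1"] \<nu> by (auto simp: binomial_eq_0_iff)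
  ultimately have nz: "\<gamma>' \<noteq> 0" "a1 \<noteq> 0" "a2 \<noteq> 0" by simp_all
  have fi: "f i = (if \<nu> < i then \<gamma>' / a2 * (a2 / a1) * of_nat (d choose i) else 0)" if "i \<le> d" for i
    using high[of i] f(2)[of i] that nz by (auto simp: field_simps)
  have gi: "g i = (if i \<le> \<nu> then \<gamma>' / a2 * of_nat (d choose i) else 0)" if "i \<le> d" for i
    using low[of i] g0[of i] that nz by (auto simp: field_simps)
  show ?thesis
  proof (rule that[of s t "\<gamma>' / a2" "a2 / a1"])
    show "wedge s t \<noteq> 0" using W by (simp add: W_def)
    show "\<gamma>' / a2 \<noteq> 0" "a2 / a1 \<noteq> 0" using nz by simp_all
    have "wedge a u = - ((a1 + a2) * W)" unfolding ast ust W_def by (simp add: wedge_def algebra_simps)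
    moreover have "a2 / a1 = - 1 \<longleftrightarrow> a1 + a2 = 0" using nz by (auto simp: field_simps eq_neg_iff_add_eq_0)
    ultimately show "a2 / a1 = - 1 \<longleftrightarrow> wedge a u = 0" using W by simp
    fix x y
    have "pairing s (\<eta> (x *s s + y *s t)) = (\<Sum>i\<le>d. if \<nu> < i then \<gamma>' / a2 * (a2 / a1) * of_nat (d choose i) * x ^ (d - i) * y ^ i else 0)"
      unfolding f(1) by (rule sum.cong) (auto simp: fi)
    also have "\<dots> = \<gamma>' / a2 * model d \<nu> (a2 / a1) (vector [x, y]) $ 1"
      using \<nu> by (simp add: sum_above model_def sum_distrib_left mult_ac)
    finally show "pairing s (\<eta> (x *s s + y *s t)) = \<gamma>' / a2 * model d \<nu> (a2 / a1) (vector [x, y]) $ 1" .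
    have "pairing t (\<eta> (x *s s + y *s t)) = (\<Sum>i\<le>d. if i \<le> \<nu> then \<gamma>' / a2 * of_nat (d choose i) * x ^ (d - i) * y ^ i else 0)"
      unfolding g by (rule sum.cong) (auto simp: gi)
    also have "\<dots> = \<gamma>' / a2 * model d \<nu> (a2 / a1) (vector [x, y]) $ 2"
      using \<nu> by (simp add: sum_below model_def sum_distrib_left mult_ac)
    finally show "pairing t (\<eta> (x *s s + y *s t)) = \<gamma>' / a2 * model d \<nu> (a2 / a1) (vector [x, y]) $ 2" .
  qed
qed

text \<open>A linear change of the two affine coordinates, extended by the identity, conjugates the
  projective forms.\<close>

lemma linearly_conjugate_binary:
  fixes \<eta> \<zeta> :: "complex^2 \<Rightarrow> complex^2"
  assumes w: "wedge s t \<noteq> 0" and c: "c \<noteq> 0"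
    and s: "\<And>x y. pairing s (\<eta> (x *s s + y *s t)) = c * \<zeta> (vector [x, y]) $ 1"
    and t: "\<And>x y. pairing t (\<eta> (x *s s + y *s t)) = c * \<zeta> (vector [x, y]) $ 2"
  shows "linearly_conjugate (projective_form \<eta>) (projective_form \<zeta>)"
proof -
  define N :: "complex^3^3" where "N = vector [vector [s $ 1, t $ 1, 0], vector [s $ 2, t $ 2, 0], vector [0, 0, 1]]"
  have N: "invertible N" using w by (simp add: invertible_det_nz N_def det_3 wedge_def algebra_simps)
  have Nx: "N *v x = vector [x $ 1 * s $ 1 + x $ 2 * t $ 1, x $ 1 * s $ 2 + x $ 2 * t $ 2, x $ 3]" for x
    by (simp add: N_def matrix_vector_mult_def sum_3 vec_eq_iff forall_3 mult.commute)
  have "projective_form \<zeta> x = (1 / c) *s pullback N (projective_form \<eta>) x" for x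
  proof -
    define h where "h = \<eta> (x $ 1 *s s + x $ 2 *s t)"
    have "vector [x $ 1 * s $ 1 + x $ 2 * t $ 1, x $ 1 * s $ 2 + x $ 2 * t $ 2] = x $ 1 *s s + x $ 2 *s t"
      by (simp add: vec_eq_iff forall_2)
    then have P: "projective_form \<eta> (N *v x) = vector [x $ 3 * h $ 1, x $ 3 * h $ 2,
        - ((x $ 1 * s $ 1 + x $ 2 * t $ 1) * h $ 1 + (x $ 1 * s $ 2 + x $ 2 * t $ 2) * h $ 2)]"
      by (simp add: projective_form_def Let_def Nx h_def)
    have "s $ 1 * h $ 1 + s $ 2 * h $ 2 = c * \<zeta> (vector [x $ 1, x $ 2]) $ 1" "t $ 1 * h $ 1 + t $ 2 * h $ 2 = c * \<zeta> (vector [x $ 1, x $ 2]) $ 2"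
      using s[of "x $ 1" "x $ 2"] t[of "x $ 1" "x $ 2"] by (simp_all add: pairing_def sum_2 h_def)
    then have z: "\<zeta> (vector [x $ 1, x $ 2]) $ 1 = (s $ 1 * h $ 1 + s $ 2 * h $ 2) / c" "\<zeta> (vector [x $ 1, x $ 2]) $ 2 = (t $ 1 * h $ 1 + t $ 2 * h $ 2) / c"
      using c by (simp_all add: field_simps)
    show ?thesis
      using c unfolding pullback_def P
      by (simp add: vec_eq_iff forall_3 projective_form_def Let_def z matrix_vector_mult_def transpose_def sum_3 N_def field_simps
          del: transpose_matrix_vector)
  qed
  then have "same_foliation (pullback N (projective_form \<eta>)) (projective_form \<zeta>)"
    unfolding same_foliation_def using c by (intro exI[of _ "1 / c"]) (simp add: fun_eq_iff)
  then show ?thesis using N unfolding linearly_conjugate_def by blast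
qed

lemma linearly_conjugate_pullback:
  assumes "invertible M" "linearly_conjugate (pullback M \<omega>) \<omega>'"
  shows "linearly_conjugate \<omega> \<omega>'"
  using assms unfolding linearly_conjugate_def pullback_pullback by (meson invertible_mult)

lemma linearly_conjugate_scale:
  assumes "linearly_conjugate \<omega> \<omega>'" "c \<noteq> 0"
  shows "linearly_conjugate \<omega> (\<lambda>x. c *s \<omega>' x)"
proof -
  obtain M k where M: "invertible M" "k \<noteq> 0" "\<omega>' = (\<lambda>x. k *s pullback M \<omega> x)"
    using assms(1) unfolding linearly_conjugate_def same_foliation_def by blast
  then have "same_foliation (pullback M \<omega>) (\<lambda>x. c *s \<omega>' x)"
    unfolding same_foliation_def using assms(2) by (intro exI[of _ "c * k"]) (simp add: fun_eq_iff)
  then show ?thesis using M(1) unfolding linearly_conjugate_def by blast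
qed

lemma projective_form_scale: "projective_form (\<lambda>w. c *s \<eta> w) = (\<lambda>x. c *s projective_form \<eta> x)"
  by (simp add: fun_eq_iff projective_form_def Let_def vec_eq_iff forall_3 algebra_simps)

section \<open>Reading off the type\<close>

lemma count_foliation_type:
  assumes "1 \<le> j" "j \<le> d - 1"
  shows "count (foliation_type d M \<omega>) (Rsym j) = card (radial_singularities j \<omega>)"
    and "count (foliation_type d M \<omega>) (Tsym j) = card (inflection_lines j (affine_form (pullback M \<omega>)))"
proof -
  have "(\<Sum>k=1..d-1. if k = j then f k else 0) = f j" for f :: "nat \<Rightarrow> nat" using assms by simp
  note * = this
  show "count (foliation_type d M \<omega>) (Rsym j) = card (radial_singularities j \<omega>)"
    using *[of "\<lambda>k. card (radial_singularities k \<omega>)"]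
    by (simp add: foliation_type_def count_sum eq_commute[of j])
  show "count (foliation_type d M \<omega>) (Tsym j) = card (inflection_lines j (affine_form (pullback M \<omega>)))"
    using *[of "\<lambda>k. card (inflection_lines k (affine_form (pullback M \<omega>)))"]
    by (simp add: foliation_type_def count_sum eq_commute[of j])
qed

lemma card_pos_element: "card A \<ge> 1 \<Longrightarrow> \<exists>a. a \<in> A"
  by (cases "A = {}") auto

lemma affine_projective_form: "affine_form (projective_form \<eta>) = \<eta>"
proof
  fix w :: "complex^2"
  have "vector [w $ 1, w $ 2] = w" by (simp add: vec_eq_iff forall_2)
  then show "affine_form (projective_form \<eta>) w = \<eta> w"
    by (simp add: affine_form_def projective_form_def Let_def) (simp add: vec_eq_iff forall_2)
qed

lemma radial_singularity_contact:
  assumes hom: "\<And>i. hom_poly d (\<lambda>w. \<eta> w $ i)" and nz: "\<And>w. w \<noteq> 0 \<Longrightarrow> \<eta> w \<noteq> 0" and d: "d \<ge> 2"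
    and M: "invertible M" "pullback M \<omega> = projective_form \<eta>" and P: "P \<in> radial_singularities k \<omega>"
  obtains s where "contact d \<eta> s k" "P = proj_point (M *v vector [s $ 1, s $ 2, 0])"
proof -
  obtain M0 where M0: "invertible M0" "P = proj_point (M0 *v axis 3 1)" "radial_at_origin k (affine_form (pullback M0 \<omega>))"
    using P unfolding radial_singularities_def by blast
  obtain M' where M': "M ** M' = mat 1" "M' ** M = mat 1" using M(1) unfolding invertible_def by blast
  have iM': "invertible M'" unfolding invertible_def using M' by blast
  have "\<omega> = pullback M' (projective_form \<eta>)"
    unfolding M(2)[symmetric] pullback_pullback M'(1) pullback_mat_1 ..
  then have "pullback M0 \<omega> = pullback (M' ** M0) (projective_form \<eta>)" by (simp add: pullback_pullback)
  then have "radial_at_origin k (affine_form (pullback (M' ** M0) (projective_form \<eta>)))" using M0(3) by simp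
  note rc = radial_contact[OF hom nz d invertible_mult[OF iM' M0(1)] this]
  define s where "s = (M' ** M0) *v axis 3 1"
  have "vector [s $ 1, s $ 2, 0] = s" using rc(1) by (simp add: s_def vec_eq_iff forall_3)
  then have "P = proj_point (M *v vector [s $ 1, s $ 2, 0])"
    by (simp add: s_def matrix_vector_mul_assoc matrix_mul_assoc M' M0(2))
  then show ?thesis using that[of "vector [s $ 1, s $ 2]"] rc(2) by (simp add: s_def)
qed

lemma proj_point_scale: "c \<noteq> 0 \<Longrightarrow> proj_point (c *s s) = proj_point s"
proof -
  assume c: "c \<noteq> 0"
  have "range (\<lambda>a. a *s (c *s s)) = (\<lambda>a. a *s s) ` range (\<lambda>a. a * c)" by (simp add: image_image)
  also have "range (\<lambda>a. a * c) = UNIV" using surjI[of "\<lambda>a. a * c" "\<lambda>a. a / c"] c by simp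
  finally show ?thesis unfolding proj_point_def .
qed

lemma distinct_contacts:
  fixes M :: "complex^3^3"
  assumes "contact d \<eta> s k" "contact d \<eta> s' k'"
    and "k \<noteq> k' \<or> proj_point (M *v vector [s $ 1, s $ 2, 0]) \<noteq> proj_point (M *v vector [s' $ 1, s' $ 2, 0])"
  shows "wedge s s' \<noteq> 0"
proof
  assume w: "wedge s s' = 0"
  have s: "s \<noteq> 0" "s' \<noteq> 0" using assms by (auto simp: contact_def)
  obtain \<gamma> where \<gamma>: "s' = \<gamma> *s s" using wedge_zero_multiple[OF s(1) w] .
  have "M *v vector [s' $ 1, s' $ 2, 0] = \<gamma> *s (M *v vector [s $ 1, s $ 2, 0])"
    by (simp add: \<gamma> matrix_vector_mult_def vec_eq_iff sum_3[where 'a = complex] algebra_simps)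
  then show False using assms contact_unique[OF assms(1,2) w] proj_point_scale[of \<gamma>] s(2) \<gamma> by auto
qed

text \<open>Two radial singularities of different orders have different directions by
  \<open>contact_unique\<close>; if the orders agree, the type counts two distinct points.\<close>

lemma two_contacts:
  assumes hom: "\<And>i. hom_poly d (\<lambda>w. \<eta> w $ i)" and nz: "\<And>w. w \<noteq> 0 \<Longrightarrow> \<eta> w \<noteq> 0" and d: "d \<ge> 2"
    and M: "invertible M" "pullback M \<omega> = projective_form \<eta>" and k: "1 \<le> k" "k \<le> d - 1" "1 \<le> k'" "k' \<le> d - 1"
    and type: "{#Rsym k, Rsym k'#} \<subseteq># foliation_type d M \<omega>"
  obtains s s' where "contact d \<eta> s k" "contact d \<eta> s' k'" "wedge s s' \<noteq> 0"
proof -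
  have c: "count {#Rsym k, Rsym k'#} (Rsym j) \<le> card (radial_singularities j \<omega>)" if "1 \<le> j" "j \<le> d - 1" for j
    using mset_subset_eq_count[OF type, of "Rsym j"] count_foliation_type(1)[OF that] by simp
  have "\<exists>P P'. P \<in> radial_singularities k \<omega> \<and> P' \<in> radial_singularities k' \<omega> \<and> (k \<noteq> k' \<or> P \<noteq> P')"
  proof (cases "k = k'")
    case True
    then have "2 \<le> card (radial_singularities k \<omega>)" using c[OF k(1,2)] by simp
    then obtain T where "T \<subseteq> radial_singularities k \<omega>" "card T = 2" by (rule obtain_subset_with_card_n) auto
    then show ?thesis using True by (auto simp: card_2_iff)
  next
    case False
    then have "1 \<le> card (radial_singularities k \<omega>)" "1 \<le> card (radial_singularities k' \<omega>)"
      using c[OF k(1,2)] c[OF k(3,4)] by simp_all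
    then show ?thesis using False card_pos_element by blast
  qed
  then obtain P P' where P: "P \<in> radial_singularities k \<omega>" "P' \<in> radial_singularities k' \<omega>" "k \<noteq> k' \<or> P \<noteq> P'" by blast
  obtain s where s: "contact d \<eta> s k" "P = proj_point (M *v vector [s $ 1, s $ 2, 0])"
    using radial_singularity_contact[OF hom nz d M P(1)] .
  obtain s' where s': "contact d \<eta> s' k'" "P' = proj_point (M *v vector [s' $ 1, s' $ 2, 0])"
    using radial_singularity_contact[OF hom nz d M P(2)] .
  show ?thesis using that[OF s(1) s'(1)] distinct_contacts[OF s(1) s'(1)] P(3) s(2) s'(2) by blast
qed

text \<open>Contact of maximal order leaves a single monomial, so here the \<open>d\<close>-th power of
  \<open>inflection_form\<close> arises with \<open>a = u = s\<close>.\<close>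

lemma contact_maximal:
  assumes "contact d \<eta> s (d - 1)"
  obtains \<gamma> where "\<And>w. pairing s (\<eta> w) = \<gamma> * (wedge s w) ^ d"
proof -
  have s: "s \<noteq> 0" "d - 1 + 1 \<le> d" using assms by (auto simp: contact_def)
  obtain b where b: "wedge s b \<noteq> 0" using wedge_complement[OF s(1)] .
  then obtain c where c: "\<And>x y. pairing s (\<eta> (x *s s + y *s b)) = (\<Sum>i\<le>d. c i * x ^ (d - i) * y ^ i)" "\<And>i. i \<le> d - 1 \<Longrightarrow> c i = 0"
    using assms unfolding contact_def by blast
  have c': "pairing s (\<eta> (x *s s + y *s b)) = c d * y ^ d" for x y
    unfolding c(1) by (rule binary_form_last_coefficient) (use c(2) in auto)
  have "pairing s (\<eta> w) = c d / wedge s b ^ d * (wedge s w) ^ d" for w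
    by (subst basis_decomposition[OF b, of w], subst c') (simp add: power_divide)
  then show ?thesis using that by blast
qed

lemma foliation_scale: "foliation d \<omega> \<Longrightarrow> \<omega> (c *s x) = c ^ (d + 1) *s \<omega> x"
proof -
  assume "foliation d \<omega>"
  then have "\<omega> (c *s x) $ i = c ^ (d + 1) * \<omega> x $ i" for i
    unfolding foliation_def using hom_poly_scale[of "d + 1" "\<lambda>x. \<omega> x $ i" c x] by blast
  then show ?thesis by (simp add: vec_eq_iff)
qed

theorem proposition2p16:
  fixes d \<nu> :: nat and \<omega> :: "complex^3 \<Rightarrow> complex^3" and M :: "complex^3^3"
  assumes "d \<ge> 3"
    and "foliation d \<omega>"
    and "homogeneous_in_chart M \<omega>"
    and "1 \<le> \<nu>" and "\<nu> \<le> d - 2"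
  shows
    "(foliation_type d M \<omega> = {# Rsym \<nu>, Rsym (d - \<nu> - 1), Rsym (d - 1) #} \<longrightarrow>
        (legendre_flat d \<omega> \<longleftrightarrow> linearly_conjugate \<omega> (projective_form (omega3 d \<nu>)))) \<and>
     (foliation_type d M \<omega> = {# Rsym \<nu>, Rsym (d - \<nu> - 1), Tsym (d - 1) #} \<longrightarrow>
        (legendre_flat d \<omega> \<longleftrightarrow> linearly_conjugate \<omega> (projective_form (omega4 d \<nu>))))"
proof -
  have \<nu>: "\<nu> + 2 \<le> d" "\<nu> + 1 \<le> d" and d: "d \<ge> 2" "d \<ge> 1" using assms by simp_all
  have M: "invertible M" using assms(3) by (simp add: homogeneous_in_chart_def)
  have "(2 :: complex) \<noteq> 0" by simp
  then have "same_foliation (pullback M \<omega>) (pullback (homothety 2) (pullback M \<omega>))"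
    using assms(3) unfolding homogeneous_in_chart_def by blast
  then obtain \<eta> where hom: "\<And>i. hom_poly d (\<lambda>w. \<eta> w $ i)" and \<eta>: "pullback M \<omega> = projective_form \<eta>" and nz: "\<And>w. w \<noteq> 0 \<Longrightarrow> \<eta> w \<noteq> 0"
    using homogeneous_normal_form[OF foliation_pullback[OF assms(2) M] d(2)] by blast
  \<comment> \<open>both types provide these data, so only the parameter of the model remains to be determined\<close>
  have conj: "\<exists>\<mu>. \<mu> \<noteq> 0 \<and> (\<mu> = - 1 \<longleftrightarrow> wedge a u = 0) \<and> linearly_conjugate \<omega> (projective_form (model d \<nu> \<mu>))"
    if h: "contact d \<eta> s1 \<nu>" "contact d \<eta> s2 (d - \<nu> - 1)" "wedge s1 s2 \<noteq> 0" "wedge s1 u \<noteq> 0" "wedge s2 u \<noteq> 0"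
      "a \<noteq> 0" "\<And>w. pairing a (\<eta> w) = \<gamma> * (wedge u w) ^ d" for s1 s2 a u \<gamma>
  proof -
    obtain s t c \<mu> where N: "wedge s t \<noteq> 0" "c \<noteq> 0" "\<mu> \<noteq> 0" "\<mu> = - 1 \<longleftrightarrow> wedge a u = 0"
      "\<And>x y. pairing s (\<eta> (x *s s + y *s t)) = c * model d \<nu> \<mu> (vector [x, y]) $ 1"
      "\<And>x y. pairing t (\<eta> (x *s s + y *s t)) = c * model d \<nu> \<mu> (vector [x, y]) $ 2"
      using contacts_normal_form[OF h(1,2) \<nu>(2) h(3-7)] by blast
    have "linearly_conjugate (pullback M \<omega>) (projective_form (model d \<nu> \<mu>))"
      unfolding \<eta> by (rule linearly_conjugate_binary[where \<zeta> = "model d \<nu> \<mu>", OF N(1,2,5,6)])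
    then show ?thesis using linearly_conjugate_pullback[OF M] N(3,4) by blast
  qed
  note flat_conj = linearly_conjugate_flat[where \<omega> = \<omega>, OF foliation_scale[OF assms(2)]]
  note flat_model = model_legendre_flat_iff[OF assms(1) assms(4) \<nu>(1)]
  have index: "1 \<le> \<nu>" "\<nu> \<le> d - 1" "1 \<le> d - \<nu> - 1" "d - \<nu> - 1 \<le> d - 1" "1 \<le> d - 1" "d - 1 \<le> d - 1"
    using \<nu> assms(4) by simp_all
  show ?thesis
  proof (intro conjI impI)
    assume type: "foliation_type d M \<omega> = {# Rsym \<nu>, Rsym (d - \<nu> - 1), Rsym (d - 1) #}"
    have "{#Rsym \<nu>, Rsym (d - \<nu> - 1)#} \<subseteq># foliation_type d M \<omega>" unfolding type by (simp add: subseteq_mset_def)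
    then obtain s1 s2 where s: "contact d \<eta> s1 \<nu>" "contact d \<eta> s2 (d - \<nu> - 1)" "wedge s1 s2 \<noteq> 0"
      using two_contacts[OF hom nz d(1) M \<eta> index(1-4)] by blast
    have "Rsym (d - 1) \<in># foliation_type d M \<omega>" unfolding type by simp
    then have "count (foliation_type d M \<omega>) (Rsym (d - 1)) \<ge> 1" by (simp only: count_greater_eq_one_iff)
    then have "card (radial_singularities (d - 1) \<omega>) \<ge> 1" by (simp only: count_foliation_type(1)[OF index(5,6)])
    then obtain P where P: "P \<in> radial_singularities (d - 1) \<omega>" using card_pos_element by blast
    obtain u where u: "contact d \<eta> u (d - 1)" using radial_singularity_contact[OF hom nz d(1) M \<eta> P] by blast
    obtain \<gamma> where \<gamma>: "\<And>w. pairing u (\<eta> w) = \<gamma> * (wedge u w) ^ d" using contact_maximal[OF u] by blast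
    have u0: "u \<noteq> 0" using u by (simp add: contact_def)
    have "\<nu> \<noteq> d - 1" "d - \<nu> - 1 \<noteq> d - 1" using \<nu> assms(4) by simp_all
    then have "wedge s1 u \<noteq> 0" "wedge s2 u \<noteq> 0" using contact_unique[OF s(1) u] contact_unique[OF s(2) u] by auto
    from conj[OF s this u0 \<gamma>] have c: "linearly_conjugate \<omega> (projective_form (model d \<nu> (- 1)))"
      by (auto simp: wedge_simps)
    have "omega3 d \<nu> = (\<lambda>w. (- 1) *s model d \<nu> (- 1) w)"
      by (simp add: fun_eq_iff omega3_def model_def vec_eq_iff forall_2)
    then have "linearly_conjugate \<omega> (projective_form (omega3 d \<nu>))"
      using linearly_conjugate_scale[OF c, of "- 1"] by (simp only: projective_form_scale) simp
    moreover have "legendre_flat d \<omega>" unfolding flat_conj[OF c] using flat_model[of "- 1"] by simp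
    ultimately show "legendre_flat d \<omega> \<longleftrightarrow> linearly_conjugate \<omega> (projective_form (omega3 d \<nu>))" by simp
  next
    assume type: "foliation_type d M \<omega> = {# Rsym \<nu>, Rsym (d - \<nu> - 1), Tsym (d - 1) #}"
    have "{#Rsym \<nu>, Rsym (d - \<nu> - 1)#} \<subseteq># foliation_type d M \<omega>" unfolding type by (simp add: subseteq_mset_def)
    then obtain s1 s2 where s: "contact d \<eta> s1 \<nu>" "contact d \<eta> s2 (d - \<nu> - 1)" "wedge s1 s2 \<noteq> 0"
      using two_contacts[OF hom nz d(1) M \<eta> index(1-4)] by blast
    have "Tsym (d - 1) \<in># foliation_type d M \<omega>" unfolding type by simp
    then have "count (foliation_type d M \<omega>) (Tsym (d - 1)) \<ge> 1" by (simp only: count_greater_eq_one_iff)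
    then have "card (inflection_lines (d - 1) \<eta>) \<ge> 1"
      by (simp only: count_foliation_type(2)[OF index(5,6)] \<eta> affine_projective_form)
    then obtain L where "L \<in> inflection_lines (d - 1) \<eta>" using card_pos_element by blast
    then obtain l where l: "l \<noteq> 0" "\<not> invariant_line \<eta> l" "line_power_dvd l (d - 1) (jacobian_det \<eta>)"
      unfolding inflection_lines_def by blast
    obtain a u \<gamma> where a: "a \<noteq> 0" "pairing u (\<eta> u) \<noteq> 0" "\<And>w. pairing a (\<eta> w) = \<gamma> * (wedge u w) ^ d"
      using inflection_form[OF hom d(2) l] by blast
    have indep: "wedge v u \<noteq> 0" if v: "contact d \<eta> v k" for v k
    proof
      assume "wedge v u = 0"
      moreover have "v \<noteq> 0" using v by (simp add: contact_def)
      ultimately obtain c where "u = c *s v" using wedge_zero_multiple by blast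
      then show False using a(2) contact_pairing[OF v] by (simp add: hom_poly_pairing_scale[OF hom] pairing_simps)
    qed
    have au: "wedge a u \<noteq> 0"
    proof
      assume "wedge a u = 0"
      then obtain c where "u = c *s a" using wedge_zero_multiple[OF a(1)] by blast
      then have "pairing u (\<eta> u) = c * pairing a (\<eta> u)" by (simp add: pairing_simps)
      then show False using a(2) a(3)[of u] d by (simp add: wedge_simps)
    qed
    obtain \<mu> where \<mu>: "\<mu> \<noteq> 0" "\<mu> \<noteq> - 1" and c: "linearly_conjugate \<omega> (projective_form (model d \<nu> \<mu>))"
      using conj[OF s indep[OF s(1)] indep[OF s(2)] a(1,3)] au by blast
    \<comment> \<open>the parameter of the foliation \<open>omega4\<close>\<close>
    define \<mu>4 :: complex where "\<mu>4 = of_nat (d - \<nu> - 1) / of_nat \<nu>"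
    have \<nu>0: "(of_nat \<nu> :: complex) \<noteq> 0" using assms(4) by simp
    have "d - \<nu> - 1 \<noteq> 0" using \<nu> by simp
    then have "\<mu>4 \<noteq> 0" using \<nu>0 by (simp only: \<mu>4_def divide_eq_0_iff of_nat_eq_0_iff) simp
    moreover have "of_nat \<nu> * \<mu>4 = of_nat d - of_nat \<nu> - 1"
      using \<nu>0 \<nu> by (simp add: \<mu>4_def of_nat_diff)
    ultimately have \<mu>4: "of_nat \<nu> * \<mu>4 = of_nat d - of_nat \<nu> - 1" "\<mu>4 \<noteq> 0" by simp_all
    have "omega4 d \<nu> = (\<lambda>w. of_nat \<nu> *s model d \<nu> \<mu>4 w)"
      using \<nu>0 by (simp add: fun_eq_iff omega4_def model_def vec_eq_iff forall_2 \<mu>4_def)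
    then have omega4: "projective_form (omega4 d \<nu>) = (\<lambda>x. of_nat \<nu> *s projective_form (model d \<nu> \<mu>4) x)"
      by (simp only: projective_form_scale)
    show "legendre_flat d \<omega> \<longleftrightarrow> linearly_conjugate \<omega> (projective_form (omega4 d \<nu>))"
    proof
      assume "legendre_flat d \<omega>"
      then have "(\<mu> + 1) * (of_nat d - 1 - of_nat \<nu> * (\<mu> + 1)) = 0" unfolding flat_conj[OF c] flat_model[OF \<mu>(1)] .
      moreover have "\<mu> + 1 \<noteq> 0" using \<mu>(2) by (simp add: eq_neg_iff_add_eq_0)
      ultimately have "of_nat d - 1 - of_nat \<nu> * (\<mu> + 1) = 0" by simp
      then have "of_nat \<nu> * \<mu> = of_nat \<nu> * \<mu>4" unfolding \<mu>4(1) by (simp add: algebra_simps)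
      then have "\<mu> = \<mu>4" using \<nu>0 by simp
      then show "linearly_conjugate \<omega> (projective_form (omega4 d \<nu>))"
        unfolding omega4 using linearly_conjugate_scale[OF c \<nu>0] by simp
    next
      assume conj4: "linearly_conjugate \<omega> (projective_form (omega4 d \<nu>))"
      have "linearly_conjugate \<omega> (\<lambda>x. (1 / of_nat \<nu>) *s projective_form (omega4 d \<nu>) x)"
        by (rule linearly_conjugate_scale[OF conj4]) (use \<nu>0 in simp)
      then have c4: "linearly_conjugate \<omega> (projective_form (model d \<nu> \<mu>4))" unfolding omega4 using \<nu>0 by simp
      show "legendre_flat d \<omega>"
        unfolding flat_conj[OF c4] flat_model[OF \<mu>4(2)] by (simp add: distrib_left \<mu>4(1))
    qed
  qed
qed

end
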